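(* Let $(\alpha,\beta)\in(0,2)\times(0,\infty)$ and let $\sigma$, $q$ be the spherical measure and $q$-function of a layered stable law $LS_{\alpha,\beta}(\sigma,q;0)$ on $\mathbb{R}^d$. Fix $T>0$. Let $\{T_i\}_{i\ge1}$ be a sequence of iid uniform random variables on $[0,T]$, let $\{\Gamma_i\}_{i\ge1}$ be Poisson arrivals with rate $1$, and let $\{V_i\}_{i\ge1}$ be a sequence of iid random vectors in $S^{d-1}$ with common distribution $\sigma(d\xi)/\sigma(S^{d-1})$. Assume that the random sequences $\{T_i\}_{i\ge1}$, $\{\Gamma_i\}_{i\ge1}$ and $\{V_i\}_{i\ge1}$ are all mutually independent. Let \[ \overleftarrow{q}(u,\xi):=\inf\{r>0:q([r,\infty),\xi)<u\},\qquad\text{where } q([r,\infty),\xi)=\int_r^\infty q(s,\xi)\,ds, \] and let $\{b_i\}_{i\ge1}$ be the sequence of constants given by \[ b_i=\int_{i-1}^i\mathbb{E}\big[\overleftarrow{q}(s/T,V_1)V_1\,\mathbf 1(\overleftarrow{q}(s/T,V_1)\le1)\big]ds. \] Then the stochastic process \[ \left\{\sum_{i=1}^\infty\left[\overleftarrow{q}(\Gamma_i/T,V_i)V_i\,\mathbf 1(T_i\le t)-b_i\frac{t}{T}\right]:t\in[0,T]\right\} \] converges almost surely uniformly in $t$ to a Lévy process whose marginal law at time $1$ is $LS_{\alpha,\beta}(\sigma,q;0)$.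
   Context: $\mathbb{R}^d_0=\mathbb{R}^d\setminus\{0\}$, $S^{d-1}$ is the unit sphere of $\mathbb{R}^d$, and $f(x)\sim g(x)$ means $f(x)/g(x)\to1$ in the indicated limit. Vector integrals and expectations are componentwise. Layered stable law: let $(\alpha,\beta)\in(0,2)\times(0,\infty)$, $\sigma$ a finite positive measure on $S^{d-1}$, and $q:(0,\infty)\times S^{d-1}\to(0,\infty)$ a measurable function (the $q$-function) such that for each $\xi\in S^{d-1}$, $q(r,\xi)\sim c_1(\xi)r^{-\alpha-1}$ as $r\to0$ and $q(r,\xi)\sim c_2(\xi)r^{-\beta-1}$ as $r\to\infty$, where $c_1,c_2$ are $\sigma$-integrable functions on $S^{d-1}$. The Lévy measure is \[\nu(B)=\int_{S^{d-1}}\sigma(d\xi)\int_0^\infty \mathbf 1_B(r\xi)q(r,\xi)\,dr,\quad B\in\mathcal B(\mathbb{R}^d_0).\] For $\eta\in\mathbb{R}^d$, $LS_{\alpha,\beta}(\sigma,q;\eta)$ is the infinitely divisible law on $\mathbb{R}^d$, without Gaussian component, with characteristic function \[y\mapsto\exp\Big[i\langle y,\eta\rangle+\int_{\mathbb{R}^d_0}(e^{i\langle y,z\rangle}-1-i\langle y,z\rangle\mathbf 1_{\{\|z\|\le1\}}(z))\nu(dz)\Big].\]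
   Formalization: In the series and in b_i, Γ_i/T and s/T are replaced by Γ_i/(Tσ(S^{d-1})) and s/(Tσ(S^{d-1})); as written, the limit has Lévy measure ν/σ(S^{d-1}), so the claim fails unless σ(S^{d-1})=1, where the two versions agree. *)

theory Defs
  imports "HOL-Probability.Probability" "HOL-Library.Landau_Symbols"
begin

section \<open>Layered stable laws\<close>

abbreviation sphere_borel :: "(real ^ 'd) measure" where
  "sphere_borel \<equiv> restrict_space borel (sphere 0 1)"

definition layered_levy_measure ::
    "(real ^ 'd) measure \<Rightarrow> (real \<Rightarrow> real ^ 'd \<Rightarrow> real) \<Rightarrow> (real ^ 'd) measure" where
  "layered_levy_measure \<sigma> q =
     measure_of (- {0}) (sets (restrict_space borel (- {0})))
       (\<lambda>B. \<integral>\<^sup>+ \<xi>. (\<integral>\<^sup>+ r \<in> {0<..}. indicator B (r *\<^sub>R \<xi>) * ennreal (q r \<xi>) \<partial>lborel) \<partial>\<sigma>)"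

text \<open>
  Since \<open>q\<close> is positive, each asymptotic equivalence forces the corresponding \<open>c1 \<xi>\<close>, \<open>c2 \<xi>\<close>
  to be positive, so it is the convergence of the quotient to 1. The asymptotics are
  pointwise in \<open>\<xi>\<close> and do not imply that the resulting measure is a Levy measure; this is the
  last conjunct, implicit in speaking of the infinitely divisible law.
\<close>

definition layered_stable_data ::
    "real \<Rightarrow> real \<Rightarrow> (real ^ 'd) measure \<Rightarrow> (real \<Rightarrow> real ^ 'd \<Rightarrow> real) \<Rightarrow> bool" where
  "layered_stable_data \<alpha> \<beta> \<sigma> q \<longleftrightarrow>
     \<alpha> \<in> {0<..<2} \<and> \<beta> > 0 \<and>
     finite_measure \<sigma> \<and> sets \<sigma> = sets sphere_borel \<and>
     (\<lambda>(r, \<xi>). q r \<xi>) \<in> borel_measurable (restrict_space borel {0<..} \<Otimes>\<^sub>M sphere_borel) \<and>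
     (\<forall>r>0. \<forall>\<xi>\<in>sphere 0 1. q r \<xi> > 0) \<and>
     (\<exists>c1 c2. integrable \<sigma> c1 \<and> integrable \<sigma> c2 \<and>
        (\<forall>\<xi>\<in>sphere 0 1.
           (\<lambda>r. q r \<xi>) \<sim>[at_right 0] (\<lambda>r. c1 \<xi> * r powr (- \<alpha> - 1)) \<and>
           (\<lambda>r. q r \<xi>) \<sim>[at_top] (\<lambda>r. c2 \<xi> * r powr (- \<beta> - 1)))) \<and>
     (\<integral>\<^sup>+ z. ennreal (min 1 ((norm z)\<^sup>2)) \<partial>layered_levy_measure \<sigma> q) < \<infinity>"

lemma emeasure_layered_levy_measure:
  fixes \<sigma> :: "(real ^ 'd) measure"
  assumes d: "layered_stable_data \<alpha> \<beta> \<sigma> q"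
    and B: "B \<in> sets borel" "0 \<notin> B"
  shows "emeasure (layered_levy_measure \<sigma> q) B =
    (\<integral>\<^sup>+ \<xi>. (\<integral>\<^sup>+ r \<in> {0<..}. indicator B (r *\<^sub>R \<xi>) * ennreal (q r \<xi>) \<partial>lborel) \<partial>\<sigma>)"
proof -
  have s\<sigma>: "sets \<sigma> = sets sphere_borel"
    using d by (simp add: layered_stable_data_def)
  interpret finite_measure \<sigma> using d by (simp add: layered_stable_data_def)
  have q: "(\<lambda>(r, \<xi>). q r \<xi>) \<in> borel_measurable (restrict_space lborel {0<..} \<Otimes>\<^sub>M \<sigma>)"
  proof -
    have "sets (restrict_space lborel {0<..} \<Otimes>\<^sub>M \<sigma>) =
        sets (restrict_space borel {0<..} \<Otimes>\<^sub>M (sphere_borel :: (real ^ 'd) measure))"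
      by (intro sets_pair_measure_cong sets_restrict_space_cong s\<sigma>) simp
    then show ?thesis
      using d by (subst measurable_cong_sets[OF _ refl]) (auto simp: layered_stable_data_def)
  qed
  have [measurable]: "(\<lambda>\<xi>. \<xi>) \<in> \<sigma> \<rightarrow>\<^sub>M borel"
    by (subst measurable_cong_sets[OF s\<sigma> refl]) (simp add: measurable_restrict_space1)
  let ?L = "restrict_space lborel {0::real<..}"
  interpret L: sigma_finite_measure ?L
    by (intro sigma_finite_measure_restrict_space lborel.sigma_finite_measure_axioms) auto
  define N where "N = distr (density (\<sigma> \<Otimes>\<^sub>M ?L) (\<lambda>(\<xi>, r). ennreal (q r \<xi>)))
     borel (\<lambda>(\<xi>, r). r *\<^sub>R \<xi>)"
  have [measurable]: "(\<lambda>(\<xi>, r). q r \<xi>) \<in> borel_measurable (\<sigma> \<Otimes>\<^sub>M ?L)"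
    using measurable_pair_swap[OF q] by (simp add: case_prod_unfold)
  have [measurable]: "(\<lambda>r. r) \<in> ?L \<rightarrow>\<^sub>M borel"
    by (auto intro: measurable_restrict_space1)
  have [measurable]: "(\<lambda>(\<xi>, r). r *\<^sub>R \<xi>) \<in> (\<sigma> \<Otimes>\<^sub>M ?L) \<rightarrow>\<^sub>M (borel :: (real ^ 'd) measure)"
    by (simp add: case_prod_unfold)
  have N: "emeasure N A =
      (\<integral>\<^sup>+ \<xi>. (\<integral>\<^sup>+ r \<in> {0<..}. indicator A (r *\<^sub>R \<xi>) * ennreal (q r \<xi>) \<partial>lborel) \<partial>\<sigma>)"
    if [measurable]: "A \<in> sets borel" for A
  proof -
    have "emeasure N A =
        (\<integral>\<^sup>+ p. ennreal (q (snd p) (fst p)) * indicator A (snd p *\<^sub>R fst p) \<partial>(\<sigma> \<Otimes>\<^sub>M ?L))"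
      unfolding N_def
      by (subst emeasure_distr, simp, simp, subst emeasure_density)
         (auto intro!: nn_integral_cong simp: case_prod_unfold indicator_def)
    also have "\<dots> = (\<integral>\<^sup>+ \<xi>. \<integral>\<^sup>+ r. ennreal (q r \<xi>) * indicator A (r *\<^sub>R \<xi>) \<partial>?L \<partial>\<sigma>)"
      by (subst L.nn_integral_fst[symmetric]) (simp_all add: case_prod_unfold)
    finally show ?thesis
      by (simp add: nn_integral_restrict_space mult.commute mult.left_commute)
  qed
  have sub: "sets (restrict_space borel (- {0 :: real ^ 'd})) \<subseteq> sets borel"
    by (auto simp: sets_restrict_space)
  show ?thesis
  proof (rule emeasure_measure_of[OF layered_levy_measure_def])
    show "sets (restrict_space borel (- {0 :: real ^ 'd})) \<subseteq> Pow (- {0})"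
      by (auto simp: sets_restrict_space)
    have se: "sets (layered_levy_measure \<sigma> q) = sets (restrict_space borel (- {0}))"
      unfolding layered_levy_measure_def
      using sets.sigma_sets_eq[of "restrict_space borel (- {0 :: real ^ 'd})"]
        sets.space_closed[of "restrict_space borel (- {0 :: real ^ 'd})"]
      by (subst sets_measure_of) (simp_all add: space_restrict_space)
    show "B \<in> sets (layered_levy_measure \<sigma> q)"
      unfolding se using B by (auto simp: sets_restrict_space image_iff intro!: bexI[of _ B])
    show "positive (sets (layered_levy_measure \<sigma> q))
      (\<lambda>B. \<integral>\<^sup>+ \<xi>. (\<integral>\<^sup>+ r \<in> {0<..}. indicator B (r *\<^sub>R \<xi>) * ennreal (q r \<xi>) \<partial>lborel) \<partial>\<sigma>)"
      by (simp add: positive_def)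
    show "countably_additive (sets (layered_levy_measure \<sigma> q))
      (\<lambda>B. \<integral>\<^sup>+ \<xi>. (\<integral>\<^sup>+ r \<in> {0<..}. indicator B (r *\<^sub>R \<xi>) * ennreal (q r \<xi>) \<partial>lborel) \<partial>\<sigma>)"
      unfolding countably_additive_def se
    proof safe
      fix A :: "nat \<Rightarrow> (real ^ 'd) set"
      assume A: "range A \<subseteq> sets (restrict_space borel (- {0}))" and dis: "disjoint_family A"
      have A': "range A \<subseteq> sets borel" using A sub by blast
      then have "A i \<in> sets borel" for i by auto
      moreover have "(\<Union>i. A i) \<in> sets borel" using A' by auto
      ultimately show "(\<Sum>i. \<integral>\<^sup>+ \<xi>. (\<integral>\<^sup>+ r \<in> {0<..}.
          indicator (A i) (r *\<^sub>R \<xi>) * ennreal (q r \<xi>) \<partial>lborel) \<partial>\<sigma>) =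
        (\<integral>\<^sup>+ \<xi>. (\<integral>\<^sup>+ r \<in> {0<..}. indicator (\<Union>i. A i) (r *\<^sub>R \<xi>) * ennreal (q r \<xi>) \<partial>lborel) \<partial>\<sigma>)"
        using A' dis suminf_emeasure[of A N] by (simp add: N[symmetric] N_def)
    qed
  qed
qed

definition char_fun :: "(real ^ 'd) measure \<Rightarrow> real ^ 'd \<Rightarrow> complex" where
  "char_fun \<mu> y = (\<integral>x. iexp (y \<bullet> x) \<partial>\<mu>)"

text \<open>
  A law is determined by its characteristic function; infinite divisibility and the absence of a
  Gaussian component can be read off from the Levy-Khintchine form of the exponent.
\<close>

definition layered_stable_law ::
    "real \<Rightarrow> real \<Rightarrow> (real ^ 'd) measure \<Rightarrow> (real \<Rightarrow> real ^ 'd \<Rightarrow> real) \<Rightarrow> real ^ 'd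
      \<Rightarrow> (real ^ 'd) measure \<Rightarrow> bool" where
  "layered_stable_law \<alpha> \<beta> \<sigma> q \<eta> \<mu> \<longleftrightarrow>
     layered_stable_data \<alpha> \<beta> \<sigma> q \<and> prob_space \<mu> \<and> sets \<mu> = sets borel \<and>
     (\<forall>y. char_fun \<mu> y =
        exp (\<i> * complex_of_real (y \<bullet> \<eta>) +
          (\<integral>z. (iexp (y \<bullet> z) - 1 - \<i> * complex_of_real ((y \<bullet> z) * indicator {z. norm z \<le> 1} z))
             \<partial>layered_levy_measure \<sigma> q)))"

definition q_tail :: "(real \<Rightarrow> real ^ 'd \<Rightarrow> real) \<Rightarrow> real \<Rightarrow> real ^ 'd \<Rightarrow> ennreal" where
  "q_tail q r \<xi> = (\<integral>\<^sup>+ s \<in> {r..}. ennreal (q s \<xi>) \<partial>lborel)"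

definition q_inverse :: "(real \<Rightarrow> real ^ 'd \<Rightarrow> real) \<Rightarrow> real \<Rightarrow> real ^ 'd \<Rightarrow> real" where
  "q_inverse q u \<xi> = Inf {r. r > 0 \<and> q_tail q r \<xi> < ennreal u}"

section \<open>Levy processes\<close>

definition cadlag_on :: "real set \<Rightarrow> (real \<Rightarrow> 'v::topological_space) \<Rightarrow> bool" where
  "cadlag_on I f \<longleftrightarrow>
     (\<forall>t\<in>I. (f \<longlongrightarrow> f t) (at t within (I \<inter> {t<..})) \<and>
            (\<exists>l. (f \<longlongrightarrow> l) (at t within (I \<inter> {..<t}))))"

text \<open>The time set \<open>I\<close> is meant to be an interval starting at 0, either bounded or unbounded.\<close>

definition levy_process_on ::
    "'w measure \<Rightarrow> real set \<Rightarrow> (real \<Rightarrow> 'w \<Rightarrow> real ^ 'd) \<Rightarrow> bool" where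
  "levy_process_on M I X \<longleftrightarrow>
     prob_space M \<and>
     (\<forall>t\<in>I. X t \<in> borel_measurable M) \<and>
     (AE \<omega> in M. X 0 \<omega> = 0) \<and>
     (\<forall>(n::nat) ts. (\<forall>i\<le>n. ts i \<in> I) \<and> (\<forall>i<n. ts i \<le> ts (Suc i)) \<longrightarrow>
        prob_space.indep_vars M (\<lambda>_. borel) (\<lambda>i \<omega>. X (ts (Suc i)) \<omega> - X (ts i) \<omega>) {..<n}) \<and>
     (\<forall>s h. s \<in> I \<and> h \<ge> 0 \<and> s + h \<in> I \<longrightarrow>
        distr M borel (\<lambda>\<omega>. X (s + h) \<omega> - X s \<omega>) = distr M borel (\<lambda>\<omega>. X h \<omega> - X 0 \<omega>)) \<and>
     (\<forall>t\<in>I. \<forall>\<epsilon>>0. ((\<lambda>s. measure M {\<omega> \<in> space M. dist (X s \<omega>) (X t \<omega>) > \<epsilon>}) \<longlongrightarrow> 0)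
        (at t within I)) \<and>
     (AE \<omega> in M. cadlag_on I (\<lambda>t. X t \<omega>))"

definition path_law ::
    "'w measure \<Rightarrow> real set \<Rightarrow> (real \<Rightarrow> 'w \<Rightarrow> real ^ 'd) \<Rightarrow> (real \<Rightarrow> real ^ 'd) measure" where
  "path_law M I X = distr M (\<Pi>\<^sub>M t\<in>I. borel) (\<lambda>\<omega>. \<lambda>t\<in>I. X t \<omega>)"

text \<open>
  A Levy process on \<open>[0,T]\<close> is extended in law to \<open>[0,\<infinity>)\<close>, because its marginal law at time 1 has
  to make sense also if \<open>T < 1\<close>. The underlying space may be too small to carry an extension, so
  another one is used, with sample points of the type of paths.
\<close>

definition levy_process_with_unit_marginal ::
    "'w measure \<Rightarrow> real \<Rightarrow> (real \<Rightarrow> 'w \<Rightarrow> real ^ 'd) \<Rightarrow> ((real ^ 'd) measure \<Rightarrow> bool) \<Rightarrow> bool" where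
  "levy_process_with_unit_marginal M T X is_law \<longleftrightarrow>
     levy_process_on M {0..T} X \<and>
     (\<exists>(N :: (real \<Rightarrow> real ^ 'd) measure) Y.
        levy_process_on N {0..} Y \<and>
        path_law N {0..T} Y = path_law M {0..T} X \<and>
        is_law (distr N borel (Y 1)))"

section \<open>The random sequences and the series\<close>

text \<open>All sequences are indexed by \<open>i \<ge> 1\<close>; their values at 0 are irrelevant.\<close>

definition iid_seq :: "'w measure \<Rightarrow> 'a measure \<Rightarrow> 'a measure \<Rightarrow> (nat \<Rightarrow> 'w \<Rightarrow> 'a) \<Rightarrow> bool" where
  "iid_seq M S \<mu> X \<longleftrightarrow>
     prob_space.indep_vars M (\<lambda>_. S) X {1..} \<and> (\<forall>i\<ge>1. distr M S (X i) = \<mu>)"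

definition poisson_arrivals :: "'w measure \<Rightarrow> real \<Rightarrow> (nat \<Rightarrow> 'w \<Rightarrow> real) \<Rightarrow> bool" where
  "poisson_arrivals M l \<Gamma> \<longleftrightarrow>
     (\<exists>E. iid_seq M borel (density lborel (exponential_density l)) E \<and>
        (\<forall>i\<ge>1. \<forall>\<omega>\<in>space M. \<Gamma> i \<omega> = (\<Sum>k=1..i. E k \<omega>)))"

definition seq_events :: "'w measure \<Rightarrow> 'a measure \<Rightarrow> (nat \<Rightarrow> 'w \<Rightarrow> 'a) \<Rightarrow> 'w set set" where
  "seq_events M S X =
     sets (vimage_algebra (space M) (\<lambda>\<omega>. \<lambda>i\<in>{1..}. X i \<omega>) (\<Pi>\<^sub>M i\<in>{1..}. S))"

text \<open>
  The series represents a Levy process with Levy measure determined by \<open>\<sigma>\<close> and \<open>q\<close> only if the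
  arrivals are divided by \<open>T * \<sigma>(S)\<close>, with \<open>\<sigma>(S)\<close> the total mass of \<open>\<sigma>\<close>, as the directions are drawn
  from the normalised measure. For \<open>\<sigma>(S) = 1\<close> this is division by \<open>T\<close>.
\<close>

definition centering ::
    "'w measure \<Rightarrow> (real ^ 'd) measure \<Rightarrow> (real \<Rightarrow> real ^ 'd \<Rightarrow> real) \<Rightarrow> real
      \<Rightarrow> (nat \<Rightarrow> 'w \<Rightarrow> real ^ 'd) \<Rightarrow> nat \<Rightarrow> real ^ 'd" where
  "centering M \<sigma> q T V i =
     (LINT s:{real i - 1..real i}|lborel.
        (\<integral>\<omega>. indicator {\<omega>. q_inverse q (s / (T * measure \<sigma> (sphere 0 1))) (V 1 \<omega>) \<le> 1} \<omega> *\<^sub>R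
              q_inverse q (s / (T * measure \<sigma> (sphere 0 1))) (V 1 \<omega>) *\<^sub>R V 1 \<omega> \<partial>M))"

definition series_partial_sum ::
    "'w measure \<Rightarrow> (real ^ 'd) measure \<Rightarrow> (real \<Rightarrow> real ^ 'd \<Rightarrow> real) \<Rightarrow> real
      \<Rightarrow> (nat \<Rightarrow> 'w \<Rightarrow> real) \<Rightarrow> (nat \<Rightarrow> 'w \<Rightarrow> real) \<Rightarrow> (nat \<Rightarrow> 'w \<Rightarrow> real ^ 'd)
      \<Rightarrow> nat \<Rightarrow> real \<Rightarrow> 'w \<Rightarrow> real ^ 'd" where
  "series_partial_sum M \<sigma> q T U \<Gamma> V n t \<omega> =
     (\<Sum>i=1..n.
        indicator {\<omega>. U i \<omega> \<le> t} \<omega> *\<^sub>R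
          q_inverse q (\<Gamma> i \<omega> / (T * measure \<sigma> (sphere 0 1))) (V i \<omega>) *\<^sub>R V i \<omega>
        - (t / T) *\<^sub>R centering M \<sigma> q T V i)"

end

theory Submission
  imports Defs "HOL-Real_Asymp.Real_Asymp"
begin

text \<open>
  On the canonical space of the noise (waiting times, directions, uniform times) put
  \<open>H x v = q\<^sup>\<leftarrow>(x / (T \<sigma>(S)), v) v\<close>: the image of the law of \<open>(x, v)\<close>, Lebesgue measure times the
  direction law, is \<open>T \<nu>\<close> off the origin.

  For the convergence, only finitely many jumps exceed 1, and each truncated small jump is split into
  its value times \<open>1(U \<le> t) - t / T\<close> and \<open>t / T\<close> times the jump. The sums of the first kind are
  martingales in the number of terms for fixed \<open>t\<close>; for fixed term, after division by \<open>1 - t / T\<close> or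
  \<open>t / T\<close>, they are martingales along a grid of times, which gives a maximal inequality uniform in
  \<open>t\<close> on each half of \<open>[0, T]\<close>. The second sums converge after compensation by integrals from
  \<open>\<Gamma> (i - 1)\<close> to \<open>\<Gamma> i\<close>; replacing the latter by integrals from \<open>i - 1\<close> to \<open>i\<close> costs nothing in the limit,
  by Kronecker's lemma for \<open>\<Gamma> n - n\<close> with weights coming from the square integrable function
  \<open>x \<mapsto> \<integral> min 1 \<parallel>H x v\<parallel>\<close>.

  All distributional properties of the limit are read off from the joint characteristic function of
  its increments, which an exponential martingale in the waiting times yields in closed form. The
  extension to \<open>[0,\<infinity>)\<close> concatenates independent copies.
\<close>

section \<open>Characteristic functions determine laws\<close>

text \<open>Filtrations and conditional expectations are avoided: a function of the iid noise is
  averaged over one coordinate at a time with the others fixed, and a martingale difference is a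
  function of the first coordinates that averages to 0 over its last one. The obstacle is that
  \<open>min 1 \<parallel>H x v\<parallel>\<close> is square integrable in \<open>(x, v)\<close> but
  in general not integrable (not for \<alpha> \<ge> 1), so neither the small jumps nor their
  centerings need be summable, and only L2 bounds are at hand. The function
  \<open>1(U \<le> t) - t / T\<close> is a bridge pinned at both ends: divided by
  \<open>1 - t / T\<close> it is a martingale forward in t, divided by \<open>t / T\<close> it is
  one backward in t. On the first and the second half of \<open>[0, T]\<close>, respectively, the
  divisor lies between 1/2 and 1, so the quotient is bounded by 1 and multiplying back enlarges
  nothing. No Poisson random measure is constructed: the exponential martingale takes its place, and
  independence and stationarity of increments as well as the law of the path follow from uniqueness
  for characteristic functions.\<close>

definition cf_determining :: "'v::euclidean_space itself \<Rightarrow> bool" where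
  "cf_determining _ \<longleftrightarrow> (\<forall>(M::'v measure) N. finite_measure M \<longrightarrow> finite_measure N \<longrightarrow>
     sets M = sets borel \<longrightarrow> sets N = sets borel \<longrightarrow>
     (\<forall>y. (\<integral>x. iexp (y \<bullet> x) \<partial>M) = (\<integral>x. iexp (y \<bullet> x) \<partial>N)) \<longrightarrow> M = N)"

text \<open>Taking \<open>y = 0\<close> shows that the total masses agree, so unless both measures
  vanish they can be normalised and \<open>Levy_uniqueness\<close> applies. Finite measures are
  considered because the weighted measures in \<open>integral_weighted_eqI\<close> are not
  normalised.\<close>

lemma cf_determining_real: "cf_determining TYPE(real)"
  unfolding cf_determining_def
proof (intro allI impI)
  fix M N :: "real measure"
  assume fM: "finite_measure M" and fN: "finite_measure N"
    and sM: "sets M = sets borel" and sN: "sets N = sets borel"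
    and cf: "\<forall>y. (\<integral>x. iexp (y \<bullet> x) \<partial>M) = (\<integral>x. iexp (y \<bullet> x) \<partial>N)"
  interpret M: finite_measure M by fact
  interpret N: finite_measure N by fact
  have spM: "space M = UNIV" and spN: "space N = UNIV"
    using sets_eq_imp_space_eq[OF sM] sets_eq_imp_space_eq[OF sN] by auto
  define c where "c = measure M UNIV"
  have cM: "measure M UNIV = c" by (simp add: c_def)
  have cN: "measure N UNIV = c" using cf[rule_format, of 0] spM spN by (simp add: c_def)
  show "M = N"
  proof (cases "c = 0")
    case True
    then show ?thesis
    proof (intro measure_eqI)
      fix A
      have "emeasure M A \<le> emeasure M UNIV" "emeasure N A \<le> emeasure N UNIV"
        by (intro emeasure_mono; simp add: sM sN)+
      moreover have "emeasure M UNIV = 0" "emeasure N UNIV = 0"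
        using cM cN True by (auto simp: M.emeasure_eq_measure N.emeasure_eq_measure)
      ultimately show "emeasure M A = emeasure N A" by simp
    qed (simp add: sM sN)
  next
    case False
    then have c: "c > 0" by (simp add: c_def less_le)
    define S where "S K = density K (\<lambda>_. ennreal (1 / c))" for K :: "real measure"
    have emS: "emeasure (S K) A = ennreal (1 / c) * emeasure K A" if "A \<in> sets K" for K A
      using that by (simp add: S_def emeasure_density nn_integral_cmult_indicator)
    have rdS: "real_distribution (S K)" if "finite_measure K" "sets K = sets borel" "measure K UNIV = c" for K
    proof -
      interpret K: finite_measure K by fact
      have [simp]: "space K = UNIV" using sets_eq_imp_space_eq[OF that(2)] by auto
      have "emeasure (S K) (space (S K)) = 1"
        using c that by (simp add: emS S_def[THEN arg_cong, of space] K.emeasure_eq_measure ennreal_mult[symmetric])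
      then show ?thesis
        by (intro real_distribution.intro prob_spaceI real_distribution_axioms.intro) (auto simp: S_def that)
    qed
    have chS: "char (S K) y = (1 / c) *\<^sub>R (\<integral>x. iexp (y \<bullet> x) \<partial>K)" if "sets K = sets borel" for K y
      unfolding char_def S_def
      using c that by (subst integral_density) (auto simp: measurable_cong_sets[OF that refl])
    have "S M = S N"
      by (rule Levy_uniqueness)
         (use rdS[OF fM sM cM] rdS[OF fN sN cN] cf in \<open>auto simp: chS sM sN fun_eq_iff\<close>)
    then have eq: "ennreal (1 / c) * emeasure M A = ennreal (1 / c) * emeasure N A" if "A \<in> sets borel" for A
      using emS[of A M] emS[of A N] that by (simp add: sM sN)
    show ?thesis
    proof (intro measure_eqI)
      fix A assume "A \<in> sets M"
      then have "ennreal (1 / c) * emeasure M A = ennreal (1 / c) * emeasure N A" by (intro eq) (simp add: sM)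
      then have "1 / c * measure M A = 1 / c * measure N A"
        using c by (simp add: M.emeasure_eq_measure N.emeasure_eq_measure ennreal_mult[symmetric])
      then show "emeasure M A = emeasure N A"
        using c by (simp add: M.emeasure_eq_measure N.emeasure_eq_measure)
    qed (simp add: sM sN)
  qed
qed

text \<open>One exponential factor is exchanged for an indicator: the image under \<open>X\<close>
  of the measure with density \<open>w\<close> has the integrals in \<open>cf\<close> as its
  characteristic function. The weight is there to carry the other coordinates.\<close>

lemma integral_weighted_eqI:
  fixes X :: "'a \<Rightarrow> 'v::euclidean_space" and Y :: "'b \<Rightarrow> 'v"
  assumes det: "cf_determining TYPE('v)"
    and "finite_measure M" "finite_measure N"
    and X[measurable]: "X \<in> borel_measurable M" and Y[measurable]: "Y \<in> borel_measurable N"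
    and w[measurable]: "w \<in> borel_measurable M" and v[measurable]: "v \<in> borel_measurable N"
    and w0: "\<And>x. 0 \<le> w x \<and> w x \<le> B" and v0: "\<And>x. 0 \<le> v x \<and> v x \<le> (B::real)"
    and cf: "\<And>z. (\<integral>x. w x *\<^sub>R iexp (z \<bullet> X x) \<partial>M) = (\<integral>x. v x *\<^sub>R iexp (z \<bullet> Y x) \<partial>N)"
    and A[measurable]: "A \<in> sets borel"
  shows "(\<integral>x. w x * indicator A (X x) \<partial>M) = (\<integral>x. v x * indicator A (Y x) \<partial>N)"
proof -
  interpret M: finite_measure M by fact
  interpret N: finite_measure N by fact
  let ?P = "distr (density M (\<lambda>x. ennreal (w x))) borel X"
  let ?Q = "distr (density N (\<lambda>x. ennreal (v x))) borel Y"
  have fin: "finite_measure (distr (density K (\<lambda>x. ennreal (u x))) borel Z)"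
    if "finite_measure K" and [measurable]: "Z \<in> borel_measurable K" "u \<in> borel_measurable K"
      and u: "\<And>x. u x \<le> B" for K :: "'c measure" and Z :: "'c \<Rightarrow> 'v" and u
  proof -
    interpret K: finite_measure K by fact
    have "(\<integral>\<^sup>+x. ennreal (u x) \<partial>K) \<le> (\<integral>\<^sup>+x. ennreal B \<partial>K)"
      using u by (intro nn_integral_mono ennreal_leI) auto
    also have "\<dots> < \<infinity>" by (simp add: ennreal_mult_less_top K.emeasure_eq_measure)
    finally have *: "(\<integral>\<^sup>+x. ennreal (u x) \<partial>K) < \<infinity>" .
    have "emeasure (density K (\<lambda>x. ennreal (u x))) (space K) = (\<integral>\<^sup>+x. ennreal (u x) \<partial>K)"
      by (subst emeasure_density) (auto intro!: nn_integral_cong)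
    with * show ?thesis
      by (intro finite_measure.finite_measure_distr finite_measureI) auto
  qed
  have "?P = ?Q"
  proof (rule det[unfolded cf_determining_def, rule_format])
    fix y show "(\<integral>x. iexp (y \<bullet> x) \<partial>?P) = (\<integral>x. iexp (y \<bullet> x) \<partial>?Q)"
      using cf[of y] w0 v0 by (simp add: integral_distr integral_density)
  qed (use w0 v0 in \<open>auto intro!: fin assms\<close>)
  then have "(\<integral>x. indicator A x \<partial>?P) = (\<integral>x. indicator A x \<partial>?Q :: real)" by simp
  moreover have "(\<integral>x. indicator A x \<partial>?P) = (\<integral>x. w x * indicator A (X x) \<partial>M)"
    using w0 by (subst integral_distr) (simp_all add: integral_density)
  moreover have "(\<integral>x. indicator A x \<partial>?Q) = (\<integral>x. v x * indicator A (Y x) \<partial>N)"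
    using v0 by (subst integral_distr) (simp_all add: integral_density)
  ultimately show ?thesis by simp
qed

text \<open>A weight that is a trigonometric polynomial of degree 1 in \<open>r\<close> only shifts
  the frequency of \<open>r\<close> by 0, 1 or -1, so an identity known for all frequencies passes
  to the weighted integrals.\<close>

lemma weighted_iexp:
  assumes "complex_of_real U = c + a * iexp r + b * iexp (- r)"
  shows "(W * U) *\<^sub>R iexp p = c * (W *\<^sub>R iexp (p + 0 * r)) + a * (W *\<^sub>R iexp (p + 1 * r)) + b * (W *\<^sub>R iexp (p + (-1) * r))"
proof -
  have 1: "(W * U) *\<^sub>R P = c * (W *\<^sub>R P) + a * (W *\<^sub>R (P * E)) + b * (W *\<^sub>R (P * F))"
    if "complex_of_real U = c + a * E + b * F" for P E F
    by (simp add: scaleR_conv_of_real that algebra_simps)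
  have "iexp (p + 1 * r) = iexp p * iexp r" "iexp (p + (-1) * r) = iexp p * iexp (- r)" "iexp (p + 0 * r) = iexp p"
    by (simp_all add: exp_add distrib_left exp_diff exp_minus right_diff_distrib divide_inverse)
  then show ?thesis using 1[OF assms] by metis
qed

text \<open>Exponentials are turned into indicators one coordinate at a time (\<open>claim\<close>),
  by uniqueness in that coordinate alone. The exponential of the remaining coordinates has to serve
  as a weight but is complex; since a density must be nonnegative, the weights 1,
  \<open>1 + cos R\<close> and \<open>1 + sin R\<close> stand in for it. Used for real coordinates
  this gives uniqueness for vectors, and used for vectors it gives uniqueness for families of
  vectors.\<close>

lemma cf_determines_rectangles:
  fixes X :: "'k \<Rightarrow> 'a \<Rightarrow> 'v::euclidean_space" and Y :: "'k \<Rightarrow> 'b \<Rightarrow> 'v"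
  assumes det: "cf_determining TYPE('v)"
    and fM: "finite_measure M" and fN: "finite_measure N" and K: "finite K"
    and X: "\<And>k. k \<in> K \<Longrightarrow> X k \<in> borel_measurable M"
    and Y: "\<And>k. k \<in> K \<Longrightarrow> Y k \<in> borel_measurable N"
    and cf: "\<And>y. (\<integral>\<omega>. iexp (\<Sum>k\<in>K. y k \<bullet> X k \<omega>) \<partial>M) = (\<integral>\<omega>. iexp (\<Sum>k\<in>K. y k \<bullet> Y k \<omega>) \<partial>N)"
    and A: "\<And>k. k \<in> K \<Longrightarrow> A k \<in> sets borel"
  shows "measure M {\<omega>\<in>space M. \<forall>k\<in>K. X k \<omega> \<in> A k} = measure N {\<omega>\<in>space N. \<forall>k\<in>K. Y k \<omega> \<in> A k}"
proof -
  interpret M: finite_measure M by fact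
  interpret N: finite_measure N by fact
  have claim: "(\<integral>\<omega>. (\<Prod>k\<in>J. indicator (A k) (X k \<omega>)) *\<^sub>R iexp (\<Sum>k\<in>K - J. y k \<bullet> X k \<omega>) \<partial>M)
      = (\<integral>\<omega>. (\<Prod>k\<in>J. indicator (A k) (Y k \<omega>)) *\<^sub>R iexp (\<Sum>k\<in>K - J. y k \<bullet> Y k \<omega>) \<partial>N)"
    if "finite J" "J \<subseteq> K" for J y
    using that
  proof (induction J arbitrary: y rule: finite_induct)
    case empty
    then show ?case using cf[of y] by simp
  next
    case (insert k J)
    note [measurable] = X[OF subsetD[OF insert.prems]] Y[OF subsetD[OF insert.prems]]
    have kK: "k \<in> K" and JK: "J \<subseteq> K" using insert.prems by auto
    have Xm[measurable]: "X j \<in> borel_measurable M" and Ym[measurable]: "Y j \<in> borel_measurable N"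
      and Am[measurable]: "A j \<in> sets borel" if "j \<in> K" for j
      using X Y A that by auto
    let ?L = "K - insert k J"
    have KJ: "K - J = insert k ?L" using kK insert.hyps by auto
    define w where "w \<omega> = (\<Prod>j\<in>J. indicator (A j) (X j \<omega>) :: real)" for \<omega>
    define v where "v \<omega> = (\<Prod>j\<in>J. indicator (A j) (Y j \<omega>) :: real)" for \<omega>
    define R where "R \<omega> = (\<Sum>j\<in>?L. y j \<bullet> X j \<omega>)" for \<omega>
    define Q where "Q \<omega> = (\<Sum>j\<in>?L. y j \<bullet> Y j \<omega>)" for \<omega>
    have wm[measurable]: "w \<in> borel_measurable M"
      unfolding w_def by (intro borel_measurable_prod) (use JK Am in \<open>auto intro!: measurable_compose[OF Xm borel_measurable_indicator]\<close>)
    have vm[measurable]: "v \<in> borel_measurable N"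
      unfolding v_def by (intro borel_measurable_prod) (use JK Am in \<open>auto intro!: measurable_compose[OF Ym borel_measurable_indicator]\<close>)
    have Rm[measurable]: "R \<in> borel_measurable M"
      unfolding R_def by (intro borel_measurable_sum borel_measurable_inner) auto
    have Qm[measurable]: "Q \<in> borel_measurable N"
      unfolding Q_def by (intro borel_measurable_sum borel_measurable_inner) auto
    have w01: "0 \<le> w \<omega> \<and> w \<omega> \<le> 1" for \<omega>
      unfolding w_def by (auto intro!: prod_nonneg prod_le_1)
    have v01: "0 \<le> v \<omega> \<and> v \<omega> \<le> 1" for \<omega>
      unfolding v_def by (auto intro!: prod_nonneg prod_le_1)
    \<comment> \<open>The free factor \<open>s\<close> on the remaining frequencies supplies the
      multiples 0, 1 and -1 of \<open>R\<close> that \<open>weighted_iexp\<close> asks for.\<close>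
    have IH: "(\<integral>\<omega>. w \<omega> *\<^sub>R iexp (z \<bullet> X k \<omega> + s * R \<omega>) \<partial>M) = (\<integral>\<omega>. v \<omega> *\<^sub>R iexp (z \<bullet> Y k \<omega> + s * Q \<omega>) \<partial>N)" for z s
    proof -
      let ?y = "\<lambda>j. if j = k then z else s *\<^sub>R y j"
      have sX: "(\<Sum>j\<in>K - J. ?y j \<bullet> X j \<omega>) = z \<bullet> X k \<omega> + s * R \<omega>" for \<omega>
        unfolding KJ R_def using K by (subst sum.insert) (auto simp: sum_distrib_left intro!: sum.cong)
      have sY: "(\<Sum>j\<in>K - J. ?y j \<bullet> Y j \<omega>) = z \<bullet> Y k \<omega> + s * Q \<omega>" for \<omega>
        unfolding KJ Q_def using K by (subst sum.insert) (auto simp: sum_distrib_left intro!: sum.cong)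
      show ?thesis
        using insert.IH[OF JK, of ?y] unfolding sX sY w_def v_def .
    qed
    have int: "integrable M (\<lambda>\<omega>. w \<omega> *\<^sub>R iexp (z \<bullet> X k \<omega> + s * R \<omega>))"
      "integrable N (\<lambda>\<omega>. v \<omega> *\<^sub>R iexp (z \<bullet> Y k \<omega> + s * Q \<omega>))" for z s
      using w01 v01 kK by (auto intro!: M.integrable_const_bound[where B=1] N.integrable_const_bound[where B=1])
    have key: "(\<integral>\<omega>. (w \<omega> * u (R \<omega>)) * indicator (A k) (X k \<omega>) \<partial>M) = (\<integral>\<omega>. (v \<omega> * u (Q \<omega>)) * indicator (A k) (Y k \<omega>) \<partial>N)"
      if um[measurable]: "u \<in> borel_measurable borel" and u: "\<And>r. 0 \<le> u r \<and> u r \<le> 2"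
        and e: "\<And>r. complex_of_real (u r) = c + a * iexp r + b * iexp (- r)" for u :: "real \<Rightarrow> real" and a b c
    proof (rule integral_weighted_eqI[OF det fM fN])
      fix z
      have eX: "(w \<omega> * u (R \<omega>)) *\<^sub>R iexp (z \<bullet> X k \<omega>) = c * (w \<omega> *\<^sub>R iexp (z \<bullet> X k \<omega> + 0 * R \<omega>))
         + a * (w \<omega> *\<^sub>R iexp (z \<bullet> X k \<omega> + 1 * R \<omega>)) + b * (w \<omega> *\<^sub>R iexp (z \<bullet> X k \<omega> + (-1) * R \<omega>))" for \<omega>
        by (rule weighted_iexp[OF e])
      have eY: "(v \<omega> * u (Q \<omega>)) *\<^sub>R iexp (z \<bullet> Y k \<omega>) = c * (v \<omega> *\<^sub>R iexp (z \<bullet> Y k \<omega> + 0 * Q \<omega>))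
         + a * (v \<omega> *\<^sub>R iexp (z \<bullet> Y k \<omega> + 1 * Q \<omega>)) + b * (v \<omega> *\<^sub>R iexp (z \<bullet> Y k \<omega> + (-1) * Q \<omega>))" for \<omega>
        by (rule weighted_iexp[OF e])
      show "(\<integral>\<omega>. (w \<omega> * u (R \<omega>)) *\<^sub>R iexp (z \<bullet> X k \<omega>) \<partial>M) = (\<integral>\<omega>. (v \<omega> * u (Q \<omega>)) *\<^sub>R iexp (z \<bullet> Y k \<omega>) \<partial>N)"
        unfolding eX eY
        by (simp only: Bochner_Integration.integral_add integral_mult_right_zero int integrable_mult_right IH
              Bochner_Integration.integrable_add)
    next
      show "0 \<le> w \<omega> * u (R \<omega>) \<and> w \<omega> * u (R \<omega>) \<le> 2" for \<omega>
        using w01[of \<omega>] u[of "R \<omega>"] mult_mono[of "w \<omega>" 1 "u (R \<omega>)" 2] by auto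
      show "0 \<le> v \<omega> * u (Q \<omega>) \<and> v \<omega> * u (Q \<omega>) \<le> 2" for \<omega>
        using v01[of \<omega>] u[of "Q \<omega>"] mult_mono[of "v \<omega>" 1 "u (Q \<omega>)" 2] by auto
    qed (use kK in auto)
    have k1: "(\<integral>\<omega>. (w \<omega> * 1) * indicator (A k) (X k \<omega>) \<partial>M) = (\<integral>\<omega>. (v \<omega> * 1) * indicator (A k) (Y k \<omega>) \<partial>N)"
      by (rule key[of "\<lambda>_. 1" 1 0 0]) auto
    have k2: "(\<integral>\<omega>. (w \<omega> * (1 + cos (R \<omega>))) * indicator (A k) (X k \<omega>) \<partial>M) = (\<integral>\<omega>. (v \<omega> * (1 + cos (Q \<omega>))) * indicator (A k) (Y k \<omega>) \<partial>N)"
    proof (rule key[of "\<lambda>r. 1 + cos r" 1 "1/2" "1/2"])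
      show "0 \<le> 1 + cos r \<and> 1 + cos r \<le> 2" for r :: real
        using cos_ge_minus_one[of r] cos_le_one[of r] by linarith
      show "complex_of_real (1 + cos r) = 1 + 1/2 * iexp r + 1/2 * iexp (- r)" for r
        by (simp add: complex_eq_iff exp_eq_polar cis.sel)
    qed auto
    have k3: "(\<integral>\<omega>. (w \<omega> * (1 + sin (R \<omega>))) * indicator (A k) (X k \<omega>) \<partial>M) = (\<integral>\<omega>. (v \<omega> * (1 + sin (Q \<omega>))) * indicator (A k) (Y k \<omega>) \<partial>N)"
    proof (rule key[of "\<lambda>r. 1 + sin r" 1 "- \<i>/2" "\<i>/2"])
      show "0 \<le> 1 + sin r \<and> 1 + sin r \<le> 2" for r :: real
        using sin_ge_minus_one[of r] sin_le_one[of r] by linarith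
      show "complex_of_real (1 + sin r) = 1 + - \<i>/2 * iexp r + \<i>/2 * iexp (- r)" for r
        by (simp add: complex_eq_iff exp_eq_polar cis.sel)
    qed auto
    define WX where "WX \<omega> = w \<omega> * indicator (A k) (X k \<omega>)" for \<omega>
    define WY where "WY \<omega> = v \<omega> * indicator (A k) (Y k \<omega>)" for \<omega>
    have [measurable]: "WX \<in> borel_measurable M" "WY \<in> borel_measurable N"
      unfolding WX_def WY_def using kK by (auto intro!: borel_measurable_times measurable_compose[OF Xm borel_measurable_indicator] measurable_compose[OF Ym borel_measurable_indicator])
    have WX01: "norm (WX \<omega>) \<le> 1" for \<omega>
      using w01[of \<omega>] by (auto simp: WX_def indicator_def)
    have WY01: "norm (WY \<omega>) \<le> 1" for \<omega>
      using v01[of \<omega>] by (auto simp: WY_def indicator_def)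
    have b1: "norm (WX \<omega> * t) \<le> 1" "norm (WY \<eta> * t) \<le> 1" if "\<bar>t\<bar> \<le> 1" for t \<omega> \<eta>
      using mult_mono[OF WX01[of \<omega>] that] mult_mono[OF WY01[of \<eta>] that] by (auto simp: abs_mult)
    have i: "integrable M WX" "integrable N WY" "integrable M (\<lambda>\<omega>. WX \<omega> * cos (R \<omega>))" "integrable N (\<lambda>\<omega>. WY \<omega> * cos (Q \<omega>))"
      "integrable M (\<lambda>\<omega>. WX \<omega> * sin (R \<omega>))" "integrable N (\<lambda>\<omega>. WY \<omega> * sin (Q \<omega>))"
      by (intro M.integrable_const_bound[where B=1] N.integrable_const_bound[where B=1]; use WX01 WY01 b1 in simp)+
    have k1': "(\<integral>\<omega>. WX \<omega> \<partial>M) = (\<integral>\<omega>. WY \<omega> \<partial>N)"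
      using k1 by (simp add: WX_def WY_def)
    \<comment> \<open>Subtracting the case of weight 1 isolates the cosine and the sine part, from
      which the complex exponential is put together again.\<close>
    have "(\<integral>\<omega>. WX \<omega> + WX \<omega> * cos (R \<omega>) \<partial>M) = (\<integral>\<omega>. WY \<omega> + WY \<omega> * cos (Q \<omega>) \<partial>N)"
      using k2 by (simp add: WX_def WY_def algebra_simps)
    then have c: "(\<integral>\<omega>. WX \<omega> * cos (R \<omega>) \<partial>M) = (\<integral>\<omega>. WY \<omega> * cos (Q \<omega>) \<partial>N)"
      using i k1' by simp
    have "(\<integral>\<omega>. WX \<omega> + WX \<omega> * sin (R \<omega>) \<partial>M) = (\<integral>\<omega>. WY \<omega> + WY \<omega> * sin (Q \<omega>) \<partial>N)"
      using k3 by (simp add: WX_def WY_def algebra_simps)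
    then have s: "(\<integral>\<omega>. WX \<omega> * sin (R \<omega>) \<partial>M) = (\<integral>\<omega>. WY \<omega> * sin (Q \<omega>) \<partial>N)"
      using i k1' by simp
    have pX: "(\<Prod>j\<in>insert k J. indicator (A j) (X j \<omega>)) *\<^sub>R iexp (R \<omega>)
        = complex_of_real (WX \<omega> * cos (R \<omega>)) + \<i> * complex_of_real (WX \<omega> * sin (R \<omega>))" for \<omega>
    proof -
      have "(\<Prod>j\<in>insert k J. indicator (A j) (X j \<omega>)) = WX \<omega>"
        using insert.hyps by (simp add: WX_def w_def)
      then show ?thesis
        by (simp only: complex_eq_iff) (simp add: exp_eq_polar cis.sel)
    qed
    have pY: "(\<Prod>j\<in>insert k J. indicator (A j) (Y j \<omega>)) *\<^sub>R iexp (Q \<omega>)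
        = complex_of_real (WY \<omega> * cos (Q \<omega>)) + \<i> * complex_of_real (WY \<omega> * sin (Q \<omega>))" for \<omega>
    proof -
      have "(\<Prod>j\<in>insert k J. indicator (A j) (Y j \<omega>)) = WY \<omega>"
        using insert.hyps by (simp add: WY_def v_def)
      then show ?thesis
        by (simp only: complex_eq_iff) (simp add: exp_eq_polar cis.sel)
    qed
    have "(\<integral>\<omega>. (\<Prod>j\<in>insert k J. indicator (A j) (X j \<omega>)) *\<^sub>R iexp (R \<omega>) \<partial>M)
        = complex_of_real (\<integral>\<omega>. WX \<omega> * cos (R \<omega>) \<partial>M) + \<i> * complex_of_real (\<integral>\<omega>. WX \<omega> * sin (R \<omega>) \<partial>M)"
      unfolding pX
      by (subst Bochner_Integration.integral_add, (intro integrable_mult_right integrable_of_real i)+,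
          simp only: integral_mult_right_zero integral_complex_of_real)
    moreover have "(\<integral>\<omega>. (\<Prod>j\<in>insert k J. indicator (A j) (Y j \<omega>)) *\<^sub>R iexp (Q \<omega>) \<partial>N)
        = complex_of_real (\<integral>\<omega>. WY \<omega> * cos (Q \<omega>) \<partial>N) + \<i> * complex_of_real (\<integral>\<omega>. WY \<omega> * sin (Q \<omega>) \<partial>N)"
      unfolding pY
      by (subst Bochner_Integration.integral_add, (intro integrable_mult_right integrable_of_real i)+,
          simp only: integral_mult_right_zero integral_complex_of_real)
    ultimately show ?case
      using c s by (simp add: R_def Q_def)
  qed
  have e: "(\<Prod>k\<in>K. indicator (A k) (Z k \<omega>)) = (indicator {\<omega>\<in>space L. \<forall>k\<in>K. Z k \<omega> \<in> A k} \<omega> :: real)"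
    if "\<omega> \<in> space L" for Z :: "'k \<Rightarrow> 'c \<Rightarrow> 'v" and \<omega> L
    using K that by (auto simp: indicator_def)
  have "(\<integral>\<omega>. complex_of_real (\<Prod>k\<in>K. indicator (A k) (X k \<omega>)) \<partial>M) = (\<integral>\<omega>. complex_of_real (\<Prod>k\<in>K. indicator (A k) (Y k \<omega>)) \<partial>N)"
    using claim[OF K order_refl, of "\<lambda>_. 0"] by (simp add: scaleR_conv_of_real)
  then have "(\<integral>\<omega>. (\<Prod>k\<in>K. indicator (A k) (X k \<omega>) :: real) \<partial>M) = (\<integral>\<omega>. (\<Prod>k\<in>K. indicator (A k) (Y k \<omega>)) \<partial>N)"
    by (simp only: integral_complex_of_real of_real_eq_iff)
  moreover have "{\<omega>\<in>space M. \<forall>k\<in>K. X k \<omega> \<in> A k} \<inter> space M = {\<omega>\<in>space M. \<forall>k\<in>K. X k \<omega> \<in> A k}"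
    "{\<omega>\<in>space N. \<forall>k\<in>K. Y k \<omega> \<in> A k} \<inter> space N = {\<omega>\<in>space N. \<forall>k\<in>K. Y k \<omega> \<in> A k}"
    by auto
  ultimately show ?thesis
    by (simp add: e cong: Bochner_Integration.integral_cong)
qed

text \<open>A vector is treated as the family of its real coordinates; the orthants
  \<open>{..a}\<close> are rectangles and form an intersection-stable generator of the Borel
  sets.\<close>

lemma cf_determining_vec: "cf_determining TYPE(real ^ 'd)"
  unfolding cf_determining_def
proof (intro allI impI)
  fix M N :: "(real ^ 'd) measure"
  assume fM: "finite_measure M" and fN: "finite_measure N"
    and sM: "sets M = sets borel" and sN: "sets N = sets borel"
    and cf: "\<forall>y. (\<integral>x. iexp (y \<bullet> x) \<partial>M) = (\<integral>x. iexp (y \<bullet> x) \<partial>N)"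
  interpret M: finite_measure M by fact
  interpret N: finite_measure N by fact
  have spM: "space M = UNIV" and spN: "space N = UNIV"
    using sets_eq_imp_space_eq[OF sM] sets_eq_imp_space_eq[OF sN] by auto
  have eq: "measure M {..a} = measure N {..a}" for a :: "real ^ 'd"
  proof -
    have cp: "(\<lambda>x::real ^ 'd. x $ k) \<in> borel_measurable borel" for k
      by (intro borel_measurable_continuous_onI continuous_on_component continuous_on_id)
    have mX: "(\<lambda>x. x $ k) \<in> borel_measurable M" and mY: "(\<lambda>x. x $ k) \<in> borel_measurable N" for k
      using cp[of k] by (simp_all add: measurable_cong_sets[OF sM refl] measurable_cong_sets[OF sN refl])
    have cf': "(\<integral>\<omega>. iexp (\<Sum>k\<in>UNIV. y k \<bullet> \<omega> $ k) \<partial>M) = (\<integral>\<omega>. iexp (\<Sum>k\<in>UNIV. y k \<bullet> \<omega> $ k) \<partial>N)" for y :: "'d \<Rightarrow> real"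
      using cf[rule_format, of "\<chi> k. y k"] by (simp add: inner_vec_def)
    have "measure M {\<omega>\<in>space M. \<forall>k\<in>UNIV. \<omega> $ k \<in> {..a $ k}} = measure N {\<omega>\<in>space N. \<forall>k\<in>UNIV. \<omega> $ k \<in> {..a $ k}}"
      by (rule cf_determines_rectangles[OF cf_determining_real fM fN finite mX mY cf']) auto
    moreover have "{\<omega>. \<forall>k. \<omega> $ k \<in> {..a $ k}} = {..a}" by (auto simp: less_eq_vec_def)
    ultimately show ?thesis by (simp add: spM spN less_eq_vec_def atMost_def)
  qed
  show "M = N"
  proof (rule measure_eqI_generator_eq[where E="range (\<lambda>a. {..a})" and \<Omega>=UNIV and A="\<lambda>i. {..\<chi> k. real i}"])
    show "Int_stable (range (\<lambda>a :: real ^ 'd. {..a}))"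
    proof (safe intro!: Int_stableI)
      fix a b :: "real ^ 'd"
      have "{..a} \<inter> {..b} = {..inf a b}" by auto
      then show "{..a} \<inter> {..b} \<in> range (\<lambda>a. {..a})" by blast
    qed
    show "sets M = sigma_sets UNIV (range (\<lambda>a. {..a}))" "sets N = sigma_sets UNIV (range (\<lambda>a. {..a}))"
      by (simp_all add: sM sN) (simp_all add: borel_eq_atMost)
    show "(\<Union>i. {..(\<chi> k. real i) :: real ^ 'd}) = UNIV"
    proof (safe, simp_all)
      fix x :: "real ^ 'd"
      obtain n where n: "norm x \<le> real n" using real_arch_simple by blast
      have "x $ k \<le> real n" for k
        using component_le_norm_cart[of x k] n by linarith
      then show "\<exists>n. x \<le> (\<chi> k. real n)" by (auto simp: less_eq_vec_def)
    qed
  qed (auto simp: eq M.emeasure_eq_measure N.emeasure_eq_measure)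
qed

text \<open>The product of the marginal laws has the right-hand side of \<open>cf\<close> as its
  characteristic function, so it agrees with the joint law on rectangles.\<close>

lemma (in prob_space) indep_vars_cfI:
  fixes X :: "'k \<Rightarrow> 'a \<Rightarrow> real ^ 'd"
  assumes K: "finite K" and X: "\<And>k. k \<in> K \<Longrightarrow> X k \<in> borel_measurable M"
    and cf: "\<And>y. (\<integral>\<omega>. iexp (\<Sum>k\<in>K. y k \<bullet> X k \<omega>) \<partial>M) = (\<Prod>k\<in>K. \<integral>\<omega>. iexp (y k \<bullet> X k \<omega>) \<partial>M)"
  shows "indep_vars (\<lambda>_. borel) X K"
proof (cases "K = {}")
  case True
  then show ?thesis by (auto simp: indep_vars_def indep_sets_def)
next
  case False
  \<comment> \<open>The point mass outside \<open>K\<close> is a filler that makes \<open>D\<close>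
    a family of probability laws over all indices.\<close>
  define D where "D k = (if k \<in> K then distr M borel (X k) else return borel 0)" for k
  have pD: "prob_space (D k)" for k
    using X by (auto simp: D_def intro!: prob_space_distr prob_space_return)
  then interpret D: product_prob_space D UNIV by (intro product_prob_spaceI)
  interpret DK: finite_product_prob_space D K
    by (intro finite_product_prob_space.intro finite_product_sigma_finite.intro product_prob_spaceI pD
        product_sigma_finite.intro finite_product_sigma_finite_axioms.intro K prob_space_imp_sigma_finite)
  have sD: "sets (D k) = sets borel" and spD: "space (D k) = UNIV" for k by (simp_all add: D_def)
  have eqr: "emeasure (distr M (PiM K (\<lambda>_. borel)) (\<lambda>\<omega>. \<lambda>k\<in>K. X k \<omega>)) (Pi\<^sub>E K A) = (\<Prod>k\<in>K. emeasure (D k) (A k))"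
    if A: "\<And>k. k \<in> K \<Longrightarrow> A k \<in> sets (D k)" for A
  proof -
    have A': "A k \<in> sets borel" if "k \<in> K" for k using A[OF that] by (simp add: sD)
    have "measure M {\<omega>\<in>space M. \<forall>k\<in>K. X k \<omega> \<in> A k} = measure (PiM K D) {\<omega>\<in>space (PiM K D). \<forall>k\<in>K. \<omega> k \<in> A k}"
    proof (rule cf_determines_rectangles[OF cf_determining_vec _ _ K])
      show "(\<lambda>\<omega>. \<omega> k) \<in> borel_measurable (PiM K D)" if "k \<in> K" for k
        using measurable_component_singleton[OF that, of D] by (simp add: measurable_cong_sets[OF refl sD])
      fix y :: "'k \<Rightarrow> real ^ 'd"
      have "(\<integral>\<omega>. iexp (\<Sum>k\<in>K. y k \<bullet> \<omega> k) \<partial>PiM K D) = (\<integral>\<omega>. (\<Prod>k\<in>K. iexp (y k \<bullet> \<omega> k)) \<partial>PiM K D)"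
        using K by (simp add: exp_sum sum_distrib_left)
      also have "\<dots> = (\<Prod>k\<in>K. \<integral>x. iexp (y k \<bullet> x) \<partial>D k)"
      proof (rule D.product_integral_prod[OF K])
        fix k assume k: "k \<in> K"
        show "integrable (D k) (\<lambda>x. iexp (y k \<bullet> x))"
          by (intro finite_measure.integrable_const_bound[OF prob_space.finite_measure[OF pD], where B=1]) (auto simp: measurable_cong_sets[OF sD refl])
      qed
      also have "\<dots> = (\<Prod>k\<in>K. \<integral>\<omega>. iexp (y k \<bullet> X k \<omega>) \<partial>M)"
        using X by (intro prod.cong refl) (simp add: D_def integral_distr)
      finally show "(\<integral>\<omega>. iexp (\<Sum>k\<in>K. y k \<bullet> X k \<omega>) \<partial>M) = (\<integral>\<omega>. iexp (\<Sum>k\<in>K. y k \<bullet> \<omega> k) \<partial>PiM K D)"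
        using cf[of y] by simp
    qed (use X A' DK.finite_measure_axioms finite_measure_axioms in auto)
    moreover have "{\<omega>\<in>space (PiM K D). \<forall>k\<in>K. \<omega> k \<in> A k} = Pi\<^sub>E K A"
      by (auto simp: space_PiM spD PiE_iff extensional_def)
    moreover have "(\<lambda>\<omega>. \<lambda>k\<in>K. X k \<omega>) -` Pi\<^sub>E K A \<inter> space M = {\<omega>\<in>space M. \<forall>k\<in>K. X k \<omega> \<in> A k}"
      by (auto simp: PiE_iff)
    moreover have "Pi\<^sub>E K A \<in> sets (PiM K (\<lambda>_. borel))" using A' K by (intro sets_PiM_I_finite) auto
    moreover have "(\<lambda>\<omega>. \<lambda>k\<in>K. X k \<omega>) \<in> M \<rightarrow>\<^sub>M PiM K (\<lambda>_. borel)" using X by (intro measurable_restrict) auto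
    ultimately have "emeasure (distr M (PiM K (\<lambda>_. borel)) (\<lambda>\<omega>. \<lambda>k\<in>K. X k \<omega>)) (Pi\<^sub>E K A) = emeasure (PiM K D) (Pi\<^sub>E K A)"
      by (simp add: emeasure_distr emeasure_eq_measure DK.emeasure_eq_measure)
    also have "\<dots> = (\<Prod>k\<in>K. emeasure (D k) (A k))"
      using A K by (intro D.emeasure_PiM) auto
    finally show ?thesis .
  qed
  have "distr M (PiM K (\<lambda>_. borel)) (\<lambda>\<omega>. \<lambda>k\<in>K. X k \<omega>) = PiM K D"
  proof (rule D.PiM_eqI[OF K])
    show "sets (distr M (PiM K (\<lambda>_. borel)) (\<lambda>\<omega>. \<lambda>k\<in>K. X k \<omega>)) = sets (PiM K D)"
      unfolding sets_distr by (intro sets_PiM_cong refl sD[symmetric])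
  qed (rule eqr)
  also have "\<dots> = PiM K (\<lambda>k. distr M borel (X k))"
    by (intro PiM_cong) (auto simp: D_def)
  finally show ?thesis
    using X False by (subst indep_vars_iff_distr_eq_PiM') auto
qed

section \<open>Processes given by the characteristic function of their increments\<close>

text \<open>The clock \<open>c\<close> is a parameter because the formula serves both for the limit
  on the whole line, where time is clamped to \<open>[0, T]\<close>, and for Levy processes, where
  \<open>c t = t\<close>.\<close>

definition incr_cf ::
    "'w measure \<Rightarrow> real set \<Rightarrow> (real \<Rightarrow> real) \<Rightarrow> (real \<Rightarrow> 'w \<Rightarrow> real ^ 'd) \<Rightarrow> (real ^ 'd \<Rightarrow> complex) \<Rightarrow> bool" where
  "incr_cf M I c X \<psi> \<longleftrightarrow>
     (\<forall>(n::nat) ts y. (\<forall>i\<le>n. ts i \<in> I) \<and> (\<forall>i<n. ts i \<le> ts (Suc i)) \<longrightarrow>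
        (\<integral>\<omega>. iexp (\<Sum>i<n. y i \<bullet> (X (ts (Suc i)) \<omega> - X (ts i) \<omega>)) \<partial>M) =
        exp (\<Sum>i<n. (c (ts (Suc i)) - c (ts i)) *\<^sub>R \<psi> (y i)))"

lemma incr_cfD:
  assumes "incr_cf M I c X \<psi>" "\<And>i. i \<le> n \<Longrightarrow> ts i \<in> I" "\<And>i. i < n \<Longrightarrow> ts i \<le> ts (Suc i)"
  shows "(\<integral>\<omega>. iexp (\<Sum>i<n. y i \<bullet> (X (ts (Suc i)) \<omega> - X (ts i) \<omega>)) \<partial>M) =
     exp (\<Sum>i<n. (c (ts (Suc i)) - c (ts i)) *\<^sub>R \<psi> (y i))"
  using assms unfolding incr_cf_def by blast

lemma borel_measurable_iexp: "iexp \<in> borel_measurable borel"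
  by (intro borel_measurable_continuous_onI continuous_intros)

lemma incr_cf_single:
  assumes "incr_cf M I c X \<psi>" "s \<in> I" "t \<in> I" "s \<le> t"
  shows "(\<integral>\<omega>. iexp (y \<bullet> (X t \<omega> - X s \<omega>)) \<partial>M) = exp ((c t - c s) *\<^sub>R \<psi> y)"
  using incr_cfD[OF assms(1), of 1 "\<lambda>i. if i = 0 then s else t" "\<lambda>_. y"] assms by simp

lemma distr_eq_cfI:
  fixes X :: "'a \<Rightarrow> real ^ 'd" and Y :: "'b \<Rightarrow> real ^ 'd"
  assumes "prob_space M" "prob_space N" and [measurable]: "X \<in> borel_measurable M" "Y \<in> borel_measurable N"
    and cf: "\<And>y. (\<integral>\<omega>. iexp (y \<bullet> X \<omega>) \<partial>M) = (\<integral>\<omega>. iexp (y \<bullet> Y \<omega>) \<partial>N)"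
  shows "distr M borel X = distr N borel Y"
proof (rule cf_determining_vec[unfolded cf_determining_def, rule_format])
  show "finite_measure (distr M borel X)" "finite_measure (distr N borel Y)"
    by (intro finite_measure.finite_measure_distr prob_space.finite_measure assms)+
  show "(\<integral>x. iexp (y \<bullet> x) \<partial>distr M borel X) = (\<integral>x. iexp (y \<bullet> x) \<partial>distr N borel Y)" for y
    using cf[of y] by (simp add: integral_distr)
qed simp_all

text \<open>Independence and stationarity of the increments come from the product form of
  \<open>incr_cf\<close>. Stochastic continuity reduces by stationarity to time 0, where right
  continuity of the paths gives it.\<close>

lemma levy_process_on_cfI:
  fixes X :: "real \<Rightarrow> 'w \<Rightarrow> real ^ 'd"
  assumes M: "prob_space M"
    and I0: "0 \<in> I" and I: "\<And>s t. s \<in> I \<Longrightarrow> 0 \<le> t \<Longrightarrow> t \<le> s \<Longrightarrow> t \<in> I" and Ipos: "\<And>s. s \<in> I \<Longrightarrow> 0 \<le> s"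
    and X: "\<And>t. t \<in> I \<Longrightarrow> X t \<in> borel_measurable M"
    and X0: "AE \<omega> in M. X 0 \<omega> = 0"
    and cf: "incr_cf M I (\<lambda>t. t) X \<psi>"
    and cadlag: "AE \<omega> in M. cadlag_on I (\<lambda>t. X t \<omega>)"
  shows "levy_process_on M I X"
proof -
  interpret prob_space M by fact
  have diff: "(\<lambda>\<omega>. X t \<omega> - X s \<omega>) \<in> borel_measurable M" if "s \<in> I" "t \<in> I" for s t
    using X[OF that(1)] X[OF that(2)] by simp
  have stat: "distr M borel (\<lambda>\<omega>. X (s + h) \<omega> - X s \<omega>) = distr M borel (\<lambda>\<omega>. X h \<omega> - X 0 \<omega>)"
    if "s \<in> I" "h \<ge> 0" "s + h \<in> I" for s h
  proof (rule distr_eq_cfI[OF M M])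
    have h: "h \<in> I" using I[OF that(3) that(2)] Ipos[OF that(1)] by simp
    show "(\<lambda>\<omega>. X (s + h) \<omega> - X s \<omega>) \<in> borel_measurable M" "(\<lambda>\<omega>. X h \<omega> - X 0 \<omega>) \<in> borel_measurable M"
      using diff that I0 h by auto
    show "(\<integral>\<omega>. iexp (y \<bullet> (X (s + h) \<omega> - X s \<omega>)) \<partial>M) = (\<integral>\<omega>. iexp (y \<bullet> (X h \<omega> - X 0 \<omega>)) \<partial>M)" for y
      using incr_cf_single[OF cf that(1,3), of y] incr_cf_single[OF cf I0 h, of y] that by simp
  qed
  have indep: "indep_vars (\<lambda>_. borel) (\<lambda>i \<omega>. X (ts (Suc i)) \<omega> - X (ts i) \<omega>) {..<n}"
    if ts: "\<And>i. i \<le> n \<Longrightarrow> ts i \<in> I" "\<And>i. i < n \<Longrightarrow> ts i \<le> ts (Suc i)" for n :: nat and ts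
  proof (rule indep_vars_cfI)
    show "(\<lambda>\<omega>. X (ts (Suc i)) \<omega> - X (ts i) \<omega>) \<in> borel_measurable M" if "i \<in> {..<n}" for i
      using that by (intro diff ts) auto
    fix y
    have "(\<integral>\<omega>. iexp (\<Sum>i<n. y i \<bullet> (X (ts (Suc i)) \<omega> - X (ts i) \<omega>)) \<partial>M) =
      exp (\<Sum>i<n. (ts (Suc i) - ts i) *\<^sub>R \<psi> (y i))"
      using ts by (intro incr_cfD[OF cf]) auto
    also have "\<dots> = (\<Prod>i<n. exp ((ts (Suc i) - ts i) *\<^sub>R \<psi> (y i)))"
      by (simp add: exp_sum)
    also have "\<dots> = (\<Prod>i<n. \<integral>\<omega>. iexp (y i \<bullet> (X (ts (Suc i)) \<omega> - X (ts i) \<omega>)) \<partial>M)"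
    proof (intro prod.cong refl)
      fix i assume "i \<in> {..<n}"
      then show "exp ((ts (Suc i) - ts i) *\<^sub>R \<psi> (y i)) = (\<integral>\<omega>. iexp (y i \<bullet> (X (ts (Suc i)) \<omega> - X (ts i) \<omega>)) \<partial>M)"
        by (intro incr_cf_single[OF cf, symmetric] ts) auto
    qed
    finally show "(\<integral>\<omega>. iexp (\<Sum>i<n. y i \<bullet> (X (ts (Suc i)) \<omega> - X (ts i) \<omega>)) \<partial>M) =
       (\<Prod>i<n. \<integral>\<omega>. iexp (y i \<bullet> (X (ts (Suc i)) \<omega> - X (ts i) \<omega>)) \<partial>M)" .
  qed simp
  have rc: "(\<lambda>n. measure M {\<omega> \<in> space M. dist (X (d n) \<omega>) (X 0 \<omega>) > \<epsilon>}) \<longlonglongrightarrow> 0"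
    if d: "\<And>n. d n \<in> I" "\<And>n. d n \<noteq> 0" "d \<longlonglongrightarrow> 0" and \<epsilon>: "\<epsilon> > 0" for d :: "nat \<Rightarrow> real" and \<epsilon>
  proof -
    have m: "{\<omega> \<in> space M. dist (X (d n) \<omega>) (X 0 \<omega>) > \<epsilon>} \<in> sets M" for n
      using X[OF d(1)[of n]] X[OF I0] by measurable
    have "(\<lambda>n. \<integral>\<omega>. indicator {\<omega> \<in> space M. dist (X (d n) \<omega>) (X 0 \<omega>) > \<epsilon>} \<omega> \<partial>M) \<longlonglongrightarrow> (\<integral>\<omega>. (0::real) \<partial>M)"
    proof (rule integral_dominated_convergence[where w="\<lambda>_. 1"])
      show "AE \<omega> in M. (\<lambda>n. indicator {\<omega> \<in> space M. dist (X (d n) \<omega>) (X 0 \<omega>) > \<epsilon>} \<omega> :: real) \<longlonglongrightarrow> 0"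
        using cadlag
      proof eventually_elim
        case (elim \<omega>)
        then have "((\<lambda>t. X t \<omega>) \<longlongrightarrow> X 0 \<omega>) (at 0 within (I \<inter> {0<..}))"
          using I0 by (auto simp: cadlag_on_def)
        moreover have "filterlim d (at 0 within (I \<inter> {0<..})) sequentially"
          using d Ipos by (auto simp: filterlim_at intro!: always_eventually less_le[THEN iffD2])
        ultimately have "(\<lambda>n. X (d n) \<omega>) \<longlonglongrightarrow> X 0 \<omega>" by (rule filterlim_compose)
        then have "eventually (\<lambda>n. dist (X (d n) \<omega>) (X 0 \<omega>) < \<epsilon>) sequentially"
          using \<epsilon> by (rule tendstoD)
        then show ?case
          by (intro tendsto_eventually) (auto elim!: eventually_mono)
      qed
    qed (use m in auto)
    then show ?thesis using m by simp
  qed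
  have cont: "((\<lambda>s. measure M {\<omega> \<in> space M. dist (X s \<omega>) (X t \<omega>) > \<epsilon>}) \<longlongrightarrow> 0) (at t within I)"
    if t: "t \<in> I" and \<epsilon>: "\<epsilon> > 0" for t \<epsilon>
    unfolding tendsto_at_iff_sequentially
  proof (intro allI impI)
    fix s assume s: "\<forall>i. s i \<in> I - {t}" "s \<longlonglongrightarrow> t"
    have sI: "s i \<in> I" for i using s by auto
    have ab: "\<bar>s i - t\<bar> \<in> I" for i
      using I[OF t, of "\<bar>s i - t\<bar>"] I[OF sI[of i], of "\<bar>s i - t\<bar>"] Ipos[OF t] Ipos[OF sI[of i]] by linarith
    \<comment> \<open>Starting from the earlier of the two times, the increment has the law of the
      one over \<open>[0, \<bar>s i - t\<bar>]\<close>, whichever of \<open>s i\<close> and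
      \<open>t\<close> is larger.\<close>
    have e: "measure M {\<omega> \<in> space M. dist (X (s i) \<omega>) (X t \<omega>) > \<epsilon>} =
        measure M {\<omega> \<in> space M. dist (X \<bar>s i - t\<bar> \<omega>) (X 0 \<omega>) > \<epsilon>}" for i
    proof -
      have *: "measure M {\<omega> \<in> space M. dist (X (a + h) \<omega>) (X a \<omega>) > \<epsilon>} =
        measure M {\<omega> \<in> space M. dist (X h \<omega>) (X 0 \<omega>) > \<epsilon>}" if "a \<in> I" "h \<ge> 0" "a + h \<in> I" for a h
      proof -
        have h: "h \<in> I" using I[OF that(3) that(2)] Ipos[OF that(1)] by simp
        have "measure (distr M borel (\<lambda>\<omega>. X (a + h) \<omega> - X a \<omega>)) {x. norm x > \<epsilon>} =
           measure (distr M borel (\<lambda>\<omega>. X h \<omega> - X 0 \<omega>)) {x. norm x > \<epsilon>}"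
          using stat[OF that] by simp
        moreover have "{x::real ^ 'd. norm x > \<epsilon>} \<in> sets borel" by measurable
        ultimately show ?thesis
          using diff[OF that(1,3)] diff[OF I0 h]
          by (simp add: measure_distr vimage_def Int_def dist_norm conj_commute)
      qed
      show ?thesis
      proof (cases "t \<le> s i")
        case True
        then show ?thesis using *[OF t, of "s i - t"] sI[of i] by simp
      next
        case False
        then show ?thesis using *[OF sI[of i], of "t - s i"] t by (simp add: dist_commute)
      qed
    qed
    have "(\<lambda>i. \<bar>s i - t\<bar>) \<longlonglongrightarrow> 0"
      using s(2) by (simp add: LIM_zero tendsto_rabs_zero)
    then show "((\<lambda>s. measure M {\<omega> \<in> space M. dist (X s \<omega>) (X t \<omega>) > \<epsilon>}) \<circ> s) \<longlonglongrightarrow> 0"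
      unfolding comp_def e using s(1) ab by (intro rc \<epsilon>) auto
  qed
  show ?thesis
    unfolding levy_process_on_def
    using M X X0 cadlag indep stat cont by auto
qed

section \<open>Finite-dimensional distributions and the law of the path\<close>

lemma sum_triangle:
  "(\<Sum>l<n. \<Sum>i<Suc l. a i l) = (\<Sum>i<n. \<Sum>l\<in>{i..<n}. a i l :: 'a::comm_monoid_add)" for n :: nat
proof (induction n)
  case (Suc n)
  have "(\<Sum>i<Suc n. \<Sum>l\<in>{i..<Suc n}. a i l) = (\<Sum>i<Suc n. (\<Sum>l\<in>{i..<n}. a i l) + a i n)"
    by (intro sum.cong refl) (auto simp: add.commute)
  also have "\<dots> = (\<Sum>i<n. \<Sum>l\<in>{i..<n}. a i l) + (\<Sum>i<Suc n. a i n)"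
    by (simp add: sum.distrib)
  finally show ?case using Suc by simp
qed simp

text \<open>Summation by parts: with the times sorted and 0 put in front, a linear functional of the
  values is one of the increments, whose coefficients are tail sums of \<open>y\<close>. That the
  process starts at 0 makes each value a sum of increments.\<close>

lemma incr_cf_fdd:
  fixes X :: "real \<Rightarrow> 'w \<Rightarrow> real ^ 'd"
  assumes cf: "incr_cf M I c X \<psi>" and X0: "AE \<omega> in M. X 0 \<omega> = 0" and I0: "0 \<in> I"
    and Ipos: "\<And>s. s \<in> I \<Longrightarrow> 0 \<le> s" and J: "finite J" "J \<subseteq> I"
    and X: "\<And>t. t \<in> I \<Longrightarrow> X t \<in> borel_measurable M"
    and n: "n = card J" and ts: "ts = (!) (0 # sorted_list_of_set J)"
  shows "(\<integral>\<omega>. iexp (\<Sum>t\<in>J. y t \<bullet> X t \<omega>) \<partial>M) =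
    exp (\<Sum>i<n. (c (ts (Suc i)) - c (ts i)) *\<^sub>R \<psi> (\<Sum>l\<in>{i..<n}. y (ts (Suc l))))"
proof -
  let ?xs = "sorted_list_of_set J"
  have len: "length ?xs = n" using n by simp
  have setx: "set ?xs = J" using J by simp
  have tsS: "ts (Suc i) = ?xs ! i" for i by (simp add: ts)
  have ts0: "ts 0 = 0" by (simp add: ts)
  have mem: "?xs ! i \<in> J" if "i < n" for i using that len setx nth_mem by metis
  have tsI: "ts i \<in> I" if "i \<le> n" for i
    using that I0 mem J by (cases i) (auto simp: ts0 tsS)
  have mono: "ts i \<le> ts (Suc i)" if "i < n" for i
  proof (cases i)
    case 0
    then show ?thesis using mem[of 0] J Ipos that by (auto simp: ts0 tsS)
  next
    case (Suc k)
    then show ?thesis using sorted_nth_mono[OF sorted_sorted_list_of_set, of k "Suc k" J] that len by (simp add: tsS)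
  qed
  have "(\<integral>\<omega>. iexp (\<Sum>t\<in>J. y t \<bullet> X t \<omega>) \<partial>M) =
    (\<integral>\<omega>. iexp (\<Sum>i<n. (\<Sum>l\<in>{i..<n}. y (ts (Suc l))) \<bullet> (X (ts (Suc i)) \<omega> - X (ts i) \<omega>)) \<partial>M)"
  proof (rule integral_cong_AE)
    show "(\<lambda>\<omega>. iexp (\<Sum>t\<in>J. y t \<bullet> X t \<omega>)) \<in> borel_measurable M"
      using X J by (intro measurable_compose[OF _ borel_measurable_iexp]) 
        (auto intro!: borel_measurable_sum borel_measurable_inner)
    show "(\<lambda>\<omega>. iexp (\<Sum>i<n. (\<Sum>l\<in>{i..<n}. y (ts (Suc l))) \<bullet> (X (ts (Suc i)) \<omega> - X (ts i) \<omega>))) \<in> borel_measurable M"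
      using X tsI by (intro measurable_compose[OF _ borel_measurable_iexp]) 
        (auto intro!: borel_measurable_sum borel_measurable_inner borel_measurable_diff)
    show "AE \<omega> in M. iexp (\<Sum>t\<in>J. y t \<bullet> X t \<omega>) =
      iexp (\<Sum>i<n. (\<Sum>l\<in>{i..<n}. y (ts (Suc l))) \<bullet> (X (ts (Suc i)) \<omega> - X (ts i) \<omega>))"
      using X0
    proof eventually_elim
      case (elim \<omega>)
      have tel: "X (ts (Suc l)) \<omega> = (\<Sum>i<Suc l. X (ts (Suc i)) \<omega> - X (ts i) \<omega>)" for l
        by (subst sum_lessThan_telescope) (simp add: ts0 elim)
      have "(\<Sum>t\<in>J. y t \<bullet> X t \<omega>) = (\<Sum>l<n. y (ts (Suc l)) \<bullet> X (ts (Suc l)) \<omega>)"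
        using sum.reindex_bij_betw[OF bij_betw_nth[OF distinct_sorted_list_of_set[of J], of "{..<n}" J], of "\<lambda>t. y t \<bullet> X t \<omega>"] len setx
        by (simp add: tsS)
      also have "\<dots> = (\<Sum>l<n. \<Sum>i<Suc l. y (ts (Suc l)) \<bullet> (X (ts (Suc i)) \<omega> - X (ts i) \<omega>))"
        by (subst tel) (simp only: inner_sum_right)
      also have "\<dots> = (\<Sum>i<n. (\<Sum>l\<in>{i..<n}. y (ts (Suc l))) \<bullet> (X (ts (Suc i)) \<omega> - X (ts i) \<omega>))"
        by (subst sum_triangle) (simp only: inner_sum_left)
      finally show ?case by simp
    qed
  qed
  also have "\<dots> = exp (\<Sum>i<n. (c (ts (Suc i)) - c (ts i)) *\<^sub>R \<psi> (\<Sum>l\<in>{i..<n}. y (ts (Suc l))))"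
    using tsI mono by (intro incr_cfD[OF cf]) auto
  finally show ?thesis .
qed

lemma path_law_cfI:
  fixes X :: "real \<Rightarrow> 'w \<Rightarrow> real ^ 'd" and Y :: "real \<Rightarrow> 'v \<Rightarrow> real ^ 'd"
  assumes "prob_space M" "prob_space N"
    and cfX: "incr_cf M I c X \<psi>" and X0: "AE \<omega> in M. X 0 \<omega> = 0"
    and cfY: "incr_cf N I c Y \<psi>" and Y0: "AE \<omega> in N. Y 0 \<omega> = 0"
    and I0: "0 \<in> I" and Ipos: "\<And>s. s \<in> I \<Longrightarrow> 0 \<le> s"
    and X: "\<And>t. t \<in> I \<Longrightarrow> X t \<in> borel_measurable M" and Y: "\<And>t. t \<in> I \<Longrightarrow> Y t \<in> borel_measurable N"
  shows "path_law M I X = path_law N I Y"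
  unfolding path_law_def
proof (rule measure_eqI_PiM_infinite[where I=I and M="\<lambda>_. borel"])
  interpret M: prob_space M by fact
  interpret N: prob_space N by fact
  have mX: "(\<lambda>\<omega>. \<lambda>t\<in>I. X t \<omega>) \<in> M \<rightarrow>\<^sub>M (\<Pi>\<^sub>M t\<in>I. borel)" and mY: "(\<lambda>\<omega>. \<lambda>t\<in>I. Y t \<omega>) \<in> N \<rightarrow>\<^sub>M (\<Pi>\<^sub>M t\<in>I. borel)"
    using X Y by (auto intro!: measurable_restrict)
  show "finite_measure (distr M (\<Pi>\<^sub>M t\<in>I. borel) (\<lambda>\<omega>. \<lambda>t\<in>I. X t \<omega>))"
    by (intro M.finite_measure_distr mX)
  fix A :: "real \<Rightarrow> (real ^ 'd) set" and J assume J: "finite J" "J \<subseteq> I" and A: "\<And>i. i \<in> J \<Longrightarrow> A i \<in> sets borel"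
  have eq: "measure M {\<omega>\<in>space M. \<forall>t\<in>J. X t \<omega> \<in> A t} = measure N {\<omega>\<in>space N. \<forall>t\<in>J. Y t \<omega> \<in> A t}"
  proof (rule cf_determines_rectangles[OF cf_determining_vec M.finite_measure_axioms N.finite_measure_axioms J(1)])
    show "(\<integral>\<omega>. iexp (\<Sum>t\<in>J. y t \<bullet> X t \<omega>) \<partial>M) = (\<integral>\<omega>. iexp (\<Sum>t\<in>J. y t \<bullet> Y t \<omega>) \<partial>N)" for y
      by (rule trans[OF incr_cf_fdd[OF cfX X0 I0 _ J _ refl refl] incr_cf_fdd[OF cfY Y0 I0 _ J _ refl refl, symmetric]])
        (use Ipos X Y in auto)
  qed (use X Y A J in auto)
  have S: "prod_emb I (\<lambda>_. borel) J (Pi\<^sub>E J A) \<in> sets (\<Pi>\<^sub>M t\<in>I. borel)"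
    using J A by (intro sets_PiM_I) auto
  have pX: "(\<lambda>\<omega>. \<lambda>t\<in>I. X t \<omega>) -` prod_emb I (\<lambda>_. borel) J (Pi\<^sub>E J A) \<inter> space M = {\<omega>\<in>space M. \<forall>t\<in>J. X t \<omega> \<in> A t}"
    using J by (fastforce simp: prod_emb_def PiE_iff)
  have pY: "(\<lambda>\<omega>. \<lambda>t\<in>I. Y t \<omega>) -` prod_emb I (\<lambda>_. borel) J (Pi\<^sub>E J A) \<inter> space N = {\<omega>\<in>space N. \<forall>t\<in>J. Y t \<omega> \<in> A t}"
    using J by (fastforce simp: prod_emb_def PiE_iff)
  show "emeasure (distr M (\<Pi>\<^sub>M t\<in>I. borel) (\<lambda>\<omega>. \<lambda>t\<in>I. X t \<omega>)) (prod_emb I (\<lambda>_. borel) J (Pi\<^sub>E J A)) =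
    emeasure (distr N (\<Pi>\<^sub>M t\<in>I. borel) (\<lambda>\<omega>. \<lambda>t\<in>I. Y t \<omega>)) (prod_emb I (\<lambda>_. borel) J (Pi\<^sub>E J A))"
    by (simp add: emeasure_distr[OF mX S] emeasure_distr[OF mY S] pX pY M.emeasure_eq_measure N.emeasure_eq_measure eq)
qed simp_all

section \<open>Concatenation of independent copies\<close>

lemma sum_clamp:
  assumes "T \<ge> 0" "0 \<le> t"
  shows "(\<Sum>j<m. max 0 (min T (t - real j * T))) = min (real m * T) t"
proof (induction m)
  case (Suc m)
  then show ?case using assms by (auto simp: distrib_right max_def min_def)
qed (use assms in simp)

lemma cadlag_on_mono: "cadlag_on UNIV f \<Longrightarrow> cadlag_on I (f :: real \<Rightarrow> 'v::topological_space)"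
  unfolding cadlag_on_def by (auto intro: tendsto_within_subset)

lemma cadlag_on_shift:
  fixes f :: "real \<Rightarrow> 'v::topological_space"
  assumes "cadlag_on UNIV f" shows "cadlag_on UNIV (\<lambda>t. f (t - a))"
  unfolding cadlag_on_def
proof safe
  fix t
  have r: "filterlim (\<lambda>t. t - a) (at_right (t - a)) (at_right t)" and l: "filterlim (\<lambda>t. t - a) (at_left (t - a)) (at_left t)"
    by (auto simp: filterlim_at eventually_at_filter intro!: tendsto_eq_intros)
  from assms obtain L where "(f \<longlongrightarrow> f (t - a)) (at_right (t - a))" "(f \<longlongrightarrow> L) (at_left (t - a))"
    unfolding cadlag_on_def by auto
  from filterlim_compose[OF this(1) r] filterlim_compose[OF this(2) l]
  show "((\<lambda>t. f (t - a)) \<longlongrightarrow> f (t - a)) (at t within UNIV \<inter> {t<..})"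
    "\<exists>l. ((\<lambda>t. f (t - a)) \<longlongrightarrow> l) (at t within UNIV \<inter> {..<t})" by auto
qed

lemma cadlag_on_sum:
  fixes f :: "'i \<Rightarrow> real \<Rightarrow> 'v::real_normed_vector"
  assumes "\<And>i. i \<in> A \<Longrightarrow> cadlag_on UNIV (f i)" shows "cadlag_on UNIV (\<lambda>t. \<Sum>i\<in>A. f i t)"
  unfolding cadlag_on_def
proof safe
  fix t
  have "\<forall>i. \<exists>l. i \<in> A \<longrightarrow> (f i \<longlongrightarrow> l) (at_left t)" using assms by (auto simp: cadlag_on_def)
  then obtain l where "\<And>i. i \<in> A \<Longrightarrow> (f i \<longlongrightarrow> l i) (at_left t)" by metis
  then have "((\<lambda>t. \<Sum>i\<in>A. f i t) \<longlongrightarrow> (\<Sum>i\<in>A. l i)) (at_left t)" by (rule tendsto_sum)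
  then show "\<exists>l. ((\<lambda>t. \<Sum>i\<in>A. f i t) \<longlongrightarrow> l) (at t within UNIV \<inter> {..<t})" by auto
  show "((\<lambda>t. \<Sum>i\<in>A. f i t) \<longlongrightarrow> (\<Sum>i\<in>A. f i t)) (at t within UNIV \<inter> {t<..})"
    using assms by (intro tendsto_sum) (auto simp: cadlag_on_def)
qed

text \<open>Countably many independent copies of \<open>X\<close> are run one after the other; copy
  \<open>j\<close> is 0 up to time \<open>j * T\<close> and its clock stops at
  \<open>(j + 1) * T\<close>. Path space is then used as the sample space, which gives the sample
  points the required type.\<close>

lemma levy_extension:
  fixes X :: "real \<Rightarrow> 's \<Rightarrow> real ^ 'd"
  assumes S: "prob_space S" and T: "T > 0"
    and X: "\<And>t. X t \<in> borel_measurable S"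
    and X0: "\<And>t \<omega>. t \<le> 0 \<Longrightarrow> X t \<omega> = 0"
    and cad: "\<And>\<omega>. cadlag_on UNIV (\<lambda>t. X t \<omega>)"
    and cf: "incr_cf S UNIV (\<lambda>t. max 0 (min T t)) X \<psi>"
  shows "\<exists>(N :: (real \<Rightarrow> real ^ 'd) measure) Y. prob_space N \<and> levy_process_on N {0..} Y \<and>
     incr_cf N {0..} (\<lambda>t. t) Y \<psi> \<and> (AE \<omega> in N. Y 0 \<omega> = 0) \<and> (\<forall>t\<ge>0. Y t \<in> borel_measurable N)"
proof -
  interpret S: prob_space S by fact
  define P where "P = PiM UNIV (\<lambda>_::nat. S)"
  interpret PS: product_prob_space "\<lambda>_::nat. S" UNIV by (intro product_prob_spaceI S)
  interpret P: prob_space P unfolding P_def by (intro prob_space_PiM S)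
  define Y where "Y t w = (\<Sum>j<nat \<lceil>t / T\<rceil>. X (t - real j * T) (w j))" for t and w :: "nat \<Rightarrow> 's"
  \<comment> \<open>Copies that have not started contribute 0, so one fixed number of summands works
    for all times up to \<open>m * T\<close>. This gives cadlag paths locally and a common range for
    finitely many times.\<close>
  have Yalt: "Y t w = (\<Sum>j<m. X (t - real j * T) (w j))" if "t \<le> real m * T" for t w m
  proof -
    have "t / T \<le> real m" using that T by (simp add: field_simps)
    then have le: "nat \<lceil>t / T\<rceil> \<le> m" by (simp add: ceiling_le_iff nat_le_iff)
    show ?thesis unfolding Y_def
    proof (rule sum.mono_neutral_left)
      show "\<forall>j\<in>{..<m} - {..<nat \<lceil>t / T\<rceil>}. X (t - real j * T) (w j) = 0"
      proof
        fix j assume "j \<in> {..<m} - {..<nat \<lceil>t / T\<rceil>}"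
        then have "nat \<lceil>t / T\<rceil> \<le> j" by auto
        then have "t / T \<le> real j" by linarith
        then show "X (t - real j * T) (w j) = 0" using T by (intro X0) (simp add: field_simps)
      qed
    qed (use le in auto)
  qed
  have cw: "(\<lambda>w. w j) \<in> P \<rightarrow>\<^sub>M S" for j unfolding P_def by simp
  have Xw: "(\<lambda>w. X t (w j)) \<in> borel_measurable P" for t j
    by (rule measurable_compose[OF cw X])
  have Ym: "Y t \<in> borel_measurable P" for t
    unfolding Y_def by (intro borel_measurable_sum Xw)
  have Ycad: "cadlag_on {0..} (\<lambda>t. Y t w)" for w
  proof -
    have loc: "cadlag_on UNIV (\<lambda>t. \<Sum>j<m. X (t - real j * T) (w j))" for m
      by (intro cadlag_on_sum cadlag_on_shift cad)
    show ?thesis unfolding cadlag_on_def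
    proof safe
      fix t :: real
      obtain m where m: "t / T < real m" using reals_Archimedean2 by blast
      then have mt: "t < real m * T" using T by (simp add: field_simps)
      let ?g = "\<lambda>t. \<Sum>j<m. X (t - real j * T) (w j)"
      have ev: "eventually (\<lambda>s. ?g s = Y s w) (at t within A)" for A
        using order_tendstoD(2)[OF tendsto_ident_at mt]
        by eventually_elim (simp add: Yalt[symmetric])
      obtain l where "(?g \<longlongrightarrow> ?g t) (at_right t)" "(?g \<longlongrightarrow> l) (at_left t)"
        using loc[of m] unfolding cadlag_on_def by auto
      then have g: "(?g \<longlongrightarrow> ?g t) (at t within {0..} \<inter> {t<..})" "(?g \<longlongrightarrow> l) (at t within {0..} \<inter> {..<t})"
        by (auto elim!: tendsto_within_subset)
      show "((\<lambda>t. Y t w) \<longlongrightarrow> Y t w) (at t within {0..} \<inter> {t<..})"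
        using Lim_transform_eventually[OF g(1) ev] Yalt[of t m w] mt by simp
      show "\<exists>l. ((\<lambda>t. Y t w) \<longlongrightarrow> l) (at t within {0..} \<inter> {..<t})"
        using Lim_transform_eventually[OF g(2) ev] by blast
    qed
  qed
  have cfY: "incr_cf P {0..} (\<lambda>t. t) Y \<psi>"
    unfolding incr_cf_def
  proof (intro allI impI, elim conjE)
    fix n :: nat and ts :: "nat \<Rightarrow> real" and y :: "nat \<Rightarrow> real ^ 'd"
    assume ts: "\<forall>i\<le>n. ts i \<in> {0..}" and mono: "\<forall>i<n. ts i \<le> ts (Suc i)"
    obtain m where m: "Max (ts ` {..n}) / T < real m" using reals_Archimedean2 by blast
    have mt: "ts i \<le> real m * T" if "i \<le> n" for i
    proof -
      have "ts i \<le> Max (ts ` {..n})" using that by auto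
      also have "\<dots> \<le> real m * T" using m T by (simp only: pos_divide_less_eq)
      finally show ?thesis .
    qed
    define F where "F j v = iexp (\<Sum>i<n. y i \<bullet> (X (ts (Suc i) - real j * T) v - X (ts i - real j * T) v))" for j v
    have Fm: "F j \<in> borel_measurable S" for j
      unfolding F_def using X by (intro measurable_compose[OF _ borel_measurable_iexp])
        (auto intro!: borel_measurable_sum borel_measurable_inner borel_measurable_diff)
    have dP: "distr P (PiM {..<m} (\<lambda>_. S)) (\<lambda>w. restrict w {..<m}) = PiM {..<m} (\<lambda>_. S)"
      unfolding P_def by (rule PS.distr_PiM_restrict_finite) auto
    have rm: "(\<lambda>w. restrict w {..<m}) \<in> P \<rightarrow>\<^sub>M PiM {..<m} (\<lambda>_. S)"
      unfolding P_def by (intro measurable_restrict_subset) auto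
    have Fp: "(\<lambda>x. \<Prod>j<m. F j (x j)) \<in> borel_measurable (PiM {..<m} (\<lambda>_. S))"
    proof (rule borel_measurable_prod)
      fix j assume "j \<in> {..<m}"
      then show "(\<lambda>x. F j (x j)) \<in> borel_measurable (PiM {..<m} (\<lambda>_. S))"
        using measurable_compose[OF measurable_component_singleton[of j "{..<m}" "\<lambda>_. S"] Fm] by simp
    qed
    have "(\<integral>w. iexp (\<Sum>i<n. y i \<bullet> (Y (ts (Suc i)) w - Y (ts i) w)) \<partial>P) = (\<integral>w. (\<Prod>j<m. F j (w j)) \<partial>P)"
    proof (rule Bochner_Integration.integral_cong[OF refl])
      fix w
      have "(\<Sum>i<n. y i \<bullet> (Y (ts (Suc i)) w - Y (ts i) w)) =
        (\<Sum>i<n. \<Sum>j<m. y i \<bullet> (X (ts (Suc i) - real j * T) (w j) - X (ts i - real j * T) (w j)))"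
        using mt by (intro sum.cong refl) (simp add: Yalt[of _ m] sum_subtractf[symmetric] inner_sum_right)
      also have "\<dots> = (\<Sum>j<m. \<Sum>i<n. y i \<bullet> (X (ts (Suc i) - real j * T) (w j) - X (ts i - real j * T) (w j)))"
        by (rule sum.swap)
      finally have "iexp (\<Sum>i<n. y i \<bullet> (Y (ts (Suc i)) w - Y (ts i) w)) =
        exp (\<Sum>j<m. \<i> * complex_of_real (\<Sum>i<n. y i \<bullet> (X (ts (Suc i) - real j * T) (w j) - X (ts i - real j * T) (w j))))"
        by (simp only: of_real_sum sum_distrib_left)
      then show "iexp (\<Sum>i<n. y i \<bullet> (Y (ts (Suc i)) w - Y (ts i) w)) = (\<Prod>j<m. F j (w j))"
        unfolding F_def by (simp only: exp_sum[OF finite_lessThan])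
    qed
    also have "\<dots> = (\<integral>x. (\<Prod>j<m. F j (x j)) \<partial>distr P (PiM {..<m} (\<lambda>_. S)) (\<lambda>w. restrict w {..<m}))"
      by (subst integral_distr[OF rm Fp]) simp
    also have "\<dots> = (\<Prod>j<m. \<integral>v. F j v \<partial>S)"
      unfolding dP
    proof (rule PS.product_integral_prod)
      have "norm (F j v) \<le> 1" for j v by (simp only: F_def norm_exp_i_times)
      then show "integrable S (F j)" for j by (intro S.integrable_const_bound[where B=1] Fm) auto
    qed simp
    also have "\<dots> = (\<Prod>j<m. exp (\<Sum>i<n. (max 0 (min T (ts (Suc i) - real j * T)) - max 0 (min T (ts i - real j * T))) *\<^sub>R \<psi> (y i)))"
      unfolding F_def using mono
      by (intro prod.cong refl incr_cfD[OF cf, where ts="\<lambda>i. ts i - real _ * T"]) auto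
    also have "\<dots> = exp (\<Sum>j<m. \<Sum>i<n. (max 0 (min T (ts (Suc i) - real j * T)) - max 0 (min T (ts i - real j * T))) *\<^sub>R \<psi> (y i))"
      by (simp only: exp_sum[OF finite_lessThan])
    also have "\<dots> = exp (\<Sum>i<n. (\<Sum>j<m. max 0 (min T (ts (Suc i) - real j * T)) - max 0 (min T (ts i - real j * T))) *\<^sub>R \<psi> (y i))"
      by (subst sum.swap) (simp only: scaleR_sum_left)
    \<comment> \<open>The clock of copy \<open>j\<close> measures the part of \<open>[0, t]\<close>
      in the block from \<open>j * T\<close> to \<open>(j + 1) * T\<close>; by
      \<open>sum_clamp\<close> these lengths add up to \<open>t\<close>.\<close>
    also have "\<dots> = exp (\<Sum>i<n. (ts (Suc i) - ts i) *\<^sub>R \<psi> (y i))"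
      using T ts mt by (intro arg_cong[where f=exp] sum.cong refl arg_cong2[where f=scaleR])
        (simp add: sum_subtractf sum_clamp min_absorb2)
    finally show "(\<integral>w. iexp (\<Sum>i<n. y i \<bullet> (Y (ts (Suc i)) w - Y (ts i) w)) \<partial>P) = exp (\<Sum>i<n. (ts (Suc i) - ts i) *\<^sub>R \<psi> (y i))" .
  qed
  define \<Phi> where "\<Phi> w = (\<lambda>t. Y t w)" for w
  \<comment> \<open>The product sigma-algebra does not contain the set of cadlag paths. The largest
    sigma-algebra that makes \<Phi> measurable does, since the preimage of this set is
    everything.\<close>
  define \<A> where "\<A> = {A. \<Phi> -` A \<inter> space P \<in> sets P}"
  have sa: "sigma_algebra UNIV \<A>"
    unfolding sigma_algebra_iff2
  proof (intro conjI ballI allI impI)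
    fix A assume "A \<in> \<A>"
    then have "space P - (\<Phi> -` A \<inter> space P) \<in> sets P" by (auto simp: \<A>_def)
    moreover have "\<Phi> -` (UNIV - A) \<inter> space P = space P - (\<Phi> -` A \<inter> space P)" by blast
    ultimately show "UNIV - A \<in> \<A>" by (simp add: \<A>_def)
  next
    fix A :: "nat \<Rightarrow> _" assume "range A \<subseteq> \<A>"
    then have "(\<Union>i. \<Phi> -` A i \<inter> space P) \<in> sets P" unfolding \<A>_def by blast
    moreover have "\<Phi> -` (\<Union>i. A i) \<inter> space P = (\<Union>i. \<Phi> -` A i \<inter> space P)" by blast
    ultimately show "(\<Union>i. A i) \<in> \<A>" by (simp add: \<A>_def)
  qed (auto simp: \<A>_def)
  define Q where "Q = measure_of UNIV \<A> (\<lambda>_. 0)"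
  have sQ: "sets Q = \<A>" and spQ: "space Q = UNIV"
    unfolding Q_def by (simp_all add: sigma_algebra.sets_measure_of_eq[OF sa] sigma_algebra.space_measure_of_eq[OF sa])
  have \<Phi>m: "\<Phi> \<in> P \<rightarrow>\<^sub>M Q"
    by (rule measurableI) (auto simp: spQ sQ \<A>_def)
  define N where "N = distr P Q \<Phi>"
  interpret N: prob_space N unfolding N_def by (rule P.prob_space_distr[OF \<Phi>m])
  have evm: "(\<lambda>f. f t) \<in> borel_measurable N" for t :: real
  proof (rule measurableI)
    fix B :: "(real ^ 'd) set" assume "B \<in> sets borel"
    then have "(\<lambda>w. Y t w) -` B \<inter> space P \<in> sets P" using Ym by measurable
    then show "(\<lambda>f. f t) -` B \<inter> space N \<in> sets N"
      by (simp add: N_def sQ spQ \<A>_def \<Phi>_def vimage_def)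
  qed simp
  have cfN: "incr_cf N {0..} (\<lambda>t. t) (\<lambda>t f. f t) \<psi>"
    unfolding incr_cf_def
  proof (intro allI impI)
    fix n :: nat and ts :: "nat \<Rightarrow> real" and y :: "nat \<Rightarrow> real ^ 'd"
    assume *: "(\<forall>i\<le>n. ts i \<in> {0..}) \<and> (\<forall>i<n. ts i \<le> ts (Suc i))"
    have "(\<integral>f. iexp (\<Sum>i<n. y i \<bullet> (f (ts (Suc i)) - f (ts i))) \<partial>N) = (\<integral>w. iexp (\<Sum>i<n. y i \<bullet> (Y (ts (Suc i)) w - Y (ts i) w)) \<partial>P)"
    proof -
      have "(\<lambda>f. iexp (\<Sum>i<n. y i \<bullet> (f (ts (Suc i)) - f (ts i)))) \<in> borel_measurable N"
        using evm by (intro measurable_compose[OF _ borel_measurable_iexp])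
          (auto intro!: borel_measurable_sum borel_measurable_inner borel_measurable_diff)
      then show ?thesis
        unfolding N_def by (subst integral_distr[OF \<Phi>m]) (simp_all add: \<Phi>_def)
    qed
    also have "\<dots> = exp (\<Sum>i<n. (ts (Suc i) - ts i) *\<^sub>R \<psi> (y i))"
      by (rule incr_cfD[OF cfY]) (use * in auto)
    finally show "(\<integral>f. iexp (\<Sum>i<n. y i \<bullet> (f (ts (Suc i)) - f (ts i))) \<partial>N) = exp (\<Sum>i<n. (ts (Suc i) - ts i) *\<^sub>R \<psi> (y i))" .
  qed
  have cN: "AE f in N. cadlag_on {0..} f"
  proof -
    have e: "\<Phi> -` {f. cadlag_on {0..} f} = UNIV" using Ycad by (auto simp: \<Phi>_def)
    have "{f. cadlag_on {0..} f} \<in> \<A>" unfolding \<A>_def mem_Collect_eq e by simp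
    then have "{f \<in> space Q. cadlag_on {0..} f} \<in> sets Q" by (simp add: sQ spQ)
    then show ?thesis unfolding N_def using Ycad by (subst AE_distr_iff[OF \<Phi>m]) (auto simp: \<Phi>_def)
  qed
  have zN: "AE f in N. f 0 = 0"
  proof -
    have e: "\<Phi> -` {f. f 0 = 0} = UNIV" by (auto simp: \<Phi>_def Y_def)
    have "{f. f 0 = 0} \<in> \<A>" unfolding \<A>_def mem_Collect_eq e by simp
    then have "{f \<in> space Q. f 0 = 0} \<in> sets Q" by (simp add: sQ spQ)
    then show ?thesis unfolding N_def by (subst AE_distr_iff[OF \<Phi>m]) (auto simp: \<Phi>_def Y_def)
  qed
  have "levy_process_on N {0..} (\<lambda>t f. f t)"
    by (rule levy_process_on_cfI[OF N.prob_space_axioms _ _ _ _ zN cfN cN]) (use evm in auto)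
  then show ?thesis using N.prob_space_axioms cfN zN evm by blast
qed

section \<open>Maximal inequalities\<close>

lemma integrable_mult_square:
  fixes f g :: "'a \<Rightarrow> real"
  assumes [measurable]: "f \<in> borel_measurable M" "g \<in> borel_measurable M"
    and "integrable M (\<lambda>x. (f x)\<^sup>2)" "integrable M (\<lambda>x. (g x)\<^sup>2)"
  shows "integrable M (\<lambda>x. f x * g x)"
proof (rule Bochner_Integration.integrable_bound)
  show "integrable M (\<lambda>x. (f x)\<^sup>2 + (g x)\<^sup>2)" using assms by simp
  show "AE x in M. norm (f x * g x) \<le> norm ((f x)\<^sup>2 + (g x)\<^sup>2)"
  proof (intro AE_I2)
    fix x
    have "2 * \<bar>f x\<bar> * \<bar>g x\<bar> \<le> \<bar>f x\<bar>\<^sup>2 + \<bar>g x\<bar>\<^sup>2" by (rule sum_squares_bound)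
    moreover have "0 \<le> \<bar>f x\<bar> * \<bar>g x\<bar>" by simp
    ultimately have "\<bar>f x\<bar> * \<bar>g x\<bar> \<le> (f x)\<^sup>2 + (g x)\<^sup>2" by (simp only: power2_abs)
    then show "norm (f x * g x) \<le> norm ((f x)\<^sup>2 + (g x)\<^sup>2)" by (simp add: abs_mult)
  qed
qed simp

lemma integrable_square_bound:
  fixes f g :: "'a \<Rightarrow> real"
  assumes "f \<in> borel_measurable M" "integrable M (\<lambda>x. (g x)\<^sup>2)" "\<And>x. \<bar>f x\<bar> \<le> \<bar>g x\<bar>"
  shows "integrable M (\<lambda>x. (f x)\<^sup>2)"
  by (rule Bochner_Integration.integrable_bound[OF assms(2)]) (use assms(1,3) in \<open>auto simp: abs_le_square_iff\<close>)

lemma square_sum_le_card: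
  fixes f :: "'i \<Rightarrow> real"
  assumes "finite I"
  shows "(\<Sum>i\<in>I. f i)\<^sup>2 \<le> card I * (\<Sum>i\<in>I. (f i)\<^sup>2)"
  using Cauchy_Schwarz_ineq_sum[of "\<lambda>_. 1" f I] by simp

lemma integrable_square_sum:
  fixes f :: "'i \<Rightarrow> 'a \<Rightarrow> real"
  assumes I: "finite I" and f: "\<And>i. i \<in> I \<Longrightarrow> f i \<in> borel_measurable M" "\<And>i. i \<in> I \<Longrightarrow> integrable M (\<lambda>x. (f i x)\<^sup>2)"
  shows "integrable M (\<lambda>x. (\<Sum>i\<in>I. f i x)\<^sup>2)"
proof (rule Bochner_Integration.integrable_bound)
  show "integrable M (\<lambda>x. card I * (\<Sum>i\<in>I. (f i x)\<^sup>2))" using f by (intro integrable_mult_right Bochner_Integration.integrable_sum) auto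
  show "AE x in M. norm ((\<Sum>i\<in>I. f i x)\<^sup>2) \<le> norm (card I * (\<Sum>i\<in>I. (f i x)\<^sup>2))"
    using square_sum_le_card[OF I] by (auto simp: abs_of_nonneg sum_nonneg)
qed (use f in simp)

text \<open>Doob's L2 inequality before taking expectations. With \<open>m\<close> the running
  maximum, the transform sum is at most \<open>m N * x N - (m N)\<^sup>2 / 2\<close>: this is kept
  while the maximum stays and gains \<open>(x (Suc N) - m N)\<^sup>2 / 2\<close> when it is raised.
  Completing the square in \<open>m N - 2 * x N\<close> produces the factor 4.\<close>

lemma pathwise_doob:
  fixes x :: "nat \<Rightarrow> real"
  shows "(Max (x ` {..N}))\<^sup>2 + 4 * (\<Sum>k<N. Max (x ` {..k}) * (x (Suc k) - x k)) \<le> 4 * (x N)\<^sup>2"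
proof -
  let ?m = "\<lambda>k. Max (x ` {..k})"
  have step: "?m (Suc k) = max (x (Suc k)) (?m k)" for k
    by (simp add: atMost_Suc)
  have "(\<Sum>k<N. ?m k * (x (Suc k) - x k)) \<le> ?m N * x N - (?m N)\<^sup>2 / 2"
  proof (induction N)
    case 0
    have "0 \<le> (x 0)\<^sup>2" by simp
    then show ?case by (simp add: power2_eq_square)
  next
    case (Suc N)
    have "?m N * x (Suc N) - (?m N)\<^sup>2 / 2 \<le> ?m (Suc N) * x (Suc N) - (?m (Suc N))\<^sup>2 / 2"
    proof (cases "x (Suc N) \<le> ?m N")
      case False
      have "0 \<le> (x (Suc N) - ?m N)\<^sup>2" by simp
      then show ?thesis using False unfolding step by (simp add: max_def power2_eq_square algebra_simps)
    qed (simp add: step max_def)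
    with Suc show ?case by (simp add: algebra_simps)
  qed
  moreover have "0 \<le> (?m N - 2 * x N)\<^sup>2" by simp
  ultimately show ?thesis by (simp add: power2_eq_square algebra_simps)
qed

text \<open>The increments of each \<open>X j\<close> are only required to be orthogonal to functions of the past of
  the whole family; the maximum over \<open>J\<close> is then a submartingale.\<close>

lemma doob_L2:
  fixes X :: "'j \<Rightarrow> nat \<Rightarrow> 'a \<Rightarrow> real"
  assumes J: "finite J" "J \<noteq> {}"
    and X: "\<And>j k. j \<in> J \<Longrightarrow> X j k \<in> borel_measurable M"
    and sq: "\<And>j k. j \<in> J \<Longrightarrow> integrable M (\<lambda>\<omega>. (X j k \<omega>)\<^sup>2)"
    and orth: "\<And>k j Z. k < K \<Longrightarrow> j \<in> J \<Longrightarrow> Z \<in> borel_measurable M \<Longrightarrow> integrable M (\<lambda>\<omega>. (Z \<omega>)\<^sup>2) \<Longrightarrow>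
      \<forall>\<omega> \<omega>'. (\<forall>j\<in>J. \<forall>l\<le>k. X j l \<omega> = X j l \<omega>') \<longrightarrow> Z \<omega> = Z \<omega>' \<Longrightarrow>
      (\<integral>\<omega>. Z \<omega> * (X j (Suc k) \<omega> - X j k \<omega>) \<partial>M) = 0"
  shows "integrable M (\<lambda>\<omega>. (Max ((\<lambda>k. Max ((\<lambda>j. \<bar>X j k \<omega>\<bar>) ` J)) ` {..K}))\<^sup>2)" (is ?int)
    and "(\<integral>\<omega>. (Max ((\<lambda>k. Max ((\<lambda>j. \<bar>X j k \<omega>\<bar>) ` J)) ` {..K}))\<^sup>2 \<partial>M) \<le> 4 * (\<integral>\<omega>. (Max ((\<lambda>j. \<bar>X j K \<omega>\<bar>) ` J))\<^sup>2 \<partial>M)" (is ?le)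
proof -
  define f where "f k \<omega> = Max ((\<lambda>j. \<bar>X j k \<omega>\<bar>) ` J)" for k \<omega>
  define m where "m k \<omega> = Max ((\<lambda>l. f l \<omega>) ` {..k})" for k \<omega>
  \<comment> \<open>The coefficients \<open>c\<close> form a subgradient of the maximum of absolute
    values: signs, averaged over all indices that attain it. Averaging avoids a choice, so that
    \<open>c\<close> is measurable and a function of the current values alone.\<close>
  define cnt where "cnt k \<omega> = (\<Sum>j\<in>J. if \<bar>X j k \<omega>\<bar> = f k \<omega> then 1 else 0 :: real)" for k \<omega>
  define c where "c j k \<omega> = (if \<bar>X j k \<omega>\<bar> = f k \<omega> then sgn (X j k \<omega>) / cnt k \<omega> else 0)" for j k \<omega>
  have Xf: "\<bar>X j k \<omega>\<bar> \<le> f k \<omega>" if "j \<in> J" for j k \<omega>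
    using that J by (auto simp: f_def)
  have f0: "0 \<le> f k \<omega>" for k \<omega>
    using J Xf by (metis abs_ge_zero all_not_in_conv order_trans)
  have fm[measurable]: "f k \<in> borel_measurable M" for k
    unfolding f_def using J X by (intro borel_measurable_Max) auto
  have mm[measurable]: "m k \<in> borel_measurable M" for k
    unfolding m_def by (intro borel_measurable_Max) auto
  have ex: "\<exists>j\<in>J. \<bar>X j k \<omega>\<bar> = f k \<omega>" for k \<omega>
  proof -
    have "f k \<omega> \<in> (\<lambda>j. \<bar>X j k \<omega>\<bar>) ` J" unfolding f_def using J by (intro Max_in) auto
    then show ?thesis by auto
  qed
  have cnt1: "cnt k \<omega> \<ge> 1" for k \<omega>
  proof -
    obtain j where "j \<in> J" "\<bar>X j k \<omega>\<bar> = f k \<omega>" using ex by blast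
    then show ?thesis
      using member_le_sum[of j J "\<lambda>j. if \<bar>X j k \<omega>\<bar> = f k \<omega> then 1 else 0 :: real"] J by (simp add: cnt_def)
  qed
  have cntm[measurable]: "cnt k \<in> borel_measurable M" for k
    unfolding cnt_def
  proof (rule borel_measurable_sum)
    fix j assume "j \<in> J"
    note [measurable] = X[OF this]
    show "(\<lambda>\<omega>. if \<bar>X j k \<omega>\<bar> = f k \<omega> then 1 else 0 :: real) \<in> borel_measurable M" by measurable
  qed
  have cm: "c j k \<in> borel_measurable M" if "j \<in> J" for j k
    unfolding c_def using X[OF that] by measurable
  have mf: "f l \<omega> \<le> m k \<omega>" if "l \<le> k" for l k \<omega>
    using that by (auto simp: m_def)
  have m0: "0 \<le> m k \<omega>" for k \<omega>
    using mf[of k k \<omega>] f0[of k \<omega>] by linarith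
  have cabs: "\<bar>c j k \<omega>\<bar> \<le> 1" for j k \<omega>
    using cnt1[of k \<omega>] by (auto simp: c_def abs_sgn_eq divide_le_eq)
  have c1: "(\<Sum>j\<in>J. c j k \<omega> * X j k \<omega>) = f k \<omega>" for k \<omega>
  proof -
    have "(\<Sum>j\<in>J. c j k \<omega> * X j k \<omega>) = (\<Sum>j\<in>J. (if \<bar>X j k \<omega>\<bar> = f k \<omega> then 1 else 0) * (f k \<omega> / cnt k \<omega>))"
      by (intro sum.cong refl) (auto simp: c_def abs_sgn[symmetric] mult.commute)
    also have "\<dots> = cnt k \<omega> * (f k \<omega> / cnt k \<omega>)" by (simp only: sum_distrib_right[symmetric] cnt_def)
    finally show ?thesis using cnt1[of k \<omega>] by simp
  qed
  have c2: "(\<Sum>j\<in>J. c j k \<omega> * X j (Suc k) \<omega>) \<le> f (Suc k) \<omega>" for k \<omega>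
  proof -
    have "(\<Sum>j\<in>J. c j k \<omega> * X j (Suc k) \<omega>) \<le> (\<Sum>j\<in>J. (if \<bar>X j k \<omega>\<bar> = f k \<omega> then 1 else 0) * (f (Suc k) \<omega> / cnt k \<omega>))"
    proof (rule sum_mono)
      fix j assume j: "j \<in> J"
      have "sgn (X j k \<omega>) * X j (Suc k) \<omega> \<le> f (Suc k) \<omega>"
        using Xf[OF j, of "Suc k" \<omega>] f0[of "Suc k" \<omega>] by (auto simp: sgn_if)
      then show "c j k \<omega> * X j (Suc k) \<omega> \<le> (if \<bar>X j k \<omega>\<bar> = f k \<omega> then 1 else 0) * (f (Suc k) \<omega> / cnt k \<omega>)"
        using cnt1[of k \<omega>] by (auto simp: c_def divide_right_mono)
    qed
    also have "\<dots> = cnt k \<omega> * (f (Suc k) \<omega> / cnt k \<omega>)" by (simp only: sum_distrib_right[symmetric] cnt_def)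
    finally show ?thesis using cnt1[of k \<omega>] by simp
  qed
  have sqf: "integrable M (\<lambda>\<omega>. (f k \<omega>)\<^sup>2)" for k
  proof (rule integrable_square_bound[where g="\<lambda>\<omega>. \<Sum>j\<in>J. \<bar>X j k \<omega>\<bar>"])
    show "integrable M (\<lambda>x. (\<Sum>j\<in>J. \<bar>X j k x\<bar>)\<^sup>2)"
      using X sq J by (intro integrable_square_sum) (auto intro: borel_measurable_abs)
    fix \<omega>
    obtain j where "j \<in> J" "\<bar>X j k \<omega>\<bar> = f k \<omega>" using ex by blast
    then have "f k \<omega> \<le> (\<Sum>j\<in>J. \<bar>X j k \<omega>\<bar>)" using J member_le_sum[of j J "\<lambda>j. \<bar>X j k \<omega>\<bar>"] by auto
    then show "\<bar>f k \<omega>\<bar> \<le> \<bar>\<Sum>j\<in>J. \<bar>X j k \<omega>\<bar>\<bar>" using f0[of k \<omega>] by simp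
  qed simp
  have sqm: "integrable M (\<lambda>\<omega>. (m k \<omega>)\<^sup>2)" for k
  proof (rule integrable_square_bound[where g="\<lambda>\<omega>. \<Sum>l\<le>k. f l \<omega>"])
    show "integrable M (\<lambda>x. (\<Sum>l\<le>k. f l x)\<^sup>2)" by (intro integrable_square_sum sqf) auto
    fix \<omega>
    have "m k \<omega> \<in> (\<lambda>l. f l \<omega>) ` {..k}" unfolding m_def by (intro Max_in) auto
    then obtain l where "l \<le> k" "m k \<omega> = f l \<omega>" by auto
    then have "m k \<omega> \<le> (\<Sum>l\<le>k. f l \<omega>)" using member_le_sum[of l "{..k}" "\<lambda>l. f l \<omega>"] f0 by auto
    then show "\<bar>m k \<omega>\<bar> \<le> \<bar>\<Sum>l\<le>k. f l \<omega>\<bar>" using m0[of k \<omega>] by simp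
  qed simp
  have sqZ: "integrable M (\<lambda>\<omega>. (m k \<omega> * c j k \<omega>)\<^sup>2)" if "j \<in> J" for j k
    using cabs cm[OF that] by (intro integrable_square_bound[OF _ sqm[of k]]) (auto simp: abs_mult mult_left_le)
  have sqD: "integrable M (\<lambda>\<omega>. (X j (Suc k) \<omega> - X j k \<omega>)\<^sup>2)" if "j \<in> J" for j k
    unfolding power2_diff mult.assoc
    by (intro Bochner_Integration.integrable_diff Bochner_Integration.integrable_add integrable_mult_right
        integrable_mult_square sq X that)
  have int: "integrable M (\<lambda>\<omega>. (m k \<omega> * c j k \<omega>) * (X j (Suc k) \<omega> - X j k \<omega>))" if "j \<in> J" for j k
    using X[OF that] cm[OF that] by (intro integrable_mult_square sqZ sqD that) auto
  have zero: "(\<integral>\<omega>. (m k \<omega> * c j k \<omega>) * (X j (Suc k) \<omega> - X j k \<omega>) \<partial>M) = 0" if "j \<in> J" "k < K" for j k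
  proof (rule orth[OF that(2,1) _ sqZ[OF that(1)]], safe)
    fix \<omega> \<omega>' assume eq': "\<forall>j\<in>J. \<forall>l\<le>k. X j l \<omega> = X j l \<omega>'"
    have eq: "X j l \<omega> = X j l \<omega>'" if "j \<in> J" "l \<le> k" for j l using eq' that by blast
    have f: "f l \<omega> = f l \<omega>'" if "l \<le> k" for l
      unfolding f_def using eq that by (intro arg_cong[where f=Max] image_cong) auto
    have "m k \<omega> = m k \<omega>'" unfolding m_def using f by (intro arg_cong[where f=Max] image_cong) auto
    moreover have "cnt k \<omega> = cnt k \<omega>'" unfolding cnt_def using f eq by (intro sum.cong) auto
    moreover have "c j k \<omega> = c j k \<omega>'" unfolding c_def using f eq[OF that(1) order_refl] calculation by auto
    ultimately show "m k \<omega> * c j k \<omega> = m k \<omega>' * c j k \<omega>'" by simp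
  qed (use cm that in auto)
  \<comment> \<open>By \<open>c1\<close> and \<open>c2\<close>, \<open>R\<close> lies below the
    transform sum of \<open>f\<close> in \<open>pathwise_doob\<close>; being a combination of
    increments of the \<open>X j\<close> with coefficients from the past, it has mean 0.\<close>
  define R where "R \<omega> = (\<Sum>k<K. \<Sum>j\<in>J. (m k \<omega> * c j k \<omega>) * (X j (Suc k) \<omega> - X j k \<omega>))" for \<omega>
  have Rint: "integrable M R" unfolding R_def by (intro Bochner_Integration.integrable_sum int)
  have "integral\<^sup>L M R = (\<Sum>k<K. \<Sum>j\<in>J. \<integral>\<omega>. (m k \<omega> * c j k \<omega>) * (X j (Suc k) \<omega> - X j k \<omega>) \<partial>M)"
    unfolding R_def by (subst Bochner_Integration.integral_sum, (intro Bochner_Integration.integrable_sum int)?)+ (auto intro!: sum.cong Bochner_Integration.integral_sum int)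
  also have "\<dots> = 0" by (simp add: zero)
  finally have R0: "integral\<^sup>L M R = 0" .
  have pt: "(m K \<omega>)\<^sup>2 \<le> 4 * (f K \<omega>)\<^sup>2 - 4 * R \<omega>" for \<omega>
  proof -
    have "R \<omega> \<le> (\<Sum>k<K. m k \<omega> * (f (Suc k) \<omega> - f k \<omega>))"
      unfolding R_def
    proof (rule sum_mono)
      fix k
      have "(\<Sum>j\<in>J. (m k \<omega> * c j k \<omega>) * (X j (Suc k) \<omega> - X j k \<omega>)) =
        m k \<omega> * ((\<Sum>j\<in>J. c j k \<omega> * X j (Suc k) \<omega>) - (\<Sum>j\<in>J. c j k \<omega> * X j k \<omega>))"
        by (simp add: sum_subtractf[symmetric] sum_distrib_left algebra_simps)
      also have "\<dots> \<le> m k \<omega> * (f (Suc k) \<omega> - f k \<omega>)"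
        using c1[of k \<omega>] c2[of k \<omega>] m0[of k \<omega>] by (intro mult_left_mono) auto
      finally show "(\<Sum>j\<in>J. (m k \<omega> * c j k \<omega>) * (X j (Suc k) \<omega> - X j k \<omega>)) \<le> m k \<omega> * (f (Suc k) \<omega> - f k \<omega>)" .
    qed
    with pathwise_doob[of "\<lambda>k. f k \<omega>" K] show ?thesis unfolding m_def by linarith
  qed
  show ?int using sqm[of K] by (simp add: m_def f_def)
  have "(\<integral>\<omega>. (m K \<omega>)\<^sup>2 \<partial>M) \<le> (\<integral>\<omega>. 4 * (f K \<omega>)\<^sup>2 - 4 * R \<omega> \<partial>M)"
    using sqm sqf Rint pt by (intro integral_mono) auto
  also have "\<dots> = 4 * (\<integral>\<omega>. (f K \<omega>)\<^sup>2 \<partial>M)" using sqf Rint R0 by simp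
  finally show ?le by (simp add: m_def f_def)
qed

text \<open>The bounds do not depend on the grid or the horizon, so by monotone convergence they
  hold for the supremum \<open>R m\<close> over all \<open>n\<close> and \<open>t\<close>. The
  infimum of \<open>R m\<close> over \<open>m\<close> then has mean 0 and vanishes almost
  surely.\<close>

lemma AE_uniformly_Cauchy_of_maximal_bound:
  fixes W :: "nat \<Rightarrow> 't \<Rightarrow> 'a \<Rightarrow> real"
  assumes G: "incseq G" "\<And>k. finite (G k)" "\<And>k. G k \<noteq> {}"
    and W: "\<And>n t. W n t \<in> borel_measurable M"
    and int: "\<And>m N k. integrable M (\<lambda>\<omega>. (Max ((\<lambda>n. Max ((\<lambda>t. \<bar>W (m + n) t \<omega> - W m t \<omega>\<bar>) ` G k)) ` {..N}))\<^sup>2)"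
    and bd: "\<And>m N k. (\<integral>\<omega>. (Max ((\<lambda>n. Max ((\<lambda>t. \<bar>W (m + n) t \<omega> - W m t \<omega>\<bar>) ` G k)) ` {..N}))\<^sup>2 \<partial>M) \<le> \<epsilon> m"
    and \<epsilon>: "\<epsilon> \<longlonglongrightarrow> 0"
  shows "AE \<omega> in M. \<forall>e>0. \<exists>m. \<forall>n. \<forall>t\<in>(\<Union>k. G k). \<bar>W (m + n) t \<omega> - W m t \<omega>\<bar> < e"
proof -
  define f where "f m k \<omega> = Max ((\<lambda>n. Max ((\<lambda>t. \<bar>W (m + n) t \<omega> - W m t \<omega>\<bar>) ` G k)) ` {..k})" for m k \<omega>
  have fge: "\<bar>W (m + n) t \<omega> - W m t \<omega>\<bar> \<le> f m k \<omega>" if "n \<le> k" "t \<in> G k" for m n t k \<omega>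
  proof -
    have "\<bar>W (m + n) t \<omega> - W m t \<omega>\<bar> \<le> Max ((\<lambda>t. \<bar>W (m + n) t \<omega> - W m t \<omega>\<bar>) ` G k)"
      using that G by auto
    also have "\<dots> \<le> f m k \<omega>" unfolding f_def using that by (intro Max_ge) auto
    finally show ?thesis .
  qed
  have f0: "0 \<le> f m k \<omega>" for m k \<omega>
    using G(3)[of k] fge[of 0 k _ m \<omega>] by (metis abs_ge_zero all_not_in_conv le0 order_trans)
  have fmono: "f m k \<omega> \<le> f m l \<omega>" if "k \<le> l" for m k l \<omega>
  proof -
    have "G k \<subseteq> G l" using G(1) that by (auto simp: incseq_def)
    then have "f m k \<omega> \<le> f m l \<omega> \<longleftrightarrow> True"
      unfolding f_def using that G by (subst Max_le_iff) (auto intro!: fge[unfolded f_def])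
    then show ?thesis by simp
  qed
  have fm[measurable]: "f m k \<in> borel_measurable M" for m k
    unfolding f_def using G W by (intro borel_measurable_Max) auto
  define R where "R m \<omega> = (SUP k. ennreal ((f m k \<omega>)\<^sup>2))" for m \<omega>
  have Rm[measurable]: "R m \<in> borel_measurable M" for m unfolding R_def by measurable
  have R: "(\<integral>\<^sup>+\<omega>. R m \<omega> \<partial>M) \<le> ennreal (\<epsilon> m)" for m
  proof -
    have "(\<integral>\<^sup>+\<omega>. R m \<omega> \<partial>M) = (SUP k. \<integral>\<^sup>+\<omega>. ennreal ((f m k \<omega>)\<^sup>2) \<partial>M)"
      unfolding R_def using fmono f0
      by (intro nn_integral_monotone_convergence_SUP) (auto simp: incseq_def le_fun_def intro!: ennreal_leI power_mono)
    also have "\<dots> \<le> ennreal (\<epsilon> m)"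
    proof (rule SUP_least)
      fix k
      have "(\<integral>\<^sup>+\<omega>. ennreal ((f m k \<omega>)\<^sup>2) \<partial>M) = ennreal (\<integral>\<omega>. (f m k \<omega>)\<^sup>2 \<partial>M)"
        unfolding f_def by (intro nn_integral_eq_integral int) auto
      also have "\<dots> \<le> ennreal (\<epsilon> m)" unfolding f_def by (intro ennreal_leI bd)
      finally show "(\<integral>\<^sup>+\<omega>. ennreal ((f m k \<omega>)\<^sup>2) \<partial>M) \<le> ennreal (\<epsilon> m)" .
    qed
    finally show ?thesis .
  qed
  have "(\<integral>\<^sup>+\<omega>. (INF m. R m \<omega>) \<partial>M) \<le> 0"
  proof (rule LIMSEQ_le_const)
    show "(\<lambda>m. ennreal (\<epsilon> m)) \<longlonglongrightarrow> 0" using tendsto_ennrealI[OF \<epsilon>] by simp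
    have "(\<integral>\<^sup>+\<omega>. (INF m. R m \<omega>) \<partial>M) \<le> ennreal (\<epsilon> m)" for m
      by (rule order_trans[OF nn_integral_mono R]) (rule INF_lower, simp)
    then show "\<exists>N. \<forall>n\<ge>N. (\<integral>\<^sup>+\<omega>. (INF m. R m \<omega>) \<partial>M) \<le> ennreal (\<epsilon> n)" by blast
  qed
  then have "(\<integral>\<^sup>+\<omega>. (INF m. R m \<omega>) \<partial>M) = 0" by simp
  then have "AE \<omega> in M. (INF m. R m \<omega>) = 0" by (subst (asm) nn_integral_0_iff_AE) auto
  then show ?thesis
  proof eventually_elim
    case (elim \<omega>)
    show ?case
    proof (intro allI impI)
      fix e :: real assume e: "e > 0"
      then have "(INF m. R m \<omega>) < ennreal (e\<^sup>2)" using elim by simp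
      then obtain m where m: "R m \<omega> < ennreal (e\<^sup>2)" by (auto simp: INF_less_iff)
      have "\<bar>W (m + n) t \<omega> - W m t \<omega>\<bar> < e" if "t \<in> (\<Union>k. G k)" for n t
      proof -
        obtain k where "t \<in> G k" using \<open>t \<in> _\<close> by auto
        then have t: "t \<in> G (max k n)" using G(1) by (auto simp: incseq_def) (meson max.cobounded1 subsetD)
        have "ennreal ((f m (max k n) \<omega>)\<^sup>2) \<le> R m \<omega>" unfolding R_def by (rule SUP_upper) simp
        then have "ennreal ((f m (max k n) \<omega>)\<^sup>2) < ennreal (e\<^sup>2)" using m by order
        then have "(f m (max k n) \<omega>)\<^sup>2 < e\<^sup>2" using e by (simp add: ennreal_less_iff)
        then have "f m (max k n) \<omega> < e" using e by (simp add: power_less_imp_less_base)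
        then show ?thesis using fge[of n "max k n" t m \<omega>] t by simp
      qed
      then show "\<exists>m. \<forall>n. \<forall>t\<in>(\<Union>k. G k). \<bar>W (m + n) t \<omega> - W m t \<omega>\<bar> < e" by blast
    qed
  qed
qed

section \<open>Resampling one coordinate of an iid sequence\<close>

locale iid_space =
  fixes R :: "'r measure"
  assumes R: "prob_space R"
begin

definition S :: "(nat \<Rightarrow> 'r) measure" where "S = PiM UNIV (\<lambda>_. R)"

sublocale R: prob_space R by (rule R)

sublocale S: prob_space S unfolding S_def by (intro prob_space_PiM R)

lemma measurable_coord[measurable]: "(\<lambda>\<omega>. \<omega> i) \<in> S \<rightarrow>\<^sub>M R"
  unfolding S_def by simp

lemma measurable_upd: "(\<lambda>(s, \<omega>). (fun_upd \<omega> (i) s)) \<in> R \<Otimes>\<^sub>M S \<rightarrow>\<^sub>M S"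
  unfolding S_def by (simp add: split_beta') (intro measurable_fun_upd[where J=UNIV]; simp)

lemma distr_upd: "distr (R \<Otimes>\<^sub>M S) S (\<lambda>(s, \<omega>). (fun_upd \<omega> (i) s)) = S"
  using distr_pair_PiM_eq_PiM[of UNIV "\<lambda>_. R" i] R by (simp add: S_def)

lemma measurable_upd_section:
  assumes f: "f \<in> S \<rightarrow>\<^sub>M N" shows "(\<lambda>(s, \<omega>). f ((fun_upd \<omega> (i) s))) \<in> R \<Otimes>\<^sub>M S \<rightarrow>\<^sub>M N"
  using measurable_compose[OF measurable_upd f, of i] by (simp add: split_beta')

text \<open>This stands in for conditioning on all coordinates other than \<open>i\<close>:
  replacing coordinate \<open>i\<close> by an independent copy does not change the law of the
  sequence.\<close>

lemma nn_integral_resample: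
  assumes f: "f \<in> borel_measurable S"
  shows "(\<integral>\<^sup>+\<omega>. f \<omega> \<partial>S) = (\<integral>\<^sup>+\<omega>. \<integral>\<^sup>+s. f ((fun_upd \<omega> (i) s)) \<partial>R \<partial>S)"
proof -
  interpret RS: pair_sigma_finite R S ..
  have "(\<integral>\<^sup>+\<omega>. f \<omega> \<partial>S) = (\<integral>\<^sup>+\<omega>. f \<omega> \<partial>distr (R \<Otimes>\<^sub>M S) S (\<lambda>(s, \<omega>). (fun_upd \<omega> (i) s)))"
    by (simp only: distr_upd)
  also have "\<dots> = (\<integral>\<^sup>+p. (case p of (s, \<omega>) \<Rightarrow> f ((fun_upd \<omega> (i) s))) \<partial>(R \<Otimes>\<^sub>M S))"
    by (subst nn_integral_distr[OF measurable_upd]) (use f in \<open>simp_all add: split_beta'\<close>)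
  also have "\<dots> = (\<integral>\<^sup>+\<omega>. \<integral>\<^sup>+s. f ((fun_upd \<omega> (i) s)) \<partial>R \<partial>S)"
    by (subst RS.nn_integral_snd[symmetric]) (use measurable_upd_section[OF f] in \<open>auto simp: split_beta'\<close>)
  finally show ?thesis .
qed

lemma integral_resample:
  fixes f :: "_ \<Rightarrow> 'b::{banach, second_countable_topology}"
  assumes f: "integrable S f"
  shows "(\<integral>\<omega>. f \<omega> \<partial>S) = (\<integral>\<omega>. \<integral>s. f ((fun_upd \<omega> (i) s)) \<partial>R \<partial>S)"
proof -
  interpret RS: pair_sigma_finite R S ..
  have fm: "f \<in> borel_measurable S" using f by auto
  have int: "integrable (R \<Otimes>\<^sub>M S) (\<lambda>(s, \<omega>). f ((fun_upd \<omega> (i) s)))"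
    using integrable_distr_eq[OF measurable_upd fm, of i] f distr_upd[of i] by (simp add: split_beta')
  have "(\<integral>\<omega>. f \<omega> \<partial>S) = (\<integral>\<omega>. f \<omega> \<partial>distr (R \<Otimes>\<^sub>M S) S (\<lambda>(s, \<omega>). (fun_upd \<omega> (i) s)))"
    by (simp only: distr_upd)
  also have "\<dots> = (\<integral>p. (case p of (s, \<omega>) \<Rightarrow> f ((fun_upd \<omega> (i) s))) \<partial>(R \<Otimes>\<^sub>M S))"
    by (subst integral_distr[OF measurable_upd fm]) (simp add: split_beta')
  also have "\<dots> = (\<integral>\<omega>. \<integral>s. f ((fun_upd \<omega> (i) s)) \<partial>R \<partial>S)"
    using RS.integral_snd[OF int] by simp
  finally show ?thesis .
qed

text \<open>\<open>dep\<close> and \<open>mean\<close> together say that \<open>D i t\<close> is a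
  martingale difference for every \<open>t\<close>. Doob's inequality in the number of terms,
  applied to the family over the grid, leaves only the bound \<open>bd\<close> for a fixed number of
  terms to be assumed.\<close>

lemma AE_martingale_Cauchy:
  fixes D :: "nat \<Rightarrow> 't \<Rightarrow> (nat \<Rightarrow> 'r) \<Rightarrow> real"
  assumes G: "incseq G" "\<And>k. finite (G k)" "\<And>k. G k \<noteq> {}"
    and D: "\<And>i t. D i t \<in> borel_measurable S" and sq: "\<And>i t. integrable S (\<lambda>\<omega>. (D i t \<omega>)\<^sup>2)"
    and dep: "\<And>i t \<omega> \<omega>'. (\<And>j. j \<le> i \<Longrightarrow> \<omega> j = \<omega>' j) \<Longrightarrow> D i t \<omega> = D i t \<omega>'"
    and mean: "\<And>i t \<omega>. (\<integral>s. D i t ((fun_upd \<omega> (i) s)) \<partial>R) = 0"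
    and bd: "\<And>m N k. (\<integral>\<omega>. (Max ((\<lambda>t. \<bar>\<Sum>i=m..<m+N. D i t \<omega>\<bar>) ` G k))\<^sup>2 \<partial>S) \<le> \<epsilon> m"
    and \<epsilon>: "\<epsilon> \<longlonglongrightarrow> 0"
  shows "AE \<omega> in S. \<forall>e>0. \<exists>m. \<forall>n. \<forall>t\<in>(\<Union>k. G k). \<bar>(\<Sum>i<m+n. D i t \<omega>) - (\<Sum>i<m. D i t \<omega>)\<bar> < e"
proof -
  define X where "X m t n \<omega> = (\<Sum>i=m..<m+n. D i t \<omega>)" for m t n \<omega>
  have diff: "(\<Sum>i<m+n. D i t \<omega>) - (\<Sum>i<m. D i t \<omega>) = X m t n \<omega>" for m n t \<omega>
    unfolding X_def using sum.atLeastLessThan_concat[of 0 m "m+n" "\<lambda>i. D i t \<omega>"] by (simp add: lessThan_atLeast0)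
  have Xm: "X m t n \<in> borel_measurable S" for m t n unfolding X_def using D by simp
  have Xsq: "integrable S (\<lambda>\<omega>. (X m t n \<omega>)\<^sup>2)" for m t n
    unfolding X_def using D sq by (intro integrable_square_sum) auto
  \<comment> \<open>Resampling coordinate \<open>m + k\<close> leaves the partial sums up to
    \<open>k\<close>, hence \<open>Z\<close>, unchanged, while the new increment averages to
    0.\<close>
  have orth: "(\<integral>\<omega>. Z \<omega> * (X m t (Suc k) \<omega> - X m t k \<omega>) \<partial>S) = 0"
    if Z: "Z \<in> borel_measurable S" "integrable S (\<lambda>\<omega>. (Z \<omega>)\<^sup>2)"
      and Zd: "\<forall>\<omega> \<omega>'. (\<forall>t\<in>G g. \<forall>l\<le>k. X m t l \<omega> = X m t l \<omega>') \<longrightarrow> Z \<omega> = Z \<omega>'" for Z m t k g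
  proof -
    have inc: "X m t (Suc k) \<omega> - X m t k \<omega> = D (m + k) t \<omega>" for \<omega> by (simp add: X_def)
    have "(\<integral>\<omega>. Z \<omega> * D (m + k) t \<omega> \<partial>S) = (\<integral>\<omega>. \<integral>s. Z ((fun_upd \<omega> (m + k) s)) * D (m + k) t ((fun_upd \<omega> (m + k) s)) \<partial>R \<partial>S)"
      by (intro integral_resample integrable_mult_square Z D sq)
    also have "\<dots> = (\<integral>\<omega>. \<integral>s. Z \<omega> * D (m + k) t ((fun_upd \<omega> (m + k) s)) \<partial>R \<partial>S)"
    proof (intro Bochner_Integration.integral_cong refl arg_cong2[where f="(*)"] Zd[rule_format])
      fix \<omega> s t l assume l: "l \<le> k"
      show "X m t l ((fun_upd \<omega> (m + k) s)) = X m t l \<omega>"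
        unfolding X_def using l by (intro sum.cong refl dep) auto
    qed
    also have "\<dots> = 0" by (simp add: mean)
    finally show ?thesis by (simp add: inc)
  qed
  have *: "integrable S (\<lambda>\<omega>. (Max ((\<lambda>n. Max ((\<lambda>t. \<bar>X m t n \<omega>\<bar>) ` G k)) ` {..N}))\<^sup>2)"
    "(\<integral>\<omega>. (Max ((\<lambda>n. Max ((\<lambda>t. \<bar>X m t n \<omega>\<bar>) ` G k)) ` {..N}))\<^sup>2 \<partial>S) \<le> 4 * \<epsilon> m" for m N k
  proof -
    note d = doob_L2[of "G k" "X m" S N, OF G(2,3) Xm Xsq orth]
    show "integrable S (\<lambda>\<omega>. (Max ((\<lambda>n. Max ((\<lambda>t. \<bar>X m t n \<omega>\<bar>) ` G k)) ` {..N}))\<^sup>2)"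
      by (rule d(1))
    show "(\<integral>\<omega>. (Max ((\<lambda>n. Max ((\<lambda>t. \<bar>X m t n \<omega>\<bar>) ` G k)) ` {..N}))\<^sup>2 \<partial>S) \<le> 4 * \<epsilon> m"
      by (rule order_trans[OF d(2)]) (use bd[of m N k] in \<open>simp_all add: X_def\<close>)
  qed
  show ?thesis
  proof (rule AE_uniformly_Cauchy_of_maximal_bound[OF G, where \<epsilon>="\<lambda>m. 4 * \<epsilon> m"])
    show "(\<lambda>m. 4 * \<epsilon> m) \<longlonglongrightarrow> 0" using tendsto_mult_right_zero[OF \<epsilon>] by simp
  qed (use D * in \<open>auto simp only: diff intro!: borel_measurable_sum\<close>)
qed

text \<open>Pythagoras: a cross term vanishes on resampling the later of its two
  coordinates.\<close>

lemma orthogonal_sum_square: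
  fixes D :: "nat \<Rightarrow> (nat \<Rightarrow> 'r) \<Rightarrow> real"
  assumes D: "\<And>i. D i \<in> borel_measurable S" and sq: "\<And>i. integrable S (\<lambda>\<omega>. (D i \<omega>)\<^sup>2)"
    and dep: "\<And>i \<omega> \<omega>'. (\<And>j. j \<le> i \<Longrightarrow> \<omega> j = \<omega>' j) \<Longrightarrow> D i \<omega> = D i \<omega>'"
    and mean: "\<And>i \<omega>. (\<integral>s. D i ((fun_upd \<omega> (i) s)) \<partial>R) = 0"
  shows "(\<integral>\<omega>. (\<Sum>i=m..<m+N. D i \<omega>)\<^sup>2 \<partial>S) = (\<Sum>i=m..<m+N. \<integral>\<omega>. (D i \<omega>)\<^sup>2 \<partial>S)"
proof (induction N)
  case (Suc N)
  define X where "X \<omega> = (\<Sum>i=m..<m+N. D i \<omega>)" for \<omega>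
  have Xm: "X \<in> borel_measurable S" unfolding X_def using D by simp
  have Xsq: "integrable S (\<lambda>\<omega>. (X \<omega>)\<^sup>2)"
    unfolding X_def using D sq by (intro integrable_square_sum) auto
  have int: "integrable S (\<lambda>\<omega>. X \<omega> * D (m + N) \<omega>)"
    by (intro integrable_mult_square Xm Xsq D sq)
  have "(\<integral>\<omega>. X \<omega> * D (m + N) \<omega> \<partial>S) = (\<integral>\<omega>. \<integral>s. X ((fun_upd \<omega> (m + N) s)) * D (m + N) ((fun_upd \<omega> (m + N) s)) \<partial>R \<partial>S)"
    by (rule integral_resample[OF int])
  also have "\<dots> = (\<integral>\<omega>. \<integral>s. X \<omega> * D (m + N) ((fun_upd \<omega> (m + N) s)) \<partial>R \<partial>S)"
    unfolding X_def by (intro Bochner_Integration.integral_cong refl arg_cong2[where f="(*)"] sum.cong dep) auto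
  also have "\<dots> = 0" by (simp add: mean)
  finally have 0: "(\<integral>\<omega>. X \<omega> * D (m + N) \<omega> \<partial>S) = 0" .
  have "(\<integral>\<omega>. (\<Sum>i=m..<m+Suc N. D i \<omega>)\<^sup>2 \<partial>S) = (\<integral>\<omega>. (X \<omega>)\<^sup>2 + (D (m + N) \<omega>)\<^sup>2 + 2 * (X \<omega> * D (m + N) \<omega>) \<partial>S)"
    by (simp add: X_def power2_sum mult.assoc)
  also have "\<dots> = (\<integral>\<omega>. (X \<omega>)\<^sup>2 \<partial>S) + (\<integral>\<omega>. (D (m + N) \<omega>)\<^sup>2 \<partial>S)"
    using Xsq sq int 0 by simp
  finally show ?case using Suc by (simp add: X_def)
qed simp

text \<open>This is \<open>AE_martingale_Cauchy\<close> for a grid of one point, with the tail of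
  the series of variances as the bound.\<close>

lemma AE_martingale_convergent:
  fixes D :: "nat \<Rightarrow> (nat \<Rightarrow> 'r) \<Rightarrow> real"
  assumes D: "\<And>i. D i \<in> borel_measurable S" and sq: "\<And>i. integrable S (\<lambda>\<omega>. (D i \<omega>)\<^sup>2)"
    and dep: "\<And>i \<omega> \<omega>'. (\<And>j. j \<le> i \<Longrightarrow> \<omega> j = \<omega>' j) \<Longrightarrow> D i \<omega> = D i \<omega>'"
    and mean: "\<And>i \<omega>. (\<integral>s. D i ((fun_upd \<omega> (i) s)) \<partial>R) = 0"
    and sum: "summable (\<lambda>i. \<integral>\<omega>. (D i \<omega>)\<^sup>2 \<partial>S)"
  shows "AE \<omega> in S. convergent (\<lambda>n. \<Sum>i<n. D i \<omega>)"
proof -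
  let ?v = "\<lambda>i. \<integral>\<omega>. (D i \<omega>)\<^sup>2 \<partial>S"
  have "AE \<omega> in S. \<forall>e>0. \<exists>m. \<forall>n. \<forall>t\<in>(\<Union>k::nat. {()}). \<bar>(\<Sum>i<m+n. D i \<omega>) - (\<Sum>i<m. D i \<omega>)\<bar> < e"
  proof (rule AE_martingale_Cauchy[of "\<lambda>_. {()}" "\<lambda>i _. D i" "\<lambda>m. \<Sum>i. ?v (i + m)", OF _ _ _ D sq dep mean])
    show "(\<lambda>m. \<Sum>i. ?v (i + m)) \<longlonglongrightarrow> 0" by (rule suminf_exist_split2[OF sum])
    fix m N :: nat
    have "(\<Sum>i=m..<m+N. ?v i) = (\<Sum>i<N. ?v (i + m))"
      using sum.shift_bounds_nat_ivl[of ?v 0 m N] by (simp add: lessThan_atLeast0 add.commute)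
    also have "\<dots> \<le> (\<Sum>i. ?v (i + m))" using sum by (intro sum_le_suminf summable_ignore_initial_segment) auto
    finally show "(\<integral>\<omega>. (Max ((\<lambda>t. \<bar>\<Sum>i=m..<m+N. D i \<omega>\<bar>) ` {()}))\<^sup>2 \<partial>S) \<le> (\<Sum>i. ?v (i + m))"
      using orthogonal_sum_square[OF D sq dep mean, of m N] by simp
  qed (simp_all add: incseq_def)
  then show ?thesis
  proof eventually_elim
    case (elim \<omega>)
    show ?case unfolding Cauchy_convergent_iff[symmetric]
    proof (rule metric_CauchyI)
      fix e :: real assume "e > 0"
      then obtain m where m: "\<And>n. \<bar>(\<Sum>i<m+n. D i \<omega>) - (\<Sum>i<m. D i \<omega>)\<bar> < e / 2"
        using elim[rule_format, of "e / 2"] by auto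
      show "\<exists>M. \<forall>a\<ge>M. \<forall>b\<ge>M. dist (\<Sum>i<a. D i \<omega>) (\<Sum>i<b. D i \<omega>) < e"
      proof (intro exI allI impI)
        fix a b assume "a \<ge> m" "b \<ge> m"
        then have "\<bar>(\<Sum>i<a. D i \<omega>) - (\<Sum>i<m. D i \<omega>)\<bar> < e / 2" "\<bar>(\<Sum>i<b. D i \<omega>) - (\<Sum>i<m. D i \<omega>)\<bar> < e / 2"
          using m[of "a - m"] m[of "b - m"] by simp_all
        then show "dist (\<Sum>i<a. D i \<omega>) (\<Sum>i<b. D i \<omega>) < e"
          unfolding dist_real_def by linarith
      qed
    qed
  qed
qed

end

section \<open>Integrals over half-open intervals\<close>

text \<open>Half-open, so that the intervals between successive arrivals tile without overlap; for
  \<open>b \<le> a\<close> it is 0, unlike an oriented integral.\<close>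

definition ioc_integral :: "(real \<Rightarrow> 'b) \<Rightarrow> real \<Rightarrow> real \<Rightarrow> 'b::{banach, second_countable_topology}" where
  "ioc_integral h a b = (\<integral>x. (if a < x \<and> x \<le> b then h x else 0) \<partial>lborel)"

lemma ioc_integrable:
  fixes h :: "real \<Rightarrow> 'b::{banach, second_countable_topology}"
  assumes [measurable]: "h \<in> borel_measurable borel" and B: "\<And>x. norm (h x) \<le> B"
  shows "integrable lborel (\<lambda>x. if a < x \<and> x \<le> b then h x else 0)"
proof (rule Bochner_Integration.integrable_bound)
  show "integrable lborel (\<lambda>x. indicator {a..b} x * B)"
    by (intro integrable_mult_left integrable_real_indicator) (auto simp: emeasure_lborel_Icc_eq)
qed (use B order_trans[OF norm_ge_zero B] in \<open>auto simp: indicator_def\<close>)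

lemma ioc_integral_le:
  fixes h :: "real \<Rightarrow> 'b::{banach, second_countable_topology}"
  assumes h: "h \<in> borel_measurable borel" and B: "\<And>x. norm (h x) \<le> B"
    and C: "\<And>x. a < x \<Longrightarrow> x \<le> b \<Longrightarrow> norm (h x) \<le> C" and ab: "a \<le> b"
  shows "norm (ioc_integral h a b) \<le> C * (b - a)"
proof -
  have "norm (ioc_integral h a b) \<le> (\<integral>x. norm (if a < x \<and> x \<le> b then h x else 0) \<partial>lborel)"
    unfolding ioc_integral_def by (rule integral_norm_bound)
  also have "\<dots> \<le> (\<integral>x. indicator {a<..b} x * C \<partial>lborel)"
    by (intro integral_mono integrable_norm ioc_integrable[OF h B] integrable_mult_left integrable_real_indicator)
       (use C ab in \<open>auto simp: indicator_def\<close>)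
  also have "\<dots> = C * (b - a)" using ab by simp
  finally show ?thesis .
qed

lemma ioc_integral_empty: "b \<le> a \<Longrightarrow> ioc_integral h a b = 0"
  unfolding ioc_integral_def by (subst Bochner_Integration.integral_cong[where g="\<lambda>_. 0"]) auto

lemma ioc_integral_add:
  fixes h :: "real \<Rightarrow> 'b::{banach, second_countable_topology}"
  assumes h: "h \<in> borel_measurable borel" and B: "\<And>x. norm (h x) \<le> B" and "a \<le> b" "b \<le> c"
  shows "ioc_integral h a b + ioc_integral h b c = ioc_integral h a c"
  unfolding ioc_integral_def
  by (subst Bochner_Integration.integral_add[symmetric, OF ioc_integrable[OF h B] ioc_integrable[OF h B]])
    (use assms in \<open>auto intro!: Bochner_Integration.integral_cong\<close>)

lemma borel_measurable_ioc_integral: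
  fixes h :: "real \<Rightarrow> 'b::{banach, second_countable_topology}"
  assumes [measurable]: "h \<in> borel_measurable borel" "f \<in> borel_measurable M" "g \<in> borel_measurable M"
  shows "(\<lambda>\<omega>. ioc_integral h (f \<omega>) (g \<omega>)) \<in> borel_measurable M"
  unfolding ioc_integral_def by (intro lborel.borel_measurable_lebesgue_integral) measurable

section \<open>The exponential law\<close>

abbreviation expo :: "real measure" where
  "expo \<equiv> density lborel (exponential_density 1)"

lemma prob_space_expo: "prob_space expo"
  by (rule prob_space_exponential_density) simp

lemma AE_expo_pos: "AE e in expo. e > 0"
proof -
  have "AE x in lborel. x \<noteq> (0::real)" by (rule AE_lborel_singleton)
  then have "AE x in lborel. 0 < ennreal (exponential_density 1 x) \<longrightarrow> 0 < x"
    by eventually_elim (auto simp: exponential_density_def split: if_splits)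
  then show ?thesis by (subst AE_density) auto
qed

lemma emeasure_expo_ge:
  assumes "y \<ge> 0" shows "emeasure expo {y..} = ennreal (exp (- y))"
proof -
  interpret prob_space expo by (rule prob_space_expo)
  have "distributed expo lborel (\<lambda>x. x) (exponential_density 1)"
    by (auto simp: distributed_def distr_id2)
  from exponential_distributedD_gt[OF this assms] have gt: "measure expo {y<..} = exp (- y)"
    by (simp add: greaterThan_def)
  have "AE x in lborel. x \<noteq> y" by (rule AE_lborel_singleton)
  then have ae: "AE x in expo. x \<noteq> y" by (subst AE_density) (auto elim: eventually_mono)
  have "emeasure expo {y..} = emeasure expo {y<..}"
    by (rule emeasure_eq_AE) (use ae in \<open>auto elim!: eventually_mono\<close>)
  then show ?thesis using gt by (simp add: emeasure_eq_measure)
qed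

text \<open>The density \<open>exp (- (x - \<gamma>))\<close> of the next arrival at
  \<open>x\<close> is also the probability that the wait from \<gamma> reaches \<open>x\<close>.
  Hence a value at the next arrival has the same mean as the integral over the waiting interval: the
  compensator formula for a single step.\<close>

lemma nn_integral_expo_shift:
  assumes [measurable]: "h \<in> borel_measurable borel"
  shows "(\<integral>\<^sup>+e. h (\<gamma> + e) \<partial>expo) = (\<integral>\<^sup>+e. \<integral>\<^sup>+x. (if \<gamma> < x \<and> x \<le> \<gamma> + e then h x else 0) \<partial>lborel \<partial>expo)"
proof -
  interpret prob_space expo by (rule prob_space_expo)
  interpret pair_sigma_finite expo lborel ..
  have "(\<integral>\<^sup>+e. h (\<gamma> + e) \<partial>expo) = (\<integral>\<^sup>+e. ennreal (exponential_density 1 e) * h (\<gamma> + e) \<partial>lborel)"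
    by (subst nn_integral_density) auto
  also have "\<dots> = (\<integral>\<^sup>+x. ennreal (exponential_density 1 (x - \<gamma>)) * h x \<partial>lborel)"
    using nn_integral_real_affine[of "\<lambda>x. ennreal (exponential_density 1 (x - \<gamma>)) * h x" 1 \<gamma>] by simp
  also have "\<dots> = (\<integral>\<^sup>+x. \<integral>\<^sup>+e. (if \<gamma> < x \<and> x \<le> \<gamma> + e then h x else 0) \<partial>expo \<partial>lborel)"
  proof (rule nn_integral_cong_AE)
    have "AE x in lborel. x \<noteq> \<gamma>" by (rule AE_lborel_singleton)
    then show "AE x in lborel. ennreal (exponential_density 1 (x - \<gamma>)) * h x =
      (\<integral>\<^sup>+e. (if \<gamma> < x \<and> x \<le> \<gamma> + e then h x else 0) \<partial>expo)"
    proof eventually_elim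
      case (elim x)
      show ?case
      proof (cases "\<gamma> < x")
        case True
        have "(\<integral>\<^sup>+e. (if \<gamma> < x \<and> x \<le> \<gamma> + e then h x else 0) \<partial>expo) = (\<integral>\<^sup>+e. h x * indicator {x - \<gamma>..} e \<partial>expo)"
          using True by (intro nn_integral_cong) (auto simp: indicator_def)
        also have "\<dots> = h x * ennreal (exp (- (x - \<gamma>)))"
          using True emeasure_expo_ge[of "x - \<gamma>"] by (simp add: nn_integral_cmult_indicator)
        finally show ?thesis using True by (simp add: exponential_density_def mult.commute)
      qed (use elim in \<open>auto simp: exponential_density_def\<close>)
    qed
  qed
  also have "\<dots> = (\<integral>\<^sup>+e. \<integral>\<^sup>+x. (if \<gamma> < x \<and> x \<le> \<gamma> + e then h x else 0) \<partial>lborel \<partial>expo)"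
    by (rule Fubini') measurable
  finally show ?thesis .
qed

lemma expo_moments:
  shows "integrable expo (\<lambda>e. e)" "(\<integral>e. e \<partial>expo) = 1"
    and "integrable expo (\<lambda>e. e\<^sup>2)" "(\<integral>e. e\<^sup>2 \<partial>expo) = 2"
proof -
  have 1: "(\<integral>\<^sup>+e. ennreal (e ^ k) \<partial>expo) = ennreal (fact k)" for k
  proof -
    have "(\<integral>\<^sup>+e. ennreal (e ^ k) \<partial>expo) = (\<integral>\<^sup>+e. ennreal (exponential_density 1 e) * ennreal (e ^ k) \<partial>lborel)"
      by (subst nn_integral_density) auto
    also have "\<dots> = (\<integral>\<^sup>+e. ennreal (erlang_density 0 1 e * e ^ k) \<partial>lborel)"
    proof (rule nn_integral_cong)
      fix e :: real
      show "ennreal (exponential_density 1 e) * ennreal (e ^ k) = ennreal (erlang_density 0 1 e * e ^ k)"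
        by (cases "e < 0") (auto simp: erlang_density_def ennreal_mult)
    qed
    also have "\<dots> = ennreal (fact k)"
      by (subst nn_integral_erlang_ith_moment) auto
    finally show ?thesis .
  qed
  have pos: "AE e in expo. 0 \<le> e ^ k" for k
    using AE_expo_pos by (rule eventually_mono) (simp add: less_imp_le)
  have hb: "has_bochner_integral expo (\<lambda>e. e ^ k) (fact k)" for k
    by (rule has_bochner_integral_nn_integral[OF _ pos[of k]]) (simp_all add: 1)
  from hb[of 1] show "integrable expo (\<lambda>e. e)" "(\<integral>e. e \<partial>expo) = 1"
    by (auto simp: has_bochner_integral_iff)
  from hb[of 2] show "integrable expo (\<lambda>e. e\<^sup>2)" "(\<integral>e. e\<^sup>2 \<partial>expo) = 2"
    by (auto simp: has_bochner_integral_iff)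
qed

lemma integral_expo_shift:
  fixes h :: "real \<Rightarrow> real"
  assumes h[measurable]: "h \<in> borel_measurable borel" and B: "\<And>x. \<bar>h x\<bar> \<le> B"
  shows "integrable expo (\<lambda>e. ioc_integral h \<gamma> (\<gamma> + e))"
    and "(\<integral>e. h (\<gamma> + e) \<partial>expo) = (\<integral>e. ioc_integral h \<gamma> (\<gamma> + e) \<partial>expo)"
proof -
  interpret prob_space expo by (rule prob_space_expo)
  have Bn: "norm (h x) \<le> B" for x using B by simp
  have B0: "0 \<le> B" using B[of 0] by linarith
  have meas: "(\<lambda>e. ioc_integral h \<gamma> (\<gamma> + e)) \<in> borel_measurable borel" if "h \<in> borel_measurable borel" for h :: "real \<Rightarrow> real" and \<gamma>
    using that by (intro borel_measurable_ioc_integral) auto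
  have bd: "\<bar>ioc_integral h \<gamma> (\<gamma> + e)\<bar> \<le> B * \<bar>e\<bar>" if h: "h \<in> borel_measurable borel" "\<And>x. \<bar>h x\<bar> \<le> B" for h :: "real \<Rightarrow> real" and \<gamma> e B
    using ioc_integral_le[OF h(1), of B \<gamma> "\<gamma> + e" B] ioc_integral_empty[of "\<gamma> + e" \<gamma> h] h(2) order_trans[OF abs_ge_zero h(2)]
    by (cases "e \<ge> 0") (auto simp: mult_nonneg_nonpos)
  have int: "integrable expo (\<lambda>e. ioc_integral h \<gamma> (\<gamma> + e))" if h: "h \<in> borel_measurable borel" "\<And>x. \<bar>h x\<bar> \<le> B" for h :: "real \<Rightarrow> real" and \<gamma> B
  proof (rule Bochner_Integration.integrable_bound)
    show "integrable expo (\<lambda>e. B * e)" by (intro integrable_mult_right expo_moments(1))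
    show "(\<lambda>e. ioc_integral h \<gamma> (\<gamma> + e)) \<in> borel_measurable expo" using meas[OF h(1)] by simp
    show "AE e in expo. norm (ioc_integral h \<gamma> (\<gamma> + e)) \<le> norm (B * e)"
      using bd[OF h] order_trans[OF abs_ge_zero h(2)] by (simp add: abs_mult)
  qed
  show "integrable expo (\<lambda>e. ioc_integral h \<gamma> (\<gamma> + e))" by (rule int[OF h B])
  have pos: "(\<integral>e. k (\<gamma> + e) \<partial>expo) = (\<integral>e. ioc_integral k \<gamma> (\<gamma> + e) \<partial>expo)"
    if k[measurable]: "k \<in> borel_measurable borel" and k0: "\<And>x. 0 \<le> k x" and kB: "\<And>x. \<bar>k x\<bar> \<le> C" for k :: "real \<Rightarrow> real" and C
  proof -
    have kB': "norm (k x) \<le> C" for x using kB by simp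
    have i0: "0 \<le> ioc_integral k \<gamma> (\<gamma> + e)" for e
      unfolding ioc_integral_def using k0 by (intro integral_nonneg_AE) auto
    have "ennreal (\<integral>e. k (\<gamma> + e) \<partial>expo) = (\<integral>\<^sup>+e. ennreal (k (\<gamma> + e)) \<partial>expo)"
      using k0 kB' by (intro nn_integral_eq_integral[symmetric] integrable_const_bound[where B=C]) auto
    also have "\<dots> = (\<integral>\<^sup>+e. \<integral>\<^sup>+x. (if \<gamma> < x \<and> x \<le> \<gamma> + e then ennreal (k x) else 0) \<partial>lborel \<partial>expo)"
      by (rule nn_integral_expo_shift) simp
    also have "\<dots> = (\<integral>\<^sup>+e. ennreal (ioc_integral k \<gamma> (\<gamma> + e)) \<partial>expo)"
    proof (rule nn_integral_cong)
      fix e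
      have "(\<integral>\<^sup>+x. (if \<gamma> < x \<and> x \<le> \<gamma> + e then ennreal (k x) else 0) \<partial>lborel) =
        (\<integral>\<^sup>+x. ennreal (if \<gamma> < x \<and> x \<le> \<gamma> + e then k x else 0) \<partial>lborel)"
        by (intro nn_integral_cong) auto
      also have "\<dots> = ennreal (ioc_integral k \<gamma> (\<gamma> + e))"
        unfolding ioc_integral_def using k0 by (intro nn_integral_eq_integral ioc_integrable[OF k kB']) auto
      finally show "(\<integral>\<^sup>+x. (if \<gamma> < x \<and> x \<le> \<gamma> + e then ennreal (k x) else 0) \<partial>lborel) = ennreal (ioc_integral k \<gamma> (\<gamma> + e))" .
    qed
    also have "\<dots> = ennreal (\<integral>e. ioc_integral k \<gamma> (\<gamma> + e) \<partial>expo)"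
      using i0 by (intro nn_integral_eq_integral int[OF k kB]) auto
    finally show ?thesis
      using k0 i0 by (subst (asm) ennreal_inj) (auto intro!: integral_nonneg_AE)
  qed
  \<comment> \<open>Adding the bound \<open>B\<close> makes the integrand nonnegative; the constant
    \<open>B\<close> is a second instance and is subtracted afterwards.\<close>
  have pB: "(\<integral>e. h (\<gamma> + e) + B \<partial>expo) = (\<integral>e. ioc_integral (\<lambda>x. h x + B) \<gamma> (\<gamma> + e) \<partial>expo)"
  proof (rule pos[of "\<lambda>x. h x + B" "2 * B"])
    show "0 \<le> h x + B" "\<bar>h x + B\<bar> \<le> 2 * B" for x using B[of x] by linarith+
  qed simp
  have cB: "(\<integral>e. B \<partial>expo) = (\<integral>e. ioc_integral (\<lambda>x. B) \<gamma> (\<gamma> + e) \<partial>expo)"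
    by (rule pos[of "\<lambda>_. B" B]) (use B0 in auto)
  have split: "ioc_integral (\<lambda>x. h x + B) \<gamma> (\<gamma> + e) = ioc_integral h \<gamma> (\<gamma> + e) + ioc_integral (\<lambda>x. B) \<gamma> (\<gamma> + e)" for e
    unfolding ioc_integral_def
    by (subst Bochner_Integration.integral_add[symmetric, OF ioc_integrable[OF h Bn] ioc_integrable[of "\<lambda>_. B" B]])
       (use B0 in \<open>auto intro!: Bochner_Integration.integral_cong\<close>)
  have "(\<integral>e. h (\<gamma> + e) + B \<partial>expo) = (\<integral>e. h (\<gamma> + e) \<partial>expo) + (\<integral>e. B \<partial>expo)"
    using Bn B0 by (intro Bochner_Integration.integral_add integrable_const_bound[where B=B]) auto
  moreover have "(\<integral>e. ioc_integral h \<gamma> (\<gamma> + e) + ioc_integral (\<lambda>x. B) \<gamma> (\<gamma> + e) \<partial>expo) =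
     (\<integral>e. ioc_integral h \<gamma> (\<gamma> + e) \<partial>expo) + (\<integral>e. ioc_integral (\<lambda>x. B) \<gamma> (\<gamma> + e) \<partial>expo)"
    using B0 by (intro Bochner_Integration.integral_add int[OF h B] int[of "\<lambda>_. B" B]) auto
  ultimately show "(\<integral>e. h (\<gamma> + e) \<partial>expo) = (\<integral>e. ioc_integral h \<gamma> (\<gamma> + e) \<partial>expo)"
    using pB cB split by simp
qed

section \<open>Shot noise on the canonical space\<close>

definition noise_law :: "'a::euclidean_space measure \<Rightarrow> real \<Rightarrow> (real \<times> 'a \<times> real) measure" where
  "noise_law L T = expo \<Otimes>\<^sub>M (L \<Otimes>\<^sub>M uniform_measure lborel {0..T})"

text \<open>An arrival at \<open>x\<close> with mark \<open>v\<close> produces the jump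
  \<open>H x v\<close>. \<open>H_anti\<close> bounds a compensator over a waiting interval by its
  value at the left end, \<open>H_cont\<close> makes the compensator of the exponential martingale
  differentiable, and \<open>H_int\<close> is the integrability condition of a Levy measure.\<close>

locale shot_noise =
  fixes L :: "'a::euclidean_space measure" and H :: "real \<Rightarrow> 'a \<Rightarrow> 'a" and T :: real
  assumes prob_L: "prob_space L" and sets_L[measurable_cong]: "sets L = sets borel"
    and T: "T > 0"
    and H_meas: "(\<lambda>(x, v). H x v) \<in> borel_measurable (borel \<Otimes>\<^sub>M borel)"
    and H_0: "\<And>x v. x \<le> 0 \<Longrightarrow> H x v = 0"
    and H_anti: "\<And>x y v. 0 < x \<Longrightarrow> x \<le> y \<Longrightarrow> norm (H y v) \<le> norm (H x v)"
    and H_cont: "\<And>x v. 0 < x \<Longrightarrow> isCont (\<lambda>x. H x v) x"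
    and H_int: "(\<integral>\<^sup>+x. \<integral>\<^sup>+v. ennreal ((min 1 (norm (H x v)))\<^sup>2) \<partial>L \<partial>lborel) < \<infinity>"
begin

abbreviation "unif \<equiv> uniform_measure lborel {0..T}"

sublocale L: prob_space L by (rule prob_L)
sublocale U: prob_space unif using T by (intro prob_space_uniform_measure) auto
sublocale E: prob_space expo by (rule prob_space_expo)
sublocale LU: pair_prob_space L unif ..
sublocale ELU: pair_prob_space expo "L \<Otimes>\<^sub>M unif" ..

lemma prob_noise: "prob_space (noise_law L T)"
  unfolding noise_law_def by (rule ELU.P.prob_space_axioms)

sublocale iid_space "noise_law L T" by (rule iid_space.intro[OF prob_noise])

lemma sets_noise_law[measurable_cong]: "sets (noise_law L T) = sets (borel \<Otimes>\<^sub>M (borel \<Otimes>\<^sub>M borel))"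
  unfolding noise_law_def by (intro sets_pair_measure_cong) (auto simp: sets_L)

lemma space_L: "space L = UNIV"
  using sets_eq_imp_space_eq[OF sets_L] by simp

lemma unif_mass[simp]: "emeasure lborel {0..T} / emeasure lborel {0..T} = 1"
  using T by (intro ennreal_divide_self) auto

lemma emeasure_L[simp]: "emeasure L UNIV = 1"
  using L.emeasure_space_1 by (simp add: space_L)

lemma space_S: "space S = UNIV"
proof -
  have "space (noise_law L T) = UNIV"
    using sets_eq_imp_space_eq[OF sets_noise_law] by (simp add: space_pair_measure)
  then show ?thesis by (simp add: S_def space_PiM)
qed

lemma H_measurable[measurable (raw)]:
  assumes "f \<in> borel_measurable M" "g \<in> borel_measurable M" shows "(\<lambda>x. H (f x) (g x)) \<in> borel_measurable M"
  using measurable_compose[OF measurable_Pair[OF assms] H_meas] by simp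

text \<open>Coordinates count from 0, so jump \<open>i\<close> happens at \<open>Gam (Suc i)\<close>
  and is determined by the coordinates up to and including \<open>i\<close>, while
  \<open>Gam i\<close> is free of coordinate \<open>i\<close>.\<close>

definition Gam :: "nat \<Rightarrow> (nat \<Rightarrow> real \<times> 'a \<times> real) \<Rightarrow> real" where
  "Gam n \<omega> = (\<Sum>i<n. fst (\<omega> i))"

abbreviation "mk i \<omega> \<equiv> fst (snd (\<omega> i))"
abbreviation "tm i \<omega> \<equiv> snd (snd (\<omega> i))"

lemma coord_measurable[measurable]:
  "(\<lambda>\<omega>. fst (\<omega> i)) \<in> borel_measurable S" "(\<lambda>\<omega>. mk i \<omega>) \<in> borel_measurable S" "(\<lambda>\<omega>. tm i \<omega>) \<in> borel_measurable S"
proof -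
  have "(\<lambda>s. fst s) \<in> borel_measurable (noise_law L T)" "(\<lambda>s. fst (snd s)) \<in> borel_measurable (noise_law L T)"
    "(\<lambda>s. snd (snd s)) \<in> borel_measurable (noise_law L T)"
    unfolding measurable_cong_sets[OF sets_noise_law refl] by measurable
  from this[THEN measurable_compose[OF measurable_coord]] show
    "(\<lambda>\<omega>. fst (\<omega> i)) \<in> borel_measurable S" "(\<lambda>\<omega>. mk i \<omega>) \<in> borel_measurable S" "(\<lambda>\<omega>. tm i \<omega>) \<in> borel_measurable S" .
qed

lemma Gam_measurable[measurable]: "Gam n \<in> borel_measurable S"
  unfolding Gam_def by measurable

lemma Gam_Suc: "Gam (Suc n) \<omega> = Gam n \<omega> + fst (\<omega> n)" and Gam_0: "Gam 0 \<omega> = 0"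
  by (simp_all add: Gam_def)

lemma Gam_upd: "n \<le> i \<Longrightarrow> Gam n (fun_upd \<omega> i s) = Gam n \<omega>"
  by (auto simp: Gam_def intro!: sum.cong)

lemma Gam_Suc_upd: "Gam (Suc i) (fun_upd \<omega> i s) = Gam i \<omega> + fst s"
  by (simp add: Gam_Suc Gam_upd)

lemma Gam_cong: "(\<And>j. j < n \<Longrightarrow> \<omega> j = \<omega>' j) \<Longrightarrow> Gam n \<omega> = Gam n \<omega>'"
  by (auto simp: Gam_def intro!: sum.cong)

lemma AE_coord: "(AE s in noise_law L T. P s) \<Longrightarrow> AE \<omega> in S. \<forall>i. P (\<omega> i)"
  unfolding S_def by (subst AE_all_countable) (intro allI AE_PiM_component, auto intro: prob_noise)

lemma nn_integral_noise:
  assumes [measurable]: "f \<in> borel_measurable (borel \<Otimes>\<^sub>M (borel \<Otimes>\<^sub>M borel))"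
  shows "(\<integral>\<^sup>+s. f s \<partial>noise_law L T) = (\<integral>\<^sup>+e. \<integral>\<^sup>+v. \<integral>\<^sup>+u. f (e, v, u) \<partial>unif \<partial>L \<partial>expo)"
  unfolding noise_law_def
  by (subst LU.P.nn_integral_fst[symmetric], measurable, subst U.nn_integral_fst[symmetric], measurable)

lemma integral_noise:
  fixes f :: "_ \<Rightarrow> 'b::{banach, second_countable_topology}"
  assumes [measurable]: "integrable (noise_law L T) f"
  shows "(\<integral>s. f s \<partial>noise_law L T) = (\<integral>e. \<integral>w. f (e, w) \<partial>(L \<Otimes>\<^sub>M unif) \<partial>expo)"
  using ELU.integral_fst'[of f] assms unfolding noise_law_def by simp

lemma AE_noise_fst: "(AE e in expo. P e) \<Longrightarrow> AE s in noise_law L T. P (fst s)"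
proof -
  assume P: "AE e in expo. P e"
  have d: "distr (noise_law L T) expo fst = expo"
    unfolding noise_law_def by (rule LU.P.distr_pair_fst)
  show ?thesis
  proof (rule AE_distrD[of fst _ expo P])
    show "fst \<in> noise_law L T \<rightarrow>\<^sub>M expo" by (simp add: noise_law_def)
    show "AE e in distr (noise_law L T) expo fst. P e" unfolding d by (rule P)
  qed
qed

lemma AE_exp_pos: "AE \<omega> in S. \<forall>i. fst (\<omega> i) > 0"
  by (intro AE_coord AE_noise_fst AE_expo_pos)

lemma Gam_mono: "(\<And>i. fst (\<omega> i) > 0) \<Longrightarrow> m \<le> n \<Longrightarrow> Gam m \<omega> \<le> Gam n \<omega>"
  unfolding Gam_def by (intro sum_mono2) (auto intro: less_imp_le)

lemma Gam_pos: "(\<And>i. fst (\<omega> i) > 0) \<Longrightarrow> 0 < n \<Longrightarrow> 0 < Gam n \<omega>"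
  unfolding Gam_def by (intro sum_pos) auto

text \<open>Half of Campbell's formula. Each term becomes an integral over the waiting interval
  before the arrival, and these disjoint intervals lie in the positive half-line. The other half
  would need that the arrivals tend to infinity, which is established only in
  \<open>AE_Gam_drift\<close>.\<close>

lemma campbell_le:
  assumes F[measurable]: "(\<lambda>(x, v). F x v) \<in> borel_measurable (borel \<Otimes>\<^sub>M borel)"
  shows "(\<Sum>i. \<integral>\<^sup>+\<omega>. F (Gam (Suc i) \<omega>) (mk i \<omega>) \<partial>S) \<le> (\<integral>\<^sup>+x. (if 0 < x then \<integral>\<^sup>+v. F x v \<partial>L else 0) \<partial>lborel)"
proof -
  have [measurable (raw)]: "(\<lambda>x. F (f x) (g x)) \<in> borel_measurable M"
    if "f \<in> borel_measurable M" "g \<in> borel_measurable M" for f g and M :: "'z measure"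
    using measurable_compose[OF measurable_Pair[OF that] F] by simp
  define h where "h x = (\<integral>\<^sup>+v. F x v \<partial>L)" for x
  have h[measurable]: "h \<in> borel_measurable borel" unfolding h_def by measurable
  define I where "I a b = (\<integral>\<^sup>+x. (if a < x \<and> x \<le> b then h x else 0) \<partial>lborel)" for a b
  have Im[measurable]: "(\<lambda>\<omega>. I (f \<omega>) (g \<omega>)) \<in> borel_measurable M"
    if [measurable]: "f \<in> borel_measurable M" "g \<in> borel_measurable M" for f g and M :: "'z measure"
    unfolding I_def by measurable
  \<comment> \<open>Average over coordinate \<open>i\<close>, apply the compensator formula to its
    waiting time, and put the coordinate back.\<close>
  have step: "(\<integral>\<^sup>+\<omega>. F (Gam (Suc i) \<omega>) (mk i \<omega>) \<partial>S) = (\<integral>\<^sup>+\<omega>. I (Gam i \<omega>) (Gam (Suc i) \<omega>) \<partial>S)" for i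
  proof -
    have "(\<integral>\<^sup>+\<omega>. F (Gam (Suc i) \<omega>) (mk i \<omega>) \<partial>S) = (\<integral>\<^sup>+\<omega>. \<integral>\<^sup>+s. F (Gam i \<omega> + fst s) (fst (snd s)) \<partial>noise_law L T \<partial>S)"
      by (subst nn_integral_resample[of _ i]) (simp_all add: Gam_Suc_upd)
    also have "\<dots> = (\<integral>\<^sup>+\<omega>. \<integral>\<^sup>+e. h (Gam i \<omega> + e) \<partial>expo \<partial>S)"
      by (subst nn_integral_noise) (simp_all add: h_def)
    also have "\<dots> = (\<integral>\<^sup>+\<omega>. \<integral>\<^sup>+e. I (Gam i \<omega>) (Gam i \<omega> + e) \<partial>expo \<partial>S)"
      unfolding I_def by (subst nn_integral_expo_shift) simp_all
    also have "\<dots> = (\<integral>\<^sup>+\<omega>. \<integral>\<^sup>+s. I (Gam i \<omega>) (Gam i \<omega> + fst s) \<partial>noise_law L T \<partial>S)"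
      by (subst nn_integral_noise) (simp_all add: space_L)
    also have "\<dots> = (\<integral>\<^sup>+\<omega>. I (Gam i \<omega>) (Gam (Suc i) \<omega>) \<partial>S)"
      by (subst (2) nn_integral_resample[of _ i]) (simp_all add: Gam_Suc_upd Gam_upd)
    finally show ?thesis .
  qed
  have "(\<Sum>i. \<integral>\<^sup>+\<omega>. F (Gam (Suc i) \<omega>) (mk i \<omega>) \<partial>S) = (\<integral>\<^sup>+\<omega>. (\<Sum>i. I (Gam i \<omega>) (Gam (Suc i) \<omega>)) \<partial>S)"
    unfolding step by (rule nn_integral_suminf[symmetric]) simp
  also have "\<dots> \<le> (\<integral>\<^sup>+\<omega>. (\<integral>\<^sup>+x. (if 0 < x then h x else 0) \<partial>lborel) \<partial>S)"
  proof (rule nn_integral_mono_AE)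
    show "AE \<omega> in S. (\<Sum>i. I (Gam i \<omega>) (Gam (Suc i) \<omega>)) \<le> (\<integral>\<^sup>+x. (if 0 < x then h x else 0) \<partial>lborel)"
      using AE_exp_pos
    proof eventually_elim
      case (elim \<omega>)
      have mono: "Gam m \<omega> \<le> Gam n \<omega>" if "m \<le> n" for m n using Gam_mono[OF _ that] elim by blast
      have "(\<Sum>i<n. I (Gam i \<omega>) (Gam (Suc i) \<omega>)) \<le> (\<integral>\<^sup>+x. (if 0 < x then h x else 0) \<partial>lborel)" for n
      proof -
        have "(\<Sum>i<n. I (Gam i \<omega>) (Gam (Suc i) \<omega>)) = I 0 (Gam n \<omega>)"
        proof (induction n)
          case (Suc n)
          have "I 0 (Gam n \<omega>) + I (Gam n \<omega>) (Gam (Suc n) \<omega>) = I 0 (Gam (Suc n) \<omega>)"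
            unfolding I_def using mono[of 0 n] mono[of n "Suc n"]
            by (subst nn_integral_add[symmetric]) (auto intro!: nn_integral_cong simp: Gam_0)
          then show ?case using Suc by simp
        next
          case 0
          have "(\<lambda>x. if 0 < x \<and> x \<le> 0 then h x else 0) = (\<lambda>_. 0)" by (auto simp: fun_eq_iff)
          then show ?case by (simp add: I_def Gam_0)
        qed
        also have "\<dots> \<le> (\<integral>\<^sup>+x. (if 0 < x then h x else 0) \<partial>lborel)"
          unfolding I_def by (intro nn_integral_mono) auto
        finally show ?thesis .
      qed
      then show ?case by (intro suminf_le_const) auto
    qed
  qed
  finally show ?thesis unfolding h_def by (simp add: S.emeasure_space_1 cong: if_cong)
qed

end

section \<open>Kronecker's lemma\<close>

text \<open>The weights \<open>w\<close> are the reciprocals of the usual increasing normalisers.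
  With \<open>r\<close> the deviation of the weighted partial sums from their limit,
  \<open>y i\<close> is an increment of \<open>r\<close> divided by \<open>w i\<close>, and
  summation by parts applies.\<close>

lemma kronecker_lemma:
  fixes w y :: "nat \<Rightarrow> real"
  assumes pos: "\<And>n. w n > 0" and dec: "\<And>n. w (Suc n) \<le> w n" and w0: "w \<longlonglongrightarrow> 0"
    and conv: "convergent (\<lambda>n. \<Sum>i<n. w i * y i)"
  shows "(\<lambda>n. w n * (\<Sum>i<Suc n. y i)) \<longlonglongrightarrow> 0"
proof -
  obtain s where s: "(\<lambda>n. \<Sum>i<n. w i * y i) \<longlonglongrightarrow> s" using conv by (auto simp: convergent_def)
  define r where "r n = (\<Sum>i<n. w i * y i) - s" for n
  have r0: "r \<longlonglongrightarrow> 0" unfolding r_def using s by (simp add: LIM_zero)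
  have y: "y i = (r (Suc i) - r i) / w i" for i using pos[of i] by (simp add: r_def)
  \<comment> \<open>Summation by parts in inductive form: the boundary term
    \<open>r (Suc n) / w n\<close> is split off, and the bound telescopes because
    \<open>1 / w\<close> increases.\<close>
  have est: "\<bar>(\<Sum>i=N..n. y i) - r (Suc n) / w n\<bar> \<le> \<epsilon> / w n"
    if N: "\<And>i. i \<ge> N \<Longrightarrow> \<bar>r i\<bar> \<le> \<epsilon>" and n: "n \<ge> N" for N n \<epsilon>
    using n
  proof (induction n rule: dec_induct)
    case base
    have "(\<Sum>i=N..N. y i) - r (Suc N) / w N = - r N / w N" by (simp add: y diff_divide_distrib)
    moreover have "\<bar>- r N / w N\<bar> = \<bar>r N\<bar> / w N" using pos[of N] by simp
    moreover have "\<bar>r N\<bar> / w N \<le> \<epsilon> / w N" using N[of N] pos[of N] by (intro divide_right_mono) auto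
    ultimately show ?case by (simp only:)
  next
    case (step n)
    have v: "1 / w n \<le> 1 / w (Suc n)" using pos[of "Suc n"] dec[of n] by (intro divide_left_mono) (auto simp: pos)
    have "(\<Sum>i=N..Suc n. y i) - r (Suc (Suc n)) / w (Suc n) =
      ((\<Sum>i=N..n. y i) - r (Suc n) / w n) - r (Suc n) * (1 / w (Suc n) - 1 / w n)"
      using step by (simp add: y[of "Suc n"] diff_divide_distrib right_diff_distrib)
    also have "\<bar>\<dots>\<bar> \<le> \<epsilon> / w n + \<epsilon> * (1 / w (Suc n) - 1 / w n)"
    proof (rule order_trans[OF abs_triangle_ineq4 add_mono])
      show "\<bar>r (Suc n) * (1 / w (Suc n) - 1 / w n)\<bar> \<le> \<epsilon> * (1 / w (Suc n) - 1 / w n)"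
        using v N[of "Suc n"] step by (simp add: abs_mult mult_right_mono)
    qed (rule step.IH)
    also have "\<dots> = \<epsilon> / w (Suc n)" by (simp add: right_diff_distrib)
    finally show ?case .
  qed
  show ?thesis
  proof (rule LIMSEQ_I)
    fix e :: real assume e: "e > 0"
    obtain N where N: "\<And>i. i \<ge> N \<Longrightarrow> \<bar>r i\<bar> \<le> e / 4"
      using LIMSEQ_D[OF r0, of "e / 4"] e by (auto intro: less_imp_le)
    have "(\<lambda>n. w n * \<bar>\<Sum>i<N. y i\<bar>) \<longlonglongrightarrow> 0" using tendsto_mult_left_zero[OF w0] .
    then obtain N' where N': "\<And>n. n \<ge> N' \<Longrightarrow> w n * \<bar>\<Sum>i<N. y i\<bar> < e / 2"
      using order_tendstoD(2)[of _ 0 sequentially "e / 2"] e unfolding eventually_sequentially by (metis half_gt_zero)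
    show "\<exists>no. \<forall>n\<ge>no. norm (w n * (\<Sum>i<Suc n. y i) - 0) < e"
    proof (intro exI allI impI)
      fix n assume n: "n \<ge> max N N'"
      have split: "(\<Sum>i<Suc n. y i) = (\<Sum>i<N. y i) + (\<Sum>i=N..n. y i)"
        using n sum.atLeastLessThan_concat[of 0 N "Suc n" y] by (simp add: lessThan_atLeast0 atLeastLessThanSuc_atLeastAtMost)
      have "\<bar>\<Sum>i=N..n. y i\<bar> \<le> (e / 4) / w n + \<bar>r (Suc n) / w n\<bar>"
        using est[of N "e / 4" n, OF N] n by linarith
      also have "\<bar>r (Suc n) / w n\<bar> \<le> (e / 4) / w n"
        using divide_right_mono[OF N[of "Suc n"], of "w n"] n pos[of n] by (simp only: abs_divide) simp
      finally have "w n * \<bar>\<Sum>i=N..n. y i\<bar> \<le> w n * ((e / 4) / w n + (e / 4) / w n)"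
        using pos[of n] by (intro mult_left_mono) auto
      then have 2: "w n * \<bar>\<Sum>i=N..n. y i\<bar> \<le> e / 2" using pos[of n] by (simp add: distrib_left)
      have "\<bar>w n * (\<Sum>i<Suc n. y i)\<bar> \<le> w n * \<bar>\<Sum>i<N. y i\<bar> + w n * \<bar>\<Sum>i=N..n. y i\<bar>"
        unfolding split using pos[of n] by (simp add: abs_mult distrib_left[symmetric] abs_triangle_ineq)
      then show "norm (w n * (\<Sum>i<Suc n. y i) - 0) < e" using 2 N'[of n] n by simp
    qed
  qed
qed

lemma summable_of_suminf_nn_integral:
  fixes f :: "nat \<Rightarrow> 'a \<Rightarrow> real"
  assumes "\<And>i. integrable M (f i)" "\<And>i x. 0 \<le> f i x" "(\<Sum>i. \<integral>\<^sup>+x. ennreal (f i x) \<partial>M) < \<infinity>"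
  shows "summable (\<lambda>i. \<integral>x. f i x \<partial>M)"
proof (rule summable_suminf_not_top)
  show "0 \<le> (\<integral>x. f i x \<partial>M)" for i using assms by (intro integral_nonneg_AE) auto
  have "(\<integral>\<^sup>+x. ennreal (f i x) \<partial>M) = ennreal (\<integral>x. f i x \<partial>M)" for i
    using assms by (intro nn_integral_eq_integral) auto
  then show "(\<Sum>i. ennreal (\<integral>x. f i x \<partial>M)) \<noteq> top" using assms(3) by simp
qed

section \<open>Square summability of the truncated jumps and convergence of the compensated
  sums\<close>

context shot_noise
begin

lemma S_distr_coord: "distr S (noise_law L T) (\<lambda>\<omega>. \<omega> i) = noise_law L T"
  unfolding S_def by (rule distr_PiM_component) (auto intro: prob_noise)

lemma integrable_coord:
  fixes f :: "_ \<Rightarrow> real"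
  assumes "integrable (noise_law L T) f" shows "integrable S (\<lambda>\<omega>. f (\<omega> i))"
  using assms integrable_distr[of "\<lambda>\<omega>. \<omega> i" S "noise_law L T" f] S_distr_coord[of i] by simp

lemma noise_distr_fst: "distr (noise_law L T) expo fst = expo"
  unfolding noise_law_def by (rule LU.P.distr_pair_fst)

lemma fst_measurable_noise: "fst \<in> noise_law L T \<rightarrow>\<^sub>M expo"
  by (simp add: noise_law_def)

lemma noise_fst:
  fixes f :: "real \<Rightarrow> real"
  assumes "integrable expo f"
  shows "integrable (noise_law L T) (\<lambda>s. f (fst s))" "(\<integral>s. f (fst s) \<partial>noise_law L T) = (\<integral>e. f e \<partial>expo)"
  using assms integrable_distr[OF fst_measurable_noise, of f] integral_distr[OF fst_measurable_noise, of f]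
  by (simp_all add: noise_distr_fst)

text \<open>The case distinctions all end in 0 because the Bochner integral of a non-integrable
  function is 0 by convention.\<close>

lemma integral_noise_zero:
  fixes f :: "_ \<Rightarrow> real"
  assumes "\<And>e v. (\<integral>u. f (e, v, u) \<partial>unif) = 0"
  shows "(\<integral>s. f s \<partial>noise_law L T) = 0"
proof (cases "integrable (noise_law L T) f")
  case True
  have "(\<integral>w. f (e, w) \<partial>(L \<Otimes>\<^sub>M unif)) = 0" for e
  proof (cases "integrable (L \<Otimes>\<^sub>M unif) (\<lambda>w. f (e, w))")
    case True
    then show ?thesis using LU.integral_fst'[OF True] assms by simp
  qed (simp add: not_integrable_integral_eq)
  then show ?thesis by (simp add: integral_noise[OF True])
qed (simp add: not_integrable_integral_eq)

lemma integral_noise_bounded: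
  fixes f :: "_ \<Rightarrow> 'b::{banach, second_countable_topology}"
  assumes f[measurable]: "f \<in> borel_measurable (borel \<Otimes>\<^sub>M (borel \<Otimes>\<^sub>M borel))" and B: "\<And>s. norm (f s) \<le> B"
  shows "(\<integral>s. f s \<partial>noise_law L T) = (\<integral>e. \<integral>v. \<integral>u. f (e, v, u) \<partial>unif \<partial>L \<partial>expo)"
proof -
  have "integrable (noise_law L T) f"
    using B by (intro R.integrable_const_bound[where B=B]) auto
  then have "(\<integral>s. f s \<partial>noise_law L T) = (\<integral>e. \<integral>w. f (e, w) \<partial>(L \<Otimes>\<^sub>M unif) \<partial>expo)"
    by (rule integral_noise)
  also have "\<dots> = (\<integral>e. \<integral>v. \<integral>u. f (e, v, u) \<partial>unif \<partial>L \<partial>expo)"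
  proof (rule Bochner_Integration.integral_cong[OF refl])
    fix e
    have "integrable (L \<Otimes>\<^sub>M unif) (\<lambda>w. f (e, w))"
      using B by (intro LU.P.integrable_const_bound[where B=B]) auto
    from LU.integral_fst'[OF this] show "(\<integral>w. f (e, w) \<partial>(L \<Otimes>\<^sub>M unif)) = (\<integral>v. \<integral>u. f (e, v, u) \<partial>unif \<partial>L)"
      by simp
  qed
  finally show ?thesis .
qed

text \<open>The common envelope of all compensator densities: it dominates the mean over
  \<open>v\<close> of any \<open>F x v\<close> bounded by the truncated jump, and it is
  nonincreasing for positive \<open>x\<close> and square integrable, though in general not
  integrable.\<close>

definition g :: "real \<Rightarrow> real" where "g x = (\<integral>v. min 1 (norm (H x v)) \<partial>L)"

lemma min_H_integrable: "integrable L (\<lambda>v. min 1 (norm (H x v)))"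
  by (intro L.integrable_const_bound[where B=1]) auto

lemma g_measurable[measurable]: "g \<in> borel_measurable borel"
  unfolding g_def by measurable

lemma g_nonneg: "0 \<le> g x" and g_le_1: "g x \<le> 1"
proof -
  show "0 \<le> g x" unfolding g_def by (intro integral_nonneg_AE) auto
  have "g x \<le> (\<integral>v. 1 \<partial>L)" unfolding g_def by (intro integral_mono min_H_integrable) auto
  then show "g x \<le> 1" by (simp add: L.prob_space)
qed

lemma g_anti: "0 < x \<Longrightarrow> x \<le> y \<Longrightarrow> g y \<le> g x"
  unfolding g_def using H_anti by (intro integral_mono min_H_integrable) (auto simp: min_le_iff_disj)

text \<open>Jensen's inequality, in the form that the variance of
  \<open>min 1 \<parallel>H x v\<parallel>\<close> is nonnegative.\<close>

lemma g_square_le: "(g x)\<^sup>2 \<le> (\<integral>v. (min 1 (norm (H x v)))\<^sup>2 \<partial>L)"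
proof -
  have i2: "integrable L (\<lambda>v. (min 1 (norm (H x v)))\<^sup>2)"
    by (intro L.integrable_const_bound[where B=1]) (auto simp: power_le_one)
  have "0 \<le> L.variance (\<lambda>v. min 1 (norm (H x v)))" by (rule L.variance_positive)
  then show ?thesis using L.variance_eq[OF min_H_integrable i2] by (simp add: g_def)
qed

lemma nn_integral_g_square: "(\<integral>\<^sup>+x. (if 0 < x then ennreal ((g x)\<^sup>2) else 0) \<partial>lborel) < \<infinity>"
proof -
  have "(\<integral>\<^sup>+x. (if 0 < x then ennreal ((g x)\<^sup>2) else 0) \<partial>lborel) \<le>
    (\<integral>\<^sup>+x. \<integral>\<^sup>+v. ennreal ((min 1 (norm (H x v)))\<^sup>2) \<partial>L \<partial>lborel)"
  proof (rule nn_integral_mono)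
    fix x
    have "ennreal ((g x)\<^sup>2) \<le> ennreal (\<integral>v. (min 1 (norm (H x v)))\<^sup>2 \<partial>L)" by (intro ennreal_leI g_square_le)
    also have "\<dots> = (\<integral>\<^sup>+v. ennreal ((min 1 (norm (H x v)))\<^sup>2) \<partial>L)"
      by (intro nn_integral_eq_integral[symmetric] L.integrable_const_bound[where B=1]) (auto simp: power_le_one)
    finally show "(if 0 < x then ennreal ((g x)\<^sup>2) else 0) \<le> (\<integral>\<^sup>+v. ennreal ((min 1 (norm (H x v)))\<^sup>2) \<partial>L)" by simp
  qed
  also have "\<dots> < \<infinity>" by (rule H_int)
  finally show ?thesis .
qed

definition J :: "nat \<Rightarrow> (nat \<Rightarrow> real \<times> 'a \<times> real) \<Rightarrow> real" where
  "J i \<omega> = min 1 (norm (H (Gam (Suc i) \<omega>) (mk i \<omega>)))"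

lemma J_measurable[measurable]: "J i \<in> borel_measurable S"
  unfolding J_def by measurable

lemma J_bounds: "0 \<le> J i \<omega>" "J i \<omega> \<le> 1" by (auto simp: J_def)

lemma J_square_integrable: "integrable S (\<lambda>\<omega>. (J i \<omega>)\<^sup>2)"
  using J_bounds by (intro S.integrable_const_bound[where B=1]) (auto simp: power_le_one)

lemma suminf_J_square: "(\<Sum>i. \<integral>\<^sup>+\<omega>. ennreal ((J i \<omega>)\<^sup>2) \<partial>S) < \<infinity>"
proof -
  have "(\<Sum>i. \<integral>\<^sup>+\<omega>. ennreal ((J i \<omega>)\<^sup>2) \<partial>S) \<le>
    (\<integral>\<^sup>+x. (if 0 < x then \<integral>\<^sup>+v. ennreal ((min 1 (norm (H x v)))\<^sup>2) \<partial>L else 0) \<partial>lborel)"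
    unfolding J_def by (rule campbell_le) measurable
  also have "\<dots> \<le> (\<integral>\<^sup>+x. \<integral>\<^sup>+v. ennreal ((min 1 (norm (H x v)))\<^sup>2) \<partial>L \<partial>lborel)"
    by (intro nn_integral_mono) auto
  finally show ?thesis using H_int by (rule order_le_less_trans)
qed

lemma summable_J_square: "summable (\<lambda>i. \<integral>\<omega>. (J i \<omega>)\<^sup>2 \<partial>S)"
  by (rule summable_of_suminf_nn_integral[OF J_square_integrable _ suminf_J_square]) simp

lemma AE_J_tendsto_0: "AE \<omega> in S. (\<lambda>i. J i \<omega>) \<longlonglongrightarrow> 0"
proof -
  have "(\<integral>\<^sup>+\<omega>. (\<Sum>i. ennreal ((J i \<omega>)\<^sup>2)) \<partial>S) \<noteq> \<infinity>"
    using suminf_J_square by (subst nn_integral_suminf) auto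
  then have "AE \<omega> in S. (\<Sum>i. ennreal ((J i \<omega>)\<^sup>2)) \<noteq> \<infinity>"
    by (intro nn_integral_PInf_AE) auto
  then show ?thesis
  proof eventually_elim
    case (elim \<omega>)
    then have "summable (\<lambda>i. (J i \<omega>)\<^sup>2)" by (intro summable_suminf_not_top) auto
    then have "(\<lambda>i. (J i \<omega>)\<^sup>2) \<longlonglongrightarrow> 0" by (rule summable_LIMSEQ_zero)
    from tendsto_real_sqrt[OF this] show ?case by (simp add: J_bounds)
  qed
qed

lemma summable_g_Gam: "summable (\<lambda>i. \<integral>\<omega>. (g (Gam (Suc i) \<omega>))\<^sup>2 \<partial>S)"
proof (rule summable_of_suminf_nn_integral)
  show "integrable S (\<lambda>\<omega>. (g (Gam (Suc i) \<omega>))\<^sup>2)" for i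
    using g_nonneg g_le_1 by (intro S.integrable_const_bound[where B=1]) (auto simp: power_le_one)
  have "(\<Sum>i. \<integral>\<^sup>+\<omega>. ennreal ((g (Gam (Suc i) \<omega>))\<^sup>2) \<partial>S) \<le> (\<integral>\<^sup>+x. (if 0 < x then \<integral>\<^sup>+v. ennreal ((g x)\<^sup>2) \<partial>L else 0) \<partial>lborel)"
    by (rule campbell_le[of "\<lambda>x v. ennreal ((g x)\<^sup>2)"]) measurable
  also have "\<dots> = (\<integral>\<^sup>+x. (if 0 < x then ennreal ((g x)\<^sup>2) else 0) \<partial>lborel)"
    by (simp add: space_L cong: if_cong)
  finally show "(\<Sum>i. \<integral>\<^sup>+\<omega>. ennreal ((g (Gam (Suc i) \<omega>))\<^sup>2) \<partial>S) < \<infinity>"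
    using nn_integral_g_square by (rule order_le_less_trans)
qed simp

text \<open>The terms are martingale differences by the compensator formula of one waiting time.
  Their variances are summable by Campbell's inequality, applied to the squared truncated jumps and
  to the square of the envelope \<open>g\<close>.\<close>

lemma AE_compensated_convergent:
  fixes F :: "real \<Rightarrow> 'a \<Rightarrow> real"
  assumes F: "(\<lambda>(x, v). F x v) \<in> borel_measurable (borel \<Otimes>\<^sub>M borel)"
    and bd: "\<And>x v. \<bar>F x v\<bar> \<le> min 1 (norm (H x v))"
  shows "AE \<omega> in S. convergent (\<lambda>n. \<Sum>i<n. F (Gam (Suc i) \<omega>) (mk i \<omega>)
     - ioc_integral (\<lambda>x. \<integral>v. F x v \<partial>L) (Gam i \<omega>) (Gam (Suc i) \<omega>))"
proof -
  have Fm[measurable (raw)]: "(\<lambda>x. F (f x) (k x)) \<in> borel_measurable M"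
    if "f \<in> borel_measurable M" "k \<in> borel_measurable M" for f k and M :: "'z measure"
    using measurable_compose[OF measurable_Pair[OF that] F] by simp
  define h where "h x = (\<integral>v. F x v \<partial>L)" for x
  have hm[measurable]: "h \<in> borel_measurable borel" unfolding h_def by measurable
  have F1: "\<bar>F x v\<bar> \<le> 1" for x v using bd[of x v] by simp
  have Fi: "integrable L (F x)" for x
    using F1 by (intro L.integrable_const_bound[where B=1]) auto
  have hg: "\<bar>h x\<bar> \<le> g x" for x
  proof -
    have "\<bar>h x\<bar> \<le> (\<integral>v. \<bar>F x v\<bar> \<partial>L)" unfolding h_def by (rule integral_abs_bound)
    also have "\<dots> \<le> g x" unfolding g_def using bd Fi by (intro integral_mono min_H_integrable) auto
    finally show ?thesis .
  qed
  have h1: "\<bar>h x\<bar> \<le> 1" for x using hg[of x] g_le_1[of x] by linarith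
  have h1n: "norm (h x) \<le> 1" for x using h1 by simp
  have iocm[measurable (raw)]: "(\<lambda>\<omega>. ioc_integral h (f \<omega>) (k \<omega>)) \<in> borel_measurable M"
    if "f \<in> borel_measurable M" "k \<in> borel_measurable M" for f k and M :: "'z measure"
    by (rule borel_measurable_ioc_integral[OF hm that])
  have ioc_bd: "\<bar>ioc_integral h x (x + e)\<bar> \<le> \<bar>e\<bar>" for x e
    using ioc_integral_le[OF hm h1n h1n, of x "x + e"] ioc_integral_empty[of "x + e" x h] by (cases "e \<ge> 0") auto
  define D where "D i \<omega> = F (Gam (Suc i) \<omega>) (mk i \<omega>) - ioc_integral h (Gam i \<omega>) (Gam (Suc i) \<omega>)" for i \<omega>
  have Dm[measurable]: "D i \<in> borel_measurable S" for i unfolding D_def by measurable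
  have e2: "integrable S (\<lambda>\<omega>. (fst (\<omega> i))\<^sup>2)" for i
    by (rule integrable_coord[OF noise_fst(1)]) (rule expo_moments(3))
  have ab2: "(a - b)\<^sup>2 \<le> 2 * a\<^sup>2 + 2 * b\<^sup>2" for a b :: real
    using zero_le_power2[of "a + b"] by (simp add: power2_eq_square algebra_simps)
  have sq: "integrable S (\<lambda>\<omega>. (D i \<omega>)\<^sup>2)" for i
  proof (rule Bochner_Integration.integrable_bound)
    show "integrable S (\<lambda>\<omega>. 2 * 1 + 2 * (fst (\<omega> i))\<^sup>2)" using e2 by simp
    have "(D i \<omega>)\<^sup>2 \<le> 2 * 1 + 2 * (fst (\<omega> i))\<^sup>2" for \<omega>
    proof -
      have "(D i \<omega>)\<^sup>2 \<le> 2 * (F (Gam (Suc i) \<omega>) (mk i \<omega>))\<^sup>2 + 2 * (ioc_integral h (Gam i \<omega>) (Gam (Suc i) \<omega>))\<^sup>2"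
        unfolding D_def by (rule ab2)
      moreover have "(F (Gam (Suc i) \<omega>) (mk i \<omega>))\<^sup>2 \<le> 1" using F1 by (simp add: abs_square_le_1)
      moreover have "(ioc_integral h (Gam i \<omega>) (Gam (Suc i) \<omega>))\<^sup>2 \<le> (fst (\<omega> i))\<^sup>2"
        unfolding Gam_Suc abs_le_square_iff[symmetric] by (rule ioc_bd)
      ultimately show ?thesis by linarith
    qed
    then show "AE \<omega> in S. norm ((D i \<omega>)\<^sup>2) \<le> norm (2 * 1 + 2 * (fst (\<omega> i))\<^sup>2)" by simp
  qed simp
  have dep: "D i \<omega> = D i \<omega>'" if "\<And>j. j \<le> i \<Longrightarrow> \<omega> j = \<omega>' j" for i \<omega> \<omega>'
  proof -
    have "Gam (Suc i) \<omega> = Gam (Suc i) \<omega>'" "Gam i \<omega> = Gam i \<omega>'" using that by (auto intro!: Gam_cong)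
    then show ?thesis unfolding D_def using that[of i] by simp
  qed
  have mean: "(\<integral>s. D i (fun_upd \<omega> i s) \<partial>noise_law L T) = 0" for i \<omega>
  proof -
    let ?c = "Gam i \<omega>"
    have m: "(\<lambda>e. ioc_integral h ?c (?c + e)) \<in> borel_measurable borel" by measurable
    have iF: "integrable (noise_law L T) (\<lambda>s. F (?c + fst s) (fst (snd s)))"
      using F1 by (intro R.integrable_const_bound[where B=1]) auto
    note iI = noise_fst[OF integral_expo_shift(1)[OF hm h1, of ?c]]
    have "(\<integral>s. D i (fun_upd \<omega> i s) \<partial>noise_law L T) =
      (\<integral>s. F (?c + fst s) (fst (snd s)) \<partial>noise_law L T) - (\<integral>s. ioc_integral h ?c (?c + fst s) \<partial>noise_law L T)"
      unfolding D_def Gam_Suc_upd using iF iI(1) by (simp add: Gam_upd)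
    also have "(\<integral>s. F (?c + fst s) (fst (snd s)) \<partial>noise_law L T) = (\<integral>e. h (?c + e) \<partial>expo)"
      using F1 U.prob_space by (subst integral_noise_bounded[where B=1]) (simp_all add: h_def del: measure_uniform_measure)
    also have "\<dots> = (\<integral>s. ioc_integral h ?c (?c + fst s) \<partial>noise_law L T)"
      using integral_expo_shift(2)[OF hm h1, of ?c] iI(2) by simp
    finally show ?thesis by (rule trans) simp
  qed
  \<comment> \<open>The compensator is at most the waiting time times \<open>g\<close> at its left
    end. The two are independent and the squared waiting time has mean 2, whence the constant
    \<open>4 = 2 * 2\<close>. Term 0 is left out because \<open>g\<close> is monotone only for
    positive arguments.\<close>
  have bound: "(\<integral>\<omega>. (D (Suc i) \<omega>)\<^sup>2 \<partial>S) \<le> 2 * (\<integral>\<omega>. (J (Suc i) \<omega>)\<^sup>2 \<partial>S) + 4 * (\<integral>\<omega>. (g (Gam (Suc i) \<omega>))\<^sup>2 \<partial>S)" for i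
  proof -
    have ie: "integrable S (\<lambda>\<omega>. (fst (\<omega> (Suc i)))\<^sup>2 * (g (Gam (Suc i) \<omega>))\<^sup>2)"
      by (rule Bochner_Integration.integrable_bound[OF e2[of "Suc i"]])
         (use g_nonneg g_le_1 in \<open>auto intro!: mult_left_le power_le_one\<close>)
    have "(\<integral>\<omega>. (D (Suc i) \<omega>)\<^sup>2 \<partial>S) \<le> (\<integral>\<omega>. 2 * (J (Suc i) \<omega>)\<^sup>2 + 2 * ((fst (\<omega> (Suc i)))\<^sup>2 * (g (Gam (Suc i) \<omega>))\<^sup>2) \<partial>S)"
    proof (rule integral_mono_AE[OF sq])
      show "integrable S (\<lambda>\<omega>. 2 * (J (Suc i) \<omega>)\<^sup>2 + 2 * ((fst (\<omega> (Suc i)))\<^sup>2 * (g (Gam (Suc i) \<omega>))\<^sup>2))"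
        using J_square_integrable ie by simp
      show "AE \<omega> in S. (D (Suc i) \<omega>)\<^sup>2 \<le> 2 * (J (Suc i) \<omega>)\<^sup>2 + 2 * ((fst (\<omega> (Suc i)))\<^sup>2 * (g (Gam (Suc i) \<omega>))\<^sup>2)"
        using AE_exp_pos
      proof eventually_elim
        case (elim \<omega>)
        have pos: "0 < Gam (Suc i) \<omega>" using Gam_pos elim by blast
        have "\<bar>ioc_integral h (Gam (Suc i) \<omega>) (Gam (Suc (Suc i)) \<omega>)\<bar> \<le> g (Gam (Suc i) \<omega>) * (Gam (Suc (Suc i)) \<omega> - Gam (Suc i) \<omega>)"
        proof (rule ioc_integral_le[OF hm h1n, unfolded real_norm_def])
          show "\<bar>h x\<bar> \<le> g (Gam (Suc i) \<omega>)" if "Gam (Suc i) \<omega> < x" for x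
            using hg[of x] g_anti[OF pos, of x] that by linarith
          show "Gam (Suc i) \<omega> \<le> Gam (Suc (Suc i)) \<omega>" using elim[rule_format, of "Suc i"] by (simp add: Gam_Suc[of "Suc i"])
        qed
        then have "\<bar>ioc_integral h (Gam (Suc i) \<omega>) (Gam (Suc (Suc i)) \<omega>)\<bar> \<le> \<bar>fst (\<omega> (Suc i)) * g (Gam (Suc i) \<omega>)\<bar>"
          using g_nonneg elim[rule_format, of "Suc i"] by (simp add: Gam_Suc[of "Suc i"] mult.commute)
        then have "(ioc_integral h (Gam (Suc i) \<omega>) (Gam (Suc (Suc i)) \<omega>))\<^sup>2 \<le> (fst (\<omega> (Suc i)))\<^sup>2 * (g (Gam (Suc i) \<omega>))\<^sup>2"
          unfolding abs_le_square_iff by (simp add: power_mult_distrib)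
        moreover have "(F (Gam (Suc (Suc i)) \<omega>) (mk (Suc i) \<omega>))\<^sup>2 \<le> (J (Suc i) \<omega>)\<^sup>2"
          unfolding abs_le_square_iff[symmetric] using bd J_bounds by (simp add: J_def)
        moreover have "(D (Suc i) \<omega>)\<^sup>2 \<le> 2 * (F (Gam (Suc (Suc i)) \<omega>) (mk (Suc i) \<omega>))\<^sup>2 + 2 * (ioc_integral h (Gam (Suc i) \<omega>) (Gam (Suc (Suc i)) \<omega>))\<^sup>2"
          unfolding D_def by (rule ab2)
        ultimately show ?case by linarith
      qed
    qed
    also have "\<dots> = 2 * (\<integral>\<omega>. (J (Suc i) \<omega>)\<^sup>2 \<partial>S) + 2 * (\<integral>\<omega>. (fst (\<omega> (Suc i)))\<^sup>2 * (g (Gam (Suc i) \<omega>))\<^sup>2 \<partial>S)"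
      using J_square_integrable ie by simp
    also have "(\<integral>\<omega>. (fst (\<omega> (Suc i)))\<^sup>2 * (g (Gam (Suc i) \<omega>))\<^sup>2 \<partial>S) = (\<integral>\<omega>. 2 * (g (Gam (Suc i) \<omega>))\<^sup>2 \<partial>S)"
      using noise_fst(2)[OF expo_moments(3)] expo_moments(4)
      by (subst integral_resample[OF ie, of "Suc i"]) (simp add: Gam_upd)
    finally show ?thesis by simp
  qed
  have "summable (\<lambda>i. \<integral>\<omega>. (D (Suc i) \<omega>)\<^sup>2 \<partial>S)"
  proof (rule summable_comparison_test)
    show "summable (\<lambda>i. 2 * (\<integral>\<omega>. (J (Suc i) \<omega>)\<^sup>2 \<partial>S) + 4 * (\<integral>\<omega>. (g (Gam (Suc i) \<omega>))\<^sup>2 \<partial>S))"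
      by (intro summable_add summable_mult summable_g_Gam summable_J_square[THEN summable_Suc_iff[THEN iffD2]])
    show "\<exists>N. \<forall>n\<ge>N. norm (\<integral>\<omega>. (D (Suc n) \<omega>)\<^sup>2 \<partial>S) \<le> 2 * (\<integral>\<omega>. (J (Suc n) \<omega>)\<^sup>2 \<partial>S) + 4 * (\<integral>\<omega>. (g (Gam (Suc n) \<omega>))\<^sup>2 \<partial>S)"
      using bound by simp
  qed
  then have "summable (\<lambda>i. \<integral>\<omega>. (D i \<omega>)\<^sup>2 \<partial>S)" by (rule summable_Suc_iff[THEN iffD1])
  from AE_martingale_convergent[OF Dm sq dep mean this] show ?thesis
    unfolding D_def h_def .
qed

end

section \<open>Uniform convergence\<close>

lemma pow2_frac_le: "k \<le> 2 ^ K \<Longrightarrow> real k / 2 ^ K \<le> 1"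
proof -
  assume "k \<le> 2 ^ K"
  then have "real k \<le> real (2 ^ K)" by (simp only: of_nat_le_iff)
  then show ?thesis by simp
qed

lemma inverse_bounds_half: "1 / 2 \<le> r \<Longrightarrow> r \<le> 1 \<Longrightarrow> 1 / r \<le> 2 \<and> 1 \<le> 1 / (r::real)"
  by (auto simp: divide_le_eq le_divide_eq)

context shot_noise
begin

text \<open>Clamping extends the paths to the whole line, constant outside \<open>[0, T]\<close>, so
  that path properties can be stated without boundary cases.\<close>

definition cl :: "real \<Rightarrow> real" where "cl t = max 0 (min T t)"

lemma cl_bounds: "0 \<le> cl t" "cl t \<le> T" using T by (auto simp: cl_def)
lemma cl_mono: "s \<le> t \<Longrightarrow> cl s \<le> cl t" by (auto simp: cl_def)
lemma cl_eq: "0 \<le> t \<Longrightarrow> t \<le> T \<Longrightarrow> cl t = t" by (simp add: cl_def)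
lemma cl_cl: "cl (cl t) = cl t" by (intro cl_eq cl_bounds)
lemma cl_cont: "isCont cl t" unfolding cl_def by (intro continuous_intros)

lemma unif_le: "0 \<le> c \<Longrightarrow> c \<le> T \<Longrightarrow> (\<integral>u. (if u \<le> c then 1 else 0) \<partial>unif) = c / T"
proof -
  assume c: "0 \<le> c" "c \<le> T"
  have "(\<integral>u. (if u \<le> c then 1 else 0 :: real) \<partial>unif) = (\<integral>u. indicator {..c} u \<partial>unif)"
    by (intro Bochner_Integration.integral_cong) (auto simp: indicator_def)
  also have "\<dots> = measure unif {..c}" by simp
  also have "{0..T} \<inter> {..c} = {0..c}" using c by auto
  then have "measure unif {..c} = c / T"
    using c T by (subst measure_uniform_measure) auto
  finally show ?thesis .
qed

lemma unif_integrable: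
  fixes f :: "real \<Rightarrow> real"
  assumes "f \<in> borel_measurable borel" "\<And>u. \<bar>f u\<bar> \<le> C" shows "integrable unif f"
  using assms by (intro U.integrable_const_bound[where B=C]) auto

lemma unif_gt: "0 \<le> c \<Longrightarrow> c \<le> T \<Longrightarrow> (\<integral>u. (if c < u then 1 else 0) \<partial>unif) = 1 - c / T"
proof -
  assume c: "0 \<le> c" "c \<le> T"
  have "(\<integral>u. (if c < u then 1 else 0 :: real) \<partial>unif) = (\<integral>u. 1 - (if u \<le> c then 1 else 0) \<partial>unif)"
    by (intro Bochner_Integration.integral_cong) auto
  also have "\<dots> = (\<integral>u. 1 \<partial>unif) - (\<integral>u. (if u \<le> c then 1 else 0) \<partial>unif)"
    by (rule Bochner_Integration.integral_diff; rule unif_integrable[where C=1]) auto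
  also have "(\<integral>u. 1 \<partial>unif) = (1::real)" using U.prob_space by (simp del: measure_uniform_measure)
  finally show ?thesis using unif_le[OF c] by simp
qed

text \<open>Once \<open>u\<close> leaves the set \<open>Al k\<close> of times still undecided at stage \<open>k\<close>, the values
  \<open>\<eta> k u\<close> are frozen; so \<open>\<eta> k\<close> is a martingale in \<open>k\<close> under the uniform law.\<close>

lemma grid_maximal:
  fixes F :: "real \<Rightarrow> 'a \<Rightarrow> real" and \<eta> :: "nat \<Rightarrow> real \<Rightarrow> real" and Al :: "nat \<Rightarrow> real set"
  assumes F: "(\<lambda>(x, v). F x v) \<in> borel_measurable (borel \<Otimes>\<^sub>M borel)"
    and bd: "\<And>x v. \<bar>F x v\<bar> \<le> min 1 (norm (H x v))"
    and \<eta>: "\<And>k. \<eta> k \<in> borel_measurable borel" "\<And>k u. k \<le> K \<Longrightarrow> \<bar>\<eta> k u\<bar> \<le> 1"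
    and A1: "\<And>k l u u'. k < K \<Longrightarrow> l \<le> k \<Longrightarrow> u \<in> Al k \<Longrightarrow> u' \<in> Al k \<Longrightarrow> \<eta> l u = \<eta> l u'"
    and A2: "\<And>k u. k < K \<Longrightarrow> u \<notin> Al k \<Longrightarrow> \<eta> (Suc k) u = \<eta> k u"
    and A3: "\<And>k. k \<le> K \<Longrightarrow> (\<integral>u. \<eta> k u \<partial>unif) = 0"
  shows "integrable S (\<lambda>\<omega>. (Max ((\<lambda>k. \<bar>\<Sum>i=m..<m+N. F (Gam (Suc i) \<omega>) (mk i \<omega>) * \<eta> k (tm i \<omega>)\<bar>) ` {..K}))\<^sup>2)"
    and "(\<integral>\<omega>. (Max ((\<lambda>k. \<bar>\<Sum>i=m..<m+N. F (Gam (Suc i) \<omega>) (mk i \<omega>) * \<eta> k (tm i \<omega>)\<bar>) ` {..K}))\<^sup>2 \<partial>S)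
      \<le> 4 * (\<Sum>i=m..<m+N. \<integral>\<omega>. (J i \<omega>)\<^sup>2 \<partial>S)"
proof -
  have Fm[measurable (raw)]: "(\<lambda>x. F (f x) (k x)) \<in> borel_measurable M"
    if "f \<in> borel_measurable M" "k \<in> borel_measurable M" for f k and M :: "'z measure"
    using measurable_compose[OF measurable_Pair[OF that] F] by simp
  note [measurable] = \<eta>(1)
  \<comment> \<open>\<open>doob_L2\<close> takes a sequence over all indices, so the grid process is
    frozen after its last index \<open>K\<close>.\<close>
  define \<eta>' where "\<eta>' k = \<eta> (min k K)" for k
  have \<eta>'m[measurable]: "\<eta>' k \<in> borel_measurable borel" for k unfolding \<eta>'_def by simp
  have \<eta>'1: "\<bar>\<eta>' k u\<bar> \<le> 1" for k u unfolding \<eta>'_def by (intro \<eta>(2)) simp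
  have F1: "\<bar>F x v\<bar> \<le> 1" for x v using bd[of x v] by simp
  define a where "a i \<omega> = F (Gam (Suc i) \<omega>) (mk i \<omega>)" for i \<omega>
  define Y where "Y i k \<omega> = a i \<omega> * \<eta>' k (tm i \<omega>)" for i k \<omega>
  \<comment> \<open>Here the discrete time of \<open>doob_L2\<close> is the grid index
    \<open>k\<close>, the number of terms is fixed, and the family consists of a single process,
    indexed by \<open>unit\<close>.\<close>
  define X where "X (j::unit) k \<omega> = (\<Sum>i=m..<m+N. Y i k \<omega>)" for j k \<omega>
  have am[measurable]: "a i \<in> borel_measurable S" for i unfolding a_def by measurable
  have Ym[measurable]: "Y i k \<in> borel_measurable S" for i k unfolding Y_def by measurable
  have Xm: "X j k \<in> borel_measurable S" for j k unfolding X_def by measurable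
  have aJ: "\<bar>a i \<omega>\<bar> \<le> J i \<omega>" for i \<omega> using bd by (simp add: a_def J_def)
  have YJ: "\<bar>Y i k \<omega>\<bar> \<le> J i \<omega>" for i k \<omega>
    using mult_mono[OF aJ[of i \<omega>] \<eta>'1[of k "tm i \<omega>"]] J_bounds(1)[of i \<omega>] by (simp add: Y_def abs_mult)
  have Ysq: "integrable S (\<lambda>\<omega>. (Y i k \<omega>)\<^sup>2)" for i k
    by (rule integrable_square_bound[OF _ J_square_integrable[of i]]) (use YJ J_bounds in auto)
  have Xsq: "integrable S (\<lambda>\<omega>. (X j k \<omega>)\<^sup>2)" for j k
    unfolding X_def by (intro integrable_square_sum Ysq) auto
  have int\<eta>: "integrable unif (\<eta>' k)" for k by (rule unif_integrable[OF _ \<eta>'1]) simp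
  have \<eta>'0: "(\<integral>u. \<eta>' k u \<partial>unif) = 0" for k unfolding \<eta>'_def by (intro A3) simp
  have updS: "Gam n (fun_upd \<omega> i (e, v, u)) = Gam n (fun_upd \<omega> i (e, v, u'))" for n \<omega> i e v u u'
    unfolding Gam_def by (intro sum.cong refl) simp
  have orth: "(\<integral>\<omega>. Z \<omega> * (X j (Suc k) \<omega> - X j k \<omega>) \<partial>S) = 0"
    if k: "k < K" and Zm: "Z \<in> borel_measurable S" and Zsq: "integrable S (\<lambda>\<omega>. (Z \<omega>)\<^sup>2)"
      and Zd: "\<forall>\<omega> \<omega>'. (\<forall>j\<in>UNIV. \<forall>l\<le>k. X j l \<omega> = X j l \<omega>') \<longrightarrow> Z \<omega> = Z \<omega>'" for k j Z
  proof -
    have int: "integrable S (\<lambda>\<omega>. Z \<omega> * Y i l \<omega>)" for i l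
      by (intro integrable_mult_square Zm Zsq Ym Ysq)
    have zero: "(\<integral>\<omega>. Z \<omega> * Y i (Suc k) \<omega> - Z \<omega> * Y i k \<omega> \<partial>S) = 0" for i
    proof -
      have inner: "(\<integral>s. Z (fun_upd \<omega> i s) * Y i (Suc k) (fun_upd \<omega> i s) - Z (fun_upd \<omega> i s) * Y i k (fun_upd \<omega> i s) \<partial>noise_law L T) = 0" for \<omega>
      proof (rule integral_noise_zero)
        fix e v
        let ?w = "\<lambda>u. fun_upd \<omega> i (e, v, u)"
        have Yw: "Y i l (?w u) = F (Gam i \<omega> + e) v * \<eta>' l u" for l u
          by (simp add: Y_def a_def Gam_Suc_upd)
        show "(\<integral>u. Z (?w u) * Y i (Suc k) (?w u) - Z (?w u) * Y i k (?w u) \<partial>unif) = 0"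
        proof (cases "Al k = {}")
          case True
          then have "\<eta>' (Suc k) u = \<eta>' k u" for u using A2[OF k, of u] k by (simp add: \<eta>'_def)
          then show ?thesis by (simp add: Yw)
        next
          case False
          then obtain u0 where u0: "u0 \<in> Al k" by blast
          \<comment> \<open>On \<open>Al k\<close> the past values, and with them \<open>Z\<close>,
            do not vary with \<open>u\<close>; off \<open>Al k\<close> the increment is 0. So
            \<open>Z\<close> may be evaluated at \<open>u0\<close> throughout and taken out of the
            integral of an increment of mean 0.\<close>
          have "Z (?w u) * Y i (Suc k) (?w u) - Z (?w u) * Y i k (?w u) =
            (Z (?w u0) * F (Gam i \<omega> + e) v) * (\<eta>' (Suc k) u - \<eta>' k u)" for u
          proof (cases "u \<in> Al k")
            case True
            have "Z (?w u) = Z (?w u0)"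
            proof (rule Zd[rule_format])
              fix j l assume l: "l \<le> k"
              have "Y i' l (?w u) = Y i' l (?w u0)" for i'
              proof (cases "i' = i")
                case True
                then show ?thesis
                  using A1[OF k l \<open>u \<in> Al k\<close> u0] l k by (simp add: Yw \<eta>'_def)
              next
                case False
                then show ?thesis by (simp add: Y_def a_def updS[of _ _ _ _ _ u u0])
              qed
              then show "X j l (?w u) = X j l (?w u0)" unfolding X_def by (intro sum.cong refl)
            qed
            then show ?thesis by (simp add: Yw right_diff_distrib)
          next
            case False
            then have "\<eta>' (Suc k) u = \<eta>' k u" using A2[OF k, of u] k by (simp add: \<eta>'_def)
            then show ?thesis by (simp add: Yw)
          qed
          then show ?thesis
            using int\<eta>[of k] int\<eta>[of "Suc k"] \<eta>'0[of k] \<eta>'0[of "Suc k"] by simp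
        qed
      qed
      have "(\<integral>\<omega>. Z \<omega> * Y i (Suc k) \<omega> - Z \<omega> * Y i k \<omega> \<partial>S) = (\<integral>\<omega>. \<integral>s. Z (fun_upd \<omega> i s) * Y i (Suc k) (fun_upd \<omega> i s) - Z (fun_upd \<omega> i s) * Y i k (fun_upd \<omega> i s) \<partial>noise_law L T \<partial>S)"
        by (rule integral_resample) (intro Bochner_Integration.integrable_diff int)
      also have "\<dots> = 0" unfolding inner by simp
      finally show ?thesis .
    qed
    have "Z \<omega> * (X j (Suc k) \<omega> - X j k \<omega>) = (\<Sum>i=m..<m+N. Z \<omega> * Y i (Suc k) \<omega> - Z \<omega> * Y i k \<omega>)" for \<omega>
      by (simp add: X_def sum_subtractf[symmetric] sum_distrib_left right_diff_distrib)
    then have "(\<integral>\<omega>. Z \<omega> * (X j (Suc k) \<omega> - X j k \<omega>) \<partial>S) = (\<Sum>i=m..<m+N. \<integral>\<omega>. Z \<omega> * Y i (Suc k) \<omega> - Z \<omega> * Y i k \<omega> \<partial>S)"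
      by (simp only:) (intro Bochner_Integration.integral_sum Bochner_Integration.integrable_diff int)
    then show ?thesis by (simp only: zero sum.neutral_const)
  qed
  note d = doob_L2[of UNIV X S K, OF _ _ Xm Xsq orth]
  have Xe: "\<bar>X () k \<omega>\<bar> = \<bar>\<Sum>i=m..<m+N. F (Gam (Suc i) \<omega>) (mk i \<omega>) * \<eta> k (tm i \<omega>)\<bar>" if "k \<le> K" for k \<omega>
    using that by (simp add: X_def Y_def a_def \<eta>'_def min_absorb1)
  have UN: "(\<lambda>j. \<bar>X j k \<omega>\<bar>) ` UNIV = {\<bar>X () k \<omega>\<bar>}" for k \<omega>
    by (simp add: UNIV_unit)
  have Me: "Max ((\<lambda>k. Max ((\<lambda>j. \<bar>X j k \<omega>\<bar>) ` UNIV)) ` {..K}) = Max ((\<lambda>k. \<bar>\<Sum>i=m..<m+N. F (Gam (Suc i) \<omega>) (mk i \<omega>) * \<eta> k (tm i \<omega>)\<bar>) ` {..K})" for \<omega>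
    unfolding UN by (intro arg_cong[where f=Max] image_cong refl) (simp add: Xe)
  have "integrable S (\<lambda>\<omega>. (Max ((\<lambda>k. Max ((\<lambda>j. \<bar>X j k \<omega>\<bar>) ` UNIV)) ` {..K}))\<^sup>2)" by (rule d(1)) auto
  then show "integrable S (\<lambda>\<omega>. (Max ((\<lambda>k. \<bar>\<Sum>i=m..<m+N. F (Gam (Suc i) \<omega>) (mk i \<omega>) * \<eta> k (tm i \<omega>)\<bar>) ` {..K}))\<^sup>2)"
    unfolding Me .
  have mean: "(\<integral>s. Y i K (fun_upd \<omega> i s) \<partial>noise_law L T) = 0" for i \<omega>
    by (rule integral_noise_zero) (simp add: Y_def a_def Gam_Suc_upd \<eta>'0)
  have dep: "Y i K \<omega> = Y i K \<omega>'" if "\<And>j. j \<le> i \<Longrightarrow> \<omega> j = \<omega>' j" for i \<omega> \<omega>'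
    using that[of i] Gam_cong[of "Suc i" \<omega> \<omega>'] that by (simp add: Y_def a_def)
  have "(\<integral>\<omega>. (Max ((\<lambda>k. Max ((\<lambda>j. \<bar>X j k \<omega>\<bar>) ` UNIV)) ` {..K}))\<^sup>2 \<partial>S) \<le> 4 * (\<integral>\<omega>. (Max ((\<lambda>j. \<bar>X j K \<omega>\<bar>) ` UNIV))\<^sup>2 \<partial>S)"
    by (rule d(2)) auto
  also have "(\<integral>\<omega>. (Max ((\<lambda>j. \<bar>X j K \<omega>\<bar>) ` UNIV))\<^sup>2 \<partial>S) = (\<integral>\<omega>. (\<Sum>i=m..<m+N. Y i K \<omega>)\<^sup>2 \<partial>S)"
    unfolding UN by (simp add: X_def)
  also have "\<dots> = (\<Sum>i=m..<m+N. \<integral>\<omega>. (Y i K \<omega>)\<^sup>2 \<partial>S)"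
    by (rule orthogonal_sum_square[OF Ym Ysq dep mean])
  also have "\<dots> \<le> (\<Sum>i=m..<m+N. \<integral>\<omega>. (J i \<omega>)\<^sup>2 \<partial>S)"
    using YJ J_bounds by (intro sum_mono integral_mono Ysq J_square_integrable) (simp add: abs_le_square_iff[symmetric])
  finally show "(\<integral>\<omega>. (Max ((\<lambda>k. \<bar>\<Sum>i=m..<m+N. F (Gam (Suc i) \<omega>) (mk i \<omega>) * \<eta> k (tm i \<omega>)\<bar>) ` {..K}))\<^sup>2 \<partial>S)
      \<le> 4 * (\<Sum>i=m..<m+N. \<integral>\<omega>. (J i \<omega>)\<^sup>2 \<partial>S)"
    unfolding Me by simp
qed

text \<open>The part of a jump that averages to 0 over its uniform time; what remains of the jump is
  the factor \<open>cl t / T\<close>.\<close>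

definition thin :: "(real \<Rightarrow> 'a \<Rightarrow> real) \<Rightarrow> nat \<Rightarrow> real \<Rightarrow> (nat \<Rightarrow> real \<times> 'a \<times> real) \<Rightarrow> real" where
  "thin F i t \<omega> = F (Gam (Suc i) \<omega>) (mk i \<omega>) * ((if tm i \<omega> \<le> cl t then 1 else 0) - cl t / T)"

text \<open>Common to both halves of \<open>[0, T]\<close>. By \<open>fac\<close> and
  \<open>c1\<close> the bridge is a factor of modulus at most 1 times a martingale \<eta> along the
  grid. Doob's inequality enters twice: over the grid for a fixed number of terms
  (\<open>grid_maximal\<close>), then over the number of terms
  (\<open>AE_martingale_Cauchy\<close>).\<close>

lemma AE_thin_grid:
  fixes F :: "real \<Rightarrow> 'a \<Rightarrow> real" and tt :: "nat \<Rightarrow> nat \<Rightarrow> real"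
  assumes F: "(\<lambda>(x, v). F x v) \<in> borel_measurable (borel \<Otimes>\<^sub>M borel)"
    and bd: "\<And>x v. \<bar>F x v\<bar> \<le> min 1 (norm (H x v))"
    and tt: "\<And>K k. k \<le> 2 ^ K \<Longrightarrow> 0 \<le> tt K k \<and> tt K k \<le> T"
    and inc: "incseq (\<lambda>K. tt K ` {..2 ^ K})"
    and \<eta>: "\<And>K k. \<eta> K k \<in> borel_measurable borel" "\<And>K k u. k \<le> 2 ^ K \<Longrightarrow> \<bar>\<eta> K k u\<bar> \<le> 1"
    and A1: "\<And>K k l u u'. k < 2 ^ K \<Longrightarrow> l \<le> k \<Longrightarrow> u \<in> Al K k \<Longrightarrow> u' \<in> Al K k \<Longrightarrow> \<eta> K l u = \<eta> K l u'"
    and A2: "\<And>K k u. k < 2 ^ K \<Longrightarrow> u \<notin> Al K k \<Longrightarrow> \<eta> K (Suc k) u = \<eta> K k u"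
    and A3: "\<And>K k. k \<le> 2 ^ K \<Longrightarrow> (\<integral>u. \<eta> K k u \<partial>unif) = 0"
    and fac: "\<And>K k u. k \<le> 2 ^ K \<Longrightarrow> (if u \<le> tt K k then 1 else 0) - tt K k / T = c K k * \<eta> K k u"
    and c1: "\<And>K k. k \<le> 2 ^ K \<Longrightarrow> \<bar>c K k\<bar> \<le> (1::real)"
  shows "AE \<omega> in S. \<forall>e>0. \<exists>m. \<forall>n. \<forall>t\<in>(\<Union>K. tt K ` {..2 ^ K}). \<bar>(\<Sum>i<m+n. thin F i t \<omega>) - (\<Sum>i<m. thin F i t \<omega>)\<bar> < e"
proof -
  have Fm[measurable (raw)]: "(\<lambda>x. F (f x) (k x)) \<in> borel_measurable M"
    if "f \<in> borel_measurable M" "k \<in> borel_measurable M" for f k and M :: "'z measure"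
    using measurable_compose[OF measurable_Pair[OF that] F] by simp
  let ?v = "\<lambda>i. \<integral>\<omega>. (J i \<omega>)\<^sup>2 \<partial>S"
  have thin_m[measurable]: "thin F i t \<in> borel_measurable S" for i t unfolding thin_def by measurable
  have thJ: "\<bar>thin F i t \<omega>\<bar> \<le> J i \<omega>" for i t \<omega>
  proof -
    have "\<bar>(if tm i \<omega> \<le> cl t then 1 else 0) - cl t / T\<bar> \<le> 1"
    proof -
      have "0 \<le> cl t / T" "cl t / T \<le> 1" using cl_bounds[of t] T by simp_all
      then show ?thesis by (auto simp: abs_le_iff)
    qed
    then show ?thesis
      using mult_mono[OF bd[of "Gam (Suc i) \<omega>" "mk i \<omega>"], of _ 1] by (simp add: thin_def J_def abs_mult)
  qed
  show ?thesis
  proof (rule AE_martingale_Cauchy[OF inc _ _ thin_m, where \<epsilon>="\<lambda>m. 4 * (\<Sum>i. ?v (i + m))"])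
    show "integrable S (\<lambda>\<omega>. (thin F i t \<omega>)\<^sup>2)" for i t
      by (rule integrable_square_bound[OF thin_m J_square_integrable[of i]]) (use thJ J_bounds in auto)
    show "thin F i t \<omega> = thin F i t \<omega>'" if "\<And>j. j \<le> i \<Longrightarrow> \<omega> j = \<omega>' j" for i t \<omega> \<omega>'
      using that[of i] Gam_cong[of "Suc i" \<omega> \<omega>'] that by (simp add: thin_def)
    show "(\<integral>s. thin F i t (fun_upd \<omega> i s) \<partial>noise_law L T) = 0" for i t \<omega>
    proof (rule integral_noise_zero)
      fix e v
      have "(\<integral>u. (if u \<le> cl t then 1 else 0) - cl t / T \<partial>unif) = (\<integral>u. (if u \<le> cl t then 1 else 0) \<partial>unif) - (\<integral>u. cl t / T \<partial>unif)"
        by (intro Bochner_Integration.integral_diff unif_integrable[where C=1] unif_integrable[where C="\<bar>cl t / T\<bar>"]) auto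
      also have "(\<integral>u. cl t / T \<partial>unif) = cl t / T" using U.prob_space by (simp del: measure_uniform_measure)
      finally have "(\<integral>u. (if u \<le> cl t then 1 else 0) - cl t / T \<partial>unif) = 0" using unif_le[OF cl_bounds] by simp
      then show "(\<integral>u. thin F i t (fun_upd \<omega> i (e, v, u)) \<partial>unif) = 0"
        by (simp add: thin_def Gam_Suc_upd)
    qed
    have "(\<lambda>m. \<Sum>i. ?v (i + m)) \<longlonglongrightarrow> 0" by (rule suminf_exist_split2[OF summable_J_square])
    from tendsto_mult_right_zero[OF this] show "(\<lambda>m. 4 * (\<Sum>i. ?v (i + m))) \<longlonglongrightarrow> 0" by simp
    fix m N K
    let ?M = "\<lambda>\<omega>. Max ((\<lambda>k. \<bar>\<Sum>i=m..<m+N. F (Gam (Suc i) \<omega>) (mk i \<omega>) * \<eta> K k (tm i \<omega>)\<bar>) ` {..2 ^ K})"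
    let ?W = "\<lambda>\<omega>. Max ((\<lambda>t. \<bar>\<Sum>i=m..<m+N. thin F i t \<omega>\<bar>) ` tt K ` {..2 ^ K})"
    note gm = grid_maximal[of F "\<eta> K" "2 ^ K" "Al K" m N, OF F bd \<eta>(1) \<eta>(2) A1 A2 A3]
    have le: "?W \<omega> \<le> ?M \<omega>" for \<omega>
    proof (rule Max.boundedI)
      fix x assume "x \<in> (\<lambda>t. \<bar>\<Sum>i=m..<m+N. thin F i t \<omega>\<bar>) ` tt K ` {..2 ^ K}"
      then obtain k where k: "k \<le> 2 ^ K" "x = \<bar>\<Sum>i=m..<m+N. thin F i (tt K k) \<omega>\<bar>" by auto
      have "(\<Sum>i=m..<m+N. thin F i (tt K k) \<omega>) = c K k * (\<Sum>i=m..<m+N. F (Gam (Suc i) \<omega>) (mk i \<omega>) * \<eta> K k (tm i \<omega>))"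
        unfolding thin_def sum_distrib_left using tt[OF k(1)]
        by (intro sum.cong refl) (simp add: cl_eq fac[OF k(1)])
      then have "x \<le> 1 * \<bar>\<Sum>i=m..<m+N. F (Gam (Suc i) \<omega>) (mk i \<omega>) * \<eta> K k (tm i \<omega>)\<bar>"
        unfolding k(2) abs_mult[symmetric] using c1[OF k(1)] by (simp only: abs_mult) (intro mult_right_mono, auto)
      also have "\<dots> \<le> ?M \<omega>" using k(1) by (auto intro!: Max_ge)
      finally show "x \<le> ?M \<omega>" .
    qed auto
    have W0: "0 \<le> ?W \<omega>" for \<omega>
      by (rule order_trans[OF abs_ge_zero Max_ge[of _ "\<bar>\<Sum>i=m..<m+N. thin F i (tt K 0) \<omega>\<bar>"]]) auto
    have Wm: "?W \<in> borel_measurable S" by (intro borel_measurable_Max) auto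
    have "(\<integral>\<omega>. (?W \<omega>)\<^sup>2 \<partial>S) \<le> (\<integral>\<omega>. (?M \<omega>)\<^sup>2 \<partial>S)"
    proof (rule integral_mono[OF _ gm(1)])
      show "integrable S (\<lambda>\<omega>. (?W \<omega>)\<^sup>2)"
      proof (rule integrable_square_bound[OF Wm gm(1)])
        show "\<bar>?W \<omega>\<bar> \<le> \<bar>?M \<omega>\<bar>" for \<omega> using le[of \<omega>] W0[of \<omega>] by linarith
      qed
      show "(?W \<omega>)\<^sup>2 \<le> (?M \<omega>)\<^sup>2" for \<omega> using le W0 by (rule power_mono)
    qed
    also have "\<dots> \<le> 4 * (\<Sum>i=m..<m+N. ?v i)" by (rule gm(2))
    also have "(\<Sum>i=m..<m+N. ?v i) = (\<Sum>i<N. ?v (i + m))"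
      using sum.shift_bounds_nat_ivl[of ?v 0 m N] by (simp add: lessThan_atLeast0 add.commute)
    also have "\<dots> \<le> (\<Sum>i. ?v (i + m))"
      using summable_J_square by (intro sum_le_suminf summable_ignore_initial_segment) auto
    finally show "(\<integral>\<omega>. (?W \<omega>)\<^sup>2 \<partial>S) \<le> 4 * (\<Sum>i. ?v (i + m))" by simp
  qed auto
qed

text \<open>Time runs forward: \<eta> is -1 once the grid has passed \<open>u\<close>, and before
  that it depends only on the grid point. As \<open>1 - t / T \<ge> 1 / 2\<close> here, \<eta> stays
  between -1 and 1.\<close>

lemma AE_thin_first_half:
  fixes F :: "real \<Rightarrow> 'a \<Rightarrow> real"
  assumes F: "(\<lambda>(x, v). F x v) \<in> borel_measurable (borel \<Otimes>\<^sub>M borel)"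
    and bd: "\<And>x v. \<bar>F x v\<bar> \<le> min 1 (norm (H x v))"
  shows "AE \<omega> in S. \<forall>e>0. \<exists>m. \<forall>n. \<forall>t\<in>(\<Union>K. (\<lambda>k. T / 2 * (real k / 2 ^ K)) ` {..2 ^ K}).
    \<bar>(\<Sum>i<m+n. thin F i t \<omega>) - (\<Sum>i<m. thin F i t \<omega>)\<bar> < e"
proof -
  define tt where "tt K k = T / 2 * (real k / 2 ^ K)" for K k :: nat
  define \<eta> where "\<eta> K k u = (if tt K k < u then 1 / (1 - tt K k / T) else 0) - 1" for K k u
  have r: "real k / 2 ^ K \<le> 1" if "k \<le> 2 ^ K" for k K :: nat
    using that by (rule pow2_frac_le)
  have tt0: "0 \<le> tt K k" for K k using T by (simp add: tt_def)
  have tt1: "tt K k / T \<le> 1 / 2" if "k \<le> 2 ^ K" for K k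
    using r[OF that] T by (simp add: tt_def)
  have tt2: "tt K k \<le> T" if "k \<le> 2 ^ K" for K k
    using tt1[OF that] T by (simp add: divide_le_eq)
  have mono: "tt K l \<le> tt K k" if "l \<le> k" for K l k
    unfolding tt_def using T that by (intro mult_left_mono divide_right_mono) auto
  have "AE \<omega> in S. \<forall>e>0. \<exists>m. \<forall>n. \<forall>t\<in>(\<Union>K. tt K ` {..2 ^ K}). \<bar>(\<Sum>i<m+n. thin F i t \<omega>) - (\<Sum>i<m. thin F i t \<omega>)\<bar> < e"
  proof (rule AE_thin_grid[OF F bd, where \<eta>=\<eta> and Al="\<lambda>K k. {tt K k<..}" and c="\<lambda>K k. - (1 - tt K k / T)"])
    show "incseq (\<lambda>K. tt K ` {..2 ^ K})"
    proof (rule incseq_SucI, safe)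
      fix K k :: nat assume "k \<le> 2 ^ K"
      then show "tt K k \<in> tt (Suc K) ` {..2 ^ Suc K}"
        by (intro image_eqI[of _ _ "2 * k"]) (simp_all add: tt_def)
    qed
    show "\<eta> K k \<in> borel_measurable borel" for K k unfolding \<eta>_def by measurable
    show "\<bar>\<eta> K k u\<bar> \<le> 1" if "k \<le> 2 ^ K" for K k u
    proof -
      have "1 - tt K k / T \<ge> 1 / 2" "1 - tt K k / T \<le> 1" using tt1[OF that] tt0[of K k] T by auto
      then have "1 / (1 - tt K k / T) \<le> 2" "1 / (1 - tt K k / T) \<ge> 1" by (auto simp: divide_le_eq le_divide_eq)
      then show ?thesis by (simp add: \<eta>_def)
    qed
    show "\<eta> K l u = \<eta> K l u'" if "l \<le> k" "u \<in> {tt K k<..}" "u' \<in> {tt K k<..}" for K k l u u'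
      using mono[OF that(1), of K] that by (simp add: \<eta>_def)
    show "\<eta> K (Suc k) u = \<eta> K k u" if "u \<notin> {tt K k<..}" for K k u
      using mono[of k "Suc k" K] that by (simp add: \<eta>_def)
    show "(\<integral>u. \<eta> K k u \<partial>unif) = 0" if "k \<le> 2 ^ K" for K k
    proof -
      let ?a = "1 / (1 - tt K k / T)"
      have i1: "integrable unif (\<lambda>u. if tt K k < u then 1 else 0 :: real)" and ic: "integrable unif (\<lambda>u. 1 :: real)"
        by (rule unif_integrable[of _ 1]; simp)+
      have "(\<integral>u. \<eta> K k u \<partial>unif) = (\<integral>u. ?a * (if tt K k < u then 1 else 0) - 1 \<partial>unif)"
        unfolding \<eta>_def by (intro Bochner_Integration.integral_cong) auto
      also have "\<dots> = ?a * (\<integral>u. (if tt K k < u then 1 else 0) \<partial>unif) - (\<integral>u. 1 \<partial>unif)"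
        by (subst Bochner_Integration.integral_diff[OF integrable_mult_right[OF i1] ic])
          (simp only: integral_mult_right_zero)
      also have "(\<integral>u. 1 \<partial>unif) = (1::real)" using U.prob_space by (simp del: measure_uniform_measure)
      also have "?a * (\<integral>u. (if tt K k < u then 1 else 0) \<partial>unif) = 1"
      proof -
        have "1 - tt K k / T \<noteq> 0" using tt1[OF that] by linarith
        then have "?a * (1 - tt K k / T) = 1" by (rule nonzero_eq_divide_eq[THEN iffD1, OF _ refl])
        then show ?thesis unfolding unif_gt[OF tt0 tt2[OF that]] .
      qed
      finally show ?thesis by simp
    qed
    show "(if u \<le> tt K k then 1 else 0) - tt K k / T = - (1 - tt K k / T) * \<eta> K k u" if "k \<le> 2 ^ K" for K k u
    proof -
      have gen: "- x * (1 / x - 1) = x - 1" if "x \<noteq> 0" for x :: real using that by (simp add: right_diff_distrib)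
      have "1 - tt K k / T \<noteq> 0" using tt1[OF that] by linarith
      from gen[OF this] show ?thesis by (cases "u \<le> tt K k") (simp_all only: \<eta>_def, simp_all)
    qed
    show "\<bar>- (1 - tt K k / T)\<bar> \<le> 1" if "k \<le> 2 ^ K" for K k
      using tt1[OF that] tt0[of K k] T by (auto simp: abs_le_iff)
  qed (use tt0 tt2 in auto)
  then show ?thesis by (simp add: tt_def)
qed

text \<open>Time runs backward from \<open>T\<close>: the undecided \<open>u\<close> are those below
  the grid point, \<eta> is -1 once the grid has passed below \<open>u\<close>, and the divisor is
  \<open>t / T \<ge> 1 / 2\<close>.\<close>

lemma AE_thin_second_half:
  fixes F :: "real \<Rightarrow> 'a \<Rightarrow> real"
  assumes F: "(\<lambda>(x, v). F x v) \<in> borel_measurable (borel \<Otimes>\<^sub>M borel)"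
    and bd: "\<And>x v. \<bar>F x v\<bar> \<le> min 1 (norm (H x v))"
  shows "AE \<omega> in S. \<forall>e>0. \<exists>m. \<forall>n. \<forall>t\<in>(\<Union>K. (\<lambda>k. T - T / 2 * (real k / 2 ^ K)) ` {..2 ^ K}).
    \<bar>(\<Sum>i<m+n. thin F i t \<omega>) - (\<Sum>i<m. thin F i t \<omega>)\<bar> < e"
proof -
  define tt where "tt K k = T - T / 2 * (real k / 2 ^ K)" for K k :: nat
  define \<eta> where "\<eta> K k u = (if u \<le> tt K k then 1 / (tt K k / T) else 0) - 1" for K k u
  have r: "real k / 2 ^ K \<le> 1" if "k \<le> 2 ^ K" for k K :: nat
    using that by (rule pow2_frac_le)
  have tt2: "tt K k \<le> T" for K k using T by (simp add: tt_def)
  have tt1: "1 / 2 \<le> tt K k / T" if "k \<le> 2 ^ K" for K k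
    using r[OF that] T by (simp add: tt_def diff_divide_distrib)
  have tt3: "tt K k / T \<le> 1" for K k using tt2[of K k] T by simp
  have tt0: "0 \<le> tt K k" if "k \<le> 2 ^ K" for K k
    using tt1[OF that] T by (simp add: le_divide_eq)
  have mono: "tt K k \<le> tt K l" if "l \<le> k" for K l k
    unfolding tt_def using T that by (intro diff_left_mono mult_left_mono divide_right_mono) auto
  have "AE \<omega> in S. \<forall>e>0. \<exists>m. \<forall>n. \<forall>t\<in>(\<Union>K. tt K ` {..2 ^ K}). \<bar>(\<Sum>i<m+n. thin F i t \<omega>) - (\<Sum>i<m. thin F i t \<omega>)\<bar> < e"
  proof (rule AE_thin_grid[OF F bd, where \<eta>=\<eta> and Al="\<lambda>K k. {..tt K k}" and c="\<lambda>K k. tt K k / T"])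
    show "incseq (\<lambda>K. tt K ` {..2 ^ K})"
    proof (rule incseq_SucI, safe)
      fix K k :: nat assume "k \<le> 2 ^ K"
      then show "tt K k \<in> tt (Suc K) ` {..2 ^ Suc K}"
        by (intro image_eqI[of _ _ "2 * k"]) (simp_all add: tt_def)
    qed
    show "\<eta> K k \<in> borel_measurable borel" for K k unfolding \<eta>_def by measurable
    show "\<bar>\<eta> K k u\<bar> \<le> 1" if "k \<le> 2 ^ K" for K k u
    proof -
      have "1 / (tt K k / T) \<le> 2" "1 / (tt K k / T) \<ge> 1"
        using inverse_bounds_half[OF tt1[OF that] tt3[of K]] by simp_all
      then show ?thesis by (simp add: \<eta>_def)
    qed
    show "\<eta> K l u = \<eta> K l u'" if "l \<le> k" "u \<in> {..tt K k}" "u' \<in> {..tt K k}" for K k l u u'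
      using mono[OF that(1), of K] that by (simp add: \<eta>_def)
    show "\<eta> K (Suc k) u = \<eta> K k u" if "u \<notin> {..tt K k}" for K k u
      using mono[of k "Suc k" K] that by (simp add: \<eta>_def)
    show "(\<integral>u. \<eta> K k u \<partial>unif) = 0" if "k \<le> 2 ^ K" for K k
    proof -
      let ?a = "1 / (tt K k / T)"
      have i1: "integrable unif (\<lambda>u. if u \<le> tt K k then 1 else 0 :: real)" and ic: "integrable unif (\<lambda>u. 1 :: real)"
        by (rule unif_integrable[of _ 1]; simp)+
      have "(\<integral>u. \<eta> K k u \<partial>unif) = (\<integral>u. ?a * (if u \<le> tt K k then 1 else 0) - 1 \<partial>unif)"
        unfolding \<eta>_def by (intro Bochner_Integration.integral_cong) auto
      also have "\<dots> = ?a * (\<integral>u. (if u \<le> tt K k then 1 else 0) \<partial>unif) - (\<integral>u. 1 \<partial>unif)"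
        by (subst Bochner_Integration.integral_diff[OF integrable_mult_right[OF i1] ic])
          (simp only: integral_mult_right_zero)
      also have "(\<integral>u. 1 \<partial>unif) = (1::real)" using U.prob_space by (simp del: measure_uniform_measure)
      also have "?a * (\<integral>u. (if u \<le> tt K k then 1 else 0) \<partial>unif) = 1"
        using unif_le[OF tt0[OF that] tt2] tt1[OF that] by auto
      finally show ?thesis by simp
    qed
    show "(if u \<le> tt K k then 1 else 0) - tt K k / T = tt K k / T * \<eta> K k u" if "k \<le> 2 ^ K" for K k u
      using tt1[OF that] T by (auto simp: \<eta>_def right_diff_distrib)
    show "\<bar>tt K k / T\<bar> \<le> 1" if "k \<le> 2 ^ K" for K k
      using tt1[OF that] tt3[of K k] by (auto simp: abs_le_iff)
  qed (use tt0 tt2 in auto)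
  then show ?thesis by (simp add: tt_def)
qed

section \<open>From the grid to all times\<close>

lemma dense_grid:
  assumes t: "0 \<le> t" "t < T / 2" "t < b"
  shows "\<exists>q\<in>(\<Union>K. (\<lambda>k. T / 2 * (real k / 2 ^ K)) ` {..2 ^ K}). t < q \<and> q < b"
proof -
  \<comment> \<open>The mesh \<open>(T / 2) / 2 ^ K\<close> is made smaller than
    \<open>b - t\<close>; then the first grid point to the right of \<open>t\<close>, with index
    \<open>k\<close> below, is less than \<open>b\<close>.\<close>
  obtain K where K: "(T / 2) / (b - t) < 2 ^ K" using real_arch_pow[of 2 "(T / 2) / (b - t)"] by auto
  define k where "k = Suc (nat \<lfloor>t * 2 ^ K / (T / 2)\<rfloor>)"
  have "0 \<le> t * 2 ^ K / (T / 2)" using t T by simp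
  then have "real (nat \<lfloor>t * 2 ^ K / (T / 2)\<rfloor>) = of_int \<lfloor>t * 2 ^ K / (T / 2)\<rfloor>" by simp
  then have fl: "real (nat \<lfloor>t * 2 ^ K / (T / 2)\<rfloor>) \<le> t * 2 ^ K / (T / 2)" and fu: "t * 2 ^ K / (T / 2) < real k"
    unfolding k_def of_nat_Suc using floor_correct[of "t * 2 ^ K / (T / 2)"] by linarith+
  have "t * 2 ^ K / (T / 2) < 2 ^ K" using t T by (simp add: divide_less_eq)
  then have "real (nat \<lfloor>t * 2 ^ K / (T / 2)\<rfloor>) < 2 ^ K" using fl by linarith
  then have "real (nat \<lfloor>t * 2 ^ K / (T / 2)\<rfloor>) < real (2 ^ K)" by simp
  then have k: "k \<le> 2 ^ K" unfolding k_def by (simp only: of_nat_less_iff Suc_le_eq)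
  have 1: "t < T / 2 * (real k / 2 ^ K)"
    using fu T by (simp add: divide_less_eq less_divide_eq mult.commute mult.left_commute)
  have "T / 2 * (real k / 2 ^ K) \<le> T / 2 * ((t * 2 ^ K / (T / 2) + 1) / 2 ^ K)"
    using fl T unfolding k_def by (intro mult_left_mono divide_right_mono) auto
  also have "\<dots> = t + (T / 2) / 2 ^ K" using T by (simp add: add_divide_distrib distrib_left)
  also have "(T / 2) / 2 ^ K < b - t"
  proof -
    have "T / 2 < 2 ^ K * (b - t)" using K t(3) by (subst (asm) pos_divide_less_eq) auto
    then show ?thesis by (subst pos_divide_less_eq) (auto simp: mult.commute)
  qed
  finally show ?thesis using 1 k by (intro bexI[of _ "T / 2 * (real k / 2 ^ K)"]) auto
qed

lemma cadlag_step: "cadlag_on UNIV (\<lambda>t. if u \<le> cl t then (c::'v::real_normed_vector) else 0)"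
  unfolding cadlag_on_def
proof safe
  fix t
  have lim: "(cl \<longlongrightarrow> cl t) (at t within A)" for A
    using cl_cont[of t] unfolding isCont_def by (rule tendsto_within_subset) simp
  show "((\<lambda>t. if u \<le> cl t then c else 0) \<longlongrightarrow> (if u \<le> cl t then c else 0)) (at t within UNIV \<inter> {t<..})"
  proof (rule tendsto_eventually, cases "u \<le> cl t")
    case True
    then have "u \<le> cl s" if "t < s" for s using cl_mono[of t s] that by linarith
    then show "eventually (\<lambda>s. (if u \<le> cl s then c else 0) = (if u \<le> cl t then c else 0)) (at t within UNIV \<inter> {t<..})"
      using True by (auto simp: eventually_at_filter)
  next
    case False
    then have "eventually (\<lambda>s. cl s < u) (at t within UNIV \<inter> {t<..})" by (intro order_tendstoD(2)[OF lim]) simp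
    then show "eventually (\<lambda>s. (if u \<le> cl s then c else 0) = (if u \<le> cl t then c else 0)) (at t within UNIV \<inter> {t<..})"
      by (rule eventually_mono) (use False in auto)
  qed
  show "\<exists>l. ((\<lambda>t. if u \<le> cl t then c else 0) \<longlongrightarrow> l) (at t within UNIV \<inter> {..<t})"
  proof (cases "\<exists>s<t. u \<le> cl s")
    case True
    then obtain s where s: "s < t" "u \<le> cl s" by blast
    have "eventually (\<lambda>r. s < r) (at t within UNIV \<inter> {..<t})"
      by (rule order_tendstoD(1)[OF tendsto_ident_at s(1)])
    then have "eventually (\<lambda>r. (if u \<le> cl r then c else 0) = c) (at t within UNIV \<inter> {..<t})"
      by eventually_elim (use s cl_mono in \<open>auto intro: order_trans less_imp_le\<close>)
    then show ?thesis by (intro exI[of _ c] tendsto_eventually)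
  next
    case False
    then have "eventually (\<lambda>r. (if u \<le> cl r then c else 0) = 0) (at t within UNIV \<inter> {..<t})"
      by (auto simp: eventually_at_filter)
    then show ?thesis by (intro exI[of _ 0] tendsto_eventually)
  qed
qed

lemma cadlag_isCont: "(\<And>t. isCont f t) \<Longrightarrow> cadlag_on UNIV f" for f :: "real \<Rightarrow> 'v::real_normed_vector"
  unfolding cadlag_on_def isCont_def by (auto intro!: exI intro: tendsto_within_subset)

lemma cadlag_diff:
  fixes f k :: "real \<Rightarrow> 'v::real_normed_vector"
  assumes "cadlag_on UNIV f" "cadlag_on UNIV k" shows "cadlag_on UNIV (\<lambda>t. f t - k t)"
  unfolding cadlag_on_def
proof safe
  fix t
  have "\<exists>l. (f \<longlongrightarrow> l) (at_left t)" "\<exists>l. (k \<longlongrightarrow> l) (at_left t)"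
    using assms by (simp_all add: cadlag_on_def)
  then obtain l1 l2 where "(f \<longlongrightarrow> l1) (at_left t)" "(k \<longlongrightarrow> l2) (at_left t)" by blast
  from tendsto_diff[OF this] show "\<exists>l. ((\<lambda>t. f t - k t) \<longlongrightarrow> l) (at t within UNIV \<inter> {..<t})" by auto
  show "((\<lambda>t. f t - k t) \<longlongrightarrow> f t - k t) (at t within UNIV \<inter> {t<..})"
    using assms by (intro tendsto_diff) (auto simp: cadlag_on_def)
qed

lemma cadlag_thin: "cadlag_on UNIV (\<lambda>t. thin F i t \<omega>)"
proof -
  have "thin F i t \<omega> = (if tm i \<omega> \<le> cl t then F (Gam (Suc i) \<omega>) (mk i \<omega>) else 0) - F (Gam (Suc i) \<omega>) (mk i \<omega>) * (cl t / T)" for t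
    by (simp add: thin_def right_diff_distrib)
  then show ?thesis
    using T by (simp only:) (intro cadlag_diff cadlag_step cadlag_isCont continuous_intros cl_cont, auto)
qed

text \<open>A violation at some \<open>t < T\<close> would persist on an interval to the right of
  \<open>t\<close>, by right continuity, and hence occur at a grid point. The time \<open>T\<close>
  itself belongs to the second grid, as its point of index 0.\<close>

lemma AE_thin_Cauchy:
  fixes F :: "real \<Rightarrow> 'a \<Rightarrow> real"
  assumes F: "(\<lambda>(x, v). F x v) \<in> borel_measurable (borel \<Otimes>\<^sub>M borel)"
    and bd: "\<And>x v. \<bar>F x v\<bar> \<le> min 1 (norm (H x v))"
  shows "AE \<omega> in S. \<forall>e>0. \<exists>m. \<forall>n\<ge>m. \<forall>t. \<bar>(\<Sum>i<n. thin F i t \<omega>) - (\<Sum>i<m. thin F i t \<omega>)\<bar> \<le> e"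
  using AE_thin_first_half[OF F bd] AE_thin_second_half[OF F bd]
proof eventually_elim
  case (elim \<omega>)
  let ?Q1 = "\<Union>K. (\<lambda>k. T / 2 * (real k / 2 ^ K)) ` {..2 ^ K}" and ?Q2 = "\<Union>K. (\<lambda>k. T - T / 2 * (real k / 2 ^ K)) ` {..2 ^ K}"
  let ?W = "\<lambda>n t. \<Sum>i<n. thin F i t \<omega>"
  show ?case
  proof (intro allI impI)
    fix e :: real assume e: "e > 0"
    obtain m1 where m1: "\<And>n t. t \<in> ?Q1 \<Longrightarrow> \<bar>?W (m1 + n) t - ?W m1 t\<bar> < e / 2"
      using elim(1)[rule_format, of "e / 2"] e by auto
    obtain m2 where m2: "\<And>n t. t \<in> ?Q2 \<Longrightarrow> \<bar>?W (m2 + n) t - ?W m2 t\<bar> < e / 2"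
      using elim(2)[rule_format, of "e / 2"] e by auto
    define m where "m = max m1 m2"
    have Q: "\<bar>?W n t - ?W m t\<bar> \<le> e" if t: "t \<in> ?Q1 \<union> ?Q2" and n: "n \<ge> m" for n t
    proof -
      have key: "\<bar>?W n t - ?W m t\<bar> \<le> e" if "\<And>n. \<bar>?W (m' + n) t - ?W m' t\<bar> < e / 2" "m' \<le> m" for m'
      proof -
        have "\<bar>?W n t - ?W m' t\<bar> < e / 2" "\<bar>?W m t - ?W m' t\<bar> < e / 2"
          using that(1)[of "n - m'"] that(1)[of "m - m'"] that(2) n by simp_all
        then show ?thesis by linarith
      qed
      show ?thesis
      proof (cases "t \<in> ?Q1")
        case True
        show ?thesis by (rule key[of m1, OF m1[OF True]]) (simp add: m_def)
      next
        case False
        then have t2: "t \<in> ?Q2" using t by blast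
        show ?thesis by (rule key[of m2, OF m2[OF t2]]) (simp add: m_def)
      qed
    qed
    have "\<bar>?W n t - ?W m t\<bar> \<le> e" if t: "0 \<le> t" "t < T" and n: "n \<ge> m" for n t
    proof (rule ccontr)
      assume c: "\<not> \<bar>?W n t - ?W m t\<bar> \<le> e"
      have "cadlag_on UNIV (\<lambda>t. ?W n t - ?W m t)"
        by (intro cadlag_diff cadlag_on_sum cadlag_thin)
      then have "((\<lambda>t. ?W n t - ?W m t) \<longlongrightarrow> ?W n t - ?W m t) (at_right t)" by (auto simp: cadlag_on_def)
      then have "((\<lambda>t. \<bar>?W n t - ?W m t\<bar>) \<longlongrightarrow> \<bar>?W n t - ?W m t\<bar>) (at_right t)" by (rule tendsto_rabs)
      from order_tendstoD(1)[OF this, of e] c have "eventually (\<lambda>t. e < \<bar>?W n t - ?W m t\<bar>) (at_right t)" by simp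
      then obtain b where b: "b > t" "\<And>s. t < s \<Longrightarrow> s < b \<Longrightarrow> e < \<bar>?W n s - ?W m s\<bar>"
        unfolding eventually_at_right_field by blast
      have "\<exists>q\<in>?Q1 \<union> ?Q2. t < q \<and> q < b"
      proof (cases "t < T / 2")
        case True
        then show ?thesis using dense_grid[OF t(1) True b(1)] by blast
      next
        case False
        obtain q where q: "q \<in> ?Q1" "t - T / 2 < q" "q < b - T / 2"
        proof -
          have "0 \<le> t - T / 2" "t - T / 2 < T / 2" "t - T / 2 < b - T / 2" using False t b(1) by simp_all
          from dense_grid[OF this] show ?thesis using that by blast
        qed
        then obtain K k where k: "k \<le> 2 ^ K" "q = T / 2 * (real k / 2 ^ K)" by auto
        \<comment> \<open>The second grid is the first one shifted by \<open>T / 2\<close>, numbered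
          backwards.\<close>
        have "q + T / 2 = T - T / 2 * (real (2 ^ K - k) / 2 ^ K)"
          using k by (simp add: of_nat_diff diff_divide_distrib right_diff_distrib)
        then have "q + T / 2 \<in> (\<lambda>k. T - T / 2 * (real k / 2 ^ K)) ` {..2 ^ K}" by (rule image_eqI) simp
        then have "q + T / 2 \<in> ?Q1 \<union> ?Q2" by blast
        moreover have "t < q + T / 2" "q + T / 2 < b" using q by linarith+
        ultimately show ?thesis by blast
      qed
      then obtain q where q: "q \<in> ?Q1 \<union> ?Q2" "t < q" "q < b" by blast
      show False using b(2)[OF q(2,3)] Q[OF q(1) n] by linarith
    qed
    moreover have "\<bar>?W n T - ?W m T\<bar> \<le> e" if "n \<ge> m" for n
    proof (rule Q[OF _ that])
      have "T \<in> (\<lambda>k. T - T / 2 * (real k / 2 ^ 0)) ` {..2 ^ 0}" by (intro image_eqI[of _ _ 0]) auto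
      then show "T \<in> ?Q1 \<union> ?Q2" by blast
    qed
    ultimately have all: "\<bar>?W n t - ?W m t\<bar> \<le> e" if "0 \<le> t" "t \<le> T" "n \<ge> m" for n t
      using that by (cases "t = T") auto
    have tc: "thin F i t \<omega> = thin F i (cl t) \<omega>" for i t by (simp add: thin_def cl_cl)
    show "\<exists>m. \<forall>n\<ge>m. \<forall>t. \<bar>?W n t - ?W m t\<bar> \<le> e"
    proof (intro exI allI impI)
      fix n t assume "n \<ge> m"
      then show "\<bar>?W n t - ?W m t\<bar> \<le> e" using all[OF cl_bounds, of n t] tc by simp
    qed
  qed
qed

text \<open>Comparison of a monotone function with its integral over intervals of length 1/2. The
  argument is halved because the \<open>n\<close>-th arrival is only known to be eventually at least
  \<open>n / 2\<close>, and the weight must control \<open>g\<close> from there on.\<close>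

lemma summable_g_half: "summable (\<lambda>i. (g ((real i + 1) / 2))\<^sup>2)"
proof (rule summable_suminf_not_top)
  define I where "I a b = (\<integral>\<^sup>+x. (if a < x \<and> x \<le> b then ennreal ((g x)\<^sup>2) else 0) \<partial>lborel)" for a b
  have step: "ennreal ((g ((real n + 1) / 2))\<^sup>2) \<le> 2 * I (real n / 2) ((real n + 1) / 2)" for n
  proof -
    let ?c = "ennreal ((g ((real n + 1) / 2))\<^sup>2)"
    have "(\<integral>\<^sup>+x. ?c * indicator {real n / 2<..(real n + 1) / 2} x \<partial>lborel) \<le> I (real n / 2) ((real n + 1) / 2)"
      unfolding I_def
    proof (rule nn_integral_mono)
      fix x
      have "?c \<le> ennreal ((g x)\<^sup>2)" if "real n / 2 < x" "x \<le> (real n + 1) / 2"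
      proof -
        have "0 < x" using that(1) of_nat_0_le_iff[of n, where 'a=real] by linarith
        then show ?thesis using g_anti[of x "(real n + 1) / 2"] that(2) g_nonneg by (intro ennreal_leI power_mono) auto
      qed
      then show "?c * indicator {real n / 2<..(real n + 1) / 2} x \<le> (if real n / 2 < x \<and> x \<le> (real n + 1) / 2 then ennreal ((g x)\<^sup>2) else 0)"
        by (auto simp: indicator_def)
    qed
    also have "(\<integral>\<^sup>+x. ?c * indicator {real n / 2<..(real n + 1) / 2} x \<partial>lborel) = ?c * ennreal (1 / 2)"
      by (simp add: nn_integral_cmult_indicator field_simps)
    finally have "2 * (?c * ennreal (1 / 2)) \<le> 2 * I (real n / 2) ((real n + 1) / 2)" by (intro mult_left_mono) auto
    moreover have "2 * (?c * ennreal (1 / 2)) = ?c"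
    proof -
      have "2 * (?c * ennreal (1 / 2)) = ?c * (ennreal 2 * ennreal (1 / 2))" by (simp add: mult.left_commute)
      also have "ennreal 2 * ennreal (1 / 2) = 1" by (subst ennreal_mult[symmetric]) auto
      finally show ?thesis by simp
    qed
    ultimately show ?thesis by simp
  qed
  have Im: "(\<lambda>x. if a < x \<and> x \<le> b then ennreal ((g x)\<^sup>2) else 0) \<in> borel_measurable lborel" for a b by measurable
  have "(\<Sum>i<n. ennreal ((g ((real i + 1) / 2))\<^sup>2)) \<le> 2 * I 0 (real n / 2)" for n
  proof (induction n)
    case (Suc n)
    have "I 0 (real n / 2) + I (real n / 2) ((real n + 1) / 2) = I 0 ((real n + 1) / 2)"
      unfolding I_def
      by (subst nn_integral_add[symmetric, OF Im Im]) (auto intro!: nn_integral_cong simp: field_simps)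
    then have eq: "2 * I 0 (real n / 2) + 2 * I (real n / 2) ((real n + 1) / 2) = 2 * I 0 (real (Suc n) / 2)"
      by (simp add: distrib_left[symmetric] add.commute)
    show ?case unfolding eq[symmetric] using add_mono[OF Suc step[of n]] by simp
  qed simp
  then have "(\<Sum>i<n. ennreal ((g ((real i + 1) / 2))\<^sup>2)) \<le> 2 * (\<integral>\<^sup>+x. (if 0 < x then ennreal ((g x)\<^sup>2) else 0) \<partial>lborel)" for n
    unfolding I_def by (rule order_trans) (intro mult_left_mono nn_integral_mono, auto)
  then have "(\<Sum>i. ennreal ((g ((real i + 1) / 2))\<^sup>2)) \<le> 2 * (\<integral>\<^sup>+x. (if 0 < x then ennreal ((g x)\<^sup>2) else 0) \<partial>lborel)"
    by (intro suminf_le_const) auto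
  also have "\<dots> < top" using nn_integral_g_square by (simp add: ennreal_mult_less_top)
  finally show "(\<Sum>i. ennreal ((g ((real i + 1) / 2))\<^sup>2)) \<noteq> top" by simp
qed simp

lemma integral_coord:
  fixes f :: "_ \<Rightarrow> real"
  assumes "f \<in> borel_measurable (noise_law L T)" shows "(\<integral>\<omega>. f (\<omega> i) \<partial>S) = (\<integral>s. f s \<partial>noise_law L T)"
  using integral_distr[of "\<lambda>\<omega>. \<omega> i" S "noise_law L T" f] assms S_distr_coord[of i] by simp

text \<open>The difference is an integral of \<open>h\<close> between \<open>n\<close> and
  \<open>Gam n\<close>. Once \<open>Gam n \<ge> n / 2\<close>, it is at most
  \<open>g (n / 2)\<close> times \<open>\<bar>Gam n - n\<bar>\<close>, which tends to 0 by
  Kronecker's lemma. This is why square integrability of \<open>g\<close> suffices.\<close>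

lemma AE_Gam_drift:
  fixes h :: "real \<Rightarrow> 'b::{banach, second_countable_topology}"
  assumes h: "h \<in> borel_measurable borel" and hg: "\<And>x. norm (h x) \<le> g x"
  shows "AE \<omega> in S. (\<lambda>n. ioc_integral h 0 (Gam n \<omega>) - ioc_integral h 0 (real n)) \<longlonglongrightarrow> 0
    \<and> filterlim (\<lambda>n. Gam n \<omega>) at_top sequentially"
proof -
  have h1: "norm (h x) \<le> 1" for x using hg[of x] g_le_1[of x] by linarith
  \<comment> \<open>The first summand is the bound for \<open>h\<close>. The second makes the
    weights positive and turns Kronecker's lemma into the strong law
    \<open>Gam n / n \<longlonglongrightarrow> 1\<close>, which gives \<open>lower\<close> and the
    divergence of the arrivals.\<close>
  define w where "w i = g ((real i + 1) / 2) + 1 / (real i + 1)" for i :: nat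
  have wpos: "w n > 0" for n using g_nonneg by (simp add: w_def add_nonneg_pos)
  have wdec: "w (Suc n) \<le> w n" for n
    unfolding w_def by (intro add_mono g_anti divide_left_mono) auto
  have wsum: "summable (\<lambda>i. (w i)\<^sup>2)"
  proof (rule summable_comparison_test)
    have "summable (\<lambda>i. inverse (real i ^ 2))" by (rule inverse_power_summable) simp
    then have "summable (\<lambda>i. inverse (real (Suc i) ^ 2))" by (rule summable_Suc_iff[THEN iffD2])
    then show "summable (\<lambda>i. 2 * (g ((real i + 1) / 2))\<^sup>2 + 2 * inverse (real (Suc i) ^ 2))"
      by (intro summable_add summable_mult summable_g_half)
    have "(w n)\<^sup>2 \<le> 2 * (g ((real n + 1) / 2))\<^sup>2 + 2 * inverse (real (Suc n) ^ 2)" for n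
    proof -
      have "(a + b)\<^sup>2 \<le> 2 * a\<^sup>2 + 2 * b\<^sup>2" for a b :: real
        using zero_le_power2[of "a - b"] by (simp add: power2_eq_square algebra_simps)
      from this[of "g ((real n + 1) / 2)" "1 / (real n + 1)"] show ?thesis
        by (simp add: w_def power_divide inverse_eq_divide add.commute)
    qed
    then show "\<exists>N. \<forall>n\<ge>N. norm ((w n)\<^sup>2) \<le> 2 * (g ((real n + 1) / 2))\<^sup>2 + 2 * inverse (real (Suc n) ^ 2)" by simp
  qed
  have w0: "w \<longlonglongrightarrow> 0"
  proof -
    have "(\<lambda>n. sqrt ((w n)\<^sup>2)) \<longlonglongrightarrow> sqrt 0" by (intro tendsto_real_sqrt summable_LIMSEQ_zero[OF wsum])
    then show ?thesis using wpos by (simp add: less_imp_le)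
  qed
  define D where "D i \<omega> = w i * (fst (\<omega> i) - 1)" for i and \<omega> :: "nat \<Rightarrow> real \<times> 'a \<times> real"
  have i2: "integrable expo (\<lambda>e. (e - 1)\<^sup>2)"
    unfolding power2_diff using expo_moments by (intro Bochner_Integration.integrable_add Bochner_Integration.integrable_diff) auto
  have Dsq: "(D i \<omega>)\<^sup>2 = (w i)\<^sup>2 * (fst (\<omega> i) - 1)\<^sup>2" for i \<omega> by (simp add: D_def power_mult_distrib)
  have e2: "integrable S (\<lambda>\<omega>. (fst (\<omega> i) - 1)\<^sup>2)" for i
    by (rule integrable_coord[OF noise_fst(1)[OF i2]])
  have "AE \<omega> in S. convergent (\<lambda>n. \<Sum>i<n. D i \<omega>)"
  proof (rule AE_martingale_convergent)
    show "D i \<in> borel_measurable S" for i unfolding D_def by measurable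
    show "integrable S (\<lambda>\<omega>. (D i \<omega>)\<^sup>2)" for i unfolding Dsq by (intro integrable_mult_right e2)
    show "D i \<omega> = D i \<omega>'" if "\<And>j. j \<le> i \<Longrightarrow> \<omega> j = \<omega>' j" for i \<omega> \<omega>' using that[of i] by (simp add: D_def)
    show "(\<integral>s. D i (fun_upd \<omega> i s) \<partial>noise_law L T) = 0" for i \<omega>
      using noise_fst[OF expo_moments(1)] expo_moments(2) R.prob_space by (simp add: D_def)
    have "(\<integral>\<omega>. (D i \<omega>)\<^sup>2 \<partial>S) = (w i)\<^sup>2 * (\<integral>e. (e - 1)\<^sup>2 \<partial>expo)" for i
      unfolding Dsq using integral_coord[of "\<lambda>s. (fst s - 1)\<^sup>2" i] noise_fst[OF i2] e2 by simp
    then show "summable (\<lambda>i. \<integral>\<omega>. (D i \<omega>)\<^sup>2 \<partial>S)" using wsum by (simp add: summable_mult2)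
  qed
  then show ?thesis using AE_exp_pos
  proof eventually_elim
    case (elim \<omega>)
    have pos: "0 < Gam (Suc n) \<omega>" for n using Gam_pos elim(2) by blast
    define d where "d n = Gam (Suc n) \<omega> - (real n + 1)" for n
    have "(\<lambda>n. w n * (\<Sum>i<Suc n. fst (\<omega> i) - 1)) \<longlonglongrightarrow> 0"
      using kronecker_lemma[OF wpos wdec w0, of "\<lambda>i. fst (\<omega> i) - 1"] elim(1) by (simp add: D_def)
    moreover have "(\<Sum>i<Suc n. fst (\<omega> i) - 1) = d n" for n
      by (simp add: sum_subtractf d_def Gam_def)
    ultimately have wd: "(\<lambda>n. w n * d n) \<longlonglongrightarrow> 0" by (simp only:)
    have ev: "eventually (\<lambda>n. \<bar>w n * d n\<bar> < 1 / 2) sequentially"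
      by (rule order_tendstoD(2)[OF tendsto_rabs_zero[OF wd]]) simp
    have lower: "(real n + 1) / 2 \<le> Gam (Suc n) \<omega>" if "\<bar>w n * d n\<bar> < 1 / 2" for n
    proof -
      have wge: "1 / (real n + 1) \<le> w n" using g_nonneg by (auto simp: w_def)
      have "1 / (real n + 1) * \<bar>d n\<bar> \<le> w n * \<bar>d n\<bar>" using wge by (intro mult_right_mono) auto
      also have "\<dots> < 1 / 2" using that wpos[of n] by (simp add: abs_mult)
      finally have dn: "\<bar>d n\<bar> < (real n + 1) / 2" by (simp add: divide_less_eq)
      have "- ((real n + 1) / 2) < d n" using dn by linarith
      then show ?thesis by (simp add: d_def field_simps)
    qed
    have "filterlim (\<lambda>n. (real n + 1) / 2) at_top sequentially" by real_asymp
    then have "filterlim (\<lambda>n. Gam (Suc n) \<omega>) at_top sequentially"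
      by (rule filterlim_at_top_mono) (use ev lower in \<open>auto elim: eventually_mono\<close>)
    then have Ginf: "filterlim (\<lambda>n. Gam n \<omega>) at_top sequentially" by (rule filterlim_sequentially_Suc[THEN iffD1])
    have "(\<lambda>n. ioc_integral h 0 (Gam (Suc n) \<omega>) - ioc_integral h 0 (real (Suc n))) \<longlonglongrightarrow> 0"
    proof (rule Lim_null_comparison)
      show "(\<lambda>n. \<bar>w n * d n\<bar>) \<longlonglongrightarrow> 0" using tendsto_rabs_zero[OF wd] .
      from ev show "eventually (\<lambda>n. norm (ioc_integral h 0 (Gam (Suc n) \<omega>) - ioc_integral h 0 (real (Suc n))) \<le> \<bar>w n * d n\<bar>) sequentially"
      proof eventually_elim
        case (elim n)
        have wge: "g ((real n + 1) / 2) \<le> w n" by (simp add: w_def)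
        have lo: "(real n + 1) / 2 \<le> Gam (Suc n) \<omega>" by (rule lower[OF elim])
        have bnd: "norm (ioc_integral h a b) \<le> g ((real n + 1) / 2) * (b - a)" if "(real n + 1) / 2 \<le> a" "a \<le> b" for a b
        proof (rule ioc_integral_le[OF h h1 _ that(2)])
          fix x assume "a < x" "x \<le> b"
          then show "norm (h x) \<le> g ((real n + 1) / 2)"
            using hg[of x] g_anti[of "(real n + 1) / 2" x] that(1) by simp
        qed
        have "norm (ioc_integral h 0 (Gam (Suc n) \<omega>) - ioc_integral h 0 (real (Suc n))) \<le> g ((real n + 1) / 2) * \<bar>d n\<bar>"
        proof (cases "real n + 1 \<le> Gam (Suc n) \<omega>")
          case True
          have "ioc_integral h 0 (real n + 1) + ioc_integral h (real n + 1) (Gam (Suc n) \<omega>) = ioc_integral h 0 (Gam (Suc n) \<omega>)"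
            by (rule ioc_integral_add[OF h h1]) (use True in auto)
          then have "ioc_integral h 0 (Gam (Suc n) \<omega>) - ioc_integral h 0 (real (Suc n)) = ioc_integral h (real n + 1) (Gam (Suc n) \<omega>)"
            by (simp add: algebra_simps)
          then show ?thesis using bnd[of "real n + 1" "Gam (Suc n) \<omega>"] True by (simp add: d_def)
        next
          case False
          have "ioc_integral h 0 (Gam (Suc n) \<omega>) + ioc_integral h (Gam (Suc n) \<omega>) (real n + 1) = ioc_integral h 0 (real n + 1)"
            by (rule ioc_integral_add[OF h h1]) (use False pos[of n] in auto)
          then have "ioc_integral h 0 (Gam (Suc n) \<omega>) - ioc_integral h 0 (real (Suc n)) = - ioc_integral h (Gam (Suc n) \<omega>) (real n + 1)"
            by (simp add: algebra_simps)
          then show ?thesis using bnd[OF lo, of "real n + 1"] False by (simp add: d_def)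
        qed
        also have "\<dots> \<le> w n * \<bar>d n\<bar>" using wge by (intro mult_right_mono) auto
        also have "\<dots> = \<bar>w n * d n\<bar>" using wpos[of n] by (simp add: abs_mult)
        finally show ?case .
      qed
    qed
    then show ?case using Ginf by (blast intro: LIMSEQ_imp_Suc)
  qed
qed

section \<open>Almost sure uniform convergence of the centred partial sums\<close>

definition H1 :: "real \<Rightarrow> 'a \<Rightarrow> 'a" where "H1 x v = (if norm (H x v) \<le> 1 then H x v else 0)"
definition hv :: "real \<Rightarrow> 'a" where "hv x = (\<integral>v. H1 x v \<partial>L)"

lemma H1_measurable[measurable (raw)]:
  assumes [measurable]: "f \<in> borel_measurable M" "k \<in> borel_measurable M" shows "(\<lambda>x. H1 (f x) (k x)) \<in> borel_measurable M"
  unfolding H1_def by measurable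

lemma norm_H1: "norm (H1 x v) \<le> min 1 (norm (H x v))" by (auto simp: H1_def)

lemma H1_integrable: "integrable L (H1 x)"
proof (rule L.integrable_const_bound[where B=1])
  show "AE v in L. norm (H1 x v) \<le> 1" using norm_H1 by (auto intro: order_trans)
qed simp

lemma hv_measurable[measurable]: "hv \<in> borel_measurable borel"
  unfolding hv_def by measurable

lemma norm_hv: "norm (hv x) \<le> g x"
proof -
  have "norm (hv x) \<le> (\<integral>v. norm (H1 x v) \<partial>L)" unfolding hv_def by (rule integral_norm_bound)
  also have "\<dots> \<le> g x" unfolding g_def using norm_H1 H1_integrable by (intro integral_mono min_H_integrable) auto
  finally show ?thesis .
qed

lemma norm_hv_1: "norm (hv x) \<le> 1" using norm_hv[of x] g_le_1[of x] by linarith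

definition jump :: "nat \<Rightarrow> (nat \<Rightarrow> real \<times> 'a \<times> real) \<Rightarrow> 'a" where
  "jump i \<omega> = H (Gam (Suc i) \<omega>) (mk i \<omega>)"

definition part :: "nat \<Rightarrow> real \<Rightarrow> (nat \<Rightarrow> real \<times> 'a \<times> real) \<Rightarrow> 'a" where
  "part n t \<omega> = (\<Sum>i<n. (if tm i \<omega> \<le> cl t then jump i \<omega> else 0) - (cl t / T) *\<^sub>R ioc_integral hv (real i) (real i + 1))"

lemma sum_ioc_nat: "(\<Sum>i<n. ioc_integral hv (real i) (real i + 1)) = ioc_integral hv 0 (real n)"
proof (induction n)
  case (Suc n)
  then show ?case using ioc_integral_add[OF hv_measurable norm_hv_1, of 0 "real n" "real n + 1"] by (simp add: add.commute)
qed (simp add: ioc_integral_empty)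

lemma sum_ioc_Gam:
  assumes "\<And>i. fst (\<omega> i) > 0"
  shows "(\<Sum>i<n. ioc_integral hv (Gam i \<omega>) (Gam (Suc i) \<omega>)) = ioc_integral hv 0 (Gam n \<omega>)"
proof (induction n)
  case (Suc n)
  then show ?case
    using ioc_integral_add[OF hv_measurable norm_hv_1, of 0 "Gam n \<omega>" "Gam (Suc n) \<omega>"] Gam_mono[OF assms, of 0 n] Gam_mono[OF assms, of n "Suc n"]
    by (simp add: Gam_0)
qed (simp add: ioc_integral_empty Gam_0)

lemma AE_part_coordinate_Cauchy:
  assumes b: "b \<in> Basis"
  shows "AE \<omega> in S. \<forall>e>0. \<exists>m. \<forall>n\<ge>m. \<forall>t. \<bar>(part n t \<omega> - part m t \<omega>) \<bullet> b\<bar> \<le> e"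
proof -
  define F where "F x v = H1 x v \<bullet> b" for x v
  have F: "(\<lambda>(x, v). F x v) \<in> borel_measurable (borel \<Otimes>\<^sub>M borel)" unfolding F_def by measurable
  have bd: "\<bar>F x v\<bar> \<le> min 1 (norm (H x v))" for x v
    using Basis_le_norm[OF b, of "H1 x v"] norm_H1[of x v] by (simp add: F_def)
  have Fb: "(\<integral>v. F x v \<partial>L) = hv x \<bullet> b" for x
    unfolding F_def hv_def using H1_integrable by simp
  have iocb: "ioc_integral (\<lambda>x. hv x \<bullet> b) p q = ioc_integral hv p q \<bullet> b" for p q
  proof -
    have "ioc_integral (\<lambda>x. hv x \<bullet> b) p q = (\<integral>x. (if p < x \<and> x \<le> q then hv x else 0) \<bullet> b \<partial>lborel)"
      unfolding ioc_integral_def by (intro Bochner_Integration.integral_cong) auto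
    then show ?thesis unfolding ioc_integral_def
      using integral_inner_left[OF ioc_integrable[OF hv_measurable norm_hv_1, of p q], of b] by simp
  qed
  show ?thesis
    using AE_exp_pos AE_thin_Cauchy[OF F bd] AE_compensated_convergent[OF F bd] AE_Gam_drift[OF hv_measurable norm_hv] AE_J_tendsto_0
  proof eventually_elim
    case (elim \<omega>)
    \<comment> \<open>\<open>A\<close> collects the bridge parts, \<open>B\<close> is the
      compensated sum of truncated jumps with the centering moved from arrival intervals to unit
      intervals, and \<open>E\<close> holds the jumps larger than 1.\<close>
    define A where "A n t = (\<Sum>i<n. thin F i t \<omega>)" for n t
    define B where "B n = (\<Sum>i<n. F (Gam (Suc i) \<omega>) (mk i \<omega>) - ioc_integral hv (Gam i \<omega>) (Gam (Suc i) \<omega>) \<bullet> b)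
        + (ioc_integral hv 0 (Gam n \<omega>) - ioc_integral hv 0 (real n)) \<bullet> b" for n
    define E where "E n t = (\<Sum>i<n. (if tm i \<omega> \<le> cl t then (jump i \<omega> - H1 (Gam (Suc i) \<omega>) (mk i \<omega>)) \<bullet> b else 0))" for n t
    have Beq: "B n = (\<Sum>i<n. F (Gam (Suc i) \<omega>) (mk i \<omega>)) - (\<Sum>i<n. ioc_integral hv (real i) (real i + 1)) \<bullet> b" for n
      using sum_ioc_Gam[of \<omega> n, symmetric] elim(1)
      by (simp add: B_def sum_subtractf inner_sum_left[symmetric] sum_ioc_nat inner_diff_left)
    have dec: "part n t \<omega> \<bullet> b = A n t + (cl t / T) * B n + E n t" for n t
    proof -
      have "part n t \<omega> \<bullet> b = (\<Sum>i<n. (if tm i \<omega> \<le> cl t then jump i \<omega> \<bullet> b else 0) - (cl t / T) * (ioc_integral hv (real i) (real i + 1) \<bullet> b))"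
        unfolding part_def inner_sum_left by (intro sum.cong refl) (auto simp: inner_diff_left)
      also have "\<dots> = (\<Sum>i<n. thin F i t \<omega> + (cl t / T) * (F (Gam (Suc i) \<omega>) (mk i \<omega>) - ioc_integral hv (real i) (real i + 1) \<bullet> b)
           + (if tm i \<omega> \<le> cl t then (jump i \<omega> - H1 (Gam (Suc i) \<omega>) (mk i \<omega>)) \<bullet> b else 0))"
        by (intro sum.cong refl) (simp add: thin_def F_def inner_diff_left algebra_simps)
      also have "\<dots> = A n t + (cl t / T) * B n + E n t"
        unfolding Beq A_def E_def by (simp only: sum.distrib sum_distrib_left[symmetric] sum_subtractf inner_sum_left)
      finally show ?thesis .
    qed
    have "convergent B"
    proof -
      have "convergent (\<lambda>n. \<Sum>i<n. F (Gam (Suc i) \<omega>) (mk i \<omega>) - ioc_integral hv (Gam i \<omega>) (Gam (Suc i) \<omega>) \<bullet> b)"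
        using elim(3) by (simp add: Fb iocb)
      moreover have "convergent (\<lambda>n. (ioc_integral hv 0 (Gam n \<omega>) - ioc_integral hv 0 (real n)) \<bullet> b)"
        using tendsto_inner[OF elim(4)[THEN conjunct1] tendsto_const[of b]] by (auto simp: convergent_def)
      ultimately show ?thesis unfolding B_def by (rule convergent_add)
    qed
    then have CB: "Cauchy B" by (rule convergent_Cauchy)
    \<comment> \<open>\<open>J i < 1\<close> says that jump \<open>i\<close> is smaller than 1, so
      from \<open>N\<close> on nothing is added to \<open>E\<close>, at any time
      \<open>t\<close>.\<close>
    have "eventually (\<lambda>i. J i \<omega> < 1) sequentially" by (rule order_tendstoD(2)[OF elim(5)]) simp
    then obtain N where N: "\<And>i. i \<ge> N \<Longrightarrow> J i \<omega> < 1" by (auto simp: eventually_sequentially)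
    have Nle: "norm (H (Gam (Suc i) \<omega>) (mk i \<omega>)) \<le> 1" if "i \<ge> N" for i
      using N[OF that] by (simp add: J_def min_def split: if_splits)
    have E0: "E n t = E N t" if "n \<ge> N" for n t
      unfolding E_def
    proof (rule sum.mono_neutral_right)
      show "\<forall>i\<in>{..<n} - {..<N}. (if tm i \<omega> \<le> cl t then (jump i \<omega> - H1 (Gam (Suc i) \<omega>) (mk i \<omega>)) \<bullet> b else 0) = 0"
        using Nle by (auto simp: jump_def H1_def)
    qed (use that in auto)
    show ?case
    proof (intro allI impI)
      fix e :: real assume e: "e > 0"
      obtain m1 where m1: "\<And>n t. n \<ge> m1 \<Longrightarrow> \<bar>A n t - A m1 t\<bar> \<le> e / 4"
        using elim(2)[rule_format, of "e / 4"] e by (auto simp: A_def)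
      obtain m2 where m2: "\<And>n m. n \<ge> m2 \<Longrightarrow> m \<ge> m2 \<Longrightarrow> \<bar>B n - B m\<bar> < e / 4"
        using metric_CauchyD[OF CB, of "e / 4"] e by (auto simp: dist_real_def)
      define m where "m = max (max m1 m2) N"
      have "\<bar>(part n t \<omega> - part m t \<omega>) \<bullet> b\<bar> \<le> e" if n: "n \<ge> m" for n t
      proof -
        have "\<bar>A n t - A m1 t\<bar> \<le> e / 4" "\<bar>A m t - A m1 t\<bar> \<le> e / 4" using m1 n by (auto simp: m_def)
        moreover have "\<bar>(cl t / T) * (B n - B m)\<bar> \<le> e / 4"
        proof -
          have "\<bar>cl t / T\<bar> \<le> 1" using cl_bounds[of t] T by simp
          then have "\<bar>cl t / T\<bar> * \<bar>B n - B m\<bar> \<le> 1 * \<bar>B n - B m\<bar>" by (intro mult_right_mono) auto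
          also have "\<dots> = \<bar>B n - B m\<bar>" by simp
          also have "\<dots> \<le> e / 4" by (rule less_imp_le, rule m2) (use n in \<open>auto simp: m_def\<close>)
          finally show ?thesis unfolding abs_mult .
        qed
        moreover have "E n t = E m t" using E0[of n t] E0[of m t] n by (simp add: m_def)
        moreover have "(part n t \<omega> - part m t \<omega>) \<bullet> b = (A n t - A m1 t) - (A m t - A m1 t) + (cl t / T) * (B n - B m) + (E n t - E m t)"
        proof -
          have gen: "(a1 + c * b1 + e1) - (a2 + c * b2 + e2) = (a1 - a3) - (a2 - a3) + c * (b1 - b2) + (e1 - e2)"
            for a1 a2 a3 b1 b2 c e1 e2 :: real by (simp add: algebra_simps)
          show ?thesis unfolding inner_diff_left dec by (rule gen)
        qed
        ultimately show ?thesis using e by linarith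
      qed
      then show "\<exists>m. \<forall>n\<ge>m. \<forall>t. \<bar>(part n t \<omega> - part m t \<omega>) \<bullet> b\<bar> \<le> e" by blast
    qed
  qed
qed

theorem AE_part_uniform_limit: "AE \<omega> in S. \<exists>X. uniform_limit UNIV (\<lambda>n t. part n t \<omega>) X sequentially"
proof -
  have "AE \<omega> in S. \<forall>b\<in>Basis. \<forall>e>0. \<exists>m. \<forall>n\<ge>m. \<forall>t. \<bar>(part n t \<omega> - part m t \<omega>) \<bullet> b\<bar> \<le> e"
    by (intro AE_finite_allI finite_Basis AE_part_coordinate_Cauchy)
  then show ?thesis
  proof eventually_elim
    case (elim \<omega>)
    have "uniformly_Cauchy_on UNIV (\<lambda>n t. part n t \<omega>)"
    proof (rule uniformly_Cauchy_onI)
      fix e :: real assume e: "e > 0"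
      \<comment> \<open>Two partial sums beyond \<open>M\<close> are both within \<delta> of a third
        in each coordinate, so they differ by at most \<open>2 * \<delta> * DIM('a) = e / 2\<close>
        in norm.\<close>
      define \<delta> where "\<delta> = e / (4 * real DIM('a))"
      have \<delta>: "\<delta> > 0" using e by (simp add: \<delta>_def)
      have "\<forall>b\<in>Basis. \<exists>m. \<forall>n\<ge>m. \<forall>t. \<bar>(part n t \<omega> - part m t \<omega>) \<bullet> b\<bar> \<le> \<delta>" using elim \<delta> by blast
      then obtain m where m: "\<And>b n t. b \<in> Basis \<Longrightarrow> n \<ge> m b \<Longrightarrow> \<bar>(part n t \<omega> - part (m b) t \<omega>) \<bullet> b\<bar> \<le> \<delta>" by metis
      define M where "M = Max (m ` Basis)"
      have mM: "m b \<le> M" if "b \<in> Basis" for b using that by (simp add: M_def)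
      have "dist (part n t \<omega>) (part k t \<omega>) < e" if "n \<ge> M" "k \<ge> M" for n k t
      proof -
        have c: "\<bar>(part n t \<omega> - part k t \<omega>) \<bullet> b\<bar> \<le> 2 * \<delta>" if b: "b \<in> Basis" for b
        proof -
          have "\<bar>(part n t \<omega> - part (m b) t \<omega>) \<bullet> b\<bar> \<le> \<delta>" "\<bar>(part k t \<omega> - part (m b) t \<omega>) \<bullet> b\<bar> \<le> \<delta>"
            using m[OF b] mM[OF b] \<open>n \<ge> M\<close> \<open>k \<ge> M\<close> by auto
          then show ?thesis unfolding inner_diff_left by linarith
        qed
        have "norm (part n t \<omega> - part k t \<omega>) \<le> (\<Sum>b\<in>Basis. \<bar>(part n t \<omega> - part k t \<omega>) \<bullet> b\<bar>)" by (rule norm_le_l1)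
        also have "\<dots> \<le> (\<Sum>b\<in>(Basis :: 'a set). 2 * \<delta>)" by (intro sum_mono c)
        also have "\<dots> = e / 2" by (simp add: \<delta>_def)
        finally show ?thesis using e by (simp add: dist_norm)
      qed
      then show "\<exists>M. \<forall>x\<in>UNIV. \<forall>m\<ge>M. \<forall>n\<ge>M. dist (part m x \<omega>) (part n x \<omega>) < e" by blast
    qed
    then have "uniformly_convergent_on UNIV (\<lambda>n t. part n t \<omega>)" by (rule Cauchy_uniformly_convergent)
    then show ?case by (simp add: uniformly_convergent_on_def)
  qed
qed

end

section \<open>The law of the limit\<close>

lemma ioc_integral_diff_const:
  fixes h :: "real \<Rightarrow> 'b::{banach, second_countable_topology}"
  assumes h: "h \<in> borel_measurable borel" and B: "\<And>x. norm (h x) \<le> B" and ab: "a \<le> b"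
  shows "ioc_integral (\<lambda>x. h x - c) a b = ioc_integral h a b - (b - a) *\<^sub>R c"
proof -
  have i: "integrable lborel (\<lambda>x. indicator {a<..b} x *\<^sub>R c)"
    using ab by (intro integrable_scaleR_left integrable_real_indicator) auto
  have "ioc_integral (\<lambda>x. h x - c) a b = (\<integral>x. (if a < x \<and> x \<le> b then h x else 0) - indicator {a<..b} x *\<^sub>R c \<partial>lborel)"
    unfolding ioc_integral_def by (intro Bochner_Integration.integral_cong) (auto simp: indicator_def)
  also have "\<dots> = ioc_integral h a b - (\<integral>x. indicator {a<..b} x *\<^sub>R c \<partial>lborel)"
    unfolding ioc_integral_def by (rule Bochner_Integration.integral_diff[OF ioc_integrable[OF h B] i])
  also have "(\<integral>x. indicator {a<..b} x *\<^sub>R c \<partial>lborel) = (b - a) *\<^sub>R c"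
    using ab by simp
  finally show ?thesis .
qed

lemma ioc_integral_has_vector_derivative:
  fixes h :: "real \<Rightarrow> 'b::{banach, second_countable_topology}"
  assumes h: "h \<in> borel_measurable borel" and B: "\<And>x. norm (h x) \<le> B" and x: "0 < x" and cont: "isCont h x"
  shows "((\<lambda>x. ioc_integral h 0 x) has_vector_derivative h x) (at x)"
  unfolding has_vector_derivative_def has_derivative_within_alt
proof (intro conjI allI impI)
  show "bounded_linear (\<lambda>y. y *\<^sub>R h x)" by (rule bounded_linear_scaleR_left)
  fix e :: real assume e: "e > 0"
  obtain d where d: "d > 0" "\<And>y. dist y x < d \<Longrightarrow> dist (h y) (h x) < e"
    using cont e unfolding continuous_at_eps_delta by blast
  have hc: "(\<lambda>y. h y - h x) \<in> borel_measurable borel" using h by simp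
  have Bc: "norm (h y - h x) \<le> 2 * B" for y
    using norm_triangle_ineq4[of "h y" "h x"] B[of y] B[of x] by linarith
  have seg: "norm (ioc_integral h a b - (b - a) *\<^sub>R h x) \<le> e * (b - a)" if ab: "a \<le> b" "\<And>y. a < y \<Longrightarrow> y \<le> b \<Longrightarrow> dist y x < d" for a b
    using ioc_integral_le[OF hc Bc, of a b e] d(2)[OF ab(2)] ab(1) ioc_integral_diff_const[OF h B ab(1), of "h x"]
    by (auto simp: dist_norm intro: less_imp_le)
  show "\<exists>d>0. \<forall>y\<in>UNIV. norm (y - x) < d \<longrightarrow> norm (ioc_integral h 0 y - ioc_integral h 0 x - (y - x) *\<^sub>R h x) \<le> e * norm (y - x)"
  proof (intro exI[of _ "min d x"] conjI ballI impI)
    fix y assume y: "norm (y - x) < min d x"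
    show "norm (ioc_integral h 0 y - ioc_integral h 0 x - (y - x) *\<^sub>R h x) \<le> e * norm (y - x)"
    proof (cases "x \<le> y")
      case True
      have "ioc_integral h 0 x + ioc_integral h x y = ioc_integral h 0 y"
        using x True by (intro ioc_integral_add[OF h B]) auto
      then have "ioc_integral h 0 y - ioc_integral h 0 x = ioc_integral h x y" by (simp add: algebra_simps)
      then show ?thesis using seg[OF True] y True by (simp add: dist_real_def)
    next
      case False
      then have "ioc_integral h 0 y + ioc_integral h y x = ioc_integral h 0 x"
        using x y by (intro ioc_integral_add[OF h B]) auto
      then have "ioc_integral h 0 y - ioc_integral h 0 x - (y - x) *\<^sub>R h x = - (ioc_integral h y x - (x - y) *\<^sub>R h x)"
        by (simp add: algebra_simps)
      then have "norm (ioc_integral h 0 y - ioc_integral h 0 x - (y - x) *\<^sub>R h x) = norm (ioc_integral h y x - (x - y) *\<^sub>R h x)"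
        by (simp only: norm_minus_cancel)
      then show ?thesis using seg[of y x] y False by (simp add: dist_real_def)
    qed
  qed (use d x in auto)
qed

lemma norm_iexp_diff2: "norm (iexp t - 1 - \<i> * t) \<le> t\<^sup>2 / 2"
  using iexp_approx1[of t 1] by (simp add: diff_diff_eq power2_eq_square)

context shot_noise
begin

definition kern :: "'a \<Rightarrow> real \<Rightarrow> 'a \<Rightarrow> complex" where
  "kern z x v = iexp (z \<bullet> H x v) - 1 - \<i> * complex_of_real (z \<bullet> H1 x v)"

definition \<kappa> :: "'a \<Rightarrow> real \<Rightarrow> complex" where "\<kappa> z x = (\<integral>v. kern z x v \<partial>L)"

text \<open>For layered stable data this is \<open>T\<close> times the Levy-Khintchine exponent; see
  \<open>exponent_eq\<close>.\<close>

definition \<psi>0 :: "'a \<Rightarrow> complex" where "\<psi>0 z = (\<integral>x. \<kappa> z x \<partial>lborel)"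

definition m2 :: "real \<Rightarrow> real" where "m2 x = (\<integral>v. (min 1 (norm (H x v)))\<^sup>2 \<partial>L)"

lemma kern_measurable[measurable (raw)]:
  assumes [measurable]: "f \<in> borel_measurable M" "k \<in> borel_measurable M" "l \<in> borel_measurable M"
  shows "(\<lambda>x. kern (f x) (k x) (l x)) \<in> borel_measurable M"
  unfolding kern_def by measurable

lemma \<kappa>_measurable[measurable]: "\<kappa> z \<in> borel_measurable borel"
  unfolding \<kappa>_def by measurable

lemma m2_measurable[measurable]: "m2 \<in> borel_measurable borel"
  unfolding m2_def by measurable

text \<open>The constant covers two regimes: jumps up to 1 give \<open>(norm z)\<^sup>2 / 2\<close>
  times the squared jump by the second order Taylor bound, larger jumps give at most 2.\<close>

lemma kern_bound: "norm (kern z x v) \<le> (2 + (norm z)\<^sup>2) * (min 1 (norm (H x v)))\<^sup>2"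
proof (cases "norm (H x v) \<le> 1")
  case True
  have "norm (kern z x v) \<le> (z \<bullet> H x v)\<^sup>2 / 2"
    using norm_iexp_diff2[of "z \<bullet> H x v"] True by (simp add: kern_def H1_def)
  also have "(z \<bullet> H x v)\<^sup>2 \<le> (norm z * norm (H x v))\<^sup>2"
    using Cauchy_Schwarz_ineq2[of z "H x v"] by (simp add: abs_le_square_iff[symmetric])
  also have "(norm z * norm (H x v))\<^sup>2 / 2 \<le> (2 + (norm z)\<^sup>2) * (norm (H x v))\<^sup>2"
  proof -
    have "(norm z * norm (H x v))\<^sup>2 / 2 = ((norm z)\<^sup>2 / 2) * (norm (H x v))\<^sup>2" by (simp add: power_mult_distrib)
    also have "\<dots> \<le> (2 + (norm z)\<^sup>2) * (norm (H x v))\<^sup>2"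
    proof (rule mult_right_mono)
      have "0 \<le> (norm z)\<^sup>2" by simp
      then show "(norm z)\<^sup>2 / 2 \<le> 2 + (norm z)\<^sup>2" by linarith
    qed simp
    finally show ?thesis .
  qed
  finally show ?thesis using True by (simp add: min_absorb2 divide_right_mono)
next
  case False
  have "norm (kern z x v) \<le> norm (iexp (z \<bullet> H x v)) + norm (1::complex)"
    using False norm_triangle_ineq4[of "iexp (z \<bullet> H x v)" 1] by (simp add: kern_def H1_def)
  then have "norm (kern z x v) \<le> 2" by (simp only: norm_exp_i_times norm_one one_add_one)
  also have "2 \<le> 2 + (norm z)\<^sup>2" by simp
  finally show ?thesis using False by (simp add: min_absorb1)
qed

lemma kern_bound2: "norm (kern z x v) \<le> 2 + (norm z)\<^sup>2"
proof -
  have "(min 1 (norm (H x v)))\<^sup>2 \<le> 1" by (simp add: power_le_one)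
  then have "(2 + (norm z)\<^sup>2) * (min 1 (norm (H x v)))\<^sup>2 \<le> (2 + (norm z)\<^sup>2) * 1" by (intro mult_left_mono) auto
  from order_trans[OF kern_bound this] show ?thesis by simp
qed

lemma kern_integrable: "integrable L (kern z x)"
  using kern_bound2 by (intro L.integrable_const_bound[where B="2 + (norm z)\<^sup>2"]) auto

lemma sq_integrable: "integrable L (\<lambda>v. (min 1 (norm (H x v)))\<^sup>2)"
  by (intro L.integrable_const_bound[where B=1]) (auto simp: power_le_one)

lemma m2_nonneg: "0 \<le> m2 x" unfolding m2_def by (intro integral_nonneg_AE) auto

lemma m2_integrable: "integrable lborel m2"
proof (rule integrableI_nonneg)
  have "(\<integral>\<^sup>+x. ennreal (m2 x) \<partial>lborel) = (\<integral>\<^sup>+x. \<integral>\<^sup>+v. ennreal ((min 1 (norm (H x v)))\<^sup>2) \<partial>L \<partial>lborel)"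
    unfolding m2_def by (intro nn_integral_cong nn_integral_eq_integral[symmetric] sq_integrable) auto
  then show "(\<integral>\<^sup>+x. ennreal (m2 x) \<partial>lborel) < \<infinity>" using H_int by simp
qed (auto simp: m2_nonneg)

lemma norm_\<kappa>: "norm (\<kappa> z x) \<le> (2 + (norm z)\<^sup>2) * m2 x"
proof -
  have "norm (\<kappa> z x) \<le> (\<integral>v. norm (kern z x v) \<partial>L)" unfolding \<kappa>_def by (rule integral_norm_bound)
  also have "\<dots> \<le> (\<integral>v. (2 + (norm z)\<^sup>2) * (min 1 (norm (H x v)))\<^sup>2 \<partial>L)"
    by (intro integral_mono integrable_norm kern_integrable integrable_mult_right sq_integrable kern_bound)
  finally show ?thesis by (simp add: m2_def)
qed

lemma \<kappa>_integrable: "integrable lborel (\<kappa> z)"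
  by (rule Bochner_Integration.integrable_bound[of _ "\<lambda>x. (2 + (norm z)\<^sup>2) * m2 x"])
    (use norm_\<kappa> m2_integrable m2_nonneg in \<open>auto simp: abs_mult\<close>)

lemma H_0_kern: "x \<le> 0 \<Longrightarrow> kern z x v = 0"
  by (simp add: kern_def H1_def H_0)

text \<open>The exponential martingale of the marked point process, for a step function \<open>\<theta>\<close> of the
  third mark: its mean is constant since \<open>\<integral>\<^sub>0\<^sup>\<infinity> \<phi> (\<gamma> + e) exp (- \<integral>\<^sub>\<gamma>\<^bsup>\<gamma> + e\<^esup> \<phi>) de = 1\<close>.\<close>

lemma exponential_martingale:
  fixes \<theta> :: "real \<Rightarrow> 'a" and \<phi> :: "real \<Rightarrow> complex"
  assumes \<theta>[measurable]: "\<theta> \<in> borel_measurable borel"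
    and \<phi>: "\<And>x. \<phi> x = (\<integral>w. iexp (\<theta> (snd w) \<bullet> H x (fst w)) \<partial>(L \<Otimes>\<^sub>M unif))"
    and C: "\<And>x. x \<ge> 0 \<Longrightarrow> Re (ioc_integral (\<lambda>x. \<phi> x - 1) 0 x) \<ge> - C"
  shows "(\<integral>\<omega>. iexp (\<Sum>i<k. \<theta> (tm i \<omega>) \<bullet> jump i \<omega>) * exp (- ioc_integral (\<lambda>x. \<phi> x - 1) 0 (Gam k \<omega>)) \<partial>S) = 1"
proof -
  define f where "f x w = iexp (\<theta> (snd w) \<bullet> H x (fst w))" for x and w :: "'a \<times> real"
  have nf: "norm (f x w) = 1" for x w by (simp only: f_def norm_exp_i_times)
  have fm[measurable (raw)]: "(\<lambda>y. f (p y) (q y)) \<in> borel_measurable M"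
    if [measurable]: "p \<in> borel_measurable M" "q \<in> M \<rightarrow>\<^sub>M borel \<Otimes>\<^sub>M borel" for p q and M :: "'z measure"
    unfolding f_def by measurable
  have LUs: "sets (L \<Otimes>\<^sub>M unif) = sets (borel \<Otimes>\<^sub>M borel)" by (intro sets_pair_measure_cong) (auto simp: sets_L)
  have fx[measurable]: "f x \<in> borel_measurable (L \<Otimes>\<^sub>M unif)" for x
    unfolding measurable_cong_sets[OF LUs refl] by measurable
  have \<phi>f: "\<phi> x = (\<integral>w. f x w \<partial>(L \<Otimes>\<^sub>M unif))" for x by (simp only: \<phi> f_def)
  have fint: "integrable (L \<Otimes>\<^sub>M unif) (f x)" for x
    by (intro LU.P.integrable_const_bound[where B=1]) (auto simp: nf)
  have \<phi>m[measurable]: "\<phi> \<in> borel_measurable borel"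
    unfolding \<phi>f[abs_def] by measurable
  have \<phi>1: "norm (\<phi> x) \<le> 1" for x
  proof -
    have "norm (\<phi> x) \<le> (\<integral>w. norm (f x w) \<partial>(L \<Otimes>\<^sub>M unif))" unfolding \<phi>f by (rule integral_norm_bound)
    then show ?thesis by (simp add: nf LU.P.prob_space)
  qed
  define h where "h x = \<phi> x - 1" for x
  have hm[measurable]: "h \<in> borel_measurable borel" unfolding h_def by measurable
  have h2: "norm (h x) \<le> 2" for x using \<phi>1[of x] norm_triangle_ineq4[of "\<phi> x" 1] by (simp add: h_def)
  have \<phi>c: "isCont \<phi> x" if x: "x > 0" for x
    unfolding continuous_at_sequentially comp_def
  proof (intro allI impI)
    fix X assume X: "X \<longlonglongrightarrow> x"
    show "(\<lambda>n. \<phi> (X n)) \<longlonglongrightarrow> \<phi> x"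
      unfolding \<phi>f
    proof (rule integral_dominated_convergence[where w="\<lambda>_. 1"])
      have "(\<lambda>n. H (X n) (fst w)) \<longlonglongrightarrow> H x (fst w)" for w
        using isCont_tendsto_compose[OF H_cont[OF x] X] .
      then show "AE w in L \<Otimes>\<^sub>M unif. (\<lambda>n. f (X n) w) \<longlonglongrightarrow> f x w"
        unfolding f_def by (intro AE_I2 tendsto_intros)
    qed (auto simp: nf LU.P.emeasure_space_1)
  qed
  have hc: "isCont h x" if "x > 0" for x unfolding h_def using \<phi>c[OF that] by (intro continuous_intros)
  define I where "I x = ioc_integral h 0 x" for x
  have Im[measurable (raw)]: "(\<lambda>y. I (p y)) \<in> borel_measurable M" if "p \<in> borel_measurable M" for p and M :: "'z measure"
    unfolding I_def by (rule borel_measurable_ioc_integral) (use that in auto)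
  have IC: "Re (I x) \<ge> - C" if "x \<ge> 0" for x using C[OF that] by (simp add: I_def h_def[abs_def])
  \<comment> \<open>For the fundamental theorem of calculus on \<open>(0, \<infinity>)\<close> the
    antiderivative needs a limit at its left end. When \<gamma> is 0, \<open>h\<close> need not be
    continuous there, but its boundedness is enough.\<close>
  have I_cont_right: "(I \<longlongrightarrow> I \<gamma>) (at_right \<gamma>)" if \<gamma>: "\<gamma> \<ge> 0" for \<gamma>
  proof (rule Lim_transform[OF tendsto_const])
    show "((\<lambda>y. I y - I \<gamma>) \<longlongrightarrow> 0) (at_right \<gamma>)"
    proof (rule Lim_null_comparison)
      show "((\<lambda>y. 2 * (y - \<gamma>)) \<longlongrightarrow> 0) (at_right \<gamma>)" by (auto intro!: tendsto_eq_intros)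
      show "eventually (\<lambda>y. norm (I y - I \<gamma>) \<le> 2 * (y - \<gamma>)) (at_right \<gamma>)"
        unfolding eventually_at_right_field
      proof (intro exI[of _ "\<gamma> + 1"] conjI allI impI)
        fix y assume y: "\<gamma> < y"
        have "I \<gamma> + ioc_integral h \<gamma> y = I y" unfolding I_def using \<gamma> y by (intro ioc_integral_add[OF hm h2]) auto
        then have "I y - I \<gamma> = ioc_integral h \<gamma> y" by (simp add: algebra_simps)
        moreover have "norm (ioc_integral h \<gamma> y) \<le> 2 * (y - \<gamma>)" using y by (intro ioc_integral_le[OF hm h2 h2]) simp
        ultimately show "norm (I y - I \<gamma>) \<le> 2 * (y - \<gamma>)" by simp
      qed simp
    qed
  qed
  have step: "(\<integral>e. \<phi> (\<gamma> + e) * exp (- I (\<gamma> + e)) \<partial>expo) = exp (- I \<gamma>)" if \<gamma>: "\<gamma> \<ge> 0" for \<gamma>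
  proof -
    \<comment> \<open>\<open>I\<close> has derivative \<open>h = \<phi> - 1\<close>, so the exponent
      \<open>e + I (\<gamma> + e)\<close> has derivative \<phi>, and \<open>F\<close> is an
      antiderivative of \<open>f'\<close>. The lower bound on the real part of \<open>I\<close>
      leaves the decay of \<open>exp (- e)\<close>, so \<open>F\<close> vanishes at
      infinity.\<close>
    define F where "F e = - exp (- (complex_of_real e + I (\<gamma> + e)))" for e
    define f' where "f' e = \<phi> (\<gamma> + e) * exp (- (complex_of_real e + I (\<gamma> + e)))" for e
    have nexp: "norm (exp (- (complex_of_real e + I (\<gamma> + e)))) \<le> exp C * exp (- e)" if "e > 0" for e
      using IC[of "\<gamma> + e"] that \<gamma> by (simp add: norm_exp_eq_Re exp_add[symmetric])
    have Fd: "(F has_vector_derivative f' e) (at e)" if e: "e > 0" for e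
    proof -
      have "(I has_vector_derivative h (\<gamma> + e)) (at (\<gamma> + e))"
        unfolding I_def[abs_def] using e \<gamma> by (intro ioc_integral_has_vector_derivative[OF hm h2] hc) auto
      moreover have "((\<lambda>e. \<gamma> + e) has_vector_derivative 1) (at e)"
        using has_vector_derivative_add[OF has_vector_derivative_const has_vector_derivative_id, of \<gamma> "at e"] by simp
      ultimately have "((\<lambda>e. I (\<gamma> + e)) has_vector_derivative h (\<gamma> + e)) (at e)"
        using vector_diff_chain_at[of "\<lambda>e. \<gamma> + e" 1 e I "h (\<gamma> + e)"]
        by (simp add: comp_def)
      then have "((\<lambda>e. - (complex_of_real e + I (\<gamma> + e))) has_vector_derivative - (1 + h (\<gamma> + e))) (at e)"
        by (auto intro!: derivative_eq_intros simp: of_real_def)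
      from field_vector_diff_chain_at[OF this DERIV_exp]
      have "((\<lambda>e. exp (- (complex_of_real e + I (\<gamma> + e)))) has_vector_derivative - (1 + h (\<gamma> + e)) * exp (- (complex_of_real e + I (\<gamma> + e)))) (at e)"
        by (simp add: comp_def)
      from has_vector_derivative_minus[OF this] show ?thesis
        by (simp add: F_def[abs_def] f'_def h_def)
    qed
    have Ic: "isCont I x" if "x > 0" for x
      using has_vector_derivative_continuous[OF ioc_integral_has_vector_derivative[OF hm h2 that hc[OF that]]]
      by (simp add: I_def[abs_def])
    have f'c: "isCont f' e" if "e > 0" for e
      unfolding f'_def using that \<gamma>
      by (intro continuous_intros isCont_o2[OF _ \<phi>c] isCont_o2[OF _ Ic]) auto
    have f'm[measurable]: "f' \<in> borel_measurable borel" unfolding f'_def by measurable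
    have f'b: "norm (f' e) \<le> exp C * exp (- e)" if "e > 0" for e
    proof -
      have "norm (f' e) \<le> 1 * (exp C * exp (- e))"
        unfolding f'_def norm_mult by (intro mult_mono \<phi>1 nexp that) auto
      then show ?thesis by simp
    qed
    have f'i: "set_integrable lborel {0<..} f'"
      unfolding set_integrable_def
    proof (rule Bochner_Integration.integrable_bound)
      have "integrable expo (\<lambda>e. exp C)" by simp
      then have "integrable lborel (\<lambda>e. exponential_density 1 e *\<^sub>R exp C)"
        by (subst (asm) integrable_density) (auto simp: exponential_density_def)
      then show "integrable lborel (\<lambda>e. exp C * exponential_density 1 e)" by (simp add: mult.commute)
      show "AE e in lborel. norm (indicator {0<..} e *\<^sub>R f' e) \<le> norm (exp C * exponential_density 1 e)"
        using f'b by (auto simp: indicator_def exponential_density_def)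
    qed simp
    have "(LBINT e=0..\<infinity>. f' e) = 0 - (- exp (- I \<gamma>))"
    proof (rule interval_integral_FTC_integrable)
      show "(F has_vector_derivative f' e) (at e)" "isCont f' e" if "0 < ereal e" for e
        using Fd f'c that by auto
      show "set_integrable lborel (einterval 0 \<infinity>) f'"
        using f'i by (simp add: einterval_def zero_ereal_def greaterThan_def)
      have "((\<lambda>e. I (\<gamma> + e)) \<longlongrightarrow> I \<gamma>) (at_right 0)"
        using I_cont_right[OF \<gamma>] by (subst (asm) filterlim_at_right_to_0) (simp add: add.commute)
      then have "(F \<longlongrightarrow> - exp (- (complex_of_real 0 + I \<gamma>))) (at_right 0)"
        unfolding F_def by (intro tendsto_intros)
      then show "((F \<circ> real_of_ereal) \<longlongrightarrow> - exp (- I \<gamma>)) (at_right 0)"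
        by (simp add: zero_ereal_def ereal_tendsto_simps)
      have "(F \<longlongrightarrow> 0) at_top"
      proof (rule Lim_null_comparison)
        show "eventually (\<lambda>e. norm (F e) \<le> exp C * exp (- e)) at_top"
          by (rule eventually_mono[OF eventually_gt_at_top[of "0::real"]]) (simp only: F_def norm_minus_cancel nexp)
        have "((\<lambda>e::real. exp (- e)) \<longlongrightarrow> 0) at_top" by real_asymp
        from tendsto_mult_right_zero[OF this] show "((\<lambda>e. exp C * exp (- e)) \<longlongrightarrow> 0) at_top" by simp
      qed
      then show "((F \<circ> real_of_ereal) \<longlongrightarrow> 0) (at_left \<infinity>)" by (simp add: ereal_tendsto_simps)
    qed simp
    also have "(LBINT e=0..\<infinity>. f' e) = (LBINT e:{0<..}. f' e)"
      using interval_integral_to_infinity_eq[of lborel 0 f'] by (simp add: zero_ereal_def)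
    also have "\<dots> = (\<integral>e. exponential_density 1 e *\<^sub>R (\<phi> (\<gamma> + e) * exp (- I (\<gamma> + e))) \<partial>lborel)"
      unfolding set_lebesgue_integral_def
    proof (rule integral_cong_AE)
      have "AE e in lborel. e \<noteq> (0::real)" by (rule AE_lborel_singleton)
      then show "AE e in lborel. indicator {0<..} e *\<^sub>R f' e = exponential_density 1 e *\<^sub>R (\<phi> (\<gamma> + e) * exp (- I (\<gamma> + e)))"
        by eventually_elim (auto simp: indicator_def f'_def exponential_density_def exp_add scaleR_conv_of_real exp_of_real[symmetric] exp_minus exp_diff divide_inverse)
    qed simp_all
    also have "\<dots> = (\<integral>e. \<phi> (\<gamma> + e) * exp (- I (\<gamma> + e)) \<partial>expo)"
      by (subst integral_density) (auto simp: exponential_density_def)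
    finally show ?thesis by simp
  qed
  define A where "A k \<omega> = iexp (\<Sum>i<k. \<theta> (tm i \<omega>) \<bullet> jump i \<omega>)" for k and \<omega> :: "nat \<Rightarrow> real \<times> 'a \<times> real"
  have jm[measurable]: "jump i \<in> borel_measurable S" for i unfolding jump_def by measurable
  have Am[measurable]: "A k \<in> borel_measurable S" for k unfolding A_def by measurable
  have nA: "norm (A k \<omega>) = 1" for k \<omega> by (simp only: A_def norm_exp_i_times)
  have AE_Gam_nonneg: "AE \<omega> in S. Gam k \<omega> \<ge> 0" for k
    using AE_exp_pos by eventually_elim (use Gam_mono[of _ 0 k] in \<open>auto simp: Gam_0\<close>)
  have nE: "norm (exp (- I x)) \<le> exp C" if "x \<ge> 0" for x using IC[OF that] by (simp add: norm_exp_eq_Re)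
  have nE': "norm (z * exp (- I x)) \<le> exp C" if "norm z = 1" "x \<ge> 0" for z x
    unfolding norm_mult that(1) using nE[OF that(2)] by (simp only: mult_1_left)
  have int: "integrable S (\<lambda>\<omega>. A k \<omega> * exp (- I (Gam k \<omega>)))" for k
  proof (rule S.integrable_const_bound[where B="exp C"])
    show "AE \<omega> in S. norm (A k \<omega> * exp (- I (Gam k \<omega>))) \<le> exp C"
      using AE_Gam_nonneg[of k] by eventually_elim (rule nE'[OF nA])
  qed measurable
  have "(\<integral>\<omega>. A k \<omega> * exp (- I (Gam k \<omega>)) \<partial>S) = 1"
  proof (induction k)
    case 0
    then show ?case by (simp add: A_def Gam_0 I_def ioc_integral_empty S.prob_space)
  next
    case (Suc k)
    \<comment> \<open>Averaging over coordinate \<open>k\<close> peels off the last jump: direction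
      and time average to \<phi> at the next arrival, and \<open>step\<close> integrates out the
      waiting time.\<close>
    have "(\<integral>\<omega>. A (Suc k) \<omega> * exp (- I (Gam (Suc k) \<omega>)) \<partial>S) =
      (\<integral>\<omega>. \<integral>s. A (Suc k) (fun_upd \<omega> k s) * exp (- I (Gam (Suc k) (fun_upd \<omega> k s))) \<partial>noise_law L T \<partial>S)"
      by (rule integral_resample[OF int])
    also have "\<dots> = (\<integral>\<omega>. A k \<omega> * exp (- I (Gam k \<omega>)) \<partial>S)"
    proof (rule integral_cong_AE)
      show "(\<lambda>\<omega>. \<integral>s. A (Suc k) (fun_upd \<omega> k s) * exp (- I (Gam (Suc k) (fun_upd \<omega> k s))) \<partial>noise_law L T) \<in> borel_measurable S"
      proof (intro R.borel_measurable_lebesgue_integral)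
        have "(\<lambda>\<omega>. A (Suc k) \<omega> * exp (- I (Gam (Suc k) \<omega>))) \<in> borel_measurable S" by measurable
        from measurable_pair_swap[OF measurable_upd_section[OF this, of k]]
        show "(\<lambda>(\<omega>, s). A (Suc k) (fun_upd \<omega> k s) * exp (- I (Gam (Suc k) (fun_upd \<omega> k s)))) \<in> borel_measurable (S \<Otimes>\<^sub>M noise_law L T)"
          by (simp add: split_beta')
      qed
      show "AE \<omega> in S. (\<integral>s. A (Suc k) (fun_upd \<omega> k s) * exp (- I (Gam (Suc k) (fun_upd \<omega> k s))) \<partial>noise_law L T) = A k \<omega> * exp (- I (Gam k \<omega>))"
        using AE_Gam_nonneg[of k]
      proof eventually_elim
        case (elim \<omega>)
        let ?\<gamma> = "Gam k \<omega>"
        have eq: "A (Suc k) (fun_upd \<omega> k s) * exp (- I (Gam (Suc k) (fun_upd \<omega> k s))) = A k \<omega> * (f (?\<gamma> + fst s) (snd s) * exp (- I (?\<gamma> + fst s)))" for s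
        proof -
          have "(\<Sum>i<k. \<theta> (tm i (fun_upd \<omega> k s)) \<bullet> jump i (fun_upd \<omega> k s)) = (\<Sum>i<k. \<theta> (tm i \<omega>) \<bullet> jump i \<omega>)"
            by (intro sum.cong refl) (simp add: jump_def Gam_upd)
          moreover have "jump k (fun_upd \<omega> k s) = H (?\<gamma> + fst s) (fst (snd s))" by (simp add: jump_def Gam_Suc_upd)
          ultimately have "A (Suc k) (fun_upd \<omega> k s) = A k \<omega> * f (?\<gamma> + fst s) (snd s)"
            by (simp add: A_def f_def exp_add distrib_left del: of_real_sum)
          then show ?thesis by (simp add: Gam_Suc_upd)
        qed
        have i: "integrable (noise_law L T) (\<lambda>s. f (?\<gamma> + fst s) (snd s) * exp (- I (?\<gamma> + fst s)))"
        proof (rule R.integrable_const_bound[where B="exp C"])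
          show "AE s in noise_law L T. norm (f (?\<gamma> + fst s) (snd s) * exp (- I (?\<gamma> + fst s))) \<le> exp C"
            using AE_noise_fst[OF AE_expo_pos] by eventually_elim (rule nE'[OF nf], use elim in simp)
        qed measurable
        have "(\<integral>s. f (?\<gamma> + fst s) (snd s) * exp (- I (?\<gamma> + fst s)) \<partial>noise_law L T) =
           (\<integral>e. \<integral>w. f (?\<gamma> + e) w * exp (- I (?\<gamma> + e)) \<partial>(L \<Otimes>\<^sub>M unif) \<partial>expo)"
          using integral_noise[OF i] by simp
        also have "\<dots> = (\<integral>e. \<phi> (?\<gamma> + e) * exp (- I (?\<gamma> + e)) \<partial>expo)"
          by (simp add: \<phi>f)
        also have "\<dots> = exp (- I ?\<gamma>)" by (rule step[OF elim])
        finally show ?case unfolding eq by simp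
      qed
    qed measurable
    finally show ?case using Suc by simp
  qed
  then show ?thesis unfolding A_def I_def h_def[abs_def] .
qed

lemma \<kappa>_nonpos: "x \<le> 0 \<Longrightarrow> \<kappa> z x = 0" by (simp add: \<kappa>_def H_0_kern)

lemma \<kappa>_bound: "norm (\<kappa> z x) \<le> 2 + (norm z)\<^sup>2"
proof -
  have "norm (\<kappa> z x) \<le> (\<integral>v. norm (kern z x v) \<partial>L)" unfolding \<kappa>_def by (rule integral_norm_bound)
  also have "\<dots> \<le> (\<integral>v. 2 + (norm z)\<^sup>2 \<partial>L)"
    by (intro integral_mono integrable_norm kern_integrable kern_bound2) simp
  finally show ?thesis by (simp add: L.prob_space)
qed

lemma norm_ioc_\<kappa>: "norm (ioc_integral (\<kappa> z) a b) \<le> (2 + (norm z)\<^sup>2) * (\<integral>x. m2 x \<partial>lborel)"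
proof -
  have "norm (ioc_integral (\<kappa> z) a b) \<le> (\<integral>x. norm (if a < x \<and> x \<le> b then \<kappa> z x else 0) \<partial>lborel)"
    unfolding ioc_integral_def by (rule integral_norm_bound)
  also have "\<dots> \<le> (\<integral>x. (2 + (norm z)\<^sup>2) * m2 x \<partial>lborel)"
  proof (intro integral_mono integrable_norm ioc_integrable[OF \<kappa>_measurable \<kappa>_bound] integrable_mult_right m2_integrable)
    fix x show "norm (if a < x \<and> x \<le> b then \<kappa> z x else 0) \<le> (2 + (norm z)\<^sup>2) * m2 x"
      using norm_\<kappa>[of z x] m2_nonneg[of x] by auto
  qed
  finally show ?thesis by simp
qed

lemma ioc_\<kappa>_tendsto:
  assumes G: "filterlim G at_top sequentially"
  shows "(\<lambda>k. ioc_integral (\<kappa> z) 0 (G k)) \<longlonglongrightarrow> \<psi>0 z"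
  unfolding ioc_integral_def \<psi>0_def
proof (rule integral_dominated_convergence[where w="\<lambda>x. norm (\<kappa> z x)"])
  show "AE x in lborel. (\<lambda>k. if 0 < x \<and> x \<le> G k then \<kappa> z x else 0) \<longlonglongrightarrow> \<kappa> z x"
  proof (intro AE_I2 tendsto_eventually)
    fix x
    have "eventually (\<lambda>k. x \<le> G k) sequentially" using G by (simp add: filterlim_at_top)
    then show "eventually (\<lambda>k. (if 0 < x \<and> x \<le> G k then \<kappa> z x else 0) = \<kappa> z x) sequentially"
      by (rule eventually_mono) (auto simp: \<kappa>_nonpos not_less)
  qed
qed (auto intro: integrable_norm \<kappa>_integrable)

lemma unif_ioc: "0 \<le> a \<Longrightarrow> a \<le> b \<Longrightarrow> b \<le> T \<Longrightarrow> (\<integral>u. (if a < u \<and> u \<le> b then 1 else 0 :: complex) \<partial>unif) = complex_of_real ((b - a) / T)"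
proof -
  assume ab: "0 \<le> a" "a \<le> b" "b \<le> T"
  have i: "integrable unif (\<lambda>u. if u \<le> c then 1 else 0 :: real)" for c by (rule unif_integrable[of _ 1]) auto
  have "(\<integral>u. (if a < u \<and> u \<le> b then 1 else 0 :: complex) \<partial>unif) = (\<integral>u. complex_of_real ((if u \<le> b then 1 else 0) - (if u \<le> a then 1 else 0)) \<partial>unif)"
    using ab by (intro Bochner_Integration.integral_cong) auto
  also have "\<dots> = complex_of_real ((\<integral>u. (if u \<le> b then 1 else 0) \<partial>unif) - (\<integral>u. (if u \<le> a then 1 else 0) \<partial>unif))"
    by (simp only: integral_complex_of_real Bochner_Integration.integral_diff[OF i i])
  also have "\<dots> = complex_of_real ((b - a) / T)"
    using ab by (simp add: unif_le diff_divide_distrib)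
  finally show ?thesis .
qed

lemma AE_noise_tm: "AE s in noise_law L T. 0 < snd (snd s)"
proof -
  have "AE u in unif. 0 < u"
  proof (rule AE_uniform_measureI)
    have "AE x in lborel. x \<noteq> (0::real)" by (rule AE_lborel_singleton)
    then show "AE x in lborel. x \<in> {0..T} \<longrightarrow> 0 < x" by eventually_elim auto
  qed simp
  then have "AE u in unif. (if u \<le> 0 then 1 else 0 :: ennreal) = 0" by eventually_elim auto
  then have z: "(\<integral>\<^sup>+u. (if u \<le> 0 then 1 else 0 :: ennreal) \<partial>unif) = 0"
    by (subst nn_integral_0_iff_AE) auto
  have "(\<integral>\<^sup>+s. (if snd (snd s) \<le> 0 then 1 else 0 :: ennreal) \<partial>noise_law L T) = 0"
    by (subst nn_integral_noise) (simp_all add: z)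
  then have "AE s in noise_law L T. (if snd (snd s) \<le> 0 then 1 else 0 :: ennreal) = 0"
    by (subst (asm) nn_integral_0_iff_AE) auto
  then show ?thesis by eventually_elim (auto split: if_splits)
qed

lemma AE_tm_pos: "AE \<omega> in S. \<forall>i. 0 < tm i \<omega>"
  by (rule AE_coord[OF AE_noise_tm])

text \<open>The intervals are disjoint, so at most one summand is nonzero and a function that is 0
  at 0 can be taken inside the sum.\<close>

lemma step_function_apply:
  fixes c :: "nat \<Rightarrow> real" and y :: "nat \<Rightarrow> 'a" and K :: "'a \<Rightarrow> complex"
  assumes K0: "K 0 = 0" and mono: "\<And>j. j < n \<Longrightarrow> c j \<le> c (Suc j)"
  shows "K (\<Sum>j<n. if c j < u \<and> u \<le> c (Suc j) then y j else 0) = (\<Sum>j<n. (if c j < u \<and> u \<le> c (Suc j) then 1 else 0) * K (y j))"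
  using mono
proof (induction n)
  case (Suc n)
  show ?case
  proof (cases "c n < u \<and> u \<le> c (Suc n)")
    case True
    have le': "m \<le> n \<longrightarrow> c i \<le> c m" if "i \<le> m" for i m
      using that
    proof (induction m rule: dec_induct)
      case (step k)
      show ?case
      proof
        assume k: "Suc k \<le> n"
        then have "c i \<le> c k" using step.IH by simp
        also have "c k \<le> c (Suc k)" using Suc.prems[of k] k by simp
        finally show "c i \<le> c (Suc k)" .
      qed
    qed simp
    have le: "c i \<le> c n" if "i \<le> n" for i using le'[OF that] by simp
    have no: "\<not> (c j < u \<and> u \<le> c (Suc j))" if "j < n" for j using le[of "Suc j"] that True by auto
    have "(\<Sum>j<n. if c j < u \<and> u \<le> c (Suc j) then y j else 0) = 0"
      "(\<Sum>j<n. (if c j < u \<and> u \<le> c (Suc j) then 1 else 0) * K (y j)) = 0"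
      using no by (intro sum.neutral; force)+
    then show ?thesis using True by simp
  next
    case False
    then show ?thesis using Suc by auto
  qed
qed (simp add: K0)

lemma jump_measurable[measurable]: "jump i \<in> borel_measurable S" unfolding jump_def by measurable

lemma part_measurable[measurable]: "part n t \<in> borel_measurable S" unfolding part_def by measurable

lemma part_eq: "part n t \<omega> = (\<Sum>i<n. if tm i \<omega> \<le> cl t then jump i \<omega> else 0) - (cl t / T) *\<^sub>R ioc_integral hv 0 (real n)"
  unfolding part_def sum_subtractf scaleR_sum_right[symmetric] sum_ioc_nat ..

text \<open>The exponential martingale is taken for the step function \<theta> with value
  \<open>y j\<close> on the \<open>j\<close>-th time interval. Its compensator splits into a part
  that converges to the combination of the \<open>\<psi>0 (y j)\<close> and a drift
  \<open>\<integral> hv\<close> up to \<open>Gam k\<close>; by \<open>AE_Gam_drift\<close> the drift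
  agrees in the limit with the centering of the partial sums. Dominated convergence then turns mean
  1 into the formula.\<close>

theorem limit_increments_cf:
  fixes ts :: "nat \<Rightarrow> real" and y :: "nat \<Rightarrow> 'a"
  assumes X: "\<And>t. X t \<in> borel_measurable S"
    and lim: "AE \<omega> in S. \<forall>t. (\<lambda>k. part k t \<omega>) \<longlonglongrightarrow> X t \<omega>"
    and mono: "\<And>j. j < n \<Longrightarrow> ts j \<le> ts (Suc j)"
  shows "(\<integral>\<omega>. iexp (\<Sum>j<n. y j \<bullet> (X (ts (Suc j)) \<omega> - X (ts j) \<omega>)) \<partial>S) =
    exp (\<Sum>j<n. ((cl (ts (Suc j)) - cl (ts j)) / T) *\<^sub>R \<psi>0 (y j))"
proof -
  define c where "c j = cl (ts j)" for j
  have cm: "c j \<le> c (Suc j)" if "j < n" for j unfolding c_def by (intro cl_mono mono that)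
  define d where "d j = (c (Suc j) - c j) / T" for j
  have d0: "0 \<le> d j" if "j < n" for j using cm[OF that] T by (simp add: d_def)
  define ind where "ind j u = (if c j < u \<and> u \<le> c (Suc j) then 1 else 0 :: complex)" for j u
  have indm[measurable]: "ind j \<in> borel_measurable borel" for j unfolding ind_def by measurable
  have ind1: "norm (ind j u) \<le> 1" for j u by (simp add: ind_def)
  have indi: "(\<integral>u. ind j u \<partial>unif) = complex_of_real (d j)" if "j < n" for j
    unfolding ind_def d_def using cm[OF that] by (intro unif_ioc) (auto simp: c_def cl_bounds)
  define \<theta> where "\<theta> u = (\<Sum>j<n. if c j < u \<and> u \<le> c (Suc j) then y j else 0)" for u
  have \<theta>m[measurable]: "\<theta> \<in> borel_measurable borel" unfolding \<theta>_def by measurable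
  have app: "K (\<theta> u) = (\<Sum>j<n. ind j u * K (y j))" if "K 0 = 0" for K :: "'a \<Rightarrow> complex" and u
    unfolding \<theta>_def ind_def by (rule step_function_apply[of K, OF that]) (rule cm)
  define \<phi> where "\<phi> x = (\<integral>w. iexp (\<theta> (snd w) \<bullet> H x (fst w)) \<partial>(L \<Otimes>\<^sub>M unif))" for x
  define h where "h x = (\<Sum>j<n. d j *\<^sub>R \<kappa> (y j) x) + \<i> * complex_of_real (\<Sum>j<n. d j * (y j \<bullet> hv x))" for x
  have LUs: "sets (L \<Otimes>\<^sub>M unif) = sets (borel \<Otimes>\<^sub>M borel)" by (intro sets_pair_measure_cong) (auto simp: sets_L)
  \<comment> \<open>Averaging over the uniform time replaces the indicator of the
    \<open>j\<close>-th interval by its relative length \<open>d j\<close>; adding and subtracting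
    the truncated jump separates \<kappa> from the drift.\<close>
  have \<phi>h: "\<phi> x - 1 = h x" for x
  proof -
    define Kv where "Kv z v = iexp (z \<bullet> H x v) - 1" for z v
    have Kvm[measurable (raw)]: "(\<lambda>w. Kv (p w) (q w)) \<in> borel_measurable M"
      if "p \<in> borel_measurable M" "q \<in> borel_measurable M" for p q and M :: "'z measure"
      unfolding Kv_def using that by measurable
    have Kv2: "norm (Kv z v) \<le> 2" for z v
    proof -
      have "norm (Kv z v) \<le> norm (iexp (z \<bullet> H x v)) + norm (1::complex)" unfolding Kv_def by (rule norm_triangle_ineq4)
      then show ?thesis by (simp only: norm_exp_i_times norm_one one_add_one)
    qed
    have Kvi: "(\<integral>v. Kv z v \<partial>L) = \<kappa> z x + \<i> * complex_of_real (z \<bullet> hv x)" for z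
    proof -
      have i: "integrable L (\<lambda>v. \<i> * complex_of_real (z \<bullet> H1 x v))"
        by (intro integrable_mult_right integrable_of_real integrable_inner_right H1_integrable)
      have "(\<integral>v. Kv z v \<partial>L) = (\<integral>v. kern z x v + \<i> * complex_of_real (z \<bullet> H1 x v) \<partial>L)"
        by (intro Bochner_Integration.integral_cong) (auto simp: Kv_def kern_def)
      also have "\<dots> = \<kappa> z x + (\<integral>v. \<i> * complex_of_real (z \<bullet> H1 x v) \<partial>L)"
        unfolding \<kappa>_def by (rule Bochner_Integration.integral_add[OF kern_integrable i])
      also have "(\<integral>v. \<i> * complex_of_real (z \<bullet> H1 x v) \<partial>L) = \<i> * complex_of_real (z \<bullet> hv x)"
        using H1_integrable by (simp add: hv_def integral_complex_of_real)
      finally show ?thesis .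
    qed
    have int1: "integrable (L \<Otimes>\<^sub>M unif) (\<lambda>w. iexp (\<theta> (snd w) \<bullet> H x (fst w)))"
    proof (rule LU.P.integrable_const_bound[where B=1])
      show "AE w in L \<Otimes>\<^sub>M unif. norm (iexp (\<theta> (snd w) \<bullet> H x (fst w))) \<le> 1" by (simp only: norm_exp_i_times order_refl AE_I2)
      show "(\<lambda>w. iexp (\<theta> (snd w) \<bullet> H x (fst w))) \<in> borel_measurable (L \<Otimes>\<^sub>M unif)"
        unfolding measurable_cong_sets[OF LUs refl] by measurable
    qed
    have int2: "integrable (L \<Otimes>\<^sub>M unif) (\<lambda>w. ind j (snd w) * Kv (y j) (fst w))" for j
    proof (rule LU.P.integrable_const_bound[where B=2])
      show "AE w in L \<Otimes>\<^sub>M unif. norm (ind j (snd w) * Kv (y j) (fst w)) \<le> 2"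
        using mult_mono[OF ind1 Kv2] by (auto simp: norm_mult)
      show "(\<lambda>w. ind j (snd w) * Kv (y j) (fst w)) \<in> borel_measurable (L \<Otimes>\<^sub>M unif)"
        unfolding measurable_cong_sets[OF LUs refl] by measurable
    qed
    have "\<phi> x - 1 = (\<integral>w. iexp (\<theta> (snd w) \<bullet> H x (fst w)) - 1 \<partial>(L \<Otimes>\<^sub>M unif))"
      unfolding \<phi>_def by (subst Bochner_Integration.integral_diff[OF int1]) (simp_all add: LU.P.prob_space)
    also have "\<dots> = (\<integral>w. (\<Sum>j<n. ind j (snd w) * Kv (y j) (fst w)) \<partial>(L \<Otimes>\<^sub>M unif))"
    proof (rule Bochner_Integration.integral_cong[OF refl])
      fix w
      show "iexp (\<theta> (snd w) \<bullet> H x (fst w)) - 1 = (\<Sum>j<n. ind j (snd w) * Kv (y j) (fst w))"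
        using app[of "\<lambda>z. Kv z (fst w)" "snd w"] by (simp add: Kv_def)
    qed
    also have "\<dots> = (\<Sum>j<n. \<integral>w. ind j (snd w) * Kv (y j) (fst w) \<partial>(L \<Otimes>\<^sub>M unif))"
      by (rule Bochner_Integration.integral_sum) (rule int2)
    also have "\<dots> = (\<Sum>j<n. d j *\<^sub>R (\<kappa> (y j) x + \<i> * complex_of_real (y j \<bullet> hv x)))"
    proof (intro sum.cong refl)
      fix j assume j: "j \<in> {..<n}"
      have "(\<integral>w. ind j (snd w) * Kv (y j) (fst w) \<partial>(L \<Otimes>\<^sub>M unif)) = (\<integral>v. \<integral>u. ind j u * Kv (y j) v \<partial>unif \<partial>L)"
        using LU.integral_fst'[OF int2[of j]] by simp
      also have "\<dots> = (\<integral>v. complex_of_real (d j) * Kv (y j) v \<partial>L)"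
        using indi[of j] j by simp
      also have "\<dots> = d j *\<^sub>R (\<kappa> (y j) x + \<i> * complex_of_real (y j \<bullet> hv x))"
        by (simp only: integral_mult_right_zero Kvi scaleR_conv_of_real)
      finally show "(\<integral>w. ind j (snd w) * Kv (y j) (fst w) \<partial>(L \<Otimes>\<^sub>M unif)) = d j *\<^sub>R (\<kappa> (y j) x + \<i> * complex_of_real (y j \<bullet> hv x))" .
    qed
    also have "\<dots> = h x"
      unfolding h_def of_real_sum sum_distrib_left sum.distrib[symmetric]
      by (intro sum.cong refl) (simp add: scaleR_conv_of_real algebra_simps)
    finally show ?thesis .
  qed
  have ioch: "ioc_integral h 0 x = (\<Sum>j<n. d j *\<^sub>R ioc_integral (\<kappa> (y j)) 0 x) + \<i> * complex_of_real (\<Sum>j<n. d j * (y j \<bullet> ioc_integral hv 0 x))" for x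
  proof -
    note i1 = ioc_integrable[OF \<kappa>_measurable \<kappa>_bound, of 0 x]
    note i2 = ioc_integrable[OF hv_measurable norm_hv_1, of 0 x]
    have "ioc_integral h 0 x = (\<integral>s. (\<Sum>j<n. d j *\<^sub>R (if 0 < s \<and> s \<le> x then \<kappa> (y j) s else 0)) + \<i> * complex_of_real (\<Sum>j<n. d j * (y j \<bullet> (if 0 < s \<and> s \<le> x then hv s else 0))) \<partial>lborel)"
      unfolding ioc_integral_def by (intro Bochner_Integration.integral_cong) (auto simp: h_def)
    also have "\<dots> = (\<integral>s. (\<Sum>j<n. d j *\<^sub>R (if 0 < s \<and> s \<le> x then \<kappa> (y j) s else 0)) \<partial>lborel) + (\<integral>s. \<i> * complex_of_real (\<Sum>j<n. d j * (y j \<bullet> (if 0 < s \<and> s \<le> x then hv s else 0))) \<partial>lborel)"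
      by (intro Bochner_Integration.integral_add Bochner_Integration.integrable_sum integrable_scaleR_right i1 integrable_mult_right integrable_of_real integrable_inner_right i2)
    also have "(\<integral>s. (\<Sum>j<n. d j *\<^sub>R (if 0 < s \<and> s \<le> x then \<kappa> (y j) s else 0)) \<partial>lborel) = (\<Sum>j<n. d j *\<^sub>R ioc_integral (\<kappa> (y j)) 0 x)"
      unfolding ioc_integral_def
      by (subst Bochner_Integration.integral_sum) (intro integrable_scaleR_right i1, simp only: integral_scaleR_right)
    also have "(\<integral>s. \<i> * complex_of_real (\<Sum>j<n. d j * (y j \<bullet> (if 0 < s \<and> s \<le> x then hv s else 0))) \<partial>lborel) =
       \<i> * complex_of_real (\<integral>s. (\<Sum>j<n. d j * (y j \<bullet> (if 0 < s \<and> s \<le> x then hv s else 0))) \<partial>lborel)"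
      by (simp only: integral_mult_right_zero integral_complex_of_real)
    also have "(\<integral>s. (\<Sum>j<n. d j * (y j \<bullet> (if 0 < s \<and> s \<le> x then hv s else 0))) \<partial>lborel) = (\<Sum>j<n. \<integral>s. d j * (y j \<bullet> (if 0 < s \<and> s \<le> x then hv s else 0)) \<partial>lborel)"
      by (rule Bochner_Integration.integral_sum) (intro integrable_mult_right integrable_inner_right i2)
    also have "\<dots> = (\<Sum>j<n. d j * (y j \<bullet> ioc_integral hv 0 x))"
      unfolding ioc_integral_def using integral_inner_right[OF i2] by (simp only: integral_mult_right_zero)
    finally show ?thesis .
  qed
  \<comment> \<open>Only \<kappa> contributes to the real part, the drift being imaginary, and the
    integrals of \<kappa> are bounded uniformly in the upper limit. So \<open>C\<close> serves both
    as the lower bound for the martingale and for the domination below.\<close>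
  define C where "C = (\<Sum>j<n. d j * ((2 + (norm (y j))\<^sup>2) * (\<integral>x. m2 x \<partial>lborel)))"
  have nK: "norm (\<Sum>j<n. d j *\<^sub>R ioc_integral (\<kappa> (y j)) 0 x) \<le> C" for x
    unfolding C_def using d0 by (intro order_trans[OF norm_sum] sum_mono) (simp add: mult_left_mono norm_ioc_\<kappa>)
  have C: "Re (ioc_integral (\<lambda>x. \<phi> x - 1) 0 x) \<ge> - C" for x
    unfolding \<phi>h ioch using abs_Re_le_cmod[of "\<Sum>j<n. d j *\<^sub>R ioc_integral (\<kappa> (y j)) 0 x"] nK[of x] by simp
  \<comment> \<open>\<open>V\<close> is the exponent of the partial sums corrected from centering up
    to \<open>k\<close> to centering up to \<open>Gam k\<close>; the correction tends to 0.\<close>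
  define V where "V k \<omega> = (\<Sum>j<n. y j \<bullet> (part k (ts (Suc j)) \<omega> - part k (ts j) \<omega>)) + (\<Sum>j<n. d j * (y j \<bullet> (ioc_integral hv 0 (real k) - ioc_integral hv 0 (Gam k \<omega>))))" for k \<omega>
  define W where "W k \<omega> = (\<Sum>j<n. d j *\<^sub>R ioc_integral (\<kappa> (y j)) 0 (Gam k \<omega>))" for k \<omega>
  have V_eq: "(\<Sum>i<k. \<theta> (tm i \<omega>) \<bullet> jump i \<omega>) = V k \<omega> + (\<Sum>j<n. d j * (y j \<bullet> ioc_integral hv 0 (Gam k \<omega>)))" for k \<omega>
  proof -
    have p: "part k (ts (Suc j)) \<omega> - part k (ts j) \<omega> = (\<Sum>i<k. if c j < tm i \<omega> \<and> tm i \<omega> \<le> c (Suc j) then jump i \<omega> else 0) - d j *\<^sub>R ioc_integral hv 0 (real k)"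
      if j: "j < n" for j
    proof -
      have "(\<Sum>i<k. if tm i \<omega> \<le> c (Suc j) then jump i \<omega> else 0) - (\<Sum>i<k. if tm i \<omega> \<le> c j then jump i \<omega> else 0)
        = (\<Sum>i<k. if c j < tm i \<omega> \<and> tm i \<omega> \<le> c (Suc j) then jump i \<omega> else 0)"
        unfolding sum_subtractf[symmetric] using cm[OF j] by (intro sum.cong refl) auto
      then show ?thesis
        unfolding part_eq c_def[symmetric] d_def by (simp add: diff_divide_distrib scaleR_diff_left algebra_simps)
    qed
    have "(\<Sum>i<k. \<theta> (tm i \<omega>) \<bullet> jump i \<omega>) = (\<Sum>i<k. \<Sum>j<n. y j \<bullet> (if c j < tm i \<omega> \<and> tm i \<omega> \<le> c (Suc j) then jump i \<omega> else 0))"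
      unfolding \<theta>_def inner_sum_left by (intro sum.cong refl) auto
    also have "\<dots> = (\<Sum>j<n. y j \<bullet> (\<Sum>i<k. if c j < tm i \<omega> \<and> tm i \<omega> \<le> c (Suc j) then jump i \<omega> else 0))"
      unfolding inner_sum_right by (rule sum.swap)
    also have "\<dots> = (\<Sum>j<n. y j \<bullet> (part k (ts (Suc j)) \<omega> - part k (ts j) \<omega>) + d j * (y j \<bullet> ioc_integral hv 0 (real k)))"
      by (intro sum.cong refl) (simp add: p inner_diff_right)
    finally show ?thesis
      unfolding V_def sum.distrib[symmetric] by (rule trans) (intro sum.cong refl, simp add: inner_diff_right algebra_simps)
  qed
  have one: "(\<integral>\<omega>. iexp (V k \<omega>) * exp (- W k \<omega>) \<partial>S) = 1" for k
  proof -
    have "(\<integral>\<omega>. iexp (\<Sum>i<k. \<theta> (tm i \<omega>) \<bullet> jump i \<omega>) * exp (- ioc_integral (\<lambda>x. \<phi> x - 1) 0 (Gam k \<omega>)) \<partial>S) = 1"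
      by (rule exponential_martingale[OF \<theta>m \<phi>_def C])
    moreover have "iexp (\<Sum>i<k. \<theta> (tm i \<omega>) \<bullet> jump i \<omega>) * exp (- ioc_integral (\<lambda>x. \<phi> x - 1) 0 (Gam k \<omega>)) = iexp (V k \<omega>) * exp (- W k \<omega>)" for \<omega>
      unfolding V_eq \<phi>h ioch W_def by (simp only: exp_add[symmetric]) (simp add: distrib_left)
    ultimately show ?thesis by simp
  qed
  define Z where "Z \<omega> = (\<Sum>j<n. y j \<bullet> (X (ts (Suc j)) \<omega> - X (ts j) \<omega>))" for \<omega>
  define \<Psi> where "\<Psi> = (\<Sum>j<n. d j *\<^sub>R \<psi>0 (y j))"
  have Zm: "Z \<in> borel_measurable S" unfolding Z_def using X by (intro borel_measurable_sum borel_measurable_inner borel_measurable_diff) auto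
  have iocm: "(\<lambda>\<omega>. ioc_integral hv 0 (Gam k \<omega>)) \<in> borel_measurable S" "(\<lambda>\<omega>. ioc_integral (\<kappa> z) 0 (Gam k \<omega>)) \<in> borel_measurable S" for k z
    by (intro borel_measurable_ioc_integral; measurable)+
  have "(\<lambda>k. \<integral>\<omega>. iexp (V k \<omega>) * exp (- W k \<omega>) \<partial>S) \<longlonglongrightarrow> (\<integral>\<omega>. iexp (Z \<omega>) * exp (- \<Psi>) \<partial>S)"
  proof (rule integral_dominated_convergence[where w="\<lambda>_. exp C"])
    show "(\<lambda>\<omega>. iexp (Z \<omega>) * exp (- \<Psi>)) \<in> borel_measurable S"
      by (intro borel_measurable_times measurable_compose[OF Zm borel_measurable_iexp]) auto
    show "(\<lambda>\<omega>. iexp (V k \<omega>) * exp (- W k \<omega>)) \<in> borel_measurable S" for k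
    proof (rule borel_measurable_times)
      have "(\<lambda>\<omega>. V k \<omega>) \<in> borel_measurable S" unfolding V_def
        by (intro borel_measurable_add borel_measurable_sum borel_measurable_times borel_measurable_inner borel_measurable_diff part_measurable iocm) auto
      then show "(\<lambda>\<omega>. iexp (V k \<omega>)) \<in> borel_measurable S" by (rule measurable_compose[OF _ borel_measurable_iexp])
      have "(\<lambda>\<omega>. W k \<omega>) \<in> borel_measurable S" unfolding W_def
        by (intro borel_measurable_sum borel_measurable_scaleR iocm) auto
      then show "(\<lambda>\<omega>. exp (- W k \<omega>)) \<in> borel_measurable S" by measurable
    qed
    show "AE \<omega> in S. norm (iexp (V k \<omega>) * exp (- W k \<omega>)) \<le> exp C" for k
    proof (rule AE_I2)
      fix \<omega>
      have "norm (exp (- W k \<omega>)) \<le> exp C"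
        using abs_Re_le_cmod[of "W k \<omega>"] nK[of "Gam k \<omega>"] by (simp add: norm_exp_eq_Re W_def)
      then show "norm (iexp (V k \<omega>) * exp (- W k \<omega>)) \<le> exp C" by (simp only: norm_mult norm_exp_i_times mult_1)
    qed
    show "AE \<omega> in S. (\<lambda>k. iexp (V k \<omega>) * exp (- W k \<omega>)) \<longlonglongrightarrow> iexp (Z \<omega>) * exp (- \<Psi>)"
      using lim AE_Gam_drift[OF hv_measurable norm_hv]
    proof eventually_elim
      case (elim \<omega>)
      have neg: "(\<lambda>k. ioc_integral hv 0 (real k) - ioc_integral hv 0 (Gam k \<omega>)) \<longlonglongrightarrow> 0"
        using tendsto_minus[OF elim(2)[THEN conjunct1]] by simp
      have "(\<lambda>k. V k \<omega>) \<longlonglongrightarrow> (\<Sum>j<n. y j \<bullet> (X (ts (Suc j)) \<omega> - X (ts j) \<omega>)) + (\<Sum>j<n. d j * (y j \<bullet> 0))"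
        unfolding V_def using elim(1) by (intro tendsto_intros neg) auto
      then have "(\<lambda>k. V k \<omega>) \<longlonglongrightarrow> Z \<omega>" by (simp add: Z_def)
      moreover have "(\<lambda>k. W k \<omega>) \<longlonglongrightarrow> \<Psi>"
        unfolding W_def \<Psi>_def by (intro tendsto_intros ioc_\<kappa>_tendsto elim(2)[THEN conjunct2])
      ultimately show ?case by (intro tendsto_intros)
    qed
  qed simp
  then have "(\<lambda>k::nat. 1) \<longlonglongrightarrow> (\<integral>\<omega>. iexp (Z \<omega>) * exp (- \<Psi>) \<partial>S)" unfolding one .
  then have "(\<integral>\<omega>. iexp (Z \<omega>) * exp (- \<Psi>) \<partial>S) = 1" by (rule LIMSEQ_unique) simp
  then have "(\<integral>\<omega>. iexp (Z \<omega>) \<partial>S) * exp (- \<Psi>) = 1" by (simp only: integral_mult_left_zero)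
  then have "(\<integral>\<omega>. iexp (Z \<omega>) \<partial>S) = exp \<Psi>" by (simp add: exp_minus field_simps)
  then show ?thesis by (simp only: Z_def \<Psi>_def d_def c_def)
qed

end

section \<open>The limit as a cadlag process\<close>

lemma cadlag_uniform_limit:
  fixes f :: "nat \<Rightarrow> real \<Rightarrow> 'v::banach"
  assumes f: "\<And>n. cadlag_on UNIV (f n)" and lim: "uniform_limit UNIV f h sequentially"
  shows "cadlag_on UNIV h"
  unfolding cadlag_on_def
proof safe
  fix t
  have sub: "uniform_limit A f h sequentially" for A using uniform_limit_on_subset[OF lim] by simp
  show "(h \<longlongrightarrow> h t) (at t within UNIV \<inter> {t<..})"
  proof (rule swap_uniform_limit[where f=f and g="\<lambda>n. f n t" and F=sequentially])
    show "\<forall>\<^sub>F n in sequentially. (f n \<longlongrightarrow> f n t) (at t within UNIV \<inter> {t<..})"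
      using f by (auto simp: cadlag_on_def)
    show "(\<lambda>n. f n t) \<longlonglongrightarrow> h t" by (rule tendsto_uniform_limitI[OF lim]) simp
  qed (rule sub, simp)
  have "\<exists>l. (f n \<longlongrightarrow> l) (at_left t)" for n using f[of n] by (simp add: cadlag_on_def)
  then obtain l where l: "\<And>n. (f n \<longlongrightarrow> l n) (at_left t)" by metis
  \<comment> \<open>The left limits inherit the uniform closeness of the functions; their limit is
    the left limit of \<open>h\<close>.\<close>
  have "Cauchy l"
  proof (rule metric_CauchyI)
    fix e :: real assume e: "e > 0"
    then obtain N where N: "\<And>n s. n \<ge> N \<Longrightarrow> dist (f n s) (h s) < e / 4"
      using uniform_limitD[OF lim, of "e / 4"] by (auto simp: eventually_sequentially)
    have "dist (l m) (l n) < e" if mn: "m \<ge> N" "n \<ge> N" for m n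
    proof -
      have "((\<lambda>s. dist (f m s) (f n s)) \<longlongrightarrow> dist (l m) (l n)) (at_left t)" by (intro tendsto_dist l)
      moreover have "dist (f m s) (f n s) \<le> e / 2" for s
        using dist_triangle2[of "f m s" "f n s" "h s"] N[OF mn(1), of s] N[OF mn(2), of s] by simp
      ultimately have "dist (l m) (l n) \<le> e / 2" by (intro tendsto_upperbound) auto
      then show ?thesis using e by simp
    qed
    then show "\<exists>M. \<forall>m\<ge>M. \<forall>n\<ge>M. dist (l m) (l n) < e" by blast
  qed
  then obtain L where L: "l \<longlonglongrightarrow> L" using Cauchy_convergent_iff[of l] by (auto simp: convergent_def)
  have "(h \<longlongrightarrow> L) (at_left t)"
    by (rule swap_uniform_limit[where f=f and g=l and F=sequentially, OF _ L sub]) (use l in auto)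
  then show "\<exists>l. (h \<longlongrightarrow> l) (at t within UNIV \<inter> {..<t})" by auto
qed

context shot_noise
begin

lemma cadlag_part: "cadlag_on UNIV (\<lambda>t. part n t \<omega>)"
  unfolding part_def using T
  by (intro cadlag_on_sum cadlag_diff cadlag_step cadlag_isCont continuous_intros cl_cont) auto

text \<open>On a null set where convergence fails or some uniform time is not positive, the path is
  set to 0. The cadlag property and the value 0 up to time 0 then hold for every sample point, as
  \<open>levy_extension\<close> demands.\<close>

theorem limit_process:
  shows "\<exists>X. (\<forall>t. X t \<in> borel_measurable S) \<and> (\<forall>t \<omega>. t \<le> 0 \<longrightarrow> X t \<omega> = 0) \<and>
    (\<forall>\<omega>. cadlag_on UNIV (\<lambda>t. X t \<omega>)) \<and>
    (AE \<omega> in S. uniform_limit UNIV (\<lambda>n t. part n t \<omega>) (\<lambda>t. X t \<omega>) sequentially)"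
proof -
  have "AE \<omega> in S. (\<exists>X. uniform_limit UNIV (\<lambda>n t. part n t \<omega>) X sequentially) \<and> (\<forall>i. 0 < tm i \<omega>)"
    using AE_part_uniform_limit AE_tm_pos by eventually_elim simp
  then obtain N where N: "{\<omega> \<in> space S. \<not> ((\<exists>X. uniform_limit UNIV (\<lambda>n t. part n t \<omega>) X sequentially) \<and> (\<forall>i. 0 < tm i \<omega>))} \<subseteq> N"
      "emeasure S N = 0" "N \<in> sets S"
    by (rule AE_E)
  have good: "\<exists>X. uniform_limit UNIV (\<lambda>n t. part n t \<omega>) X sequentially" "0 < tm i \<omega>" if "\<omega> \<notin> N" for \<omega> i
    using N(1) that by (auto simp: space_S)
  define X where "X t \<omega> = lim (\<lambda>n. if \<omega> \<in> N then 0 else part n t \<omega>)" for t \<omega>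
  have Xlim: "X t \<omega> = h t" if "\<omega> \<notin> N" "uniform_limit UNIV (\<lambda>n t. part n t \<omega>) h sequentially" for t \<omega> h
    unfolding X_def using tendsto_uniform_limitI[OF that(2), of t] that(1) by (simp add: limI)
  have Xu: "uniform_limit UNIV (\<lambda>n t. part n t \<omega>) (\<lambda>t. X t \<omega>) sequentially" if nN: "\<omega> \<notin> N" for \<omega>
  proof -
    obtain h where h: "uniform_limit UNIV (\<lambda>n t. part n t \<omega>) h sequentially" using good(1)[OF nN] by blast
    have "(\<lambda>t. X t \<omega>) = h" using Xlim[OF nN h] by auto
    with h show ?thesis by simp
  qed
  have XN: "X t \<omega> = 0" if "\<omega> \<in> N" for t \<omega> using that by (simp add: X_def)
  have "X t \<in> borel_measurable S" for t
  proof -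
    have "(\<lambda>\<omega>. if \<omega> \<in> N then 0 else part n t \<omega>) \<in> borel_measurable S" for n
      using N(3) by (intro measurable_If_set) auto
    then show ?thesis unfolding X_def[abs_def] by (rule borel_measurable_lim_metric)
  qed
  moreover have "X t \<omega> = 0" if t: "t \<le> 0" for t \<omega>
  proof (cases "\<omega> \<in> N")
    case False
    have c: "cl t = 0" using t T by (simp add: cl_def)
    have "part n t \<omega> = 0" for n
      unfolding part_def c using good(2)[OF False] by (intro sum.neutral) (simp add: not_le[symmetric])
    then show ?thesis using False by (simp add: X_def)
  qed (rule XN)
  moreover have "cadlag_on UNIV (\<lambda>t. X t \<omega>)" for \<omega>
  proof (cases "\<omega> \<in> N")
    case True
    then show ?thesis by (simp add: XN cadlag_isCont)
  next
    case False
    show ?thesis by (rule cadlag_uniform_limit[OF cadlag_part Xu[OF False]])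
  qed
  moreover have "AE \<omega> in S. uniform_limit UNIV (\<lambda>n t. part n t \<omega>) (\<lambda>t. X t \<omega>) sequentially"
    using AE_not_in[of N S] N(2,3) by (auto simp: null_sets_def elim!: eventually_mono intro: Xu)
  ultimately show ?thesis by blast
qed

end

lemma shot_noise_levy:
  fixes L :: "(real ^ 'd) measure"
  assumes "shot_noise L H T"
  shows "\<exists>X. (\<forall>t. X t \<in> borel_measurable (iid_space.S (noise_law L T))) \<and> (\<forall>t \<omega>. t \<le> 0 \<longrightarrow> X t \<omega> = 0) \<and>
    (\<forall>\<omega>. cadlag_on UNIV (\<lambda>t. X t \<omega>)) \<and>
    (AE \<omega> in iid_space.S (noise_law L T). uniform_limit UNIV (\<lambda>n t. shot_noise.part L H T n t \<omega>) (\<lambda>t. X t \<omega>) sequentially) \<and>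
    incr_cf (iid_space.S (noise_law L T)) UNIV (\<lambda>t. max 0 (min T t)) X (\<lambda>y. (1 / T) *\<^sub>R shot_noise.\<psi>0 L H y)"
proof -
  interpret shot_noise L H T by fact
  obtain X where X: "\<And>t. X t \<in> borel_measurable S" "\<And>t \<omega>. t \<le> 0 \<Longrightarrow> X t \<omega> = 0"
    "\<And>\<omega>. cadlag_on UNIV (\<lambda>t. X t \<omega>)"
    and lim: "AE \<omega> in S. uniform_limit UNIV (\<lambda>n t. part n t \<omega>) (\<lambda>t. X t \<omega>) sequentially"
    using limit_process by blast
  have lim': "AE \<omega> in S. \<forall>t. (\<lambda>k. part k t \<omega>) \<longlonglongrightarrow> X t \<omega>"
    using lim by eventually_elim (auto intro: tendsto_uniform_limitI)
  have "incr_cf S UNIV (\<lambda>t. max 0 (min T t)) X (\<lambda>y. (1 / T) *\<^sub>R \<psi>0 y)"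
    unfolding incr_cf_def
  proof (intro allI impI, elim conjE)
    fix n :: nat and ts :: "nat \<Rightarrow> real" and y :: "nat \<Rightarrow> real ^ 'd"
    assume mono: "\<forall>i<n. ts i \<le> ts (Suc i)"
    have "(\<integral>\<omega>. iexp (\<Sum>j<n. y j \<bullet> (X (ts (Suc j)) \<omega> - X (ts j) \<omega>)) \<partial>S) =
       exp (\<Sum>j<n. ((cl (ts (Suc j)) - cl (ts j)) / T) *\<^sub>R \<psi>0 (y j))"
      by (rule limit_increments_cf[OF X(1) lim']) (use mono in simp)
    also have "(\<Sum>j<n. ((cl (ts (Suc j)) - cl (ts j)) / T) *\<^sub>R \<psi>0 (y j)) =
       (\<Sum>i<n. (max 0 (min T (ts (Suc i))) - max 0 (min T (ts i))) *\<^sub>R (1 / T) *\<^sub>R \<psi>0 (y i))"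
      by (intro sum.cong refl) (simp add: cl_def)
    finally show "(\<integral>\<omega>. iexp (\<Sum>i<n. y i \<bullet> (X (ts (Suc i)) \<omega> - X (ts i) \<omega>)) \<partial>S) =
      exp (\<Sum>i<n. (max 0 (min T (ts (Suc i))) - max 0 (min T (ts i))) *\<^sub>R (1 / T) *\<^sub>R \<psi>0 (y i))" .
  qed
  then show ?thesis using X lim by blast
qed

section \<open>The inverse of the tail\<close>

text \<open>The data make \<open>q\<close> measurable only on positive radii times the sphere. The
  extension by 0 is Borel on the whole space, so \<open>tail\<close> is measurable in both arguments
  while agreeing with \<open>q_tail\<close> where that matters.\<close>

definition q_ext :: "(real \<Rightarrow> real ^ 'd \<Rightarrow> real) \<Rightarrow> real \<Rightarrow> real ^ 'd \<Rightarrow> real" where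
  "q_ext q s v = (if 0 < s \<and> norm v = 1 then q s v else 0)"

definition tail :: "(real \<Rightarrow> real ^ 'd \<Rightarrow> real) \<Rightarrow> real \<Rightarrow> real ^ 'd \<Rightarrow> ennreal" where
  "tail q r v = (\<integral>\<^sup>+s. (if r \<le> s then ennreal (q_ext q s v) else 0) \<partial>lborel)"

lemma q_ext_measurable:
  assumes d: "layered_stable_data \<alpha> \<beta> \<sigma> q"
  shows "(\<lambda>(s, v). q_ext q s v) \<in> borel_measurable (borel \<Otimes>\<^sub>M borel)"
proof -
  have q: "(\<lambda>(r, \<xi>). q r \<xi>) \<in> borel_measurable (restrict_space borel {0<..} \<Otimes>\<^sub>M sphere_borel)"
    using d by (simp add: layered_stable_data_def)
  let ?A = "{0<..} \<times> sphere 0 1 :: (real \<times> (real ^ 'd)) set"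
  have A: "?A \<in> sets (borel \<Otimes>\<^sub>M borel)" by (intro pair_measureI) auto
  have "(\<lambda>p. (fst p, snd p)) \<in> restrict_space (borel \<Otimes>\<^sub>M borel) ?A \<rightarrow>\<^sub>M restrict_space borel {0<..} \<Otimes>\<^sub>M sphere_borel"
    by (intro measurable_Pair measurable_restrict_space2 measurable_restrict_space1) (auto simp: space_restrict_space space_pair_measure)
  from measurable_compose[OF this q] have "(\<lambda>(r, \<xi>). q r \<xi>) \<in> borel_measurable (restrict_space (borel \<Otimes>\<^sub>M borel) ?A)"
    by (simp add: split_beta')
  then have "(\<lambda>p. if p \<in> ?A then (\<lambda>(r, \<xi>). q r \<xi>) p else 0) \<in> borel_measurable (borel \<Otimes>\<^sub>M borel)"
    using A by (subst (asm) measurable_restrict_space_iff[where c=0]) auto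
  also have "(\<lambda>p. if p \<in> ?A then (\<lambda>(r, \<xi>). q r \<xi>) p else 0) = (\<lambda>(s, v). q_ext q s v)"
    by (auto simp: q_ext_def fun_eq_iff)
  finally show ?thesis .
qed

locale layered =
  fixes \<alpha> \<beta> :: real and \<sigma> :: "(real ^ 'd) measure" and q :: "real \<Rightarrow> real ^ 'd \<Rightarrow> real" and T :: real
  assumes data: "layered_stable_data \<alpha> \<beta> \<sigma> q" and T: "T > 0" and mass: "measure \<sigma> (sphere 0 1) > 0"
begin

lemma q_ext_meas[measurable (raw)]:
  assumes "f \<in> borel_measurable M" "g \<in> borel_measurable M" shows "(\<lambda>x. q_ext q (f x) (g x)) \<in> borel_measurable M"
  using measurable_compose[OF measurable_Pair[OF assms] q_ext_measurable[OF data]] by simp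

lemma tail_meas[measurable (raw)]:
  assumes [measurable]: "f \<in> borel_measurable M" "g \<in> borel_measurable M" shows "(\<lambda>x. tail q (f x) (g x)) \<in> borel_measurable M"
  unfolding tail_def by measurable

lemma q_tail_eq: "norm v = 1 \<Longrightarrow> 0 < r \<Longrightarrow> q_tail q r v = tail q r v"
  unfolding q_tail_def tail_def by (intro nn_integral_cong) (auto simp: q_ext_def indicator_def)

lemma q_pos: "norm v = 1 \<Longrightarrow> 0 < s \<Longrightarrow> 0 < q s v"
  using data by (auto simp: layered_stable_data_def)

lemma tail_anti: "r \<le> s \<Longrightarrow> tail q s v \<le> tail q r v"
  unfolding tail_def by (intro nn_integral_mono) auto

text \<open>The asymptotics at infinity bound \<open>q\<close> by a multiple of
  \<open>r powr (- \<beta> - 1)\<close>, which is integrable at infinity since \<beta> is positive.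
  They say nothing about smaller radii, where for exceptional directions the tail may be
  infinite.\<close>

lemma tail_finite_far:
  assumes v: "norm v = 1"
  shows "\<exists>R>0. tail q R v < \<infinity>"
proof -
  from data obtain c :: "real ^ 'd \<Rightarrow> real" where "\<forall>\<xi>\<in>sphere 0 1. (\<lambda>r. q r \<xi>) \<sim>[at_top] (\<lambda>r. c \<xi> * r powr (- \<beta> - 1))"
    unfolding layered_stable_data_def by blast
  moreover define c2 where "c2 = c v"
  ultimately have "(\<lambda>r. q r v) \<sim>[at_top] (\<lambda>r. c2 * r powr (- \<beta> - 1))" using v by simp
  then have "(\<lambda>r. q r v) \<in> O[at_top](\<lambda>r. c2 * r powr (- \<beta> - 1))" by (rule asymp_equiv_imp_bigo)
  then obtain C where C: "C > 0" "eventually (\<lambda>r. norm (q r v) \<le> C * norm (c2 * r powr (- \<beta> - 1))) at_top"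
    by (rule landau_o.bigE)
  then obtain R0 where R0: "\<And>r. r \<ge> R0 \<Longrightarrow> norm (q r v) \<le> C * norm (c2 * r powr (- \<beta> - 1))"
    by (auto simp: eventually_at_top_linorder)
  define R where "R = max R0 1"
  have \<beta>: "\<beta> > 0" using data by (simp add: layered_stable_data_def)
  define A where "A = C * \<bar>c2\<bar>"
  have A0: "A \<ge> 0" using C by (simp add: A_def)
  have "((\<lambda>x. x powr (- \<beta> - 1)) has_integral - (R powr (- \<beta> - 1 + 1)) / (- \<beta> - 1 + 1)) {R..}"
    using \<beta> by (intro has_integral_powr_to_inf) (auto simp: R_def)
  then have "((\<lambda>x. A * (if x \<in> {R..} then x powr (- \<beta> - 1) else 0)) has_integral A * (- (R powr (- \<beta> - 1 + 1)) / (- \<beta> - 1 + 1))) UNIV"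
    by (intro has_integral_mult_right) (simp only: has_integral_restrict_UNIV)
  then have "(\<integral>\<^sup>+x. ennreal (A * (if x \<in> {R..} then x powr (- \<beta> - 1) else 0)) \<partial>lborel) = ennreal (A * (- (R powr (- \<beta> - 1 + 1)) / (- \<beta> - 1 + 1)))"
    using A0 by (intro nn_integral_has_integral_lborel) auto
  moreover have "tail q R v \<le> (\<integral>\<^sup>+x. ennreal (A * (if x \<in> {R..} then x powr (- \<beta> - 1) else 0)) \<partial>lborel)"
    unfolding tail_def
  proof (rule nn_integral_mono)
    fix s
    show "(if R \<le> s then ennreal (q_ext q s v) else 0) \<le> ennreal (A * (if s \<in> {R..} then s powr (- \<beta> - 1) else 0))"
      using R0[of s] C by (auto simp: q_ext_def A_def R_def abs_mult mult.assoc intro!: ennreal_leI)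
  qed
  ultimately have "tail q R v < \<infinity>" by (simp add: order_le_less_trans)
  then show ?thesis by (intro exI[of _ R]) (auto simp: R_def)
qed

lemma tail_small:
  assumes v: "norm v = 1" and u: "u > 0"
  shows "\<exists>r>0. tail q r v < ennreal u"
proof -
  obtain R where R: "R > 0" "tail q R v < \<infinity>" using tail_finite_far[OF v] by blast
  have "(\<lambda>n. tail q (R + real n) v) \<longlonglongrightarrow> (\<integral>\<^sup>+s. 0 \<partial>(lborel :: real measure))"
    unfolding tail_def
  proof (rule nn_integral_dominated_convergence[where w="\<lambda>s. if R \<le> s then ennreal (q_ext q s v) else 0"])
    show "(\<integral>\<^sup>+s. (if R \<le> s then ennreal (q_ext q s v) else 0) \<partial>lborel) < \<infinity>" using R by (simp add: tail_def)
    show "AE s in lborel. (\<lambda>n. if R + real n \<le> s then ennreal (q_ext q s v) else 0) \<longlonglongrightarrow> 0"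
    proof (intro AE_I2 tendsto_eventually)
      fix s :: real
      have "eventually (\<lambda>n. s - R < real n) sequentially"
        using filterlim_real_sequentially by (simp add: filterlim_at_top_dense)
      then show "eventually (\<lambda>n. (if R + real n \<le> s then ennreal (q_ext q s v) else 0) = 0) sequentially"
        by (rule eventually_mono) auto
    qed
  qed auto
  then have "(\<lambda>n. tail q (R + real n) v) \<longlonglongrightarrow> 0" by simp
  from order_tendstoD(2)[OF this, of "ennreal u"] u obtain n where "tail q (R + real n) v < ennreal u"
    by (auto simp: eventually_sequentially)
  then show ?thesis using R by (intro exI[of _ "R + real n"]) auto
qed

text \<open>Right continuity, phrased by strict lower bounds because the tail may be infinite.
  Points carry no Lebesgue mass, so \<open>[r, \<infinity>)\<close> is exhausted by
  \<open>[r + 1 / n, \<infinity>)\<close>.\<close>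

lemma tail_right_cont:
  assumes u: "u < tail q r v" shows "\<exists>r'>r. u < tail q r' v"
proof -
  have ae: "AE s in lborel. s \<noteq> r" by (rule AE_lborel_singleton)
  have "tail q r v = (\<integral>\<^sup>+s. (SUP n. (if r + 1 / real (Suc n) \<le> s then ennreal (q_ext q s v) else 0)) \<partial>lborel)"
    unfolding tail_def
  proof (rule nn_integral_cong_AE)
    show "AE s in lborel. (if r \<le> s then ennreal (q_ext q s v) else 0) = (SUP n. (if r + 1 / real (Suc n) \<le> s then ennreal (q_ext q s v) else 0))"
      using ae
    proof eventually_elim
      case (elim s)
      show ?case
      proof (cases "r < s")
        case True
        then obtain n where "1 / real (Suc n) < s - r" using nat_approx_posE[of "s - r"] by auto
        then have "r + 1 / real (Suc n) \<le> s" by linarith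
        then have "(SUP n. (if r + 1 / real (Suc n) \<le> s then ennreal (q_ext q s v) else 0)) = ennreal (q_ext q s v)"
          by (intro antisym SUP_least SUP_upper2[of n]) auto
        then show ?thesis using True by simp
      next
        case False
        have "\<not> r + 1 / real (Suc n) \<le> s" for n
        proof -
          have "0 < 1 / real (Suc n)" by simp
          with False show ?thesis by linarith
        qed
        then show ?thesis using False elim by simp
      qed
    qed
  qed
  also have "\<dots> = (SUP n. tail q (r + 1 / real (Suc n)) v)"
    unfolding tail_def
  proof (rule nn_integral_monotone_convergence_SUP)
    show "incseq (\<lambda>n s. if r + 1 / real (Suc n) \<le> s then ennreal (q_ext q s v) else 0)"
    proof (rule incseq_SucI, rule le_funI)
      fix n s
      have "1 / real (Suc (Suc n)) \<le> 1 / real (Suc n)" by (intro divide_left_mono) auto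
      then show "(if r + 1 / real (Suc n) \<le> s then ennreal (q_ext q s v) else 0) \<le> (if r + 1 / real (Suc (Suc n)) \<le> s then ennreal (q_ext q s v) else 0)"
        by (auto simp del: of_nat_Suc)
    qed
  qed measurable
  finally obtain n where "u < tail q (r + 1 / real (Suc n)) v" using u by (auto simp: less_SUP_iff)
  then show ?thesis by (intro exI[of _ "r + 1 / real (Suc n)"]) auto
qed

text \<open>Positivity of \<open>q\<close> excludes flat pieces of the tail; these would be the
  jumps of its generalised inverse.\<close>

lemma tail_strict:
  assumes v: "norm v = 1" and r: "0 < r" "r < s" and fin: "tail q s v < \<infinity>"
  shows "tail q s v < tail q r v"
proof -
  let ?I = "\<integral>\<^sup>+x. (if r \<le> x \<and> x < s then ennreal (q_ext q x v) else 0) \<partial>lborel"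
  have "tail q r v = (\<integral>\<^sup>+x. (if r \<le> x \<and> x < s then ennreal (q_ext q x v) else 0) + (if s \<le> x then ennreal (q_ext q x v) else 0) \<partial>lborel)"
    unfolding tail_def using r by (intro nn_integral_cong) auto
  also have "\<dots> = ?I + tail q s v"
    unfolding tail_def by (intro nn_integral_add) measurable
  finally have eq: "tail q r v = ?I + tail q s v" .
  have "?I \<noteq> 0"
  proof
    assume "?I = 0"
    then have "AE x in lborel. (if r \<le> x \<and> x < s then ennreal (q_ext q x v) else 0) = 0"
      by (subst (asm) nn_integral_0_iff_AE) auto
    then have ae: "AE x in lborel. x \<notin> {r..<s}"
    proof eventually_elim
      case (elim x)
      then show ?case using q_pos[OF v, of x] r v by (auto simp: q_ext_def split: if_splits)
    qed
    then have "emeasure lborel {r..<s} = 0"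
      by (subst AE_iff_measurable[symmetric, where N="{r..<s}"]) auto
    then show False using r by simp
  qed
  then have "tail q s v + 0 < tail q s v + ?I"
    unfolding ennreal_add_left_cancel_less using fin by (simp add: zero_less_iff_neq_zero less_top)
  then show ?thesis unfolding eq by (simp add: add.commute)
qed

abbreviation "qi u v \<equiv> q_inverse q u v"

lemma qi_set: "norm v = 1 \<Longrightarrow> {r. r > 0 \<and> q_tail q r v < ennreal u} = {r. r > 0 \<and> tail q r v < ennreal u}"
  by (auto simp: q_tail_eq)

lemma qi_less_iff:
  assumes v: "norm v = 1" and u: "u > 0"
  shows "qi u v < r \<longleftrightarrow> (\<exists>r'. 0 < r' \<and> r' < r \<and> tail q r' v < ennreal u)"
proof -
  have "{r. r > 0 \<and> tail q r v < ennreal u} \<noteq> {}" using tail_small[OF v u] by auto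
  moreover have "bdd_below {r. r > 0 \<and> tail q r v < ennreal u}" by (rule bdd_belowI[of _ 0]) auto
  ultimately show ?thesis
    unfolding q_inverse_def qi_set[OF v] by (subst cInf_less_iff) auto
qed

lemma qi_nonneg:
  assumes v: "norm v = 1" and u: "u > 0" shows "0 \<le> qi u v"
  using qi_less_iff[OF v u, of 0] by (metis less_trans not_less less_irrefl)

lemma qi_anti:
  assumes v: "norm v = 1" and u: "0 < u" "u \<le> u'" shows "qi u' v \<le> qi u v"
proof (rule ccontr)
  assume "\<not> qi u' v \<le> qi u v"
  then obtain r where "0 < r" "r < qi u' v" "tail q r v < ennreal u"
    using qi_less_iff[OF v u(1), of "qi u' v"] by auto
  moreover have "ennreal u \<le> ennreal u'" using u by (intro ennreal_leI)
  ultimately show False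
    using qi_less_iff[of v u' "qi u' v"] v u by (metis less_irrefl less_le_trans order_less_le_trans)
qed

text \<open>Together with \<open>qi_le\<close> this identifies the levels at which the inverse
  exceeds \<open>r\<close> as the interval from 0 to \<open>tail q r v\<close>, up to its end
  point.\<close>

lemma qi_greater: "norm v = 1 \<Longrightarrow> u > 0 \<Longrightarrow> 0 < r \<Longrightarrow> ennreal u < tail q r v \<Longrightarrow> r < qi u v"
proof -
  assume a: "norm v = 1" "u > 0" "0 < r" "ennreal u < tail q r v"
  obtain r' where r': "r' > r" "ennreal u < tail q r' v" using tail_right_cont[OF a(4)] by blast
  have "\<not> qi u v < r'"
  proof
    assume "qi u v < r'"
    then obtain s where s: "s < r'" "tail q s v < ennreal u" using qi_less_iff[OF a(1,2)] by auto
    have "tail q r' v \<le> tail q s v" using s by (intro tail_anti) simp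
    then show False using s r' by (meson less_asym le_less_trans)
  qed
  then show "r < qi u v" using r' by linarith
qed

lemma qi_le: "norm v = 1 \<Longrightarrow> u > 0 \<Longrightarrow> 0 < r \<Longrightarrow> r < qi u v \<Longrightarrow> ennreal u \<le> tail q r v"
  using qi_less_iff[of v u "qi u v"] by (metis less_irrefl not_le)

lemma qi_cont:
  assumes v: "norm v = 1" and u: "u > 0" shows "isCont (\<lambda>u. qi u v) u"
  unfolding isCont_def
proof (rule order_tendstoI)
  fix a assume a: "a < qi u v"
  have up: "eventually (\<lambda>u'. u' > 0) (at u)" using order_tendstoD(1)[OF tendsto_ident_at u] .
  show "eventually (\<lambda>u'. a < qi u' v) (at u)"
  proof (cases "a < 0")
    case True
    show ?thesis using up by eventually_elim (use qi_nonneg[OF v] True in \<open>auto intro: less_le_trans\<close>)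
  next
    case False
    \<comment> \<open>Two intermediate radii are needed: at the larger one only
      \<open>u \<le> tail q s v\<close> is known, and strict decrease down to the smaller one makes
      the inequality strict, hence stable under small changes of \<open>u\<close>. If the tail at
      \<open>s\<close> is infinite, strictness is automatic.\<close>
    define s where "s = (a + qi u v) / 2"
    define r where "r = (a + s) / 2"
    have rs: "a < r" "r < s" "s < qi u v" "0 < r" "0 < s" using a False by (auto simp: r_def s_def field_simps)
    have "ennreal u \<le> tail q s v" using qi_le[OF v u] rs by simp
    moreover have "tail q s v < tail q r v \<or> tail q s v = \<infinity>" using tail_strict[OF v rs(4,2)] by (cases "tail q s v < \<infinity>") (auto simp: top.not_eq_extremum)
    moreover have "tail q s v \<le> tail q r v" using rs by (intro tail_anti) simp
    ultimately have lt: "ennreal u < tail q r v"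
      by (metis ennreal_less_top infinity_ennreal_def le_less_trans less_le_trans order_le_less)
    have "eventually (\<lambda>u'. ennreal u' < tail q r v) (at u)"
      by (rule order_tendstoD(2)[OF tendsto_ennrealI[OF tendsto_ident_at] lt])
    then show ?thesis using up
    proof eventually_elim
      case (elim u')
      show ?case using qi_greater[OF v elim(2) rs(4) elim(1)] rs by linarith
    qed
  qed
next
  fix b assume b: "qi u v < b"
  then obtain r where r: "0 < r" "r < b" "tail q r v < ennreal u" using qi_less_iff[OF v u] by blast
  have up: "eventually (\<lambda>u'. u' > 0) (at u)" using order_tendstoD(1)[OF tendsto_ident_at u] .
  have "eventually (\<lambda>u'. tail q r v < ennreal u') (at u)"
    by (rule order_tendstoD(1)[OF tendsto_ennrealI[OF tendsto_ident_at] r(3)])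
  then show "eventually (\<lambda>u'. qi u' v < b) (at u)" using up
    by eventually_elim (use r qi_less_iff[OF v] in blast)
qed

section \<open>Measurability of the inverse and change of variables\<close>

definition qi0 :: "real \<Rightarrow> real ^ 'd \<Rightarrow> real" where
  "qi0 u v = (if 0 < u \<and> norm v = 1 then qi u v else 0)"

text \<open>Since the tail is monotone, the radius in \<open>qi_less_iff\<close> may be taken
  rational, which leaves a countable union.\<close>

lemma qi0_measurable: "(\<lambda>(u, v). qi0 u v) \<in> borel_measurable (borel \<Otimes>\<^sub>M borel)"
proof (rule borel_measurableI_less)
  fix r :: real
  have "{x \<in> space (borel \<Otimes>\<^sub>M borel). (case x of (u, v) \<Rightarrow> qi0 u v) < r} =
    {x. 0 < fst x \<and> norm (snd x :: real ^ 'd) = 1 \<and> (\<exists>r'::rat. 0 < real_of_rat r' \<and> real_of_rat r' < r \<and> tail q (real_of_rat r') (snd x) < ennreal (fst x))}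
     \<union> {x. \<not> (0 < fst x \<and> norm (snd x) = 1) \<and> 0 < r}" (is "?L = ?R")
  proof -
    have "qi u v < r \<longleftrightarrow> (\<exists>r'::rat. 0 < real_of_rat r' \<and> real_of_rat r' < r \<and> tail q (real_of_rat r') v < ennreal u)"
      if u: "0 < u" and v: "norm v = 1" for u v
    proof
      assume "qi u v < r"
      then obtain r' where r': "0 < r'" "r' < r" "tail q r' v < ennreal u" using qi_less_iff[OF v u] by blast
      obtain p :: rat where p: "r' < real_of_rat p" "real_of_rat p < r" using of_rat_dense[OF r'(2)] by blast
      have "tail q (real_of_rat p) v \<le> tail q r' v" using p by (intro tail_anti) simp
      then show "\<exists>r'::rat. 0 < real_of_rat r' \<and> real_of_rat r' < r \<and> tail q (real_of_rat r') v < ennreal u"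
        using le_less_trans[of "tail q (real_of_rat p) v" "tail q r' v" "ennreal u"] less_trans[OF r'(1) p(1)] r' p by blast
    qed (use qi_less_iff[OF v u] in blast)
    then show ?thesis by (auto simp: qi0_def space_pair_measure split: if_splits)
  qed
  moreover have "?R \<in> sets (borel \<Otimes>\<^sub>M borel)"
  proof -
    have "{x \<in> space (borel \<Otimes>\<^sub>M borel). 0 < fst x \<and> norm (snd x :: real ^ 'd) = 1 \<and> (\<exists>r'::rat. 0 < real_of_rat r' \<and> real_of_rat r' < r \<and> tail q (real_of_rat r') (snd x) < ennreal (fst x))}
     \<union> {x \<in> space (borel \<Otimes>\<^sub>M borel). \<not> (0 < fst x \<and> norm (snd x) = 1) \<and> 0 < r} \<in> sets (borel \<Otimes>\<^sub>M borel)"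
      by measurable
    then show ?thesis by (simp add: space_pair_measure)
  qed
  ultimately show "{x \<in> space (borel \<Otimes>\<^sub>M borel). (case x of (u, v) \<Rightarrow> qi0 u v) < r} \<in> sets (borel \<Otimes>\<^sub>M borel)" by simp
qed

lemma qi0_meas[measurable (raw)]:
  assumes "f \<in> borel_measurable M" "g \<in> borel_measurable M" shows "(\<lambda>x. qi0 (f x) (g x)) \<in> borel_measurable M"
  using measurable_compose[OF measurable_Pair[OF assms] qi0_measurable] by simp

text \<open>The inverse tail carries Lebesgue measure on the positive half-line to the measure with
  density \<open>q\<close>, apart from the origin, where \<open>F\<close> vanishes. Both measures
  may be infinite near 0, so they are first compared above a threshold \<epsilon>, where all upper
  half-lines have finite mass.\<close>

lemma nn_integral_qi:
  assumes v: "norm v = 1" and fin: "\<And>r. r > 0 \<Longrightarrow> tail q r v < \<infinity>"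
    and F[measurable]: "F \<in> borel_measurable borel" and F0: "F 0 = 0"
  shows "(\<integral>\<^sup>+u. (if 0 < u then F (qi0 u v) else 0) \<partial>lborel) = (\<integral>\<^sup>+s. F s * ennreal (q_ext q s v) \<partial>lborel)"
proof -
  have lev: "emeasure lborel {u. 0 < u \<and> r < qi0 u v} = tail q r v" if r: "r > 0" for r
  proof -
    let ?t = "enn2real (tail q r v)"
    have t: "tail q r v = ennreal ?t" using fin[OF r] by simp
    \<comment> \<open>The level set is squeezed between the open and the closed interval from 0 to
      the tail, which have the same length.\<close>
    have sub: "{0<..<?t} \<subseteq> {u. 0 < u \<and> r < qi0 u v}" "{u. 0 < u \<and> r < qi0 u v} \<subseteq> {0..?t}"
    proof -
      show "{0<..<?t} \<subseteq> {u. 0 < u \<and> r < qi0 u v}"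
      proof safe
        fix u assume u: "u \<in> {0<..<?t}"
        then have "ennreal u < tail q r v" by (subst t) (simp add: ennreal_less_iff)
        then show "r < qi0 u v" using qi_greater[OF v _ r, of u] u v by (simp add: qi0_def)
      qed simp
      show "{u. 0 < u \<and> r < qi0 u v} \<subseteq> {0..?t}"
      proof safe
        fix u assume u: "0 < u" "r < qi0 u v"
        then have "ennreal u \<le> tail q r v" using qi_le[OF v u(1) r] v by (simp add: qi0_def)
        then show "u \<in> {0..?t}" using u by (subst (asm) t) simp
      qed
    qed
    have m: "{u. 0 < u \<and> r < qi0 u v} \<in> sets lborel"
    proof -
      have "{u \<in> space lborel. 0 < u \<and> r < qi0 u v} \<in> sets lborel" by measurable
      then show ?thesis by simp
    qed
    have "emeasure lborel {0<..<?t} \<le> emeasure lborel {u. 0 < u \<and> r < qi0 u v}" by (intro emeasure_mono sub m)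
    moreover have "emeasure lborel {u. 0 < u \<and> r < qi0 u v} \<le> emeasure lborel {0..?t}" by (intro emeasure_mono sub) simp
    ultimately show ?thesis by (subst t) simp
  qed
  have taileq: "(\<integral>\<^sup>+s. (if r < s then ennreal (q_ext q s v) else 0) \<partial>lborel) = tail q r v" for r
    unfolding tail_def
  proof (rule nn_integral_cong_AE)
    have "AE s in lborel. s \<noteq> r" by (rule AE_lborel_singleton)
    then show "AE s in lborel. (if r < s then ennreal (q_ext q s v) else 0) = (if r \<le> s then ennreal (q_ext q s v) else 0)"
      by eventually_elim auto
  qed
  have eps: "(\<integral>\<^sup>+u. (if 0 < u \<and> \<epsilon> < qi0 u v then F (qi0 u v) else 0) \<partial>lborel) = (\<integral>\<^sup>+s. (if \<epsilon> < s then F s * ennreal (q_ext q s v) else 0) \<partial>lborel)"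
    if \<epsilon>: "\<epsilon> > 0" for \<epsilon>
  proof -
    define M1 where "M1 = distr (density lborel (\<lambda>u. if 0 < u \<and> \<epsilon> < qi0 u v then 1 else 0)) borel (\<lambda>u. qi0 u v)"
    define M2 where "M2 = density lborel (\<lambda>s. if \<epsilon> < s then ennreal (q_ext q s v) else 0)"
    have e1: "emeasure M1 {x<..} = tail q (max \<epsilon> x) v" for x
    proof -
      have "emeasure M1 {x<..} = emeasure (density lborel (\<lambda>u. if 0 < u \<and> \<epsilon> < qi0 u v then 1 else 0)) {u. x < qi0 u v}"
        unfolding M1_def by (subst emeasure_distr) (auto simp: vimage_def)
      also have "\<dots> = (\<integral>\<^sup>+u. (if 0 < u \<and> \<epsilon> < qi0 u v then 1 else 0) * indicator {u. x < qi0 u v} u \<partial>lborel)"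
      proof (rule emeasure_density)
        have "{u \<in> space lborel. x < qi0 u v} \<in> sets lborel" by measurable
        then show "{u. x < qi0 u v} \<in> sets lborel" by simp
      qed measurable
      also have "\<dots> = (\<integral>\<^sup>+u. indicator {u. 0 < u \<and> max \<epsilon> x < qi0 u v} u \<partial>lborel)"
        by (intro nn_integral_cong) (auto simp: indicator_def)
      also have "\<dots> = emeasure lborel {u. 0 < u \<and> max \<epsilon> x < qi0 u v}"
      proof (rule nn_integral_indicator)
        have "{u \<in> space lborel. 0 < u \<and> max \<epsilon> x < qi0 u v} \<in> sets lborel" by measurable
        then show "{u. 0 < u \<and> max \<epsilon> x < qi0 u v} \<in> sets lborel" by simp
      qed
      also have "\<dots> = tail q (max \<epsilon> x) v" using \<epsilon> by (intro lev) simp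
      finally show ?thesis .
    qed
    have e2: "emeasure M2 {x<..} = tail q (max \<epsilon> x) v" for x
    proof -
      have "emeasure M2 {x<..} = (\<integral>\<^sup>+s. (if max \<epsilon> x < s then ennreal (q_ext q s v) else 0) \<partial>lborel)"
        unfolding M2_def by (subst emeasure_density) (auto intro!: nn_integral_cong simp: indicator_def)
      then show ?thesis by (simp only: taileq)
    qed
    have "M1 = M2"
    proof (rule measure_eqI_lessThan)
      show "emeasure M1 {x<..} < \<infinity>" for x unfolding e1 using \<epsilon> by (intro fin) simp
    qed (simp_all add: e1 e2, simp_all add: M1_def M2_def)
    then have "(\<integral>\<^sup>+x. F x \<partial>M1) = (\<integral>\<^sup>+x. F x \<partial>M2)" by simp
    moreover have "(\<integral>\<^sup>+x. F x \<partial>M1) = (\<integral>\<^sup>+u. (if 0 < u \<and> \<epsilon> < qi0 u v then F (qi0 u v) else 0) \<partial>lborel)"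
      unfolding M1_def by (subst nn_integral_distr, simp, simp, subst nn_integral_density) (auto intro!: nn_integral_cong)
    moreover have "(\<integral>\<^sup>+x. F x \<partial>M2) = (\<integral>\<^sup>+s. (if \<epsilon> < s then F s * ennreal (q_ext q s v) else 0) \<partial>lborel)"
      unfolding M2_def by (subst nn_integral_density) (auto intro!: nn_integral_cong simp: mult.commute)
    ultimately show ?thesis by simp
  qed
  \<comment> \<open>The thresholds \<open>e n\<close> decrease to 0 and monotone convergence removes
    the restriction on both sides.\<close>
  define e where "e n = 1 / real (Suc n)" for n
  have e0: "e n > 0" for n by (simp add: e_def)
  have edec: "e (Suc n) \<le> e n" for n unfolding e_def by (intro divide_left_mono) auto
  have esmall: "\<exists>n. e n < x" if "x > 0" for x using nat_approx_posE[OF that] by (auto simp: e_def)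
  have sup: "(SUP n. (if e n < x then c else 0)) = (if 0 < x then c else (0::ennreal))" for x c
  proof (cases "0 < x")
    case True
    obtain n where n: "e n < x" using esmall[OF True] by blast
    have "(SUP n. (if e n < x then c else 0)) = c"
      by (intro antisym SUP_least SUP_upper2[of n]) (use n in auto)
    then show ?thesis using True by simp
  next
    case False
    then have "\<not> e n < x" for n using e0[of n] by linarith
    then show ?thesis using False by simp
  qed
  have inc: "(if e n < x then c else 0) \<le> (if e (Suc n) < x then c else (0::ennreal))" for n x c
    using edec[of n] by auto
  have "(\<integral>\<^sup>+u. (if 0 < u then F (qi0 u v) else 0) \<partial>lborel) = (\<integral>\<^sup>+u. (SUP n. if e n < qi0 u v then (if 0 < u then F (qi0 u v) else 0) else 0) \<partial>lborel)"
  proof (rule nn_integral_cong)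
    fix u
    show "(if 0 < u then F (qi0 u v) else 0) = (SUP n. if e n < qi0 u v then (if 0 < u then F (qi0 u v) else 0) else 0)"
      unfolding sup using qi_nonneg[OF v, of u] v F0 by (auto simp: qi0_def le_less)
  qed
  also have "\<dots> = (SUP n. \<integral>\<^sup>+u. (if e n < qi0 u v then (if 0 < u then F (qi0 u v) else 0) else 0) \<partial>lborel)"
    by (intro nn_integral_monotone_convergence_SUP incseq_SucI le_funI inc) measurable
  also have "\<dots> = (SUP n. \<integral>\<^sup>+s. (if e n < s then F s * ennreal (q_ext q s v) else 0) \<partial>lborel)"
  proof (rule SUP_cong[OF refl])
    fix n
    have "(\<integral>\<^sup>+u. (if e n < qi0 u v then (if 0 < u then F (qi0 u v) else 0) else 0) \<partial>lborel) = (\<integral>\<^sup>+u. (if 0 < u \<and> e n < qi0 u v then F (qi0 u v) else 0) \<partial>lborel)"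
      by (intro nn_integral_cong) auto
    then show "(\<integral>\<^sup>+u. (if e n < qi0 u v then (if 0 < u then F (qi0 u v) else 0) else 0) \<partial>lborel) = (\<integral>\<^sup>+s. (if e n < s then F s * ennreal (q_ext q s v) else 0) \<partial>lborel)"
      using eps[OF e0[of n]] by simp
  qed
  also have "\<dots> = (\<integral>\<^sup>+s. (SUP n. if e n < s then F s * ennreal (q_ext q s v) else 0) \<partial>lborel)"
    by (intro nn_integral_monotone_convergence_SUP[symmetric] incseq_SucI le_funI inc) measurable
  also have "\<dots> = (\<integral>\<^sup>+s. F s * ennreal (q_ext q s v) \<partial>lborel)"
    unfolding sup by (intro nn_integral_cong) (auto simp: q_ext_def)
  finally show ?thesis .
qed

section \<open>The Levy measure in polar coordinates\<close>

definition mass :: real where "mass = measure \<sigma> (sphere 0 1)"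
definition dir_law :: "(real ^ 'd) measure" where
  "dir_law = distr (scale_measure (1 / emeasure \<sigma> (sphere 0 1)) \<sigma>) borel (\<lambda>x. x)"
definition rate :: real where "rate = T * mass"
definition shot :: "real \<Rightarrow> real ^ 'd \<Rightarrow> real ^ 'd" where "shot x v = qi0 (x / rate) v *\<^sub>R v"
abbreviation \<nu> :: "(real ^ 'd) measure" where "\<nu> \<equiv> layered_levy_measure \<sigma> q"

lemma sets_\<sigma>: "sets \<sigma> = sets sphere_borel" and fin_\<sigma>: "finite_measure \<sigma>"
  using data by (simp_all add: layered_stable_data_def)

sublocale \<sigma>: finite_measure \<sigma> by (rule fin_\<sigma>)

lemma space_\<sigma>: "space \<sigma> = sphere 0 1"
  using sets_eq_imp_space_eq[OF sets_\<sigma>] by (simp add: space_restrict_space)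

lemma mass_pos: "mass > 0" using mass by (simp add: mass_def)
lemma rate_pos: "rate > 0" using mass_pos T by (simp add: rate_def)

lemma emeasure_sphere: "emeasure \<sigma> (sphere 0 1) = ennreal mass"
  by (simp add: mass_def \<sigma>.emeasure_eq_measure)

lemma id_measurable_\<sigma>: "(\<lambda>x. x) \<in> \<sigma> \<rightarrow>\<^sub>M borel"
  by (subst measurable_cong_sets[OF sets_\<sigma> refl]) (simp add: measurable_restrict_space1)

lemma id_measurable_scaled: "(\<lambda>x. x) \<in> scale_measure c \<sigma> \<rightarrow>\<^sub>M borel"
  by (subst measurable_cong_sets[OF sets_scale_measure refl]) (rule id_measurable_\<sigma>)

lemma sets_dir_law: "sets dir_law = sets borel" by (simp add: dir_law_def)

lemma nn_integral_dir_law: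
  assumes f: "f \<in> borel_measurable borel"
  shows "(\<integral>\<^sup>+v. f v \<partial>dir_law) = ennreal (1 / mass) * (\<integral>\<^sup>+v. f v \<partial>\<sigma>)"
proof -
  have f\<sigma>: "f \<in> borel_measurable \<sigma>" using measurable_compose[OF id_measurable_\<sigma> f] by simp
  have "1 / ennreal mass = ennreal (1 / mass)" using mass_pos by (simp add: divide_ennreal[symmetric] ennreal_1[symmetric] del: ennreal_1)
  then show ?thesis
    unfolding dir_law_def using f f\<sigma>
    by (subst nn_integral_distr[OF id_measurable_scaled]) (simp_all add: nn_integral_scale_measure emeasure_sphere)
qed

lemma prob_dir_law: "prob_space dir_law"
proof (rule prob_spaceI)
  have "emeasure dir_law (space dir_law) = (\<integral>\<^sup>+v. 1 \<partial>dir_law)" by simp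
  also have "\<dots> = ennreal (1 / mass) * (\<integral>\<^sup>+v. 1 \<partial>\<sigma>)" by (rule nn_integral_dir_law) simp
  also have "\<dots> = ennreal (1 / mass) * ennreal mass" by (simp add: space_\<sigma> emeasure_sphere)
  also have "\<dots> = 1" using mass_pos by (simp add: ennreal_mult[symmetric])
  finally show "emeasure dir_law (space dir_law) = 1" .
qed

lemma sigma_nn_integral_cong: "(\<And>v. norm v = 1 \<Longrightarrow> f v = g v) \<Longrightarrow> (\<integral>\<^sup>+v. f v \<partial>\<sigma>) = (\<integral>\<^sup>+v. g v \<partial>\<sigma>)"
  by (intro nn_integral_cong) (simp add: space_\<sigma>)

lemma sets_\<nu>: "sets \<nu> = sets (restrict_space borel (- {0}))"
  unfolding layered_levy_measure_def
  using sets.sigma_sets_eq[of "restrict_space borel (- {0 :: real ^ 'd})"]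
    sets.space_closed[of "restrict_space borel (- {0 :: real ^ 'd})"]
  by (subst sets_measure_of) (simp_all add: space_restrict_space)

lemma sets_\<nu>_iff: "A \<in> sets \<nu> \<longleftrightarrow> A \<in> sets borel \<and> 0 \<notin> A"
proof -
  have "- {0 :: real ^ 'd} \<inter> space borel \<in> sets borel" by simp
  from sets_restrict_space_iff[OF this, of A] show ?thesis by (auto simp: sets_\<nu>)
qed

lemma measurable_\<nu>: "f \<in> borel \<rightarrow>\<^sub>M N \<Longrightarrow> f \<in> \<nu> \<rightarrow>\<^sub>M N"
  by (subst measurable_cong_sets[OF sets_\<nu> refl]) (rule measurable_restrict_space1)

text \<open>The Levy measure as an image measure on the whole space rather than on the punctured
  one. It has no mass at the origin because \<open>q_ext\<close> is 0 at radius 0.\<close>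

definition polar :: "(real ^ 'd) measure" where
  "polar = distr (density (\<sigma> \<Otimes>\<^sub>M lborel) (\<lambda>p. ennreal (q_ext q (snd p) (fst p)))) borel (\<lambda>p. snd p *\<^sub>R fst p)"

lemma fst_measurable_\<sigma>: "fst \<in> \<sigma> \<Otimes>\<^sub>M lborel \<rightarrow>\<^sub>M borel"
  using measurable_compose[OF measurable_fst id_measurable_\<sigma>, of lborel] by simp

lemma nn_integral_polar:
  assumes F[measurable]: "F \<in> borel_measurable borel"
  shows "(\<integral>\<^sup>+z. F z \<partial>polar) = (\<integral>\<^sup>+v. \<integral>\<^sup>+s. F (s *\<^sub>R v) * ennreal (q_ext q s v) \<partial>lborel \<partial>\<sigma>)"
proof -
  note [measurable] = fst_measurable_\<sigma>
  have "(\<integral>\<^sup>+z. F z \<partial>polar) = (\<integral>\<^sup>+p. F (snd p *\<^sub>R fst p) * ennreal (q_ext q (snd p) (fst p)) \<partial>(\<sigma> \<Otimes>\<^sub>M lborel))"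
    unfolding polar_def
    by (subst nn_integral_distr, simp, simp, subst nn_integral_density) (auto simp: mult.commute)
  also have "\<dots> = (\<integral>\<^sup>+v. \<integral>\<^sup>+s. F (s *\<^sub>R v) * ennreal (q_ext q s v) \<partial>lborel \<partial>\<sigma>)"
    by (subst lborel.nn_integral_fst[symmetric]) simp_all
  finally show ?thesis .
qed

lemma \<nu>_eq_polar: "\<nu> = restrict_space polar (- {0})"
proof (rule measure_eqI)
  show "sets \<nu> = sets (restrict_space polar (- {0}))"
    unfolding sets_\<nu> by (intro sets_restrict_space_cong) (simp add: polar_def)
  fix A assume "A \<in> sets \<nu>"
  then have A: "A \<in> sets borel" "0 \<notin> A" by (simp_all add: sets_\<nu>_iff)
  have "emeasure (restrict_space polar (- {0})) A = emeasure polar A"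
    by (rule emeasure_restrict_space) (use A in \<open>auto simp: polar_def\<close>)
  also have "\<dots> = (\<integral>\<^sup>+z. indicator A z \<partial>polar)" using A by (simp add: polar_def)
  also have "\<dots> = (\<integral>\<^sup>+v. \<integral>\<^sup>+s. indicator A (s *\<^sub>R v) * ennreal (q_ext q s v) \<partial>lborel \<partial>\<sigma>)"
    using A by (intro nn_integral_polar) simp
  also have "\<dots> = (\<integral>\<^sup>+v. (\<integral>\<^sup>+r \<in> {0<..}. indicator A (r *\<^sub>R v) * ennreal (q r v) \<partial>lborel) \<partial>\<sigma>)"
    by (rule sigma_nn_integral_cong, rule nn_integral_cong) (auto simp: q_ext_def indicator_def)
  also have "\<dots> = emeasure \<nu> A"
    using emeasure_layered_levy_measure[OF data A] by simp
  finally show "emeasure \<nu> A = emeasure (restrict_space polar (- {0})) A" by simp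
qed

lemma nn_integral_\<nu>:
  assumes F[measurable]: "F \<in> borel_measurable borel"
  shows "(\<integral>\<^sup>+z. F z \<partial>\<nu>) = (\<integral>\<^sup>+v. \<integral>\<^sup>+s. F (s *\<^sub>R v) * ennreal (q_ext q s v) \<partial>lborel \<partial>\<sigma>)"
proof -
  have "(\<integral>\<^sup>+z. F z \<partial>\<nu>) = (\<integral>\<^sup>+z. F z * indicator (- {0}) z \<partial>polar)"
    unfolding \<nu>_eq_polar by (rule nn_integral_restrict_space) (simp add: polar_def)
  also have "\<dots> = (\<integral>\<^sup>+v. \<integral>\<^sup>+s. F (s *\<^sub>R v) * indicator (- {0}) (s *\<^sub>R v) * ennreal (q_ext q s v) \<partial>lborel \<partial>\<sigma>)"
    by (rule nn_integral_polar) simp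
  also have "\<dots> = (\<integral>\<^sup>+v. \<integral>\<^sup>+s. F (s *\<^sub>R v) * ennreal (q_ext q s v) \<partial>lborel \<partial>\<sigma>)"
    by (rule sigma_nn_integral_cong, rule nn_integral_cong) (auto simp: q_ext_def indicator_def)
  finally show ?thesis .
qed

lemma levy_condition: "(\<integral>\<^sup>+z. ennreal ((min 1 (norm z))\<^sup>2) \<partial>\<nu>) < \<infinity>"
proof -
  have "(min 1 (norm z))\<^sup>2 = min 1 ((norm z)\<^sup>2)" for z :: "real ^ 'd"
    by (cases "norm z \<le> 1") (auto simp: min_def power_le_one not_le one_le_power dest: less_imp_le intro: antisym)
  then show ?thesis using data by (simp add: layered_stable_data_def)
qed

text \<open>In polar coordinates the Levy condition makes
  \<open>\<integral> (min 1 s)\<^sup>2 q s v ds\<close> finite for almost every direction, and on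
  \<open>[r, \<infinity>)\<close> the weight is at least
  \<open>(min 1 r)\<^sup>2 > 0\<close>.\<close>

lemma AE_tail_finite: "AE v in \<sigma>. \<forall>r>0. tail q r v < \<infinity>"
proof -
  note [measurable] = id_measurable_\<sigma>
  define G where "G v = (\<integral>\<^sup>+s. ennreal ((min 1 (norm (s *\<^sub>R v)))\<^sup>2) * ennreal (q_ext q s v) \<partial>lborel)" for v :: "real ^ 'd"
  have Gb: "G \<in> borel_measurable borel" unfolding G_def by measurable
  have Gm: "G \<in> borel_measurable \<sigma>" using measurable_compose[OF id_measurable_\<sigma> Gb] by simp
  have "(\<integral>\<^sup>+v. G v \<partial>\<sigma>) < \<infinity>"
    using levy_condition unfolding G_def by (subst (asm) nn_integral_\<nu>) simp_all
  then have "AE v in \<sigma>. G v \<noteq> \<infinity>" by (intro nn_integral_PInf_AE Gm) simp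
  moreover have "AE v in \<sigma>. norm v = 1" by (rule AE_I2) (simp add: space_\<sigma>)
  ultimately show ?thesis
  proof eventually_elim
    case (elim v)
    show ?case
    proof (intro allI impI)
      fix r :: real assume r: "r > 0"
      have c: "ennreal ((min 1 r)\<^sup>2) \<noteq> 0" using r by (simp add: min_def)
      have "ennreal ((min 1 r)\<^sup>2) * tail q r v = (\<integral>\<^sup>+s. ennreal ((min 1 r)\<^sup>2) * (if r \<le> s then ennreal (q_ext q s v) else 0) \<partial>lborel)"
        unfolding tail_def by (rule nn_integral_cmult[symmetric]) measurable
      also have "\<dots> \<le> G v"
        unfolding G_def
      proof (rule nn_integral_mono)
        fix s
        have "ennreal ((min 1 r)\<^sup>2) \<le> ennreal ((min 1 (norm (s *\<^sub>R v)))\<^sup>2)" if "r \<le> s"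
          using that r elim(2) by (intro ennreal_leI power_mono) auto
        then show "ennreal ((min 1 r)\<^sup>2) * (if r \<le> s then ennreal (q_ext q s v) else 0) \<le> ennreal ((min 1 (norm (s *\<^sub>R v)))\<^sup>2) * ennreal (q_ext q s v)"
          by (auto intro: mult_right_mono)
      qed
      also have "G v < \<infinity>" using elim(1) by (simp add: less_top)
      finally have "ennreal ((min 1 r)\<^sup>2) * tail q r v < top" by simp
      then show "tail q r v < \<infinity>" using c by (simp add: ennreal_mult_less_top) auto
    qed
  qed
qed

lemma shot_measurable: "(\<lambda>(x, v). shot x v) \<in> borel_measurable (borel \<Otimes>\<^sub>M borel)"
  unfolding shot_def by measurable

lemma shot_meas[measurable (raw)]:
  assumes "f \<in> borel_measurable M" "g \<in> borel_measurable M" shows "(\<lambda>x. shot (f x) (g x)) \<in> borel_measurable M"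
  using measurable_compose[OF measurable_Pair[OF assms] shot_measurable] by simp

text \<open>The substitution \<open>x = rate * u\<close> contributes the factor
  \<open>T * mass\<close>, and the normalisation of the directions removes \<open>mass\<close>.
  \<open>F 0 = 0\<close> discards the arguments \<open>x \<le> 0\<close>, where \<open>shot\<close>
  is 0.\<close>

lemma nn_integral_shot:
  assumes F[measurable]: "F \<in> borel_measurable borel" and F0: "F 0 = 0"
  shows "(\<integral>\<^sup>+x. \<integral>\<^sup>+v. F (shot x v) \<partial>dir_law \<partial>lborel) = ennreal T * (\<integral>\<^sup>+z. F z \<partial>\<nu>)"
proof -
  interpret D: prob_space dir_law by (rule prob_dir_law)
  interpret LD: pair_sigma_finite lborel dir_law ..
  note [measurable_cong] = sets_dir_law
  note [measurable] = id_measurable_\<sigma>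
  have "(\<integral>\<^sup>+x. \<integral>\<^sup>+v. F (shot x v) \<partial>dir_law \<partial>lborel) = (\<integral>\<^sup>+v. \<integral>\<^sup>+x. F (shot x v) \<partial>lborel \<partial>dir_law)"
    by (rule LD.Fubini'[symmetric]) simp
  also have "\<dots> = ennreal (1 / mass) * (\<integral>\<^sup>+v. \<integral>\<^sup>+x. F (shot x v) \<partial>lborel \<partial>\<sigma>)"
    by (rule nn_integral_dir_law) simp
  also have "(\<integral>\<^sup>+v. \<integral>\<^sup>+x. F (shot x v) \<partial>lborel \<partial>\<sigma>) = (\<integral>\<^sup>+v. ennreal rate * (\<integral>\<^sup>+s. F (s *\<^sub>R v) * ennreal (q_ext q s v) \<partial>lborel) \<partial>\<sigma>)"
  proof (rule nn_integral_cong_AE)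
    have "AE v in \<sigma>. norm v = 1" by (rule AE_I2) (simp add: space_\<sigma>)
    then show "AE v in \<sigma>. (\<integral>\<^sup>+x. F (shot x v) \<partial>lborel) = ennreal rate * (\<integral>\<^sup>+s. F (s *\<^sub>R v) * ennreal (q_ext q s v) \<partial>lborel)"
      using AE_tail_finite
    proof eventually_elim
      case (elim v)
      have "(\<integral>\<^sup>+x. F (shot x v) \<partial>lborel) = ennreal rate * (\<integral>\<^sup>+u. F (shot (rate * u) v) \<partial>lborel)"
        using nn_integral_real_affine[of "\<lambda>x. F (shot x v)" rate 0] rate_pos by simp
      also have "(\<integral>\<^sup>+u. F (shot (rate * u) v) \<partial>lborel) = (\<integral>\<^sup>+u. (if 0 < u then F (qi0 u v *\<^sub>R v) else 0) \<partial>lborel)"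
        using rate_pos F0 by (intro nn_integral_cong) (auto simp: shot_def qi0_def)
      also have "\<dots> = (\<integral>\<^sup>+s. F (s *\<^sub>R v) * ennreal (q_ext q s v) \<partial>lborel)"
        by (rule nn_integral_qi[of v "\<lambda>r. F (r *\<^sub>R v)"]) (use elim F0 in auto)
      finally show ?case .
    qed
  qed
  also have "\<dots> = ennreal rate * (\<integral>\<^sup>+v. \<integral>\<^sup>+s. F (s *\<^sub>R v) * ennreal (q_ext q s v) \<partial>lborel \<partial>\<sigma>)"
    by (rule nn_integral_cmult) measurable
  also have "(\<integral>\<^sup>+v. \<integral>\<^sup>+s. F (s *\<^sub>R v) * ennreal (q_ext q s v) \<partial>lborel \<partial>\<sigma>) = (\<integral>\<^sup>+z. F z \<partial>\<nu>)"
    by (rule nn_integral_\<nu>[symmetric]) simp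
  also have "ennreal (1 / mass) * (ennreal rate * (\<integral>\<^sup>+z. F z \<partial>\<nu>)) = ennreal T * (\<integral>\<^sup>+z. F z \<partial>\<nu>)"
    using mass_pos T by (simp add: mult.assoc[symmetric] ennreal_mult[symmetric] rate_def)
  finally show ?thesis .
qed

lemma shot_noise_shot: "shot_noise dir_law shot T"
proof (rule shot_noise.intro)
  show "prob_space dir_law" by (rule prob_dir_law)
  show "sets dir_law = sets borel" by (rule sets_dir_law)
  show "0 < T" by (rule T)
  show "(\<lambda>(x, v). shot x v) \<in> borel_measurable (borel \<Otimes>\<^sub>M borel)" by (rule shot_measurable)
  show "shot x v = 0" if "x \<le> 0" for x v
    using that rate_pos by (simp add: shot_def qi0_def zero_less_divide_iff)
  show "norm (shot y v) \<le> norm (shot x v)" if "0 < x" "x \<le> y" for x y v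
  proof (cases "norm v = 1")
    case True
    have "0 < x / rate" "x / rate \<le> y / rate" using that rate_pos by (auto intro: divide_right_mono)
    then show ?thesis using qi_anti[OF True, of "x / rate" "y / rate"] qi_nonneg[OF True, of "x / rate"] qi_nonneg[OF True, of "y / rate"] True
      by (auto simp: shot_def qi0_def)
  qed (simp add: shot_def qi0_def)
  show "isCont (\<lambda>x. shot x v) x" if x: "0 < x" for x v
  proof (cases "norm v = 1")
    case True
    have u: "0 < x / rate" using x rate_pos by simp
    have "isCont (\<lambda>u. qi0 u v) (x / rate)"
    proof (rule iffD1[OF isCont_cong qi_cont[OF True u]])
      have "eventually (\<lambda>y. y \<in> {0<..}) (nhds (x / rate))" using u by (intro eventually_nhds_in_open) auto
      then show "\<forall>\<^sub>F y in nhds (x / rate). q_inverse q y v = qi0 y v" by eventually_elim (simp add: qi0_def True)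
    qed
    then have "isCont (\<lambda>x. qi0 (x / rate) v) x"
      using rate_pos by (intro isCont_o2[of x "\<lambda>x. x / rate" "\<lambda>u. qi0 u v"] continuous_intros) auto
    then show ?thesis unfolding shot_def by (intro continuous_intros)
  next
    case False
    then show ?thesis by (simp add: shot_def qi0_def)
  qed
  have "(\<integral>\<^sup>+x. \<integral>\<^sup>+v. ennreal ((min 1 (norm (shot x v)))\<^sup>2) \<partial>dir_law \<partial>lborel) = ennreal T * (\<integral>\<^sup>+z. ennreal ((min 1 (norm z))\<^sup>2) \<partial>\<nu>)"
    by (rule nn_integral_shot) auto
  then show "(\<integral>\<^sup>+x. \<integral>\<^sup>+v. ennreal ((min 1 (norm (shot x v)))\<^sup>2) \<partial>dir_law \<partial>lborel) < \<infinity>"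
    using levy_condition by (simp add: ennreal_mult_less_top)
qed

sublocale sn: shot_noise dir_law shot T by (rule shot_noise_shot)

definition kf :: "real ^ 'd \<Rightarrow> real ^ 'd \<Rightarrow> complex" where
  "kf y z = iexp (y \<bullet> z) - 1 - \<i> * complex_of_real ((y \<bullet> z) * indicator {z. norm z \<le> 1} z)"

lemma kern_kf: "sn.kern y x v = kf y (shot x v)"
  by (simp add: sn.kern_def kf_def sn.H1_def indicator_def)

text \<open>The image of Lebesgue measure times the direction law under \<open>shot\<close> is
  \<open>T\<close> times the Levy measure off the origin, by \<open>nn_integral_shot\<close> for
  indicators; integrability comes from \<open>kern_bound\<close> and the Levy condition.\<close>

theorem exponent_eq: "(1 / T) *\<^sub>R sn.\<psi>0 y = (\<integral>z. kf y z \<partial>\<nu>)"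
proof -
  interpret LD: pair_sigma_finite lborel dir_law ..
  note [measurable_cong] = sets_dir_law
  have kfm[measurable]: "kf y \<in> borel_measurable borel"
  proof -
    have "{z :: real ^ 'd. norm z \<le> 1} \<in> sets borel" by measurable
    then show ?thesis unfolding kf_def by measurable
  qed
  have kf0: "kf y 0 = 0" by (simp add: kf_def)
  have shm: "(\<lambda>p. shot (fst p) (snd p)) \<in> lborel \<Otimes>\<^sub>M dir_law \<rightarrow>\<^sub>M borel" by measurable
  have int: "integrable (lborel \<Otimes>\<^sub>M dir_law) (\<lambda>p. kf y (shot (fst p) (snd p)))"
  proof (rule integrableI_bounded)
    have "(\<integral>\<^sup>+p. ennreal (norm (kf y (shot (fst p) (snd p)))) \<partial>(lborel \<Otimes>\<^sub>M dir_law)) = (\<integral>\<^sup>+x. \<integral>\<^sup>+v. ennreal (norm (kf y (shot x v))) \<partial>dir_law \<partial>lborel)"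
      by (subst sn.L.nn_integral_fst[symmetric]) simp_all
    also have "\<dots> \<le> (\<integral>\<^sup>+x. \<integral>\<^sup>+v. ennreal (2 + (norm y)\<^sup>2) * ennreal ((min 1 (norm (shot x v)))\<^sup>2) \<partial>dir_law \<partial>lborel)"
    proof (intro nn_integral_mono)
      fix x v
      have "ennreal (norm (kf y (shot x v))) \<le> ennreal ((2 + (norm y)\<^sup>2) * (min 1 (norm (shot x v)))\<^sup>2)"
        using sn.kern_bound[of y x v] by (intro ennreal_leI) (simp add: kern_kf)
      also have "\<dots> = ennreal (2 + (norm y)\<^sup>2) * ennreal ((min 1 (norm (shot x v)))\<^sup>2)"
        by (rule ennreal_mult) auto
      finally show "ennreal (norm (kf y (shot x v))) \<le> ennreal (2 + (norm y)\<^sup>2) * ennreal ((min 1 (norm (shot x v)))\<^sup>2)" .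
    qed
    also have "\<dots> = ennreal (2 + (norm y)\<^sup>2) * (\<integral>\<^sup>+x. \<integral>\<^sup>+v. ennreal ((min 1 (norm (shot x v)))\<^sup>2) \<partial>dir_law \<partial>lborel)"
      by (simp add: nn_integral_cmult del: ennreal_plus)
    also have "\<dots> < \<infinity>" using sn.H_int by (simp add: ennreal_mult_less_top)
    finally show "(\<integral>\<^sup>+p. ennreal (norm (kf y (shot (fst p) (snd p)))) \<partial>(lborel \<Otimes>\<^sub>M dir_law)) < \<infinity>" .
  qed measurable
  define P where "P = distr (lborel \<Otimes>\<^sub>M dir_law) borel (\<lambda>p. shot (fst p) (snd p))"
  have "sn.\<psi>0 y = (\<integral>x. \<integral>v. kf y (shot x v) \<partial>dir_law \<partial>lborel)"
    by (simp add: sn.\<psi>0_def sn.\<kappa>_def kern_kf)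
  also have "\<dots> = (\<integral>p. kf y (shot (fst p) (snd p)) \<partial>(lborel \<Otimes>\<^sub>M dir_law))"
    using LD.integral_fst'[OF int] by simp
  also have "\<dots> = (\<integral>z. kf y z \<partial>P)" unfolding P_def by (rule integral_distr[OF shm kfm, symmetric])
  \<comment> \<open>\<open>P\<close> has infinite mass at the origin, coming from
    \<open>x \<le> 0\<close>. The integrand vanishes there, so the origin is cut out before the
    measures are compared.\<close>
  also have "\<dots> = (\<integral>z. indicator (- {0}) z *\<^sub>R kf y z \<partial>P)"
    by (intro Bochner_Integration.integral_cong) (auto simp: indicator_def kf0)
  also have "\<dots> = (\<integral>z. kf y z \<partial>restrict_space P (- {0}))"
    by (rule integral_restrict_space[symmetric]) (simp add: P_def)
  also have "restrict_space P (- {0}) = density \<nu> (\<lambda>_. ennreal T)"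
  proof (rule measure_eqI)
    show s: "sets (restrict_space P (- {0})) = sets (density \<nu> (\<lambda>_. ennreal T))"
      unfolding sets_density sets_\<nu> by (intro sets_restrict_space_cong) (simp add: P_def)
    fix A assume "A \<in> sets (restrict_space P (- {0}))"
    then have A\<nu>: "A \<in> sets \<nu>" using s by simp
    then have A: "A \<in> sets borel" "0 \<notin> A" by (simp_all add: sets_\<nu>_iff)
    have "emeasure (restrict_space P (- {0})) A = emeasure P A"
      by (rule emeasure_restrict_space) (use A in \<open>auto simp: P_def\<close>)
    also have "\<dots> = (\<integral>\<^sup>+z. indicator A z \<partial>P)" using A by (simp add: P_def)
    also have "\<dots> = (\<integral>\<^sup>+p. indicator A (shot (fst p) (snd p)) \<partial>(lborel \<Otimes>\<^sub>M dir_law))"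
      unfolding P_def using A by (subst nn_integral_distr[OF shm]) auto
    also have "\<dots> = (\<integral>\<^sup>+x. \<integral>\<^sup>+v. indicator A (shot x v) \<partial>dir_law \<partial>lborel)"
    proof -
      note [measurable] = A(1)
      show ?thesis by (subst sn.L.nn_integral_fst[symmetric]) simp_all
    qed
    also have "\<dots> = ennreal T * (\<integral>\<^sup>+z. indicator A z \<partial>\<nu>)" using A by (intro nn_integral_shot) auto
    also have "\<dots> = emeasure (density \<nu> (\<lambda>_. ennreal T)) A"
      using A\<nu> by (simp add: emeasure_density nn_integral_cmult)
    finally show "emeasure (restrict_space P (- {0})) A = emeasure (density \<nu> (\<lambda>_. ennreal T)) A" .
  qed
  also have "(\<integral>z. kf y z \<partial>density \<nu> (\<lambda>_. ennreal T)) = (\<integral>z. T *\<^sub>R kf y z \<partial>\<nu>)"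
    using T by (intro integral_density measurable_\<nu>[OF kfm]) auto
  also have "\<dots> = T *\<^sub>R (\<integral>z. kf y z \<partial>\<nu>)" by simp
  finally show ?thesis using T by simp
qed

end

section \<open>Independent triples\<close>

abbreviation boxes :: "('a::topological_space \<times> 'b::topological_space \<times> 'c::topological_space) set set" where
  "boxes \<equiv> {A \<times> B \<times> C | A B C. A \<in> sets borel \<and> B \<in> sets borel \<and> C \<in> sets borel}"

lemma Int_stable_boxes: "Int_stable boxes"
  unfolding Int_stable_def by (safe, simp only: Times_Int_Times) (blast intro: sets.Int)

lemma UNIV_in_boxes: "UNIV \<in> boxes"
  by (auto intro!: exI[of _ UNIV])

text \<open>In the product order every orthant \<open>{..a}\<close> is a box, and the orthants
  generate the Borel sets.\<close>

lemma sigma_sets_boxes: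
  "sigma_sets UNIV boxes = sets (borel :: ('a::ordered_euclidean_space \<times> 'b::ordered_euclidean_space \<times> 'c::ordered_euclidean_space) measure)"
proof
  have "A \<times> B \<times> C \<in> sets borel" if "A \<in> sets borel" "B \<in> sets borel" "C \<in> sets borel"
    for A :: "'a set" and B :: "'b set" and C :: "'c set"
    using that unfolding borel_prod[symmetric] by (intro pair_measureI)
  then have "boxes \<subseteq> sets (borel :: ('a \<times> 'b \<times> 'c) measure)" by blast
  from sets.sigma_sets_subset[OF this]
  show "sigma_sets UNIV boxes \<subseteq> sets (borel :: ('a \<times> 'b \<times> 'c) measure)" by simp
  have "range (\<lambda>a::'a \<times> 'b \<times> 'c. {..a}) \<subseteq> boxes"
  proof (rule image_subsetI)
    fix a :: "'a \<times> 'b \<times> 'c"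
    have "{..a} = {..fst a} \<times> {..fst (snd a)} \<times> {..snd (snd a)}" by (auto simp: less_eq_prod_def)
    moreover have "{..fst a} \<in> sets borel" "{..fst (snd a)} \<in> sets borel" "{..snd (snd a)} \<in> sets borel"
      by (simp_all add: borel_closed)
    ultimately show "{..a} \<in> boxes" by (intro CollectI exI conjI)
  qed
  then have "sigma_sets UNIV (range (\<lambda>a::'a \<times> 'b \<times> 'c. {..a})) \<subseteq> sigma_sets UNIV boxes"
    by (rule sigma_sets_mono')
  moreover have "sets (borel :: ('a \<times> 'b \<times> 'c) measure) = sigma_sets UNIV (range (\<lambda>a::'a \<times> 'b \<times> 'c. {..a}))"
    by (rule trans[OF arg_cong[where f=sets, OF borel_eq_atMost] sets_measure_of]) simp
  ultimately show "sets (borel :: ('a \<times> 'b \<times> 'c) measure) \<subseteq> sigma_sets UNIV boxes" by simp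
qed

lemma prob_eqI_boxes:
  fixes P Q :: "('a::ordered_euclidean_space \<times> 'b::ordered_euclidean_space \<times> 'c::ordered_euclidean_space) measure"
  assumes P: "prob_space P" "sets P = sets borel" and Q: "sets Q = sets borel"
    and eq: "\<And>A B C. A \<in> sets borel \<Longrightarrow> B \<in> sets borel \<Longrightarrow> C \<in> sets borel \<Longrightarrow> emeasure P (A \<times> B \<times> C) = emeasure Q (A \<times> B \<times> C)"
  shows "P = Q"
proof (rule measure_eqI_generator_eq[OF Int_stable_boxes, where \<Omega>=UNIV and A="\<lambda>_. UNIV"])
  interpret prob_space P by fact
  show "sets P = sigma_sets UNIV boxes" "sets Q = sigma_sets UNIV boxes"
    using P(2) Q by (simp_all only: sigma_sets_boxes)
  show "emeasure P UNIV \<noteq> \<infinity>" by simp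
qed (use eq UNIV_in_boxes in auto)

text \<open>The preimages of boxes are intersection-stable and generate the sigma-algebra of each
  variable, so the product rule for them extends to all events.\<close>

lemma (in prob_space) indep_vars_boxesI:
  fixes X :: "'i \<Rightarrow> 'a \<Rightarrow> 'b::ordered_euclidean_space \<times> 'c::ordered_euclidean_space \<times> 'd::ordered_euclidean_space"
  assumes X: "\<And>i. i \<in> I \<Longrightarrow> X i \<in> borel_measurable M"
    and ind: "\<And>J A B C. J \<noteq> {} \<Longrightarrow> J \<subseteq> I \<Longrightarrow> finite J \<Longrightarrow> (\<And>j. A j \<in> sets borel) \<Longrightarrow> (\<And>j. B j \<in> sets borel) \<Longrightarrow> (\<And>j. C j \<in> sets borel) \<Longrightarrow>
      prob (\<Inter>j\<in>J. X j -` (A j \<times> B j \<times> C j) \<inter> space M) = (\<Prod>j\<in>J. prob (X j -` (A j \<times> B j \<times> C j) \<inter> space M))"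
  shows "indep_vars (\<lambda>_. borel) X I"
proof -
  let ?F = "\<lambda>i. {X i -` D \<inter> space M | D. D \<in> boxes}"
  have "indep_sets ?F I"
  proof (rule indep_setsI)
    fix i assume i: "i \<in> I"
    have "D \<in> sets borel" if "D \<in> boxes" for D :: "('b \<times> 'c \<times> 'd) set"
      using sigma_sets.Basic[OF that, of UNIV] by (simp only: sigma_sets_boxes)
    then show "?F i \<subseteq> events" using measurable_sets[OF X[OF i]] by blast
  next
    fix D J assume J: "J \<noteq> {}" "J \<subseteq> I" "finite J" "\<forall>j\<in>J. D j \<in> ?F j"
    have "\<forall>j. \<exists>A B C. A \<in> sets borel \<and> B \<in> sets borel \<and> C \<in> sets borel \<and> (j \<in> J \<longrightarrow> D j = X j -` (A \<times> B \<times> C) \<inter> space M)"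
    proof (intro allI)
      fix j
      show "\<exists>A B C. A \<in> sets borel \<and> B \<in> sets borel \<and> C \<in> sets borel \<and> (j \<in> J \<longrightarrow> D j = X j -` (A \<times> B \<times> C) \<inter> space M)"
      proof (cases "j \<in> J")
        case True
        then have "D j \<in> ?F j" using J(4) by blast
        then obtain A B C where "A \<in> sets borel" "B \<in> sets borel" "C \<in> sets borel" "D j = X j -` (A \<times> B \<times> C) \<inter> space M" by auto
        then show ?thesis by (intro exI conjI impI)
      qed (auto intro!: exI[of _ "{}"])
    qed
    then obtain A B C where "\<And>j. A j \<in> sets borel" "\<And>j. B j \<in> sets borel" "\<And>j. C j \<in> sets borel"
      and D: "\<And>j. j \<in> J \<Longrightarrow> D j = X j -` (A j \<times> B j \<times> C j) \<inter> space M" by metis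
    from ind[OF J(1-3) this(1-3)] show "prob (\<Inter>j\<in>J. D j) = (\<Prod>j\<in>J. prob (D j))"
      using D by simp
  qed
  then have "indep_sets (\<lambda>i. sigma_sets (space M) (?F i)) I"
  proof (rule indep_sets_sigma)
    fix i
    show "Int_stable (?F i)"
    proof (rule Int_stableI)
      fix a b assume "a \<in> ?F i" "b \<in> ?F i"
      then obtain D D' where D: "a = X i -` D \<inter> space M" "b = X i -` D' \<inter> space M" "D \<in> boxes" "D' \<in> boxes" by blast
      from Int_stableD[OF Int_stable_boxes D(3,4)] have "D \<inter> D' \<in> boxes" .
      moreover have "a \<inter> b = X i -` (D \<inter> D') \<inter> space M" using D by auto
      ultimately show "a \<inter> b \<in> ?F i" by - (rule CollectI, rule exI[of _ "D \<inter> D'"], rule conjI, assumption+)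
    qed
  qed
  moreover have "{X i -` A \<inter> space M | A. A \<in> sets borel} = sigma_sets (space M) (?F i)" for i
    unfolding sigma_sets_boxes[symmetric] by (rule sigma_sets_vimage_commute) auto
  ultimately show ?thesis unfolding indep_vars_def2 using X by simp
qed

section \<open>The noise underlying the series\<close>

lemma measurable_seq_events:
  assumes "\<And>i \<omega>. 1 \<le> i \<Longrightarrow> \<omega> \<in> space M \<Longrightarrow> X i \<omega> \<in> space S" and i: "1 \<le> i"
  shows "X i \<in> vimage_algebra (space M) (\<lambda>\<omega>. \<lambda>i\<in>{1..}. X i \<omega>) (\<Pi>\<^sub>M i\<in>{1..}. S) \<rightarrow>\<^sub>M S"
proof -
  have "(\<lambda>\<omega>. \<lambda>i\<in>{1..}. X i \<omega>) \<in> vimage_algebra (space M) (\<lambda>\<omega>. \<lambda>i\<in>{1..}. X i \<omega>) (\<Pi>\<^sub>M i\<in>{1..}. S) \<rightarrow>\<^sub>M (\<Pi>\<^sub>M i\<in>{1..}. S)"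
    by (rule measurable_vimage_algebra1) (use assms in \<open>auto simp: space_PiM\<close>)
  from measurable_compose[OF this measurable_component_singleton[of i]] i show ?thesis by simp
qed

lemma seq_events_rectangle:
  assumes "\<And>i \<omega>. 1 \<le> i \<Longrightarrow> \<omega> \<in> space M \<Longrightarrow> X i \<omega> \<in> space S"
    and "Y \<in> vimage_algebra (space M) (\<lambda>\<omega>. \<lambda>i\<in>{1..}. X i \<omega>) (\<Pi>\<^sub>M i\<in>{1..}. S) \<rightarrow>\<^sub>M N" "A \<in> sets N"
  shows "Y -` A \<inter> space M \<in> seq_events M S X"
  using measurable_sets[OF assms(2,3)] by (simp add: seq_events_def)

lemma (in prob_space) prob_rectangle:
  assumes Y: "indep_vars (\<lambda>_. N) Y {1..}" and J: "finite J" "J \<noteq> {}" and A: "\<And>j. A j \<in> sets N"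
  shows "prob (\<Inter>j\<in>J. Y (Suc j) -` A j \<inter> space M) = (\<Prod>j\<in>J. prob (Y (Suc j) -` A j \<inter> space M))"
proof -
  have "prob (\<Inter>i\<in>Suc ` J. Y i -` A (i - 1) \<inter> space M) = (\<Prod>i\<in>Suc ` J. prob (Y i -` A (i - 1) \<inter> space M))"
    by (rule indep_varsD[OF Y]) (use J A in auto)
  then show ?thesis using J by (simp add: prod.reindex)
qed

locale layered_series = layered \<alpha> \<beta> \<sigma> q T
  for \<alpha> \<beta> :: real and \<sigma> :: "(real ^ 'd) measure" and q :: "real \<Rightarrow> real ^ 'd \<Rightarrow> real" and T :: real +
  fixes M :: "'w measure" and U \<Gamma> E :: "nat \<Rightarrow> 'w \<Rightarrow> real" and V :: "nat \<Rightarrow> 'w \<Rightarrow> real ^ 'd"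
  assumes prob_M: "prob_space M"
    and U: "iid_seq M borel (uniform_measure lborel {0..T}) U"
    and E: "iid_seq M borel expo E"
    and \<Gamma>: "\<And>i \<omega>. 1 \<le> i \<Longrightarrow> \<omega> \<in> space M \<Longrightarrow> \<Gamma> i \<omega> = (\<Sum>k=1..i. E k \<omega>)"
    and V: "iid_seq M sphere_borel (scale_measure (1 / emeasure \<sigma> (sphere 0 1)) \<sigma>) V"
    and mutual: "prob_space.indep_sets M
           (\<lambda>j::nat. if j = 1 then seq_events M borel U
                     else if j = 2 then seq_events M borel \<Gamma>
                     else seq_events M sphere_borel V) {1, 2, 3}"
begin

sublocale M: prob_space M by (rule prob_M)

lemma U_indep: "M.indep_vars (\<lambda>_. borel) U {1..}" and U_distr: "1 \<le> i \<Longrightarrow> distr M borel (U i) = uniform_measure lborel {0..T}"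
  using U by (auto simp: iid_seq_def)

lemma E_indep: "M.indep_vars (\<lambda>_. borel) E {1..}" and E_distr: "1 \<le> i \<Longrightarrow> distr M borel (E i) = expo"
  using E by (auto simp: iid_seq_def)

lemma V_sphere_measurable: "1 \<le> i \<Longrightarrow> V i \<in> M \<rightarrow>\<^sub>M sphere_borel"
  using V by (auto simp: iid_seq_def M.indep_vars_def2)

lemma V_sphere: "1 \<le> i \<Longrightarrow> \<omega> \<in> space M \<Longrightarrow> V i \<omega> \<in> sphere 0 1"
  using measurable_space[OF V_sphere_measurable] by (simp add: space_restrict_space)

lemma id_sphere_borel: "(\<lambda>x. x) \<in> sphere_borel \<rightarrow>\<^sub>M borel"
  by (simp add: measurable_restrict_space1)

lemma V_indep: "M.indep_vars (\<lambda>_. borel) V {1..}"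
  using V M.indep_vars_compose2[of "\<lambda>_. sphere_borel" V "{1..}" "\<lambda>_ x. x" "\<lambda>_. borel"] id_sphere_borel
  by (simp add: iid_seq_def)

lemma V_distr:
  assumes i: "1 \<le> i" shows "distr M borel (V i) = dir_law"
proof -
  have "distr M borel (V i) = distr (distr M sphere_borel (V i)) borel (\<lambda>x. x)"
    by (subst distr_distr[OF id_sphere_borel V_sphere_measurable[OF i]]) (simp add: comp_def)
  then show ?thesis using V i by (simp add: iid_seq_def dir_law_def)
qed

lemma meas_M:
  assumes "1 \<le> i"
  shows "U i \<in> borel_measurable M" "E i \<in> borel_measurable M" "V i \<in> borel_measurable M"
  using U_indep E_indep V_indep assms by (auto simp: M.indep_vars_def2)

text \<open>Coordinate \<open>i\<close> holds the entries with number \<open>Suc i\<close>, because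
  the given sequences start at 1 and the canonical ones at 0.\<close>

definition noise :: "'w \<Rightarrow> nat \<Rightarrow> real \<times> (real ^ 'd) \<times> real" where
  "noise \<omega> i = (E (Suc i) \<omega>, V (Suc i) \<omega>, U (Suc i) \<omega>)"

lemma noise_measurable: "(\<lambda>\<omega>. noise \<omega> i) \<in> borel_measurable M"
  unfolding noise_def borel_prod[symmetric] using meas_M[of "Suc i"] by simp

text \<open>The event is an intersection of one event for each of the three sequences. Mutual
  independence separates them, and each factorises over \<open>j\<close> because its sequence is
  iid.\<close>

lemma prob_noise_boxes:
  assumes J: "finite J" "J \<noteq> {}" and A: "\<And>j. A j \<in> sets borel" and B: "\<And>j. B j \<in> sets borel" and C: "\<And>j. C j \<in> sets borel"
  shows "M.prob (\<Inter>j\<in>J. (\<lambda>\<omega>. noise \<omega> j) -` (A j \<times> B j \<times> C j) \<inter> space M) =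
    (\<Prod>j\<in>J. measure expo (A j) * measure dir_law (B j) * measure (uniform_measure lborel {0..T}) (C j))"
proof -
  let ?W = "vimage_algebra (space M) (\<lambda>\<omega>. \<lambda>i\<in>{1..}. \<Gamma> i \<omega>) (\<Pi>\<^sub>M i\<in>{1..}. borel)"
  define SE where "SE = (\<Inter>j\<in>J. E (Suc j) -` A j \<inter> space M)"
  define SV where "SV = (\<Inter>j\<in>J. V (Suc j) -` B j \<inter> space M)"
  define SU where "SU = (\<Inter>j\<in>J. U (Suc j) -` C j \<inter> space M)"
  \<comment> \<open>Independence is assumed for the arrivals, not for the waiting times; as
    differences of successive arrivals these generate no new events. The first waiting time is the
    first arrival.\<close>
  have E_W: "E (Suc j) \<in> borel_measurable ?W" for j
  proof (cases j)
    case 0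
    have "E (Suc 0) \<omega> = \<Gamma> 1 \<omega>" if "\<omega> \<in> space ?W" for \<omega> using that \<Gamma>[of 1 \<omega>] by simp
    then show ?thesis unfolding 0 using measurable_seq_events[of M \<Gamma> borel 1] by (subst measurable_cong) auto
  next
    case (Suc k)
    have "E (Suc (Suc k)) \<omega> = \<Gamma> (Suc (Suc k)) \<omega> - \<Gamma> (Suc k) \<omega>" if "\<omega> \<in> space ?W" for \<omega>
      using that \<Gamma>[of "Suc k" \<omega>] \<Gamma>[of "Suc (Suc k)" \<omega>] by simp
    moreover have "(\<lambda>\<omega>. \<Gamma> (Suc (Suc k)) \<omega> - \<Gamma> (Suc k) \<omega>) \<in> borel_measurable ?W"
      by (intro borel_measurable_diff measurable_seq_events) auto
    ultimately show ?thesis unfolding Suc by (subst measurable_cong) auto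
  qed
  have fin: "(\<Inter>j\<in>J. F j) \<in> seq_events M N Y" if "\<And>j. j \<in> J \<Longrightarrow> F j \<in> seq_events M N Y"
    for F :: "nat \<Rightarrow> 'w set" and N :: "'z measure" and Y
    using that J unfolding seq_events_def by (intro sets.finite_INT) auto
  have SE: "SE \<in> seq_events M borel \<Gamma>"
    unfolding SE_def by (intro fin seq_events_rectangle[OF _ E_W A]) auto
  have SU: "SU \<in> seq_events M borel U"
    unfolding SU_def by (intro fin seq_events_rectangle[OF _ measurable_seq_events C]) auto
  have SV: "SV \<in> seq_events M sphere_borel V"
  proof -
    have vs: "V i \<omega> \<in> space sphere_borel" if "1 \<le> i" "\<omega> \<in> space M" for i \<omega>
      using V_sphere[OF that] by (simp add: space_restrict_space)
    show ?thesis unfolding SV_def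
      by (intro fin seq_events_rectangle[OF vs measurable_compose[OF measurable_seq_events[OF vs] id_sphere_borel] B]) auto
  qed
  have "(\<Inter>j\<in>J. (\<lambda>\<omega>. noise \<omega> j) -` (A j \<times> B j \<times> C j) \<inter> space M) =
      (\<Inter>k\<in>{1, 2, 3::nat}. if k = 1 then SU else if k = 2 then SE else SV)"
    using J by (auto simp: SE_def SV_def SU_def noise_def)
  also have "M.prob \<dots> = (\<Prod>k\<in>{1, 2, 3::nat}. M.prob (if k = 1 then SU else if k = 2 then SE else SV))"
    by (rule M.indep_setsD[OF mutual]) (use SE SU SV in auto)
  also have "\<dots> = M.prob SE * M.prob SV * M.prob SU" by simp
  also have "M.prob SE = (\<Prod>j\<in>J. measure expo (A j))"
  proof -
    have "M.prob (E (Suc j) -` A j \<inter> space M) = measure expo (A j)" for j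
      unfolding E_distr[of "Suc j", symmetric, simplified] using meas_M(2)[of "Suc j"] A by (subst measure_distr) auto
    then show ?thesis unfolding SE_def M.prob_rectangle[OF E_indep J A] by simp
  qed
  also have "M.prob SV = (\<Prod>j\<in>J. measure dir_law (B j))"
  proof -
    have "M.prob (V (Suc j) -` B j \<inter> space M) = measure dir_law (B j)" for j
      unfolding V_distr[of "Suc j", symmetric, simplified] using meas_M(3)[of "Suc j"] B by (subst measure_distr) auto
    then show ?thesis unfolding SV_def M.prob_rectangle[OF V_indep J B] by simp
  qed
  also have "M.prob SU = (\<Prod>j\<in>J. measure (uniform_measure lborel {0..T}) (C j))"
  proof -
    have "M.prob (U (Suc j) -` C j \<inter> space M) = measure (uniform_measure lborel {0..T}) (C j)" for j
      unfolding U_distr[of "Suc j", symmetric, simplified] using meas_M(1)[of "Suc j"] C by (subst measure_distr) auto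
    then show ?thesis unfolding SU_def M.prob_rectangle[OF U_indep J C] by simp
  qed
  finally show ?thesis by (simp add: prod.distrib)
qed

lemma prob_noise_box:
  assumes "A \<in> sets borel" "B \<in> sets borel" "C \<in> sets borel"
  shows "M.prob ((\<lambda>\<omega>. noise \<omega> j) -` (A \<times> B \<times> C) \<inter> space M) =
    measure expo A * measure dir_law B * measure (uniform_measure lborel {0..T}) C"
  using prob_noise_boxes[of "{j}" "\<lambda>_. A" "\<lambda>_. B" "\<lambda>_. C"] assms by simp

lemma noise_indep: "M.indep_vars (\<lambda>_. borel) (\<lambda>i \<omega>. noise \<omega> i) UNIV"
proof (rule M.indep_vars_boxesI[OF noise_measurable])
  fix J :: "nat set" and A :: "nat \<Rightarrow> real set" and B :: "nat \<Rightarrow> (real ^ 'd) set" and C :: "nat \<Rightarrow> real set"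
  assume J: "J \<noteq> {}" "finite J" and ABC: "\<And>j. A j \<in> sets borel" "\<And>j. B j \<in> sets borel" "\<And>j. C j \<in> sets borel"
  show "M.prob (\<Inter>j\<in>J. (\<lambda>\<omega>. noise \<omega> j) -` (A j \<times> B j \<times> C j) \<inter> space M) =
      (\<Prod>j\<in>J. M.prob ((\<lambda>\<omega>. noise \<omega> j) -` (A j \<times> B j \<times> C j) \<inter> space M))"
    unfolding prob_noise_boxes[OF J(2,1) ABC] by (simp only: prob_noise_box[OF ABC])
qed

lemma sets_noise_law_borel: "sets (noise_law dir_law T) = sets borel"
  by (simp only: sn.sets_noise_law borel_prod)

lemma noise_distr: "distr M borel (\<lambda>\<omega>. noise \<omega> i) = noise_law dir_law T"
proof (rule prob_eqI_boxes)
  show "prob_space (distr M borel (\<lambda>\<omega>. noise \<omega> i))" by (rule M.prob_space_distr[OF noise_measurable])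
  fix A :: "real set" and B :: "(real ^ 'd) set" and C :: "real set"
  assume ABC: "A \<in> sets borel" "B \<in> sets borel" "C \<in> sets borel"
  have D: "A \<times> B \<times> C \<in> sets borel" using ABC unfolding borel_prod[symmetric] by (intro pair_measureI)
  have "emeasure (distr M borel (\<lambda>\<omega>. noise \<omega> i)) (A \<times> B \<times> C) =
      ennreal (measure expo A * measure dir_law B * measure (uniform_measure lborel {0..T}) C)"
    using prob_noise_box[OF ABC, of i] by (subst emeasure_distr[OF noise_measurable D]) (simp add: M.emeasure_eq_measure)
  also have "\<dots> = emeasure expo A * (emeasure dir_law B * emeasure (uniform_measure lborel {0..T}) C)"
    by (simp add: sn.E.emeasure_eq_measure sn.L.emeasure_eq_measure sn.U.emeasure_eq_measure ennreal_mult mult.assoc)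
  also have "\<dots> = emeasure (noise_law dir_law T) (A \<times> B \<times> C)"
    unfolding noise_law_def using ABC
    by (simp add: sn.LU.P.emeasure_pair_measure_Times sn.U.emeasure_pair_measure_Times sets_dir_law pair_measureI)
  finally show "emeasure (distr M borel (\<lambda>\<omega>. noise \<omega> i)) (A \<times> B \<times> C) = emeasure (noise_law dir_law T) (A \<times> B \<times> C)" .
qed (simp_all add: sets_noise_law_borel)

lemma noise_measurable_S: "noise \<in> M \<rightarrow>\<^sub>M sn.S"
proof -
  have "noise \<in> M \<rightarrow>\<^sub>M PiM UNIV (\<lambda>_. noise_law dir_law T)"
  proof (rule measurable_PiM_single')
    show "(\<lambda>\<omega>. noise \<omega> i) \<in> M \<rightarrow>\<^sub>M noise_law dir_law T" for i
      using noise_measurable by (subst measurable_cong_sets[OF refl sets_noise_law_borel])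
    show "noise \<in> space M \<rightarrow> (\<Pi>\<^sub>E i\<in>UNIV. space (noise_law dir_law T))"
      by (simp add: sets_eq_imp_space_eq[OF sets_noise_law_borel])
  qed
  then show ?thesis by (simp add: sn.S_def)
qed

text \<open>This transfers almost sure statements and characteristic functions from the canonical
  space to \<open>M\<close>.\<close>

lemma distr_noise: "distr M sn.S noise = sn.S"
proof -
  have "distr M (PiM UNIV (\<lambda>_. borel)) (\<lambda>\<omega>. \<lambda>i\<in>UNIV. noise \<omega> i) = PiM UNIV (\<lambda>i. distr M borel (\<lambda>\<omega>. noise \<omega> i))"
    using noise_indep by (subst (asm) M.indep_vars_iff_distr_eq_PiM) (use noise_measurable in auto)
  then have "distr M (PiM UNIV (\<lambda>_. borel)) noise = sn.S"
    by (simp add: noise_distr sn.S_def restrict_UNIV)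
  moreover have "distr M sn.S noise = distr M (PiM UNIV (\<lambda>_. borel)) noise"
    unfolding sn.S_def by (intro distr_cong sets_PiM_cong refl sets_noise_law_borel)
  ultimately show ?thesis by simp
qed

section \<open>The series\<close>

lemma Gam_noise: "\<omega> \<in> space M \<Longrightarrow> sn.Gam (Suc n) (noise \<omega>) = \<Gamma> (Suc n) \<omega>"
  using \<Gamma>[of "Suc n" \<omega>] sum.atLeast1_atMost_eq[of "\<lambda>k. E k \<omega>" "Suc n"] by (simp only: sn.Gam_def noise_def fst_conv One_nat_def)

lemma shot_eq: "0 < x \<Longrightarrow> norm v = 1 \<Longrightarrow> shot x v = q_inverse q (x / (T * measure \<sigma> (sphere 0 1))) v *\<^sub>R v"
  using rate_pos by (simp add: shot_def qi0_def rate_def mass_def)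

lemma centering_eq: "centering M \<sigma> q T V (Suc i) = ioc_integral sn.hv (real i) (real i + 1)"
proof -
  have hv: "(\<integral>\<omega>. indicator {\<omega>. q_inverse q (s / (T * measure \<sigma> (sphere 0 1))) (V 1 \<omega>) \<le> 1} \<omega> *\<^sub>R
              q_inverse q (s / (T * measure \<sigma> (sphere 0 1))) (V 1 \<omega>) *\<^sub>R V 1 \<omega> \<partial>M) = sn.hv s" if s: "0 < s" for s
  proof -
    have "(\<integral>\<omega>. indicator {\<omega>. q_inverse q (s / (T * measure \<sigma> (sphere 0 1))) (V 1 \<omega>) \<le> 1} \<omega> *\<^sub>R
              q_inverse q (s / (T * measure \<sigma> (sphere 0 1))) (V 1 \<omega>) *\<^sub>R V 1 \<omega> \<partial>M) = (\<integral>\<omega>. sn.H1 s (V 1 \<omega>) \<partial>M)"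
    proof (rule Bochner_Integration.integral_cong[OF refl])
      fix \<omega> assume "\<omega> \<in> space M"
      then have v: "norm (V 1 \<omega>) = 1" using V_sphere[of 1 \<omega>] by simp
      have "0 < s / rate" using s rate_pos by simp
      from qi_nonneg[OF v this] have "norm (shot s (V 1 \<omega>)) = q_inverse q (s / (T * measure \<sigma> (sphere 0 1))) (V 1 \<omega>)"
        using v unfolding shot_eq[OF s v] by (simp add: rate_def mass_def)
      then show "indicator {\<omega>. q_inverse q (s / (T * measure \<sigma> (sphere 0 1))) (V 1 \<omega>) \<le> 1} \<omega> *\<^sub>R
              q_inverse q (s / (T * measure \<sigma> (sphere 0 1))) (V 1 \<omega>) *\<^sub>R V 1 \<omega> = sn.H1 s (V 1 \<omega>)"
        using shot_eq[OF s v] by (simp add: sn.H1_def indicator_def)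
    qed
    also have "\<dots> = (\<integral>v. sn.H1 s v \<partial>distr M borel (V 1))"
      using meas_M(3)[of 1] by (intro integral_distr[symmetric]) (simp_all add: sn.H1_def)
    finally show ?thesis by (simp add: V_distr sn.hv_def)
  qed
  show ?thesis
    unfolding centering_def ioc_integral_def set_lebesgue_integral_def
  \<comment> \<open>The two intervals differ by their left end point. For \<open>i = 0\<close> this
    is the point 0, which \<open>hv\<close> does not cover.\<close>
  proof (rule integral_discrete_difference[where X="{real i}"])
    fix s assume "s \<in> space lborel" "s \<notin> {real i}"
    then show "indicator {real (Suc i) - 1..real (Suc i)} s *\<^sub>R (\<integral>\<omega>. indicator {\<omega>. q_inverse q (s / (T * measure \<sigma> (sphere 0 1))) (V 1 \<omega>) \<le> 1} \<omega> *\<^sub>R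
              q_inverse q (s / (T * measure \<sigma> (sphere 0 1))) (V 1 \<omega>) *\<^sub>R V 1 \<omega> \<partial>M) = (if real i < s \<and> s \<le> real i + 1 then sn.hv s else 0)"
      using hv[of s] of_nat_0_le_iff[of i, where 'a=real]
      by (cases "real i < s \<and> s \<le> real i + 1") (auto simp: indicator_def)
  qed auto
qed

lemma series_eq_part:
  assumes \<omega>: "\<omega> \<in> space M" and pos: "\<And>i. 0 < fst (noise \<omega> i)" and t: "t \<in> {0..T}"
  shows "series_partial_sum M \<sigma> q T U \<Gamma> V n t \<omega> = sn.part n t (noise \<omega>)"
proof -
  have jump: "sn.jump i (noise \<omega>) = q_inverse q (\<Gamma> (Suc i) \<omega> / (T * measure \<sigma> (sphere 0 1))) (V (Suc i) \<omega>) *\<^sub>R V (Suc i) \<omega>" for i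
  proof -
    have "0 < \<Gamma> (Suc i) \<omega>" using sn.Gam_pos[where n="Suc i" and \<omega>="noise \<omega>", OF pos] Gam_noise[OF \<omega>] by simp
    moreover have "norm (V (Suc i) \<omega>) = 1" using V_sphere[of "Suc i" \<omega>] \<omega> by simp
    ultimately show ?thesis unfolding sn.jump_def Gam_noise[OF \<omega>] by (simp add: shot_eq noise_def)
  qed
  have "sn.cl t = t" using t by (simp add: sn.cl_def)
  then show ?thesis
    unfolding series_partial_sum_def sn.part_def One_nat_def sum.atLeast1_atMost_eq centering_eq jump
    by (intro sum.cong refl) (simp add: noise_def indicator_def)
qed

text \<open>The limit on \<open>M\<close> is the canonical limit evaluated at the noise. The
  extension to \<open>[0, \<infinity>)\<close> has the same increment formula, which forces the same
  path law on \<open>[0, T]\<close>, and at time 1 it gives the exponent \<psi>, identified by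
  \<open>exponent_eq\<close>.\<close>

theorem series_levy:
  "\<exists>X. (AE \<omega> in M. uniform_limit {0..T} (\<lambda>n t. series_partial_sum M \<sigma> q T U \<Gamma> V n t \<omega>) (\<lambda>t. X t \<omega>) sequentially) \<and>
     levy_process_with_unit_marginal M T X (layered_stable_law \<alpha> \<beta> \<sigma> q 0)"
proof -
  define \<psi> where "\<psi> y = (1 / T) *\<^sub>R sn.\<psi>0 y" for y
  obtain X where X: "\<And>t. X t \<in> borel_measurable sn.S" and X0: "\<And>t \<omega>. t \<le> 0 \<Longrightarrow> X t \<omega> = 0"
    and cad: "\<And>\<omega>. cadlag_on UNIV (\<lambda>t. X t \<omega>)"
    and lim: "AE \<omega> in sn.S. uniform_limit UNIV (\<lambda>n t. sn.part n t \<omega>) (\<lambda>t. X t \<omega>) sequentially"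
    and cf: "incr_cf sn.S UNIV (\<lambda>t. max 0 (min T t)) X \<psi>"
    using shot_noise_levy[OF shot_noise_shot] unfolding \<psi>_def[abs_def] by blast
  obtain N :: "(real \<Rightarrow> real ^ 'd) measure" and Y where N: "prob_space N" and Y_levy: "levy_process_on N {0..} Y"
    and cfY: "incr_cf N {0..} (\<lambda>t. t) Y \<psi>" and Y0: "AE \<omega> in N. Y 0 \<omega> = 0" and Y: "\<And>t. t \<ge> 0 \<Longrightarrow> Y t \<in> borel_measurable N"
    using levy_extension[OF sn.S.prob_space_axioms T X X0 cad cf] by blast
  define Z where "Z t \<omega> = X t (noise \<omega>)" for t \<omega>
  have Z: "Z t \<in> borel_measurable M" for t
    unfolding Z_def[abs_def] by (rule measurable_compose[OF noise_measurable_S X])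
  have transfer: "AE \<omega> in M. P (noise \<omega>)" if "AE w in sn.S. P w" for P
    by (rule AE_distrD[OF noise_measurable_S]) (simp only: distr_noise that)
  have "AE \<omega> in M. uniform_limit {0..T} (\<lambda>n t. series_partial_sum M \<sigma> q T U \<Gamma> V n t \<omega>) (\<lambda>t. Z t \<omega>) sequentially"
    using transfer[OF lim] transfer[OF sn.AE_exp_pos] AE_space
  proof eventually_elim
    case (elim \<omega>)
    from uniform_limit_on_subset[OF elim(1), of "{0..T}"]
    have "uniform_limit {0..T} (\<lambda>n t. sn.part n t (noise \<omega>)) (\<lambda>t. Z t \<omega>) sequentially" by (simp add: Z_def)
    then show ?case using elim(2,3) by (subst uniform_limit_cong') (auto simp: series_eq_part)
  qed
  moreover have cfZ: "incr_cf M {0..T} (\<lambda>t. t) Z \<psi>"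
    unfolding incr_cf_def
  proof (intro allI impI, elim conjE)
    fix n :: nat and ts :: "nat \<Rightarrow> real" and y :: "nat \<Rightarrow> real ^ 'd"
    assume ts: "\<forall>i\<le>n. ts i \<in> {0..T}" "\<forall>i<n. ts i \<le> ts (Suc i)"
    note [measurable] = X
    have "(\<integral>\<omega>. iexp (\<Sum>i<n. y i \<bullet> (Z (ts (Suc i)) \<omega> - Z (ts i) \<omega>)) \<partial>M) =
        (\<integral>w. iexp (\<Sum>i<n. y i \<bullet> (X (ts (Suc i)) w - X (ts i) w)) \<partial>distr M sn.S noise)"
      unfolding Z_def by (rule integral_distr[OF noise_measurable_S, symmetric]) measurable
    also have "\<dots> = exp (\<Sum>i<n. (max 0 (min T (ts (Suc i))) - max 0 (min T (ts i))) *\<^sub>R \<psi> (y i))"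
      unfolding distr_noise by (rule incr_cfD[OF cf]) (use ts in auto)
    also have "(\<Sum>i<n. (max 0 (min T (ts (Suc i))) - max 0 (min T (ts i))) *\<^sub>R \<psi> (y i)) = (\<Sum>i<n. (ts (Suc i) - ts i) *\<^sub>R \<psi> (y i))"
      using ts(1) by (intro sum.cong refl) (simp add: Suc_le_eq)
    finally show "(\<integral>\<omega>. iexp (\<Sum>i<n. y i \<bullet> (Z (ts (Suc i)) \<omega> - Z (ts i) \<omega>)) \<partial>M) = exp (\<Sum>i<n. (ts (Suc i) - ts i) *\<^sub>R \<psi> (y i))" .
  qed
  have Z0: "AE \<omega> in M. Z 0 \<omega> = 0" by (simp add: Z_def X0)
  have "levy_process_on M {0..T} Z"
    by (rule levy_process_on_cfI[OF prob_M _ _ _ Z Z0 cfZ]) (use T in \<open>auto simp: Z_def intro!: cadlag_on_mono cad\<close>)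
  moreover have "path_law N {0..T} Y = path_law M {0..T} Z"
  proof (rule path_law_cfI)
    show "incr_cf N {0..T} (\<lambda>t. t) Y \<psi>" using cfY by (auto simp: incr_cf_def)
    show "incr_cf M {0..T} (\<lambda>t. t) Z \<psi>" by (rule cfZ)
    show "AE \<omega> in N. Y 0 \<omega> = 0" "AE \<omega> in M. Z 0 \<omega> = 0" by fact+
  qed (use T N prob_M Y Z in auto)
  moreover have "layered_stable_law \<alpha> \<beta> \<sigma> q 0 (distr N borel (Y 1))"
    unfolding layered_stable_law_def
  proof (intro conjI allI)
    show "prob_space (distr N borel (Y 1))" by (rule prob_space.prob_space_distr[OF N]) (simp add: Y)
    fix y
    have "char_fun (distr N borel (Y 1)) y = (\<integral>\<omega>. iexp (y \<bullet> Y 1 \<omega>) \<partial>N)"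
      unfolding char_fun_def by (rule integral_distr) (simp_all add: Y)
    also have "\<dots> = (\<integral>\<omega>. iexp (y \<bullet> (Y 1 \<omega> - Y 0 \<omega>)) \<partial>N)"
    proof (rule integral_cong_AE)
      show "AE \<omega> in N. iexp (y \<bullet> Y 1 \<omega>) = iexp (y \<bullet> (Y 1 \<omega> - Y 0 \<omega>))" using Y0 by eventually_elim simp
    qed (use Y[of 0] Y[of 1] in measurable)
    also have "\<dots> = exp (\<psi> y)" using incr_cf_single[OF cfY, of 0 1 y] by simp
    also have "\<psi> y = (\<integral>z. kf y z \<partial>\<nu>)" unfolding \<psi>_def by (rule exponent_eq)
    finally show "char_fun (distr N borel (Y 1)) y = exp (\<i> * complex_of_real (y \<bullet> 0) +
          (\<integral>z. (iexp (y \<bullet> z) - 1 - \<i> * complex_of_real ((y \<bullet> z) * indicator {z. norm z \<le> 1} z)) \<partial>\<nu>))"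
      by (simp add: kf_def)
  qed (simp_all add: data)
  ultimately show ?thesis using Y_levy unfolding levy_process_with_unit_marginal_def by blast
qed

end

theorem mainTheorem6:
  fixes M :: "'w measure"
    and \<sigma> :: "(real ^ 'd) measure" and q :: "real \<Rightarrow> real ^ 'd \<Rightarrow> real"
    and \<alpha> \<beta> T :: real
    and U \<Gamma> :: "nat \<Rightarrow> 'w \<Rightarrow> real" and V :: "nat \<Rightarrow> 'w \<Rightarrow> real ^ 'd"
  assumes "\<alpha> \<in> {0<..<2}" and "\<beta> \<in> {0<..}"
    and "layered_stable_data \<alpha> \<beta> \<sigma> q"
    and "T > 0"
    and "prob_space M"
    and "iid_seq M borel (uniform_measure lborel {0..T}) U"
    and "poisson_arrivals M 1 \<Gamma>"
    and "iid_seq M sphere_borel (scale_measure (1 / emeasure \<sigma> (sphere 0 1)) \<sigma>) V"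
    and "prob_space.indep_sets M
           (\<lambda>j::nat. if j = 1 then seq_events M borel U
                     else if j = 2 then seq_events M borel \<Gamma>
                     else seq_events M sphere_borel V) {1, 2, 3}"
  shows "\<exists>X. (AE \<omega> in M. uniform_limit {0..T}
                 (\<lambda>n t. series_partial_sum M \<sigma> q T U \<Gamma> V n t \<omega>) (\<lambda>t. X t \<omega>) sequentially) \<and>
             levy_process_with_unit_marginal M T X (layered_stable_law \<alpha> \<beta> \<sigma> q 0)"
proof -
  interpret M: prob_space M by fact
  interpret \<sigma>: finite_measure \<sigma> using assms(3) by (simp add: layered_stable_data_def)
  have space_\<sigma>: "space \<sigma> = sphere 0 1"
    using assms(3) by (simp add: layered_stable_data_def sets_eq_imp_space_eq space_restrict_space)
  have "V 1 \<in> M \<rightarrow>\<^sub>M sphere_borel" and V1: "distr M sphere_borel (V 1) = scale_measure (1 / emeasure \<sigma> (sphere 0 1)) \<sigma>"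
    using assms(8) by (auto simp: iid_seq_def M.indep_vars_def2)
  then interpret P: prob_space "scale_measure (1 / emeasure \<sigma> (sphere 0 1)) \<sigma>"
    unfolding V1[symmetric] by (intro M.prob_space_distr)
  \<comment> \<open>The law of \<open>V 1\<close> is a probability measure, and no multiple of the
    zero measure is one; so the hypothesis on the directions excludes a vanishing \<sigma>.\<close>
  have "emeasure \<sigma> (sphere 0 1) \<noteq> 0"
    using P.emeasure_space_1 by (auto simp: space_scale_measure space_\<sigma>)
  then have mass: "measure \<sigma> (sphere 0 1) > 0"
    by (simp add: \<sigma>.emeasure_eq_measure zero_less_measure_iff)
  from assms(7) obtain E where "iid_seq M borel expo E" "\<And>i \<omega>. 1 \<le> i \<Longrightarrow> \<omega> \<in> space M \<Longrightarrow> \<Gamma> i \<omega> = (\<Sum>k=1..i. E k \<omega>)"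
    unfolding poisson_arrivals_def by auto
  then interpret layered_series \<alpha> \<beta> \<sigma> q T M U \<Gamma> E V
    using assms mass by unfold_locales auto
  show ?thesis by (rule series_levy)
qed

end
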